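(* Let $R\ge 2$ and let $r\in(0,1]$ be the solution of $r+1/r=R$. For a Borel measure $\sigma$ and $n\in\mathbb{Z}$ write $\sigma_n=\int t^n\,d\sigma(t)$. A Jacobi matrix $J$ belongs to $\mathcal{M}_R$ if and only if its associated $F$ function is of the form $$F(\lambda) = -\sigma_{-1} + (1-\sigma_{-2})\lambda + \int \frac{d\sigma(t)}{t-\lambda}\qquad(\lambda\in\mathbb{C}^+)\qquad ( * )$$ for some finite (positive) Borel measure $\sigma$ on $(-1/r,-r)\cup(r,1/r)$ that satisfies $$1-\sigma_{-2}+\int\frac{d\sigma(t)}{t^2+Et+1}>0\quad\text{for all } E\in\mathbb{R} \text{ with } |E|>R. \qquad ( ** )$$ Explicitly: (i) if $J\in\mathcal{M}_R$, then the $F$ function of $J$ has a representation $( * )$ with a (unique) finite Borel measure $\sigma$ on $(-1/r,-r)\cup(r,1/r)$ satisfying $( ** )$; (ii) conversely, if $\sigma$ is a finite Borel measure on $(-1/r,-r)\cup(r,1/r)$ satisfying $( ** )$, then the function $F$ defined by $( * )$ is the $F$ function of a unique $J\in\mathcal{M}_R$.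
   Context: A Jacobi matrix is a whole-line operator on $\ell^2(\mathbb{Z})$, $(Ju)_n=a_nu_{n+1}+a_{n-1}u_{n-1}+b_nu_n$, with $a,b\in\ell^\infty(\mathbb{Z})$, $a_n>0$, $b_n\in\mathbb{R}$. $\mathbb{C}^{\pm}$ are the open upper/lower half planes. A Herglotz function is a holomorphic map $\mathbb{C}^+\to\mathbb{C}^+$; its boundary values $m(x)=\lim_{y\to0+}m(x+iy)$ exist for a.e. $x\in\mathbb{R}$. For $z\in\mathbb{C}^+$ let $f_\pm(\cdot,z)$ be the (unique up to constant factors) solutions of $a_nf(n+1,z)+a_{n-1}f(n-1,z)+b_nf(n,z)=zf(n,z)$ that are square summable near $\pm\infty$. The half line $m$ functions are the Herglotz functions $m_\pm(z)=\mp\dfrac{f_\pm(1,z)}{a_0f_\pm(0,z)}$. $J$ is called reflectionless on a Borel set $S\subset\mathbb{R}$ of positive Lebesgue measure if $m_+(x)=-\overline{m_-(x)}$ for Lebesgue-a.e. $x\in S$. For $R\ge2$, $\mathcal{M}_R$ denotes the set of Jacobi matrices $J$ on $\ell^2(\mathbb{Z})$ that are reflectionless on $(-2,2)$ and satisfy $\|J\|\le R$. If $J$ is reflectionless on $(-2,2)$, then there is a unique holomorphic function $M:\Omega\to\mathbb{C}^+$ on $\Omega=\mathbb{C}^+\cup(-2,2)\cup\mathbb{C}^-$ with $M(z)=m_+(z)$ for $z\in\mathbb{C}^+$ and $M(z)=-\overline{m_-(\overline z)}$ for $z\in\mathbb{C}^-$. Let $\varphi(\lambda)=-\lambda-1/\lambda$,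 which maps $\mathbb{C}^+$ conformally onto $\Omega$. The $F$ function associated with $J$ is the Herglotz function $F(\lambda)=M(\varphi(\lambda))$, $\lambda\in\mathbb{C}^+$. When $R=2$ (so $r=1$) the set $(-1/r,-r)\cup(r,1/r)$ is empty and $\sigma$ is the zero measure. *)

theory Defs
  imports "HOL-Analysis.Analysis"
begin

text \<open>A Jacobi matrix is represented by its coefficient sequences \<^term>\<open>a\<close> (off-diagonal) and
  \<^term>\<open>b\<close> (diagonal).\<close>

definition jacobi_matrix :: "(int \<Rightarrow> real) \<Rightarrow> (int \<Rightarrow> real) \<Rightarrow> bool" where
  "jacobi_matrix a b \<longleftrightarrow> bounded (range a) \<and> bounded (range b) \<and> (\<forall>n. a n > 0)"

definition jacobi_op :: "(int \<Rightarrow> real) \<Rightarrow> (int \<Rightarrow> real) \<Rightarrow> (int \<Rightarrow> complex) \<Rightarrow> int \<Rightarrow> complex" where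
  "jacobi_op a b u n =
     of_real (a n) * u (n + 1) + of_real (a (n - 1)) * u (n - 1) + of_real (b n) * u n"

definition square_summable_on :: "(int \<Rightarrow> complex) \<Rightarrow> int set \<Rightarrow> bool" where
  "square_summable_on u A \<longleftrightarrow> (\<lambda>n. (cmod (u n))\<^sup>2) summable_on A"

definition l2_norm :: "(int \<Rightarrow> complex) \<Rightarrow> real" where
  "l2_norm u = sqrt (\<Sum>\<^sub>\<infinity>n\<in>UNIV. (cmod (u n))\<^sup>2)"

text \<open>The operator norm on \<open>\<ell>\<^sup>2(\<int>)\<close>. The supremum is over a nonempty set that is bounded above
  when the coefficients are bounded.\<close>

definition jacobi_norm :: "(int \<Rightarrow> real) \<Rightarrow> (int \<Rightarrow> real) \<Rightarrow> real" where
  "jacobi_norm a b =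
     (SUP u\<in>{u. square_summable_on u UNIV \<and> l2_norm u \<le> 1}. l2_norm (jacobi_op a b u))"

definition upper_half_plane :: "complex set" where
  "upper_half_plane = {z. Im z > 0}"

definition lower_half_plane :: "complex set" where
  "lower_half_plane = {z. Im z < 0}"

text \<open>For \<open>z\<close> in the upper half plane the two solutions exist and are unique up to a nonzero factor,
  and do not vanish at \<open>0\<close>, so the choices below do not affect \<open>m_plus\<close> and \<open>m_minus\<close>.\<close>

definition f_plus :: "(int \<Rightarrow> real) \<Rightarrow> (int \<Rightarrow> real) \<Rightarrow> complex \<Rightarrow> int \<Rightarrow> complex" where
  "f_plus a b z =
     (SOME f. (\<forall>n. jacobi_op a b f n = z * f n) \<and> (\<exists>n. f n \<noteq> 0) \<and> square_summable_on f {0..})"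

definition f_minus :: "(int \<Rightarrow> real) \<Rightarrow> (int \<Rightarrow> real) \<Rightarrow> complex \<Rightarrow> int \<Rightarrow> complex" where
  "f_minus a b z =
     (SOME f. (\<forall>n. jacobi_op a b f n = z * f n) \<and> (\<exists>n. f n \<noteq> 0) \<and> square_summable_on f {..0})"

definition m_plus :: "(int \<Rightarrow> real) \<Rightarrow> (int \<Rightarrow> real) \<Rightarrow> complex \<Rightarrow> complex" where
  "m_plus a b z = - (f_plus a b z 1 / (of_real (a 0) * f_plus a b z 0))"

definition m_minus :: "(int \<Rightarrow> real) \<Rightarrow> (int \<Rightarrow> real) \<Rightarrow> complex \<Rightarrow> complex" where
  "m_minus a b z = f_minus a b z 1 / (of_real (a 0) * f_minus a b z 0)"

definition has_boundary_value :: "(complex \<Rightarrow> complex) \<Rightarrow> real \<Rightarrow> complex \<Rightarrow> bool" where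
  "has_boundary_value m x w \<longleftrightarrow> ((\<lambda>y. m (Complex x y)) \<longlongrightarrow> w) (at_right 0)"

text \<open>The equation \<open>m\<^sub>+(x) = - cnj (m\<^sub>-(x))\<close> between boundary values is read as: both limits exist
  and satisfy it. They exist almost everywhere, as \<open>m\<^sub>\<plusminus>\<close> are Herglotz functions.\<close>

definition reflectionless_on :: "(int \<Rightarrow> real) \<Rightarrow> (int \<Rightarrow> real) \<Rightarrow> real set \<Rightarrow> bool" where
  "reflectionless_on a b S \<longleftrightarrow>
     S \<in> sets borel \<and> emeasure lborel S > 0 \<and>
     (AE x in lborel. x \<in> S \<longrightarrow>
        (\<exists>w v. has_boundary_value (m_plus a b) x w \<and> has_boundary_value (m_minus a b) x v \<and>
               w = - cnj v))"

definition reflectionless_class :: "real \<Rightarrow> ((int \<Rightarrow> real) \<times> (int \<Rightarrow> real)) set" where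
  "reflectionless_class R =
     {(a, b). jacobi_matrix a b \<and> reflectionless_on a b {-2<..<2} \<and> jacobi_norm a b \<le> R}"

definition Omega :: "complex set" where
  "Omega = upper_half_plane \<union> complex_of_real ` {-2<..<2} \<union> lower_half_plane"

definition is_M_function ::
    "(int \<Rightarrow> real) \<Rightarrow> (int \<Rightarrow> real) \<Rightarrow> (complex \<Rightarrow> complex) \<Rightarrow> bool" where
  "is_M_function a b M \<longleftrightarrow>
     M holomorphic_on Omega \<and> M ` Omega \<subseteq> upper_half_plane \<and>
     (\<forall>z\<in>upper_half_plane. M z = m_plus a b z) \<and>
     (\<forall>z\<in>lower_half_plane. M z = - cnj (m_minus a b (cnj z)))"

definition phi :: "complex \<Rightarrow> complex" where
  "phi l = - l - 1 / l"

text \<open>\<open>F\<close> is the \<open>F\<close> function of the Jacobi matrix. This is a relation and not a function of the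
  coefficients, because an \<open>F\<close> function is associated only with a matrix that is reflectionless on
  \<open>(-2, 2)\<close>; the values of \<open>F\<close> outside the upper half plane are irrelevant.\<close>

definition is_F_function ::
    "(int \<Rightarrow> real) \<Rightarrow> (int \<Rightarrow> real) \<Rightarrow> (complex \<Rightarrow> complex) \<Rightarrow> bool" where
  "is_F_function a b F \<longleftrightarrow>
     jacobi_matrix a b \<and> reflectionless_on a b {-2<..<2} \<and>
     (\<exists>M. is_M_function a b M \<and> (\<forall>l\<in>upper_half_plane. F l = M (phi l)))"

definition finite_borel_measure_on :: "real set \<Rightarrow> real measure \<Rightarrow> bool" where
  "finite_borel_measure_on S \<sigma> \<longleftrightarrow> finite_measure \<sigma> \<and> sets \<sigma> = sets (restrict_space borel S)"

definition sigma_support :: "real \<Rightarrow> real set" where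
  "sigma_support r = {-1/r<..<-r} \<union> {r<..<1/r}"

definition moment :: "real measure \<Rightarrow> int \<Rightarrow> real" where
  "moment \<sigma> n = (\<integral>t. t powi n \<partial>\<sigma>)"

definition F_of_measure :: "real measure \<Rightarrow> complex \<Rightarrow> complex" where
  "F_of_measure \<sigma> l =
     - of_real (moment \<sigma> (-1)) + of_real (1 - moment \<sigma> (-2)) * l
       + (\<integral>t. 1 / (of_real t - l) \<partial>\<sigma>)"

definition positivity_condition :: "real \<Rightarrow> real measure \<Rightarrow> bool" where
  "positivity_condition R \<sigma> \<longleftrightarrow>
     (\<forall>E. \<bar>E\<bar> > R \<longrightarrow> 1 - moment \<sigma> (-2) + (\<integral>t. 1 / (t\<^sup>2 + E * t + 1) \<partial>\<sigma>) > 0)"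

end

theory Submission
  imports Defs "HOL-Complex_Analysis.Complex_Analysis" "HOL-Probability.Probability" "HOL-Real_Asymp.Real_Asymp"
begin

text \<open>From \<open>J\<close> to \<open>\<sigma>\<close>: the boundary condition lets \<open>m\<^sub>+\<close> and \<open>-m\<^sub>-\<close>, which extend analytically to the complement of
  \<open>[-R, R]\<close>, be glued across \<open>(-2, 2)\<close> (compare their primitives and use a reflection argument). Pulled back by
  \<open>\<phi>\<close> this makes \<open>F\<close> a Herglotz function with \<open>F = m\<^sub>+ \<circ> \<phi>\<close> inside the unit disc and \<open>F = -m\<^sub>- \<circ> \<phi>\<close>
  outside. It is analytic off \<open>\<plusminus>[r, 1/r]\<close>, so it has a Herglotz representation with compact support; the
  asymptotics \<open>m\<^sub>+ \<approx> -1/z\<close>, that is \<open>F(0) = 0\<close> and \<open>F'(0) = 1\<close>, fix the constants as moments. The positivity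
  condition says that \<open>m\<^sub>+(E) + m\<^sub>-(E)\<close> has the sign of \<open>E\<close> for \<open>|E| > R\<close>, which expresses that there is no
  spectrum there; it also excludes point masses at the endpoints of the support.

  From \<open>\<sigma>\<close> to \<open>J\<close>: \<open>F\<close> read inside and outside the disc yields two functions that are Cauchy transforms of
  probability measures on \<open>[-R, R]\<close>, and expanding them as continued fractions gives the coefficients on the two
  half lines. The values of the continued fractions at real \<open>E\<close> are ratios of positive supersolutions of
  \<open>J u = E u\<close>, by the positivity condition also at the site \<open>0\<close>, so that \<open>-R \<le> J \<le> R\<close>.

  Uniqueness of \<open>J\<close> is the Borg--Marchenko theorem, uniqueness of \<open>\<sigma>\<close> is the uniqueness of the Herglotz
  measure.\<close>

section \<open>Weyl solutions\<close>

text \<open>The operator norm enters only through the quadratic form on finitely supported vectors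
  (\<open>form_bounded\<close>). Finite sections of J inherit the bound, resolvent estimates for
  them pass to the half lines by normal families, and in the converse direction the form is
  controlled by positive supersolutions. The gluing has nothing but almost-everywhere boundary
  values to work with, and the Herglotz functions may be unbounded near the interval. A Cayley
  transform makes them bounded by 1; their primitives are then Lipschitz up to the real axis, so the
  continuation is carried out for the primitives and differentiated afterwards. A continued fraction
  of a Cauchy transform may terminate. The class \<open>stieltjes\<close> excludes this by also
  recording a limit at 0 with positive imaginary part; 0 lies in (-2, 2) and corresponds to
  \<lambda> = \<i>, where F is analytic. The kernel t^2 + E t + 1 of the positivity condition has
  the zeros s and 1/s, the two preimages of E under \<open>phi\<close>: F(s) is a value of m_plus
  and F(1/s) one of -m_minus, so F(s) - F(1/s) is the sum of the two half-line functions at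
  E.\<close>

definition is_solution :: "(int \<Rightarrow> real) \<Rightarrow> (int \<Rightarrow> real) \<Rightarrow> complex \<Rightarrow> (int \<Rightarrow> complex) \<Rightarrow> bool" where
  "is_solution a b z f \<longleftrightarrow> (\<forall>n. jacobi_op a b f n = z * f n)"

lemma is_solution_zero:
  assumes "is_solution a b z f" and a: "\<And>n. a n > 0" and "f 0 = 0" "f 1 = 0"
  shows "f n = 0"
proof -
  have eq: "of_real (a n) * f (n + 1) + of_real (a (n - 1)) * f (n - 1) + of_real (b n) * f n = z * f n" for n
    using assms(1) by (simp add: is_solution_def jacobi_op_def)
  have an: "a n \<noteq> 0" for n using a[of n] by simp
  have "f n = 0 \<and> f (n + 1) = 0"
  proof (induction n rule: int_induct[of _ 0])
    case base show ?case using assms by simp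
  next
    case (step1 i) then show ?case using eq[of "i+1"] an[of "i+1"] by simp
  next
    case (step2 i) then show ?case using eq[of i] an[of "i-1"] by simp
  qed
  then show ?thesis ..
qed

lemma is_solution_lincomb:
  assumes "is_solution a b z f" "is_solution a b z g"
  shows "is_solution a b z (\<lambda>n. c * f n + d * g n)"
  unfolding is_solution_def
proof
  fix n
  have "jacobi_op a b (\<lambda>n. c * f n + d * g n) n = c * jacobi_op a b f n + d * jacobi_op a b g n"
    by (simp add: jacobi_op_def algebra_simps)
  with assms show "jacobi_op a b (\<lambda>n. c * f n + d * g n) n = z * (c * f n + d * g n)"
    by (simp add: is_solution_def algebra_simps)
qed

fun forward_solution :: "(int \<Rightarrow> real) \<Rightarrow> (int \<Rightarrow> real) \<Rightarrow> complex \<Rightarrow> complex \<Rightarrow> complex \<Rightarrow> nat \<Rightarrow> complex" where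
  "forward_solution a b z c d 0 = c"
| "forward_solution a b z c d (Suc 0) = d"
| "forward_solution a b z c d (Suc (Suc k)) =
     ((z - of_real (b (int k + 1))) * forward_solution a b z c d (Suc k)
        - of_real (a (int k)) * forward_solution a b z c d k) / of_real (a (int k + 1))"

text \<open>The left half is the right half of the matrix reflected by \<open>n \<mapsto> 1 - n\<close>.\<close>

definition solution :: "(int \<Rightarrow> real) \<Rightarrow> (int \<Rightarrow> real) \<Rightarrow> complex \<Rightarrow> complex \<Rightarrow> complex \<Rightarrow> int \<Rightarrow> complex" where
  "solution a b z c d n =
     (if n \<ge> 0 then forward_solution a b z c d (nat n)
      else forward_solution (\<lambda>n. a (- n)) (\<lambda>n. b (1 - n)) z d c (nat (1 - n)))"

lemma solution_0 [simp]: "solution a b z c d 0 = c"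
  and solution_1 [simp]: "solution a b z c d 1 = d"
  by (simp_all add: solution_def)

lemma is_solution_solution:
  assumes a: "\<And>n. a n > 0"
  shows "is_solution a b z (solution a b z c d)"
  unfolding is_solution_def
proof
  fix n
  have an: "a n \<noteq> 0" for n using a[of n] by simp
  let ?f = "solution a b z c d" and ?a = "\<lambda>n. a (- n)" and ?b = "\<lambda>n. b (1 - n)"
  show "jacobi_op a b ?f n = z * ?f n"
  proof (cases "n \<ge> 1")
    case True
    define k where "k = nat (n - 1)"
    have n: "n = int k + 1" using True by (simp add: k_def)
    have "?f (n + 1) = forward_solution a b z c d (Suc (Suc k))"
         "?f n = forward_solution a b z c d (Suc k)" "?f (n - 1) = forward_solution a b z c d k"
      using n by (auto simp: solution_def nat_add_distrib)
    then show ?thesis using an[of "int k + 1"] by (simp add: jacobi_op_def n)(simp add: algebra_simps)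
  next
    case False
    define k where "k = nat (- n)"
    have n: "n = - int k" using False by (simp add: k_def)
    \<comment> \<open>The formula for the left half also holds at 0 and 1, because its initial
      values are swapped. So the recurrence at n = -k stays within a single branch.\<close>
    have neg: "?f m = forward_solution ?a ?b z d c (nat (1 - m))" if "m \<le> 1" for m
    proof (cases "m < 0")
      case False
      then have "m = 0 \<or> m = 1" using that by auto
      then show ?thesis by auto
    qed (simp add: solution_def)
    have "?f (n - 1) = forward_solution ?a ?b z d c (Suc (Suc k))"
      using n by (subst neg) (auto simp: nat_add_distrib Suc_nat_eq_nat_zadd1 numeral_2_eq_2)
    moreover have "?f n = forward_solution ?a ?b z d c (Suc k)"
      using n by (subst neg) (auto simp: nat_add_distrib Suc_nat_eq_nat_zadd1)
    moreover have "?f (n + 1) = forward_solution ?a ?b z d c k"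
      using n by (subst neg) auto
    ultimately show ?thesis using an[of "- int k - 1"] 
      by (simp add: jacobi_op_def n)(simp add: algebra_simps)
  qed
qed

lemma is_solution_eq_solution:
  assumes "is_solution a b z f" and a: "\<And>n. a n > 0"
  shows "f = solution a b z (f 0) (f 1)"
proof
  fix n
  have "is_solution a b z (\<lambda>n. 1 * f n + (-1) * solution a b z (f 0) (f 1) n)"
    using is_solution_lincomb[OF assms(1) is_solution_solution[of a b z "f 0" "f 1", OF a]] by blast
  then have "1 * f n + (-1) * solution a b z (f 0) (f 1) n = 0"
    by (rule is_solution_zero) (simp_all add: a)
  then show "f n = solution a b z (f 0) (f 1) n" by simp
qed

lemma is_solution_cnj:
  assumes "is_solution a b z f"
  shows "is_solution a b (cnj z) (\<lambda>n. cnj (f n))"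
  unfolding is_solution_def
proof
  fix n
  have "jacobi_op a b (\<lambda>n. cnj (f n)) n = cnj (jacobi_op a b f n)" by (simp add: jacobi_op_def)
  with assms show "jacobi_op a b (\<lambda>n. cnj (f n)) n = cnj z * cnj (f n)" by (simp add: is_solution_def)
qed

lemma solution_cnj:
  assumes a: "\<And>n. a n > 0"
  shows "solution a b (cnj z) (cnj c) (cnj d) n = cnj (solution a b z c d n)"
proof -
  have "is_solution a b (cnj z) (\<lambda>n. cnj (solution a b z c d n))"
    by (intro is_solution_cnj is_solution_solution a)
  from is_solution_eq_solution[OF this a]
  have "(\<lambda>n. cnj (solution a b z c d n)) = solution a b (cnj z) (cnj c) (cnj d)" by simp
  from fun_cong[OF this, of n] show ?thesis by simp
qed

lemma forward_solution_holomorphic: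
  assumes "\<And>n. a n > 0"
  shows "(\<lambda>z. forward_solution a b z c d n) holomorphic_on S"
proof (induction n rule: induct_nat_012)
  case (ge2 k)
  have "a (int k + 1) \<noteq> 0" using assms[of "int k + 1"] by simp
  with ge2 show ?case unfolding forward_solution.simps
    by (intro holomorphic_intros) auto
qed auto

text \<open>Up to a constant factor, the Wronskian of \<open>f\<close> and its complex
  conjugate.\<close>

definition current :: "(int \<Rightarrow> real) \<Rightarrow> (int \<Rightarrow> complex) \<Rightarrow> int \<Rightarrow> real" where
  "current a f n = a n * Im (f (n + 1) * cnj (f n))"

lemma current_diff:
  assumes "is_solution a b z f"
  shows "current a f n - current a f (n - 1) = Im z * (cmod (f n))\<^sup>2"
proof -
  have "Im (jacobi_op a b f n * cnj (f n)) = current a f n - current a f (n - 1)"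
    by (simp add: jacobi_op_def current_def algebra_simps)
  moreover have "Im (jacobi_op a b f n * cnj (f n)) = Im (z * (f n * cnj (f n)))"
    using assms by (simp add: is_solution_def mult.assoc)
  ultimately show ?thesis
    by (simp add: complex_mult_cnj cmod_power2)
qed

lemma square_summable_on_nonneg_iff:
  "square_summable_on f {0..} \<longleftrightarrow> summable (\<lambda>n::nat. (cmod (f (int n)))\<^sup>2)"
proof -
  have "{0..} = range int"
    by (auto simp: image_iff) (metis zero_le_imp_eq_int)
  then have "square_summable_on f {0..} \<longleftrightarrow> (\<lambda>n::nat. (cmod (f (int n)))\<^sup>2) summable_on UNIV"
    unfolding square_summable_on_def by (simp add: summable_on_reindex o_def)
  also have "\<dots> \<longleftrightarrow> summable (\<lambda>n::nat. (cmod (f (int n)))\<^sup>2)"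
    by (rule summable_on_UNIV_nonneg_real_iff) simp
  finally show ?thesis .
qed

lemma square_summable_on_uminus:
  "square_summable_on f {..0} \<longleftrightarrow> square_summable_on (\<lambda>n. f (- n)) {0..}"
proof -
  have "{..0::int} = uminus ` {0..}" by simp
  then show ?thesis unfolding square_summable_on_def 
    by (simp only: summable_on_reindex[OF inj_on_subset[OF inj_uminus subset_UNIV]] o_def)
qed

text \<open>Boundedness of \<open>a\<close> keeps the weights from compensating the decay of
  \<open>f\<close>; this is what puts every such matrix in the limit point case.\<close>

lemma current_tendsto_0:
  assumes "jacobi_matrix a b" and "square_summable_on f {0..}"
  shows "(\<lambda>n::nat. current a f (int n)) \<longlonglongrightarrow> 0"
proof -
  have "(\<lambda>n::nat. (cmod (f (int n)))\<^sup>2) \<longlonglongrightarrow> 0"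
    using assms(2) unfolding square_summable_on_nonneg_iff by (rule summable_LIMSEQ_zero)
  then have "(\<lambda>n::nat. sqrt ((cmod (f (int n)))\<^sup>2)) \<longlonglongrightarrow> sqrt 0"
    by (rule tendsto_real_sqrt)
  then have "(\<lambda>n::nat. norm (f (int n))) \<longlonglongrightarrow> 0" by simp
  then have f: "(\<lambda>n::nat. f (int n)) \<longlonglongrightarrow> 0" by (rule tendsto_norm_zero_cancel)
  then have f1: "(\<lambda>n::nat. f (int n + 1)) \<longlonglongrightarrow> 0"
    using LIMSEQ_Suc[OF f] by (simp add: add.commute)
  have "(\<lambda>n::nat. Im (f (int n + 1) * cnj (f (int n)))) \<longlonglongrightarrow> Im (0 * cnj 0)"
    by (intro tendsto_intros f f1)
  then have 1: "(\<lambda>n::nat. Im (f (int n + 1) * cnj (f (int n)))) \<longlonglongrightarrow> 0" by simp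
  obtain A where A: "\<And>n. \<bar>a n\<bar> \<le> A"
    using assms(1) by (auto simp: jacobi_matrix_def bounded_iff)
  then have "\<forall>\<^sub>F n in sequentially. norm (current a f (int n)) \<le> A * \<bar>Im (f (int n + 1) * cnj (f (int n)))\<bar>"
    by (intro always_eventually allI) (simp only: current_def real_norm_def abs_mult, intro mult_right_mono, auto)
  moreover have "(\<lambda>n::nat. A * \<bar>Im (f (int n + 1) * cnj (f (int n)))\<bar>) \<longlonglongrightarrow> A * \<bar>0\<bar>"
    by (intro tendsto_intros 1)
  ultimately show ?thesis by (auto intro: Lim_null_comparison)
qed

definition weyl_solution :: "(int \<Rightarrow> real) \<Rightarrow> (int \<Rightarrow> real) \<Rightarrow> complex \<Rightarrow> (int \<Rightarrow> complex) \<Rightarrow> bool" where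
  "weyl_solution a b z f \<longleftrightarrow> is_solution a b z f \<and> (\<exists>n. f n \<noteq> 0) \<and> square_summable_on f {0..}"

text \<open>The current increases along the half line and tends to 0, so it is nonpositive at site
  2. The term with \<open>f 2\<close> is kept because strict positivity of Im m depends on it when
  \<open>f 1\<close> vanishes.\<close>

lemma weyl_solution_current:
  assumes J: "jacobi_matrix a b" and f: "is_solution a b z f" "square_summable_on f {0..}" and z: "Im z > 0"
  shows "current a f 0 \<le> - Im z * (cmod (f 1))\<^sup>2 - Im z * (cmod (f 2))\<^sup>2"
proof -
  have step: "current a f (int (Suc n)) = current a f (int n) + Im z * (cmod (f (int (Suc n))))\<^sup>2" for n
    using current_diff[OF f(1), of "int (Suc n)"] by simp
  have "incseq (\<lambda>n::nat. current a f (int n))"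
    using z step by (intro incseq_SucI) (simp del: of_nat_Suc)
  then have "current a f (int n) \<le> 0" for n
    using current_tendsto_0[OF J f(2)] by (rule incseq_le)
  from this[of "Suc (Suc 0)"] step[of 0] step[of 1] show ?thesis by simp
qed

text \<open>Otherwise \<open>f\<close> would be an eigenvector of the half-line matrix with a
  nonreal eigenvalue: its current starts at 0, which forces \<open>f 1 = 0\<close> and hence
  \<open>f = 0\<close>.\<close>

lemma weyl_solution_nonzero:
  assumes J: "jacobi_matrix a b" and f: "weyl_solution a b z f" and z: "Im z > 0"
  shows "f 0 \<noteq> 0"
proof
  assume 0: "f 0 = 0"
  have pos: "\<And>n. a n > 0" using J by (simp add: jacobi_matrix_def)
  have "current a f 0 = 0" using 0 by (simp add: current_def)
  then have "Im z * (cmod (f 1))\<^sup>2 + Im z * (cmod (f 2))\<^sup>2 \<le> 0"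
    using weyl_solution_current[OF J _ _ z, of f] f by (simp add: weyl_solution_def)
  moreover have "Im z * (cmod (f 1))\<^sup>2 \<ge> 0" "Im z * (cmod (f 2))\<^sup>2 \<ge> 0" using z by simp_all
  ultimately have "Im z * (cmod (f 1))\<^sup>2 = 0" by linarith
  then have "f 1 = 0" using z by simp
  then have "f n = 0" for n
    using is_solution_zero[of a b z f] pos 0 f by (simp add: weyl_solution_def)
  then show False using f by (simp add: weyl_solution_def)
qed

text \<open>The combination of \<open>f\<close> and \<open>g\<close> that vanishes at 0 is again a
  square summable solution, so it vanishes identically by
  \<open>weyl_solution_nonzero\<close>.\<close>

lemma weyl_solution_ratio_unique:
  assumes J: "jacobi_matrix a b" and f: "weyl_solution a b z f" and g: "weyl_solution a b z g" and z: "Im z > 0"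
  shows "f 1 / f 0 = g 1 / g 0"
proof -
  let ?h = "\<lambda>n. g 0 * f n + (- f 0) * g n"
  have "summable (\<lambda>n::nat. 2 * (cmod (g 0))\<^sup>2 * (cmod (f (int n)))\<^sup>2 + 2 * (cmod (f 0))\<^sup>2 * (cmod (g (int n)))\<^sup>2)"
    using f g by (intro summable_add summable_mult) (auto simp: weyl_solution_def square_summable_on_nonneg_iff)
  moreover have "(cmod (?h n))\<^sup>2 \<le> 2 * (cmod (g 0))\<^sup>2 * (cmod (f n))\<^sup>2 + 2 * (cmod (f 0))\<^sup>2 * (cmod (g n))\<^sup>2" for n
  proof -
    have "cmod (?h n) \<le> cmod (g 0 * f n) + cmod ((- f 0) * g n)" by (rule norm_triangle_ineq)
    then have "(cmod (?h n))\<^sup>2 \<le> (cmod (g 0 * f n) + cmod ((- f 0) * g n))\<^sup>2" by (simp add: power_mono)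
    also have "\<dots> \<le> 2 * (cmod (g 0 * f n))\<^sup>2 + 2 * (cmod ((- f 0) * g n))\<^sup>2"
      using sum_squares_bound[of "cmod (g 0 * f n)" "cmod ((- f 0) * g n)"] by (simp add: power2_sum)
    finally show ?thesis by (simp add: norm_mult power_mult_distrib)
  qed
  ultimately have "summable (\<lambda>n::nat. (cmod (?h (int n)))\<^sup>2)"
    by (auto simp only: real_norm_def abs_power2 intro: summable_comparison_test'[where N=0])
  then have "square_summable_on ?h {0..}"
    unfolding square_summable_on_nonneg_iff .
  moreover have "is_solution a b z ?h"
    using f g by (intro is_solution_lincomb) (auto simp: weyl_solution_def)
  ultimately have "\<not> (\<exists>n. ?h n \<noteq> 0)"
    using weyl_solution_nonzero[OF J _ z, of ?h] by (auto simp: weyl_solution_def)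
  then have "?h 1 = 0" by blast
  then show ?thesis
    using weyl_solution_nonzero[OF J f z] weyl_solution_nonzero[OF J g z] by (simp add: field_simps)
qed

text \<open>This eliminates the choice operator in \<open>f_plus\<close>: any Weyl solution computes
  the m function.\<close>

lemma m_plus_eqI:
  assumes J: "jacobi_matrix a b" and f: "weyl_solution a b z f" and z: "Im z > 0"
  shows "m_plus a b z = - (f 1 / (of_real (a 0) * f 0))"
proof -
  have "weyl_solution a b z (f_plus a b z)"
    using f someI[of "\<lambda>f. (\<forall>n. jacobi_op a b f n = z * f n) \<and> (\<exists>n. f n \<noteq> 0) \<and> square_summable_on f {0..}" f]
    unfolding weyl_solution_def is_solution_def f_plus_def by blast
  from weyl_solution_ratio_unique[OF J this f z]
  have "f_plus a b z 1 / f_plus a b z 0 = f 1 / f 0" .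
  moreover have "u / (c * v) = u / v / c" for u v c :: complex by (simp add: field_simps)
  ultimately show ?thesis unfolding m_plus_def by metis
qed

lemma weyl_solution_m_bounds:
  assumes J: "jacobi_matrix a b" and f: "weyl_solution a b z f" and z: "Im z > 0"
  shows "Im (m_plus a b z) > 0" and "cmod (m_plus a b z) \<le> 1 / Im z"
proof -
  let ?m = "m_plus a b z"
  have a0: "a 0 > 0" using J by (simp add: jacobi_matrix_def)
  have f0: "f 0 \<noteq> 0" by (rule weyl_solution_nonzero[OF J f z])
  have f1: "f 1 = - of_real (a 0) * ?m * f 0"
    using m_plus_eqI[OF J f z] a0 f0 by (simp add: field_simps)
  define s where "s = (cmod (f 0))\<^sup>2"
  have s: "s > 0" using f0 by (simp add: s_def)
  have "f 1 * cnj (f 0) = - of_real (a 0) * ?m * (f 0 * cnj (f 0))" by (simp add: f1)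
  also have "\<dots> = - of_real (a 0) * ?m * of_real s"
    by (simp only: complex_norm_square[symmetric] s_def of_real_power)
  finally have cur: "current a f 0 = - (a 0)\<^sup>2 * s * Im ?m"
    by (simp add: current_def power2_eq_square)
  have n1: "(cmod (f 1))\<^sup>2 = (a 0)\<^sup>2 * s * (cmod ?m)\<^sup>2"
    by (simp add: f1 norm_mult power_mult_distrib s_def)
  have le: "(a 0)\<^sup>2 * s * Im ?m \<ge> Im z * ((a 0)\<^sup>2 * s * (cmod ?m)\<^sup>2) + Im z * (cmod (f 2))\<^sup>2"
    using weyl_solution_current[OF J _ _ z, of f] f cur n1 by (simp add: weyl_solution_def)
  have nn: "Im z * (cmod (f 2))\<^sup>2 \<ge> 0" using z by simp
  have "(a 0)\<^sup>2 * s > 0" using a0 s by simp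
  moreover have "(a 0)\<^sup>2 * s * (Im z * (cmod ?m)\<^sup>2) \<le> (a 0)\<^sup>2 * s * Im ?m"
    using le nn by (simp add: mult_ac)
  \<comment> \<open>Both claims rest on Im z |m|^2 \<le> Im m: the second follows at once from Im m
    \<le> |m|.\<close>
  ultimately have key: "Im z * (cmod ?m)\<^sup>2 \<le> Im ?m"
    by (simp only: mult_le_cancel_left_pos)
  show "Im ?m > 0"
  proof (rule ccontr)
    assume "\<not> Im ?m > 0"
    then have "Im z * (cmod ?m)\<^sup>2 \<le> 0" using key by linarith
    \<comment> \<open>If m vanishes, then so do \<open>f 1\<close> and \<open>f 2\<close>, and the
      equation at site 1 gives \<open>f 0 = 0\<close>.\<close>
    then have m0: "?m = 0" using z by (simp add: mult_le_0_iff)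
    then have "f 1 = 0" "current a f 0 = 0" using f1 cur by auto
    then have "Im z * (cmod (f 2))\<^sup>2 \<le> 0" using le m0 by simp
    then have "f 2 = 0" using z by (simp add: mult_le_0_iff)
    moreover have "jacobi_op a b f 1 = z * f 1" using f by (simp add: weyl_solution_def is_solution_def)
    ultimately show False using \<open>f 1 = 0\<close> f0 a0 by (simp add: jacobi_op_def)
  qed
  have "Im z * (cmod ?m * cmod ?m) \<le> cmod ?m"
    using key abs_Im_le_cmod[of ?m] by (simp add: power2_eq_square)
  then show "cmod ?m \<le> 1 / Im z"
    using z by (cases "?m = 0") (auto simp: field_simps)
qed

text \<open>Reflection about site 0. The entry \<open>a n\<close> belongs to the bond between the
  sites \<open>n\<close> and \<open>n + 1\<close>, whence the extra shift by one compared with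
  \<open>reflect_b\<close>.\<close>

definition reflect_a :: "(int \<Rightarrow> real) \<Rightarrow> int \<Rightarrow> real" where "reflect_a a n = a (- n - 1)"
definition reflect_b :: "(int \<Rightarrow> real) \<Rightarrow> int \<Rightarrow> real" where "reflect_b b n = b (- n)"

lemma reflect_reflect [simp]: "reflect_a (reflect_a a) = a" "reflect_b (reflect_b b) = b"
  by (simp_all add: fun_eq_iff reflect_a_def reflect_b_def)

lemma jacobi_matrix_reflect:
  assumes "jacobi_matrix a b" shows "jacobi_matrix (reflect_a a) (reflect_b b)"
proof -
  have "range (reflect_a a) \<subseteq> range a" "range (reflect_b b) \<subseteq> range b"
    by (auto simp: reflect_a_def reflect_b_def)
  with assms show ?thesis
    unfolding jacobi_matrix_def by (auto intro: bounded_subset simp: reflect_a_def)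
qed

lemma jacobi_op_reflect:
  "jacobi_op (reflect_a a) (reflect_b b) (\<lambda>n. f (- n)) n = jacobi_op a b f (- n)"
proof -
  have "- (n + 1) = - n - 1" "- (n - 1) = - n + 1" "- (n - 1) - 1 = - n" by simp_all
  then show ?thesis by (simp add: jacobi_op_def reflect_a_def reflect_b_def)
qed

lemma is_solution_reflect:
  assumes "is_solution a b z f"
  shows "is_solution (reflect_a a) (reflect_b b) z (\<lambda>n. f (- n))"
  using assms by (simp add: is_solution_def jacobi_op_reflect)

text \<open>The reflected \<open>f_minus\<close> is a Weyl solution of the reflected matrix, which
  yields the ratio of the values at -1 and 0. The equation at site 0 converts it into the ratio at 1
  and 0 used in \<open>m_minus\<close>.\<close>

lemma m_minus_eq:
  assumes J: "jacobi_matrix a b" and z: "Im z > 0"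
    and f: "weyl_solution (reflect_a a) (reflect_b b) z f"
  shows "m_minus a b z =
    (z - of_real (b 0) + of_real ((a (-1))\<^sup>2) * m_plus (reflect_a a) (reflect_b b) z) / of_real ((a 0)\<^sup>2)"
proof -
  let ?P = "\<lambda>f. (\<forall>n. jacobi_op a b f n = z * f n) \<and> (\<exists>n. f n \<noteq> 0) \<and> square_summable_on f {..0}"
  have weyl: "weyl_solution (reflect_a a) (reflect_b b) z (\<lambda>n. g (- n))" if Pg: "?P g" for g
  proof -
    obtain n where "g n \<noteq> 0" using Pg by blast
    then have "g (- (- n)) \<noteq> 0" by simp
    then have "\<exists>n. g (- n) \<noteq> 0" by blast
    then show ?thesis
      using Pg is_solution_reflect[of a b z g]
      by (simp add: weyl_solution_def is_solution_def square_summable_on_uminus)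
  qed
  have "?P (\<lambda>n. f (- n))"
  proof -
    obtain n where "f n \<noteq> 0" using f by (auto simp: weyl_solution_def)
    then have "f (- (- n)) \<noteq> 0" by simp
    then have "\<exists>n. f (- n) \<noteq> 0" by blast
    then show ?thesis
      using is_solution_reflect[of "reflect_a a" "reflect_b b" z f] f
      by (simp add: weyl_solution_def is_solution_def square_summable_on_uminus)
  qed
  then have P: "?P (f_minus a b z)"
    unfolding f_minus_def by (rule someI[of ?P])
  let ?g = "f_minus a b z"
  note J' = jacobi_matrix_reflect[OF J]
  have g0: "?g 0 \<noteq> 0" using weyl_solution_nonzero[OF J' weyl[OF P] z] by simp
  have a: "a 0 > 0" "a (-1) > 0" using J by (simp_all add: jacobi_matrix_def)
  have "m_plus (reflect_a a) (reflect_b b) z = - (?g (-1) / (of_real (a (-1)) * ?g 0))"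
    using m_plus_eqI[OF J' weyl[OF P] z] by (simp add: reflect_a_def)
  then have g1: "of_real (a (-1)) * ?g (-1) = - of_real ((a (-1))\<^sup>2) * m_plus (reflect_a a) (reflect_b b) z * ?g 0"
    using a g0 by (simp add: field_simps power2_eq_square)
  have "jacobi_op a b ?g 0 = z * ?g 0" using P by blast
  then have "of_real (a 0) * ?g 1 = (z - of_real (b 0) + of_real ((a (-1))\<^sup>2) * m_plus (reflect_a a) (reflect_b b) z) * ?g 0"
    using g1 by (simp add: jacobi_op_def algebra_simps)
  moreover have "u / (c * v) = x / c\<^sup>2" if "c * u = x * v" "c \<noteq> 0" "v \<noteq> 0" for u v c x :: complex
    using that by (simp add: field_simps power2_eq_square)
  ultimately show ?thesis
    unfolding m_minus_def using a(1) g0 by simp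
qed

section \<open>Continuation of the half-line functions off the spectrum\<close>

text \<open>The numerical range of J lies in [-R, R]. Testing only finitely supported vectors keeps
  all sums finite and makes the bound hereditary under truncation.\<close>

definition form_bounded :: "(int \<Rightarrow> real) \<Rightarrow> (int \<Rightarrow> real) \<Rightarrow> real \<Rightarrow> bool" where
  "form_bounded a b R \<longleftrightarrow> (\<forall>u A. finite A \<longrightarrow> (\<forall>n. n \<notin> A \<longrightarrow> u n = 0) \<longrightarrow>
     \<bar>\<Sum>n\<in>A. Re (cnj (u n) * jacobi_op a b u n)\<bar> \<le> R * (\<Sum>n\<in>A. (cmod (u n))\<^sup>2))"

abbreviation spectral_set :: "real \<Rightarrow> complex set" where
  "spectral_set R \<equiv> complex_of_real ` {-R..R}"

lemma closed_spectral_set: "closed (spectral_set R)"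
  by (intro compact_imp_closed compact_continuous_image continuous_intros) simp

lemma Im_nonzero_not_spectral: "Im z \<noteq> 0 \<Longrightarrow> z \<notin> spectral_set R"
  by auto

text \<open>Cut \<open>f\<close> off outside {1..N}. Since \<open>f\<close> vanishes at N + 1, the
  cut vector satisfies J u = z u on {1..N} except at site 1, where the neighbour \<open>f 0\<close>
  is missing. The number \<open>q\<close> is the form of the cut vector.\<close>

lemma truncated_form:
  assumes f: "is_solution a b z f" and N: "f (int N + 1) = 0" "N \<ge> 1" and fb: "form_bounded a b R"
  defines "S \<equiv> (\<Sum>n\<in>{1..int N}. (cmod (f n))\<^sup>2)"
  shows "\<exists>q. \<bar>q\<bar> \<le> R * S \<and> of_real q = z * of_real S - of_real (a 0) * f 0 * cnj (f 1)"
proof -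
  define u where "u n = (if n \<in> {1..int N} then f n else 0)" for n
  define q where "q = (\<Sum>n\<in>{1..int N}. Re (cnj (u n) * jacobi_op a b u n))"
  have Ju: "jacobi_op a b u n = z * f n - (if n = 1 then of_real (a 0) * f 0 else 0)" if "n \<in> {1..int N}" for n
  proof -
    have "u (n + 1) = f (n + 1)"
      using that N by (cases "n = int N") (auto simp: u_def)
    moreover have "u (n - 1) = (if n = 1 then 0 else f (n - 1))" "u n = f n"
      using that by (auto simp: u_def)
    ultimately have "jacobi_op a b u n = jacobi_op a b f n - (if n = 1 then of_real (a 0) * f 0 else 0)"
      by (auto simp: jacobi_op_def)
    then show ?thesis using f by (simp add: is_solution_def)
  qed
  have "(\<Sum>n\<in>{1..int N}. cnj (u n) * jacobi_op a b u n)
      = (\<Sum>n\<in>{1..int N}. z * of_real ((cmod (f n))\<^sup>2) - (if n = 1 then of_real (a 0) * f 0 * cnj (f 1) else 0))"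
    by (intro sum.cong refl) (auto simp: Ju u_def algebra_simps complex_norm_square[symmetric] simp flip: of_real_power)
  also have "\<dots> = z * of_real S - (\<Sum>n\<in>{1..int N}. if n = 1 then of_real (a 0) * f 0 * cnj (f 1) else 0)"
    by (simp add: sum_subtractf S_def sum_distrib_left)
  also have "(\<Sum>n\<in>{1..int N}. if n = 1 then of_real (a 0) * f 0 * cnj (f 1) else 0) = of_real (a 0) * f 0 * cnj (f 1)"
    using N by (simp add: sum.delta')
  finally have sum: "(\<Sum>n\<in>{1..int N}. cnj (u n) * jacobi_op a b u n) = z * of_real S - of_real (a 0) * f 0 * cnj (f 1)" .
  \<comment> \<open>The telescoped current shows that the right-hand side is real, so it equals the
    real part \<open>q\<close>.\<close>
  have tele: "(\<Sum>n\<in>{1..int M}. Im z * (cmod (f n))\<^sup>2) = current a f (int M) - current a f 0" for M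
  proof (induction M)
    case (Suc M)
    have "{1..int (Suc M)} = insert (int (Suc M)) {1..int M}" by auto
    then show ?case using Suc current_diff[OF f, of "int (Suc M)"] by simp
  qed simp
  have "Im z * S = - current a f 0"
    using tele[of N] N by (simp add: S_def sum_distrib_left current_def)
  then have im: "Im (z * of_real S - of_real (a 0) * f 0 * cnj (f 1)) = 0"
    by (simp add: current_def algebra_simps)
  have "Re (\<Sum>n\<in>{1..int N}. cnj (u n) * jacobi_op a b u n) = q"
    by (simp add: q_def)
  then have "of_real q = z * of_real S - of_real (a 0) * f 0 * cnj (f 1)"
    using sum im by (metis complex_is_Real_iff of_real_Re)
  moreover have "\<bar>q\<bar> \<le> R * S"
  proof -
    have "\<bar>q\<bar> \<le> R * (\<Sum>n\<in>{1..int N}. (cmod (u n))\<^sup>2)"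
    proof -
      have "u n = 0" if "n \<notin> {1..int N}" for n using that by (simp only: u_def if_False)
      with fb show ?thesis unfolding form_bounded_def q_def by blast
    qed
    also have "(\<Sum>n\<in>{1..int N}. (cmod (u n))\<^sup>2) = S"
      unfolding S_def by (intro sum.cong) (auto simp: u_def)
    finally show ?thesis .
  qed
  ultimately show ?thesis by blast
qed

text \<open>A resolvent estimate for finite sections: the Rayleigh quotient q / S lies in [-R, R],
  hence |z - q / S| \<ge> d, while |z - q / S| S = |a 0 f(0) f(1)| and |f(1)|^2 \<le> S.\<close>

lemma truncated_bound:
  assumes f: "is_solution a b z f" and N: "f (int N + 1) = 0" "N \<ge> 1" and fb: "form_bounded a b R"
    and a0: "a 0 > 0" and R: "R \<ge> 0"
  defines "d \<equiv> infdist z (spectral_set R)"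
  shows "d\<^sup>2 * (\<Sum>n\<in>{1..int N}. (cmod (f n))\<^sup>2) \<le> (a 0)\<^sup>2 * (cmod (f 0))\<^sup>2"
proof -
  define S where "S = (\<Sum>n\<in>{1..int N}. (cmod (f n))\<^sup>2)"
  obtain q where q: "\<bar>q\<bar> \<le> R * S" and qe: "of_real q = z * of_real S - of_real (a 0) * f 0 * cnj (f 1)"
    using truncated_form[OF f N fb] unfolding S_def by blast
  have S0: "S \<ge> 0" unfolding S_def by (simp add: sum_nonneg)
  have d0: "d \<ge> 0" by (simp add: d_def infdist_nonneg)
  show ?thesis
  proof (cases "S = 0")
    case False
    then have S: "S > 0" using S0 by simp
    have "\<bar>q / S\<bar> \<le> R" using q S by (simp add: field_simps)
    then have "q / S \<in> {- R..R}" unfolding abs_le_iff atLeastAtMost_iff by linarith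
    then have "of_real (q / S) \<in> spectral_set R" by (rule imageI)
    then have "d \<le> cmod (z - of_real (q / S))"
      unfolding d_def by (metis dist_norm infdist_le)
    then have "d * S \<le> cmod (z - of_real (q / S)) * S" using S by simp
    also have "\<dots> = cmod ((z - of_real (q / S)) * of_real S)" using S by (simp add: norm_mult)
    also have "(z - of_real (q / S)) * of_real S = of_real (a 0) * f 0 * cnj (f 1)"
      using S qe by (simp add: algebra_simps)
    finally have 1: "d * S \<le> a 0 * cmod (f 0) * cmod (f 1)"
      using a0 by (simp add: norm_mult)
    have "(cmod (f 1))\<^sup>2 \<le> S"
      unfolding S_def using N by (intro member_le_sum) auto
    moreover have "(d * S)\<^sup>2 \<le> (a 0 * cmod (f 0) * cmod (f 1))\<^sup>2"
      using 1 d0 S by (intro power_mono) auto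
    ultimately have "(d * S)\<^sup>2 \<le> (a 0 * cmod (f 0))\<^sup>2 * S"
      by (smt (verit) mult_left_mono power_mult_distrib zero_le_power2)
    then have "d\<^sup>2 * S * S \<le> (a 0)\<^sup>2 * (cmod (f 0))\<^sup>2 * S"
      by (simp add: power2_eq_square mult_ac)
    then show ?thesis using S by (simp only: S_def[symmetric] mult_le_cancel_right_pos)
  qed (simp add: S_def[symmetric])
qed

lemma infdist_spectral_pos: "R \<ge> 0 \<Longrightarrow> z \<notin> spectral_set R \<Longrightarrow> infdist z (spectral_set R) > 0"
  using infdist_pos_not_in_closed[OF closed_spectral_set] by auto

text \<open>A zero at N + 1 would make the solution an eigenvector of the section {1..N} with an
  eigenvalue outside [-R, R].\<close>

lemma solution_Dirichlet_nonzero: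
  assumes J: "jacobi_matrix a b" and fb: "form_bounded a b R" and R: "R \<ge> 0" and z: "z \<notin> spectral_set R" and N: "N \<ge> 1"
  shows "solution a b z 0 1 (int N + 1) \<noteq> 0"
proof
  assume 0: "solution a b z 0 1 (int N + 1) = 0"
  have a: "\<And>n. a n > 0" using J by (simp add: jacobi_matrix_def)
  have "(infdist z (spectral_set R))\<^sup>2 * (\<Sum>n\<in>{1..int N}. (cmod (solution a b z 0 1 n))\<^sup>2) \<le> 0"
    using truncated_bound[OF is_solution_solution[of a b z 0 1, OF a] 0 N fb a R] by simp
  moreover have "(cmod (solution a b z 0 1 1))\<^sup>2 \<le> (\<Sum>n\<in>{1..int N}. (cmod (solution a b z 0 1 n))\<^sup>2)"
    using N by (intro member_le_sum) auto
  ultimately show False using infdist_spectral_pos[OF R z]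
    by (simp add: mult_le_0_iff)
qed

lemma solution_linear:
  assumes a: "\<And>n. a n > 0"
  shows "solution a b z c d n = c * solution a b z 1 0 n + d * solution a b z 0 1 n"
proof -
  let ?f = "\<lambda>n. c * solution a b z 1 0 n + d * solution a b z 0 1 n"
  have "is_solution a b z ?f"
    by (rule is_solution_lincomb[OF is_solution_solution[of a b z 1 0, OF a] is_solution_solution[of a b z 0 1, OF a]])
  from is_solution_eq_solution[OF this a] have "?f = solution a b z c d" by simp
  from fun_cong[OF this, of n] show ?thesis by simp
qed

text \<open>The matrix is truncated to \<open>{1..N}\<close>: the solution with this ratio vanishes at \<open>N + 1\<close>.\<close>

definition truncated_m :: "(int \<Rightarrow> real) \<Rightarrow> (int \<Rightarrow> real) \<Rightarrow> nat \<Rightarrow> complex \<Rightarrow> complex" where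
  "truncated_m a b N z = solution a b z 1 0 (int N + 1) / (of_real (a 0) * solution a b z 0 1 (int N + 1))"

lemma truncated_m_solution:
  assumes J: "jacobi_matrix a b" and fb: "form_bounded a b R" and R: "R \<ge> 0" and z: "z \<notin> spectral_set R" and N: "N \<ge> 1"
  shows "solution a b z 1 (- of_real (a 0) * truncated_m a b N z) (int N + 1) = 0"
proof -
  have a: "\<And>n. a n > 0" using J by (simp add: jacobi_matrix_def)
  have "complex_of_real (a 0) \<noteq> 0" using a[of 0] by simp
  then show ?thesis using solution_Dirichlet_nonzero[OF assms]
    by (subst solution_linear[of a, OF a]) (simp add: truncated_m_def field_simps)
qed

lemma truncated_m_sum_bound:
  assumes J: "jacobi_matrix a b" and fb: "form_bounded a b R" and R: "R \<ge> 0" and z: "z \<notin> spectral_set R" and N: "N \<ge> 1"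
  shows "(\<Sum>n\<in>{1..int N}. (cmod (solution a b z 1 (- of_real (a 0) * truncated_m a b N z) n))\<^sup>2)
           \<le> (a 0)\<^sup>2 / (infdist z (spectral_set R))\<^sup>2"
proof -
  have a: "\<And>n. a n > 0" using J by (simp add: jacobi_matrix_def)
  show ?thesis
    using truncated_bound[OF is_solution_solution[of a b z 1 "- of_real (a 0) * truncated_m a b N z", OF a] 
       truncated_m_solution[OF assms] N fb a R] infdist_spectral_pos[OF R z]
    by (simp add: field_simps)
qed

lemma truncated_m_bound:
  assumes J: "jacobi_matrix a b" and fb: "form_bounded a b R" and R: "R \<ge> 0" and z: "z \<notin> spectral_set R" and N: "N \<ge> 1"
  shows "cmod (truncated_m a b N z) \<le> 1 / infdist z (spectral_set R)"
proof -
  let ?f = "solution a b z 1 (- of_real (a 0) * truncated_m a b N z)"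
  have a: "a 0 > 0" using J by (simp add: jacobi_matrix_def)
  have "(cmod (?f 1))\<^sup>2 \<le> (\<Sum>n\<in>{1..int N}. (cmod (?f n))\<^sup>2)"
    using N by (intro member_le_sum) auto
  also note truncated_m_sum_bound[OF assms]
  finally have "(a 0 * cmod (truncated_m a b N z))\<^sup>2 \<le> (a 0 / infdist z (spectral_set R))\<^sup>2"
    using a by (simp add: norm_mult power_divide)
  then have "a 0 * cmod (truncated_m a b N z) \<le> a 0 / infdist z (spectral_set R)"
    using a infdist_nonneg[of z "spectral_set R"] by (auto intro: power2_le_imp_le)
  then have "a 0 * cmod (truncated_m a b N z) \<le> a 0 * (1 / infdist z (spectral_set R))" by simp
  then show ?thesis using a by (simp only: mult_le_cancel_left_pos)
qed

lemma solution_holomorphic: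
  assumes "\<And>n. a n > 0" and "n \<ge> 0"
  shows "(\<lambda>z. solution a b z c d n) holomorphic_on S"
  using forward_solution_holomorphic[of a b c d "nat n" S] assms by (simp add: solution_def)

lemma truncated_m_holomorphic:
  assumes J: "jacobi_matrix a b" and fb: "form_bounded a b R" and R: "R \<ge> 0" and N: "N \<ge> 1"
  shows "truncated_m a b N holomorphic_on - spectral_set R"
  unfolding truncated_m_def
  using solution_Dirichlet_nonzero[OF J fb R _ N] J
  by (intro holomorphic_intros solution_holomorphic) (auto simp: jacobi_matrix_def less_imp_neq[symmetric])

lemma truncated_m_cnj:
  assumes J: "jacobi_matrix a b" 
  shows "truncated_m a b N (cnj z) = cnj (truncated_m a b N z)"
proof -
  have a: "\<And>n. a n > 0" using J by (simp add: jacobi_matrix_def)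
  show ?thesis using solution_cnj[of a b z 1 0, OF a] solution_cnj[of a b z 0 1, OF a] 
    by (simp add: truncated_m_def)
qed

text \<open>\<open>half_line_m a b R m\<close>: the function \<open>m\<close> continues \<open>m_plus a b\<close> to the complement of \<open>[-R, R]\<close>.\<close>

definition half_line_m :: "(int \<Rightarrow> real) \<Rightarrow> (int \<Rightarrow> real) \<Rightarrow> real \<Rightarrow> (complex \<Rightarrow> complex) \<Rightarrow> bool" where
  "half_line_m a b R m \<longleftrightarrow> m holomorphic_on - spectral_set R \<and>
     (\<forall>z. Im z > 0 \<longrightarrow> m_plus a b z = m z \<and> Im (m z) > 0 \<and> cmod (m z) \<le> 1 / Im z \<and>
        weyl_solution a b z (solution a b z 1 (- of_real (a 0) * m z))) \<and>
     (\<forall>z. z \<notin> spectral_set R \<longrightarrow> m (cnj z) = cnj (m z)) \<and>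
     ((\<lambda>z. z * m z) \<longlongrightarrow> -1) at_infinity \<and>
     (\<exists>r. strict_mono r \<and> (\<forall>z. z \<notin> spectral_set R \<longrightarrow> (\<lambda>k. truncated_m a b (Suc (r k)) z) \<longlonglongrightarrow> m z))"

lemma half_line_mD:
  assumes "half_line_m a b R m"
  shows "m holomorphic_on - spectral_set R"
    and "Im z > 0 \<Longrightarrow> m_plus a b z = m z" and "Im z > 0 \<Longrightarrow> Im (m z) > 0" and "Im z > 0 \<Longrightarrow> cmod (m z) \<le> 1 / Im z"
    and "Im z > 0 \<Longrightarrow> weyl_solution a b z (solution a b z 1 (- of_real (a 0) * m z))"
    and "z \<notin> spectral_set R \<Longrightarrow> m (cnj z) = cnj (m z)"
    and "((\<lambda>z. z * m z) \<longlongrightarrow> -1) at_infinity"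
  using assms unfolding half_line_m_def by blast+

text \<open>The function arises as a normal-family limit of the m functions of finite sections. The
  uniform l^2 bound for the sections survives the limit and makes the limiting solution a Weyl
  solution, which identifies the limit with \<open>m_plus\<close> on the upper half plane.\<close>

lemma half_line_m_exists:
  assumes J: "jacobi_matrix a b" and fb: "form_bounded a b R" and R: "R \<ge> 0"
  shows "\<exists>m. half_line_m a b R m"
proof -
  have a: "\<And>n. a n > 0" using J by (simp add: jacobi_matrix_def)
  let ?S = "- spectral_set R"
  let ?T = "\<lambda>n. truncated_m a b (Suc n)"
  let ?d = "\<lambda>z. infdist z (spectral_set R)"
  \<comment> \<open>The bound 1 / d is uniform on compact sets, so Montel's theorem applies. The
    subsequence is recorded in \<open>half_line_m\<close>, because
    \<open>half_line_m_pair_positive\<close> returns to the sections at real E.\<close>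
  obtain m r where m: "m holomorphic_on ?S" and r: "strict_mono r"
    and lim: "\<And>z. z \<in> ?S \<Longrightarrow> (\<lambda>n. ?T (r n) z) \<longlonglongrightarrow> m z"
  proof (rule Montel[of ?S "range ?T" ?T])
    show "open ?S" using closed_spectral_set by (simp add: open_Compl)
    show "h holomorphic_on ?S" if "h \<in> range ?T" for h
      using that truncated_m_holomorphic[OF J fb R] by auto
    show "\<exists>B. \<forall>h\<in>range ?T. \<forall>z\<in>K. cmod (h z) \<le> B" if K: "compact K" "K \<subseteq> ?S" for K
    proof (cases "K = {}")
      case False
      have "continuous_on K ?d" by (intro continuous_intros)
      then obtain w where w: "w \<in> K" "\<And>z. z \<in> K \<Longrightarrow> ?d w \<le> ?d z"
        using continuous_attains_inf[of K ?d] K False by auto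
      have dw: "?d w > 0" using infdist_spectral_pos[OF R] w K by blast
      have "cmod (?T n z) \<le> 1 / ?d w" if "z \<in> K" for n z
      proof -
        have "cmod (?T n z) \<le> 1 / ?d z"
          using truncated_m_bound[OF J fb R, of z "Suc n"] K that by auto
        also have "\<dots> \<le> 1 / ?d w"
          using dw w(2)[OF that] by (intro divide_left_mono) auto
        finally show ?thesis .
      qed
      then show ?thesis by blast
    qed auto
  qed auto
  define f where "f z = solution a b z 1 (- of_real (a 0) * m z)" for z
  \<comment> \<open>With K fixed, the sum over {1..K} is dominated by the sum over the whole section
    as soon as the section contains {1..K}.\<close>
  have fsum: "(\<Sum>n\<in>{1..int K}. (cmod (f z n))\<^sup>2) \<le> (a 0)\<^sup>2 / (?d z)\<^sup>2" if z: "z \<notin> spectral_set R" for z K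
  proof (rule LIMSEQ_le_const2)
    let ?g = "\<lambda>k. solution a b z 1 (- of_real (a 0) * ?T (r k) z)"
    have "(\<lambda>k. ?g k n) \<longlonglongrightarrow> f z n" for n
      unfolding f_def using z
      by (subst (1 2) solution_linear[of a, OF a]) (intro tendsto_intros lim, simp)
    then show "(\<lambda>k. \<Sum>n\<in>{1..int K}. (cmod (?g k n))\<^sup>2) \<longlonglongrightarrow> (\<Sum>n\<in>{1..int K}. (cmod (f z n))\<^sup>2)"
      by (intro tendsto_intros)
    have "(\<Sum>n\<in>{1..int K}. (cmod (?g k n))\<^sup>2) \<le> (a 0)\<^sup>2 / (?d z)\<^sup>2" if "k \<ge> K" for k
    proof -
      have "K \<le> Suc (r k)" using that seq_suble[OF r, of k] by simp
      then have "(\<Sum>n\<in>{1..int K}. (cmod (?g k n))\<^sup>2) \<le> (\<Sum>n\<in>{1..int (Suc (r k))}. (cmod (?g k n))\<^sup>2)"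
        by (intro sum_mono2) auto
      also have "\<dots> \<le> (a 0)\<^sup>2 / (?d z)\<^sup>2"
        using truncated_m_sum_bound[OF J fb R z, of "Suc (r k)"] by simp
      finally show ?thesis .
    qed
    then show "\<exists>N. \<forall>k\<ge>N. (\<Sum>n\<in>{1..int K}. (cmod (?g k n))\<^sup>2) \<le> (a 0)\<^sup>2 / (?d z)\<^sup>2" by blast
  qed
  have fss: "square_summable_on (f z) {0..}" if z: "z \<notin> spectral_set R" for z
    unfolding square_summable_on_nonneg_iff
  proof (rule bounded_imp_summable)
    fix n :: nat
    have "(\<Sum>k\<le>n. (cmod (f z (int k)))\<^sup>2) = (\<Sum>k\<in>int ` {..n}. (cmod (f z k))\<^sup>2)"
      by (simp add: sum.reindex)
    also have "int ` {..n} = insert 0 {1..int n}"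
      by (auto simp: atMost_atLeast0 image_int_atLeastAtMost)
    also have "(\<Sum>k\<in>\<dots>. (cmod (f z k))\<^sup>2) \<le> (cmod (f z 0))\<^sup>2 + (a 0)\<^sup>2 / (?d z)\<^sup>2"
      using fsum[OF z, of n] by simp
    finally show "(\<Sum>k\<le>n. (cmod (f z (int k)))\<^sup>2) \<le> (cmod (f z 0))\<^sup>2 + (a 0)\<^sup>2 / (?d z)\<^sup>2" .
  qed simp
  have weyl: "weyl_solution a b z (f z)" if "z \<notin> spectral_set R" for z
  proof -
    have "f z 0 \<noteq> 0" by (simp add: f_def)
    moreover have "is_solution a b z (f z)" unfolding f_def by (rule is_solution_solution[of a, OF a])
    ultimately show ?thesis using fss[OF that] by (auto simp: weyl_solution_def)
  qed
  have upper: "m_plus a b z = m z \<and> Im (m z) > 0 \<and> cmod (m z) \<le> 1 / Im z \<and> weyl_solution a b z (f z)" if "Im z > 0" for z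
  proof -
    have w: "weyl_solution a b z (f z)" using weyl that by (simp add: Im_nonzero_not_spectral)
    have "m_plus a b z = m z" using m_plus_eqI[OF J w that] a[of 0] by (simp add: f_def)
    then show ?thesis using weyl_solution_m_bounds[OF J w that] w by simp
  qed
  have sym: "m (cnj z) = cnj (m z)" if z: "z \<notin> spectral_set R" for z
  proof (rule LIMSEQ_unique)
    have "cnj z \<notin> spectral_set R" using z by (auto simp: image_iff complex_eq_iff)
    then show "(\<lambda>n. ?T (r n) (cnj z)) \<longlonglongrightarrow> m (cnj z)" using lim by auto
    show "(\<lambda>n. ?T (r n) (cnj z)) \<longlonglongrightarrow> cnj (m z)"
      using lim[of z] z by (simp add: truncated_m_cnj[OF J] lim_cnj)
  qed
  \<comment> \<open>The equation at site 1 reads a 1 f(2) + b 1 f(1) = - a 0 (z m + 1), and the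
    values of f on the left are at most a 0 / d, which tends to 0.\<close>
  have asym: "((\<lambda>z. z * m z) \<longlongrightarrow> -1) at_infinity"
  proof -
    have f_bound: "cmod (f z n) \<le> a 0 / ?d z" if z: "z \<notin> spectral_set R" and n: "n \<ge> 1" for z n
    proof -
      have "(cmod (f z n))\<^sup>2 \<le> (\<Sum>k\<in>{1..int (nat n)}. (cmod (f z k))\<^sup>2)"
        using n by (intro member_le_sum) auto
      also note fsum[OF z]
      finally have "(cmod (f z n))\<^sup>2 \<le> (a 0 / ?d z)\<^sup>2" by (simp add: power_divide)
      then show ?thesis using a[of 0] infdist_nonneg[of z "spectral_set R"] 
        by (auto intro: power2_le_imp_le)
    qed
    have dist: "?d z \<ge> cmod z - R" for z
    proof -
      have ne: "spectral_set R \<noteq> {}" using R by simp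
      have "cmod z - R \<le> dist z w" if "w \<in> spectral_set R" for w
      proof -
        have "cmod w \<le> R" using that by (auto simp: abs_le_iff)
        then show ?thesis using norm_triangle_ineq2[of z w] by (simp add: dist_norm)
      qed
      then show ?thesis using ne by (simp add: infdist_def cINF_greatest)
    qed
    have "((\<lambda>z. z * m z + 1) \<longlongrightarrow> 0) at_infinity"
    proof (rule Lim_null_comparison)
      show "\<forall>\<^sub>F z in at_infinity. cmod (z * m z + 1) \<le> (a 1 + \<bar>b 1\<bar>) / (cmod z - R)"
        unfolding eventually_at_infinity
      proof (intro exI allI impI)
        fix z :: complex assume zR: "R + 1 \<le> cmod z"
        then have z: "z \<notin> spectral_set R" by (auto simp: abs_le_iff)
        have "jacobi_op a b (f z) 1 = z * f z 1"
          using weyl[OF z] by (simp add: weyl_solution_def is_solution_def)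
        then have "of_real (a 1) * f z 2 + of_real (b 1) * f z 1 = - of_real (a 0) * (z * m z + 1)"
          by (simp add: jacobi_op_def f_def algebra_simps)
        then have "a 0 * cmod (z * m z + 1) = cmod (of_real (a 1) * f z 2 + of_real (b 1) * f z 1)"
          using a[of 0] by (simp add: norm_mult)
        also have "\<dots> \<le> a 1 * cmod (f z 2) + \<bar>b 1\<bar> * cmod (f z 1)"
          using norm_triangle_ineq[of "of_real (a 1) * f z 2" "of_real (b 1) * f z 1"] a[of 1] by (simp add: norm_mult)
        also have "\<dots> \<le> a 1 * (a 0 / ?d z) + \<bar>b 1\<bar> * (a 0 / ?d z)"
          using a[of 1] by (intro add_mono mult_left_mono f_bound z) auto
        also have "\<dots> = a 0 * ((a 1 + \<bar>b 1\<bar>) / ?d z)" by (simp add: algebra_simps add_divide_distrib)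
        finally have "cmod (z * m z + 1) \<le> (a 1 + \<bar>b 1\<bar>) / ?d z"
          using a[of 0] by (simp only: mult_le_cancel_left_pos)
        also have "\<dots> \<le> (a 1 + \<bar>b 1\<bar>) / (cmod z - R)"
          using dist[of z] zR a[of 1] by (intro divide_left_mono) (auto intro!: mult_pos_pos)
        finally show "cmod (z * m z + 1) \<le> (a 1 + \<bar>b 1\<bar>) / (cmod z - R)" .
      qed
      have "filterlim (\<lambda>z::complex. - R + cmod z) at_top at_infinity"
        by (rule filterlim_tendsto_add_at_top[OF tendsto_const filterlim_norm_at_top])
      then have "filterlim (\<lambda>z::complex. cmod z - R) at_infinity at_infinity"
        by (intro filterlim_at_top_imp_at_infinity) simp
      then show "((\<lambda>z::complex. (a 1 + \<bar>b 1\<bar>) / (cmod z - R)) \<longlongrightarrow> 0) at_infinity"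
        by (rule tendsto_divide_0[OF tendsto_const])
    qed
    from tendsto_add[OF this tendsto_const[of "-1"]] show ?thesis by simp
  qed
  show ?thesis
    unfolding half_line_m_def
    using m upper[unfolded f_def] sym asym r lim by blast
qed

section \<open>The operator norm and the quadratic form\<close>

lemma form_boundedD:
  "form_bounded a b R \<Longrightarrow> finite A \<Longrightarrow> (\<And>n. n \<notin> A \<Longrightarrow> u n = 0) \<Longrightarrow>
     \<bar>\<Sum>n\<in>A. Re (cnj (u n) * jacobi_op a b u n)\<bar> \<le> R * (\<Sum>n\<in>A. (cmod (u n))\<^sup>2)"
  unfolding form_bounded_def by blast

lemma l2_norm_nonneg: "l2_norm u \<ge> 0"
  unfolding l2_norm_def by (simp add: infsum_nonneg)

lemma l2_norm_sq: "(l2_norm u)\<^sup>2 = (\<Sum>\<^sub>\<infinity>n\<in>UNIV. (cmod (u n))\<^sup>2)"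
  unfolding l2_norm_def by (simp add: infsum_nonneg)

lemma sum_le_l2_norm:
  assumes "square_summable_on u UNIV" "finite A"
  shows "(\<Sum>n\<in>A. (cmod (u n))\<^sup>2) \<le> (l2_norm u)\<^sup>2"
  using assms unfolding l2_norm_sq square_summable_on_def by (intro finite_sum_le_infsum) auto

lemma finite_support_l2:
  assumes "finite A" "\<And>n. n \<notin> A \<Longrightarrow> u n = 0"
  shows "square_summable_on u UNIV" and "(l2_norm u)\<^sup>2 = (\<Sum>n\<in>A. (cmod (u n))\<^sup>2)"
proof -
  have "(\<lambda>n. (cmod (u n))\<^sup>2) summable_on A" using assms by (simp add: summable_on_finite)
  then show "square_summable_on u UNIV"
    unfolding square_summable_on_def
    by (rule summable_on_cong_neutral[THEN iffD1, rotated -1]) (use assms in auto)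
  have "(\<Sum>\<^sub>\<infinity>n\<in>UNIV. (cmod (u n))\<^sup>2) = (\<Sum>\<^sub>\<infinity>n\<in>A. (cmod (u n))\<^sup>2)"
    by (rule infsum_cong_neutral) (use assms in auto)
  then show "(l2_norm u)\<^sup>2 = (\<Sum>n\<in>A. (cmod (u n))\<^sup>2)"
    using assms unfolding l2_norm_sq by simp
qed

lemma cmod_add3_sq: "(cmod (x + y + w))\<^sup>2 \<le> 3 * ((cmod x)\<^sup>2 + (cmod y)\<^sup>2 + (cmod w)\<^sup>2)"
proof -
  have "cmod (x + y + w) \<le> cmod x + cmod y + cmod w"
    using norm_triangle_ineq[of "x + y" w] norm_triangle_ineq[of x y] by linarith
  then have "(cmod (x + y + w))\<^sup>2 \<le> (cmod x + cmod y + cmod w)\<^sup>2" by (simp add: power_mono)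
  also have "\<dots> \<le> 3 * ((cmod x)\<^sup>2 + (cmod y)\<^sup>2 + (cmod w)\<^sup>2)"
    using sum_squares_bound[of "cmod x" "cmod y"] sum_squares_bound[of "cmod x" "cmod w"]
      sum_squares_bound[of "cmod y" "cmod w"] by (simp add: power2_eq_square algebra_simps)
  finally show ?thesis .
qed

text \<open>A crude constant suffices: it shows that the supremum in \<open>jacobi_norm\<close> is
  over a bounded set and that J maps l^2 to itself.\<close>

lemma jacobi_op_bounded:
  assumes J: "jacobi_matrix a b"
  shows "\<exists>C\<ge>0. \<forall>u. square_summable_on u UNIV \<longrightarrow>
           square_summable_on (jacobi_op a b u) UNIV \<and> (l2_norm (jacobi_op a b u))\<^sup>2 \<le> C * (l2_norm u)\<^sup>2"
proof -
  obtain A B where A: "\<And>n. \<bar>a n\<bar> \<le> A" and B: "\<And>n. \<bar>b n\<bar> \<le> B"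
    using J by (auto simp: jacobi_matrix_def bounded_iff)
  have A0: "A \<ge> 0" and B0: "B \<ge> 0" using A[of 0] B[of 0] by linarith+
  define M where "M = A\<^sup>2 + B\<^sup>2"
  have M: "M \<ge> 0" by (simp add: M_def)
  have "square_summable_on (jacobi_op a b u) UNIV \<and> (l2_norm (jacobi_op a b u))\<^sup>2 \<le> (9 * M) * (l2_norm u)\<^sup>2"
    if u: "square_summable_on u UNIV" for u
  proof -
    let ?g = "\<lambda>n. (cmod (u n))\<^sup>2"
    let ?h = "\<lambda>n. 3 * (M * ?g (n + 1) + M * ?g (n - 1) + M * ?g n)"
    have bij: "bij_betw (\<lambda>n::int. n + 1) UNIV UNIV" "bij_betw (\<lambda>n::int. n - 1) UNIV UNIV"
      by (rule bij_betw_byWitness[where f' = "\<lambda>n. n - 1"], auto)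
         (rule bij_betw_byWitness[where f' = "\<lambda>n. n + 1"], auto)
    have g: "?g summable_on UNIV" using u by (simp add: square_summable_on_def)
    have gp: "(\<lambda>n. ?g (n + 1)) summable_on UNIV" using summable_on_reindex_bij_betw[OF bij(1), of ?g] g by simp
    have gm: "(\<lambda>n. ?g (n - 1)) summable_on UNIV" using summable_on_reindex_bij_betw[OF bij(2), of ?g] g by simp
    have ip: "(\<Sum>\<^sub>\<infinity>n. ?g (n + 1)) = (\<Sum>\<^sub>\<infinity>n. ?g n)" by (rule infsum_reindex_bij_betw[OF bij(1), of ?g])
    have im: "(\<Sum>\<^sub>\<infinity>n. ?g (n - 1)) = (\<Sum>\<^sub>\<infinity>n. ?g n)" by (rule infsum_reindex_bij_betw[OF bij(2), of ?g])
    have hs: "?h summable_on UNIV"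
      by (intro summable_on_cmult_right summable_on_add g gp gm)
    have coef: "(cmod (of_real x * w))\<^sup>2 \<le> M * (cmod w)\<^sup>2" if "\<bar>x\<bar> \<le> A \<or> \<bar>x\<bar> \<le> B" for x w
    proof -
      have "x\<^sup>2 \<le> M" using that
        unfolding M_def by (metis A0 B0 abs_ge_zero add_increasing add_increasing2 power2_abs power_mono zero_le_power2)
      then show ?thesis by (simp add: norm_mult power_mult_distrib mult_right_mono)
    qed
    have le: "(cmod (jacobi_op a b u n))\<^sup>2 \<le> ?h n" for n
    proof -
      have "(cmod (jacobi_op a b u n))\<^sup>2 \<le> 3 * ((cmod (of_real (a n) * u (n + 1)))\<^sup>2
          + (cmod (of_real (a (n - 1)) * u (n - 1)))\<^sup>2 + (cmod (of_real (b n) * u n))\<^sup>2)"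
        unfolding jacobi_op_def by (rule cmod_add3_sq)
      also have "\<dots> \<le> ?h n"
        using A B by (intro mult_left_mono add_mono coef) auto
      finally show ?thesis .
    qed
    have s: "(\<lambda>n. (cmod (jacobi_op a b u n))\<^sup>2) summable_on UNIV"
      by (rule summable_on_comparison_test[OF hs]) (use le in auto)
    have "(\<Sum>\<^sub>\<infinity>n. (cmod (jacobi_op a b u n))\<^sup>2) \<le> (\<Sum>\<^sub>\<infinity>n. ?h n)"
      by (rule infsum_mono[OF s hs]) (use le in auto)
    also have "\<dots> = 3 * (M * (\<Sum>\<^sub>\<infinity>n. ?g n) + M * (\<Sum>\<^sub>\<infinity>n. ?g n) + M * (\<Sum>\<^sub>\<infinity>n. ?g n))"
      using g gp gm by (simp add: infsum_cmult_right summable_on_add summable_on_cmult_right infsum_add ip im)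
    finally show ?thesis using s by (simp add: l2_norm_sq square_summable_on_def)
  qed
  then show ?thesis using M by (intro exI[of _ "9 * M"]) auto
qed

text \<open>Normalise the vector and apply the Cauchy-Schwarz inequality.\<close>

lemma form_bounded_jacobi_norm:
  assumes J: "jacobi_matrix a b"
  shows "form_bounded a b (jacobi_norm a b)"
  unfolding form_bounded_def
proof (intro allI impI)
  fix u :: "int \<Rightarrow> complex" and A :: "int set"
  assume A: "finite A" and u0: "\<forall>n. n \<notin> A \<longrightarrow> u n = 0"
  let ?R = "jacobi_norm a b"
  obtain C where C: "C \<ge> 0" "\<And>u. square_summable_on u UNIV \<Longrightarrow> square_summable_on (jacobi_op a b u) UNIV"
    "\<And>u. square_summable_on u UNIV \<Longrightarrow> (l2_norm (jacobi_op a b u))\<^sup>2 \<le> C * (l2_norm u)\<^sup>2"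
    using jacobi_op_bounded[OF J] by blast
  have norm1: "l2_norm (jacobi_op a b v) \<le> ?R" if "square_summable_on v UNIV" "l2_norm v \<le> 1" for v
    unfolding jacobi_norm_def
  proof (rule cSUP_upper)
    show "bdd_above ((\<lambda>u. l2_norm (jacobi_op a b u)) ` {u. square_summable_on u UNIV \<and> l2_norm u \<le> 1})"
    proof (rule bdd_aboveI2)
      fix w assume w: "w \<in> {u. square_summable_on u UNIV \<and> l2_norm u \<le> 1}"
      have "(l2_norm w)\<^sup>2 \<le> 1" using w l2_norm_nonneg[of w] by (simp add: power_le_one)
      then have "C * (l2_norm w)\<^sup>2 \<le> C * 1" using C(1) by (intro mult_left_mono)
      then have "(l2_norm (jacobi_op a b w))\<^sup>2 \<le> C" using C(3)[of w] w by auto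
      then show "l2_norm (jacobi_op a b w) \<le> sqrt C" by (rule real_le_rsqrt)
    qed
  qed (use that in auto)
  define S where "S = (\<Sum>n\<in>A. (cmod (u n))\<^sup>2)"
  have S0: "S \<ge> 0" by (simp add: S_def sum_nonneg)
  show "\<bar>\<Sum>n\<in>A. Re (cnj (u n) * jacobi_op a b u n)\<bar> \<le> ?R * (\<Sum>n\<in>A. (cmod (u n))\<^sup>2)"
  proof (cases "S = 0")
    case True
    then have "u n = 0" if "n \<in> A" for n
      using A that by (simp add: S_def sum_nonneg_eq_0_iff)
    then show ?thesis by simp
  next
    case False
    then have S: "S > 0" using S0 by simp
    define v where "v n = of_real (1 / sqrt S) * u n" for n
    have v0: "\<And>n. n \<notin> A \<Longrightarrow> v n = 0" using u0 by (simp add: v_def)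
    have vn: "(\<Sum>n\<in>A. (cmod (v n))\<^sup>2) = 1"
      using S by (simp add: v_def norm_mult power_mult_distrib norm_divide power_divide S_def sum_divide_distrib[symmetric])
    have vs: "square_summable_on v UNIV" "(l2_norm v)\<^sup>2 = 1"
      using finite_support_l2[of A v] A v0 vn by auto
    then have "l2_norm v = 1" using l2_norm_nonneg[of v] by (simp add: power2_eq_1_iff)
    then have Jv: "l2_norm (jacobi_op a b v) \<le> ?R" using norm1 vs by simp
    have Jvu: "jacobi_op a b v n = of_real (1 / sqrt S) * jacobi_op a b u n" for n
      by (simp add: jacobi_op_def v_def algebra_simps)
    have "\<bar>\<Sum>n\<in>A. Re (cnj (v n) * jacobi_op a b v n)\<bar> \<le> (\<Sum>n\<in>A. \<bar>cmod (v n)\<bar> * \<bar>cmod (jacobi_op a b v n)\<bar>)"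
      by (rule order_trans[OF sum_abs]) (intro sum_mono, metis abs_Re_le_cmod abs_norm_cancel norm_mult complex_mod_cnj)
    also have "\<dots> \<le> L2_set (\<lambda>n. cmod (v n)) A * L2_set (\<lambda>n. cmod (jacobi_op a b v n)) A"
      by (rule L2_set_mult_ineq)
    also have "L2_set (\<lambda>n. cmod (v n)) A = 1" using vn by (simp add: L2_set_def)
    also have "1 * L2_set (\<lambda>n. cmod (jacobi_op a b v n)) A \<le> l2_norm (jacobi_op a b v)"
      using sum_le_l2_norm[OF C(2)[OF vs(1)] A] l2_norm_nonneg by (simp add: L2_set_def real_le_lsqrt)
    also note Jv
    also have "(\<Sum>n\<in>A. Re (cnj (v n) * jacobi_op a b v n)) = (\<Sum>n\<in>A. Re (cnj (u n) * jacobi_op a b u n)) / S"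
    proof -
      have "Re (cnj (v n) * jacobi_op a b v n) = Re (cnj (u n) * jacobi_op a b u n) / S" for n
      proof -
        have "cnj (v n) * jacobi_op a b v n = of_real (1 / sqrt S * (1 / sqrt S)) * (cnj (u n) * jacobi_op a b u n)"
          by (simp only: Jvu v_def complex_cnj_mult complex_cnj_complex_of_real of_real_mult mult_ac)
        also have "1 / sqrt S * (1 / sqrt S) = 1 / S" using S by simp
        finally show ?thesis by simp
      qed
      then show ?thesis by (simp add: sum_divide_distrib)
    qed
    finally show ?thesis using S by (simp add: S_def[symmetric] field_simps)
  qed
qed

lemma form_bounded_mono: "form_bounded a b R \<Longrightarrow> R \<le> R' \<Longrightarrow> form_bounded a b R'"
  unfolding form_bounded_def by (meson mult_right_mono order_trans sum_nonneg zero_le_power2)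

section \<open>The norm of a symmetric matrix from its quadratic form\<close>

lemma telescope_symmetric:
  fixes t :: "int \<Rightarrow> real"
  shows "(\<Sum>n\<in>{- int N..int N}. t n - t (n - 1)) = t (int N) - t (- int N - 1)"
proof -
  have "(\<Sum>n\<in>{- int N..- int N + int K}. t n - t (n - 1)) = t (- int N + int K) - t (- int N - 1)" for K
  proof (induction K)
    case (Suc K)
    have "{- int N..- int N + int (Suc K)} = insert (- int N + int (Suc K)) {- int N..- int N + int K}" by auto
    then show ?case using Suc by (simp add: algebra_simps)
  qed simp
  from this[of "2 * N"] show ?thesis by simp
qed

lemma jacobi_op_symmetric:
  assumes u: "\<And>n. \<bar>n\<bar> \<ge> int N \<Longrightarrow> u n = 0" and v: "\<And>n. \<bar>n\<bar> \<ge> int N \<Longrightarrow> v n = 0"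
  shows "(\<Sum>n\<in>{- int N..int N}. Re (cnj (u n) * jacobi_op a b v n)) = (\<Sum>n\<in>{- int N..int N}. Re (cnj (v n) * jacobi_op a b u n))"
proof -
  define t where "t n = a n * Re (cnj (u n) * v (n + 1) - cnj (v n) * u (n + 1))" for n
  have "Re (cnj (u n) * jacobi_op a b v n) - Re (cnj (v n) * jacobi_op a b u n) = t n - t (n - 1)" for n
    by (simp add: jacobi_op_def t_def algebra_simps)
  moreover have "t (int N) = 0" "t (- int N - 1) = 0" using u v by (auto simp: t_def)
  ultimately have "(\<Sum>n\<in>{- int N..int N}. Re (cnj (u n) * jacobi_op a b v n) - Re (cnj (v n) * jacobi_op a b u n)) = 0"
    by (simp add: telescope_symmetric)
  then show ?thesis by (simp only: sum_subtractf right_minus_eq)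
qed

text \<open>For a symmetric operator the numerical radius bounds the norm. Polarisation with v = J u
  / R expresses |J u|^2 by the forms of u + v and u - v, and the parallelogram law sums their norms;
  the scaling 1 / R balances the two terms so that exactly R^2 comes out.\<close>

lemma form_bounded_imp_op_bounded:
  assumes fb: "form_bounded a b R" and R: "R > 0" and u: "\<And>n. \<bar>n\<bar> > int K \<Longrightarrow> u n = 0"
  shows "(\<Sum>n\<in>{- int K..int K}. (cmod (jacobi_op a b u n))\<^sup>2) \<le> R\<^sup>2 * (\<Sum>n\<in>{- int K..int K}. (cmod (u n))\<^sup>2)"
proof -
  \<comment> \<open>J u reaches one site beyond the support of u, and
    \<open>jacobi_op_symmetric\<close> wants both vectors to vanish already at N.\<close>
  define N where "N = K + 2"
  let ?A = "{- int N..int N}"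
  let ?Q = "\<lambda>u v. \<Sum>n\<in>?A. Re (cnj (u n) * jacobi_op a b v n)"
  let ?n = "\<lambda>u. \<Sum>n\<in>?A. (cmod (u n))\<^sup>2"
  define v where "v n = of_real (1 / R) * jacobi_op a b u n" for n
  have v0: "v n = 0" if "\<bar>n\<bar> \<ge> int N" for n
    using that u[of n] u[of "n + 1"] u[of "n - 1"] by (simp add: v_def jacobi_op_def N_def)
  have u0: "u n = 0" if "\<bar>n\<bar> \<ge> int N" for n using that u[of n] by (simp add: N_def)
  have fbA: "\<bar>?Q w w\<bar> \<le> R * ?n w" if "\<And>n. \<bar>n\<bar> \<ge> int N \<Longrightarrow> w n = 0" for w
  proof -
    have "w n = 0" if "n \<notin> ?A" for n using that \<open>\<And>n. \<bar>n\<bar> \<ge> int N \<Longrightarrow> w n = 0\<close>[of n] by auto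
    with fb show ?thesis unfolding form_bounded_def by blast
  qed
  let ?p = "\<lambda>n. u n + v n" and ?m = "\<lambda>n. u n - v n"
  have "?Q ?p ?p - ?Q ?m ?m = 2 * ?Q u v + 2 * ?Q v u"
  proof -
    have "Re (cnj (?p n) * jacobi_op a b ?p n) - Re (cnj (?m n) * jacobi_op a b ?m n)
        = 2 * Re (cnj (u n) * jacobi_op a b v n) + 2 * Re (cnj (v n) * jacobi_op a b u n)" for n
      by (simp add: jacobi_op_def algebra_simps)
    then show ?thesis
      by (simp only: sum_distrib_left sum.distrib[symmetric] sum_subtractf[symmetric])
  qed
  also have "\<dots> = 4 * ?Q v u"
    using jacobi_op_symmetric[of N u v a b] u0 v0 by simp
  also have "?Q v u = (1 / R) * ?n (jacobi_op a b u)"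
    unfolding sum_distrib_left
  proof (intro sum.cong refl)
    fix n
    have "cnj (v n) * jacobi_op a b u n = of_real (1 / R) * (jacobi_op a b u n * cnj (jacobi_op a b u n))"
      by (simp add: v_def)
    also have "\<dots> = of_real (1 / R * (cmod (jacobi_op a b u n))\<^sup>2)"
      by (simp only: complex_norm_square of_real_mult)
    finally show "Re (cnj (v n) * jacobi_op a b u n) = 1 / R * (cmod (jacobi_op a b u n))\<^sup>2" by simp
  qed
  finally have pol: "?Q ?p ?p - ?Q ?m ?m = 4 / R * ?n (jacobi_op a b u)" by simp
  have "?Q ?p ?p - ?Q ?m ?m \<le> R * ?n ?p + R * ?n ?m"
    using fbA[of ?p] fbA[of ?m] u0 v0 by (simp add: abs_le_iff)
  also have "\<dots> = 2 * R * (?n u + ?n v)"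
  proof -
    have "(cmod (x + y))\<^sup>2 + (cmod (x - y))\<^sup>2 = 2 * ((cmod x)\<^sup>2 + (cmod y)\<^sup>2)" for x y :: complex
      by (simp only: cmod_power2) (simp add: power2_eq_square algebra_simps)
    then have "?n ?p + ?n ?m = 2 * (?n u + ?n v)"
      by (simp only: sum.distrib[symmetric] sum_distrib_left)
    then have "R * (?n ?p + ?n ?m) = R * (2 * (?n u + ?n v))" by simp
    then show ?thesis by (simp only: distrib_left mult.assoc mult.left_commute)
  qed
  also have "?n v = 1 / R\<^sup>2 * ?n (jacobi_op a b u)"
    unfolding sum_distrib_left v_def by (simp add: norm_mult power_mult_distrib norm_divide power_divide)
  finally have "4 / R * ?n (jacobi_op a b u) \<le> 2 * R * (?n u + 1 / R\<^sup>2 * ?n (jacobi_op a b u))"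
    unfolding pol .
  then have "?n (jacobi_op a b u) \<le> R\<^sup>2 * ?n u"
    using R by (simp add: field_simps power2_eq_square)
  moreover have "(\<Sum>n\<in>{- int K..int K}. (cmod (jacobi_op a b u n))\<^sup>2) \<le> ?n (jacobi_op a b u)"
    by (intro sum_mono2) (auto simp: N_def)
  moreover have "?n u = (\<Sum>n\<in>{- int K..int K}. (cmod (u n))\<^sup>2)"
    by (intro sum.mono_neutral_right) (auto simp: N_def intro!: u)
  ultimately show ?thesis by simp
qed

lemma jacobi_norm_le:
  assumes J: "jacobi_matrix a b" and fb: "form_bounded a b R" and R: "R > 0"
  shows "jacobi_norm a b \<le> R"
  unfolding jacobi_norm_def
proof (rule cSUP_least)
  have "(\<lambda>_. 0) \<in> {u. square_summable_on u UNIV \<and> l2_norm u \<le> 1}"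
    by (simp add: square_summable_on_def l2_norm_def)
  then show "{u. square_summable_on u UNIV \<and> l2_norm u \<le> 1} \<noteq> {}" by blast
next
  fix u assume "u \<in> {u. square_summable_on u UNIV \<and> l2_norm u \<le> 1}"
  then have us: "square_summable_on u UNIV" and u1: "l2_norm u \<le> 1" by auto
  have "(\<Sum>\<^sub>\<infinity>n. (cmod (jacobi_op a b u n))\<^sup>2) \<le> R\<^sup>2"
  proof (rule infsum_le_finite_sums)
    show "(\<lambda>n. (cmod (jacobi_op a b u n))\<^sup>2) summable_on UNIV"
      using jacobi_op_bounded[OF J] us by (auto simp: square_summable_on_def)
    fix F :: "int set" assume F: "finite F"
    define K where "K = nat (Max (insert 0 (abs ` F)))"
    have FK: "F \<subseteq> {- int K..int K}"
    proof
      fix n assume "n \<in> F"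
      then have "\<bar>n\<bar> \<le> Max (insert 0 (abs ` F))" using F by (intro Max_ge) auto
      then show "n \<in> {- int K..int K}" by (auto simp: K_def)
    qed
    \<comment> \<open>Cutting off one site beyond K leaves J u unchanged on {-K..K}.\<close>
    define w where "w n = (if \<bar>n\<bar> \<le> int (Suc K) then u n else 0)" for n
    have "(\<Sum>n\<in>F. (cmod (jacobi_op a b u n))\<^sup>2) \<le> (\<Sum>n\<in>{- int K..int K}. (cmod (jacobi_op a b u n))\<^sup>2)"
      using FK by (intro sum_mono2) auto
    also have "\<dots> = (\<Sum>n\<in>{- int K..int K}. (cmod (jacobi_op a b w n))\<^sup>2)"
      by (intro sum.cong refl) (auto simp: jacobi_op_def w_def)
    also have "\<dots> \<le> (\<Sum>n\<in>{- int (Suc K)..int (Suc K)}. (cmod (jacobi_op a b w n))\<^sup>2)"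
      by (intro sum_mono2) auto
    also have "\<dots> \<le> R\<^sup>2 * (\<Sum>n\<in>{- int (Suc K)..int (Suc K)}. (cmod (w n))\<^sup>2)"
      by (rule form_bounded_imp_op_bounded[OF fb R]) (simp add: w_def)
    also have "(\<Sum>n\<in>{- int (Suc K)..int (Suc K)}. (cmod (w n))\<^sup>2) = (\<Sum>n\<in>{- int (Suc K)..int (Suc K)}. (cmod (u n))\<^sup>2)"
      by (intro sum.cong refl) (auto simp: w_def)
    also have "R\<^sup>2 * \<dots> \<le> R\<^sup>2 * 1"
      using sum_le_l2_norm[OF us, of "{- int (Suc K)..int (Suc K)}"] u1 l2_norm_nonneg[of u]
      by (intro mult_left_mono) (auto simp: power_le_one intro: order_trans)
    finally show "(\<Sum>n\<in>F. (cmod (jacobi_op a b u n))\<^sup>2) \<le> R\<^sup>2" by simp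
  qed
  then show "l2_norm (jacobi_op a b u) \<le> R"
    using R unfolding l2_norm_def by (intro real_le_lsqrt) (auto simp: infsum_nonneg)
qed

lemma form_bounded_reflect:
  assumes "form_bounded a b R"
  shows "form_bounded (reflect_a a) (reflect_b b) R"
  unfolding form_bounded_def
proof (intro allI impI)
  fix u :: "int \<Rightarrow> complex" and A :: "int set"
  assume A: "finite A" and u0: "\<forall>n. n \<notin> A \<longrightarrow> u n = 0"
  let ?v = "\<lambda>n. u (- n)"
  have v0: "?v n = 0" if "n \<notin> uminus ` A" for n
    using that u0 rev_image_eqI[of "- n" A n uminus] by auto
  have "jacobi_op (reflect_a a) (reflect_b b) u n = jacobi_op a b ?v (- n)" for n
    using jacobi_op_reflect[of a b ?v n] by simp
  then have "(\<Sum>n\<in>A. Re (cnj (u n) * jacobi_op (reflect_a a) (reflect_b b) u n))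
      = (\<Sum>n\<in>uminus ` A. Re (cnj (?v n) * jacobi_op a b ?v n))"
    by (simp add: sum.reindex)
  moreover have "(\<Sum>n\<in>A. (cmod (u n))\<^sup>2) = (\<Sum>n\<in>uminus ` A. (cmod (?v n))\<^sup>2)"
    by (simp add: sum.reindex)
  ultimately show "\<bar>\<Sum>n\<in>A. Re (cnj (u n) * jacobi_op (reflect_a a) (reflect_b b) u n)\<bar> \<le> R * (\<Sum>n\<in>A. (cmod (u n))\<^sup>2)"
    using form_boundedD[OF assms finite_imageI[OF A], of uminus ?v] v0 by presburger
qed

text \<open>Formally X is -1 / G(0, 0; E) for the Green function of J, whose sign is fixed off the
  spectrum. It is obtained here from the form bound, applied to the two half-line solutions of
  finite sections joined at site 0.\<close>

lemma half_line_m_pair_positive: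
  assumes J: "jacobi_matrix a b" and fb: "form_bounded a b R" and R: "R \<ge> 0"
    and mp: "half_line_m a b R mp" and mr: "half_line_m (reflect_a a) (reflect_b b) R mr" and E: "\<bar>E\<bar> > R"
  defines "X \<equiv> of_real ((a 0)\<^sup>2) * mp (of_real E) + of_real ((a (-1))\<^sup>2) * mr (of_real E) + of_real E - of_real (b 0)"
  shows "sgn E * Re X > 0"
proof -
  let ?a' = "reflect_a a" and ?b' = "reflect_b b" and ?z = "complex_of_real E"
  have a: "\<And>n. a n > 0" using J by (simp add: jacobi_matrix_def)
  note J' = jacobi_matrix_reflect[OF J] and fb' = form_bounded_reflect[OF fb]
  have a': "\<And>n. ?a' n > 0" using J' by (simp add: jacobi_matrix_def)
  have z: "?z \<notin> spectral_set R" using E by auto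
  obtain r where r: "(\<lambda>k. truncated_m a b (Suc (r k)) ?z) \<longlonglongrightarrow> mp ?z"
    using mp z unfolding half_line_m_def by blast
  obtain s where s: "(\<lambda>k. truncated_m ?a' ?b' (Suc (s k)) ?z) \<longlonglongrightarrow> mr ?z"
    using mr z unfolding half_line_m_def by blast
  define X' where "X' k = of_real ((a 0)\<^sup>2) * truncated_m a b (Suc (r k)) ?z
     + of_real ((a (-1))\<^sup>2) * truncated_m ?a' ?b' (Suc (s k)) ?z + of_real E - of_real (b 0)" for k
  have lim: "X' \<longlonglongrightarrow> X" unfolding X'_def X_def by (intro tendsto_intros r s)
  have bound: "sgn E * Re (X' k) \<ge> \<bar>E\<bar> - R" for k
  proof -
    define N M where "N = Suc (r k)" and "M = Suc (s k)"
    define f where "f = solution a b ?z 1 (- of_real (a 0) * truncated_m a b N ?z)"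
    define g where "g = solution ?a' ?b' ?z 1 (- of_real (?a' 0) * truncated_m ?a' ?b' M ?z)"
    have f: "jacobi_op a b f n = ?z * f n" for n
      using is_solution_solution[of a b, OF a] by (simp add: f_def is_solution_def)
    have g: "jacobi_op ?a' ?b' g n = ?z * g n" for n
      using is_solution_solution[of ?a' ?b', OF a'] by (simp add: g_def is_solution_def)
    have g': "jacobi_op a b (\<lambda>n. g (- n)) n = ?z * g (- n)" for n
      using g[of "- n"] jacobi_op_reflect[of a b "\<lambda>n. g (- n)" "- n"] by simp
    have fN: "f (int N + 1) = 0" unfolding f_def
      by (rule truncated_m_solution[OF J fb R z]) (simp add: N_def)
    have gM: "g (int M + 1) = 0" unfolding g_def
      by (rule truncated_m_solution[OF J' fb' R z]) (simp add: M_def)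
    define A where "A = {- int M..int N}"
    \<comment> \<open>Both halves equal 1 at site 0 and vanish just outside the section. So J u = E
      u holds everywhere on \<open>A\<close> except at 0, where the defect is exactly
      \<open>X' k\<close>.\<close>
    define u where "u n = (if n \<notin> A then 0 else if n \<ge> 0 then f n else g (- n))" for n
    have up: "u n = f n" if "0 \<le> n" "n \<le> int N + 1" for n
      using that fN by (cases "n = int N + 1") (auto simp: u_def A_def)
    have f0: "f 0 = 1" "g 0 = 1" by (simp_all add: f_def g_def)
    have um: "u n = g (- n)" if "n \<le> 0" "- int M - 1 \<le> n" for n
    proof (cases "n = 0")
      case True then show ?thesis using f0 by (simp add: u_def A_def)
    next
      case False then show ?thesis using that gM by (cases "n = - int M - 1") (auto simp: u_def A_def add.commute)
    qed
    have Jp: "jacobi_op a b u n = ?z * u n" if "n \<in> A" "n \<ge> 1" for n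
    proof -
      have "jacobi_op a b u n = jacobi_op a b f n"
        using that by (simp add: jacobi_op_def up A_def)
      then show ?thesis using f[of n] that up[of n] by (simp add: A_def)
    qed
    have Jm: "jacobi_op a b u n = ?z * u n" if "n \<in> A" "n \<le> -1" for n
    proof -
      have "jacobi_op a b u n = jacobi_op a b (\<lambda>n. g (- n)) n"
        using that by (simp add: jacobi_op_def um A_def)
      then show ?thesis using g'[of n] that um[of n] by (simp add: A_def)
    qed
    have J0: "jacobi_op a b u 0 = ?z - X' k"
    proof -
      have "u 1 = f 1" "u (-1) = g 1" "u 0 = 1"
        using up[of 1] um[of "-1"] up[of 0] f0 by (simp_all add: N_def M_def)
      moreover have "?a' 0 = a (-1)" by (simp add: reflect_a_def)
      ultimately show ?thesis
        by (simp add: jacobi_op_def f_def g_def X'_def N_def M_def power2_eq_square algebra_simps)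
    qed
    define S where "S = (\<Sum>n\<in>A. (cmod (u n))\<^sup>2)"
    have fin: "finite A" and 0: "0 \<in> A" by (simp_all add: A_def)
    have u00: "u 0 = 1" using up[of 0] f0 by simp
    \<comment> \<open>The value 1 at site 0 gives S \<ge> 1, hence the lower bound |E| - R uniformly
      in the sections; this keeps the inequality strict in the limit.\<close>
    have S1: "S \<ge> 1"
      using member_le_sum[OF 0, of "\<lambda>n. (cmod (u n))\<^sup>2"] fin u00 by (simp add: S_def)
    have "(\<Sum>n\<in>A. Re (cnj (u n) * jacobi_op a b u n)) = (\<Sum>n\<in>A. E * (cmod (u n))\<^sup>2 - (if n = 0 then Re (X' k) else 0))"
    proof (intro sum.cong refl)
      fix n assume n: "n \<in> A"
      have sq: "Re (cnj x * (?z * x)) = E * (cmod x)\<^sup>2" for x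
        by (simp only: cmod_power2) (simp add: power2_eq_square algebra_simps)
      show "Re (cnj (u n) * jacobi_op a b u n) = E * (cmod (u n))\<^sup>2 - (if n = 0 then Re (X' k) else 0)"
      proof (cases "n = 0")
        case True then show ?thesis using J0 u00 by simp
      next
        case False
        then have "jacobi_op a b u n = ?z * u n" using Jp[of n] Jm[of n] n by linarith
        then show ?thesis using sq[of "u n"] False by simp
      qed
    qed
    also have "\<dots> = E * S - Re (X' k)"
      using fin 0 by (simp add: sum_subtractf S_def sum_distrib_left sum.delta)
    finally have q: "(\<Sum>n\<in>A. Re (cnj (u n) * jacobi_op a b u n)) = E * S - Re (X' k)" .
    have u0: "u n = 0" if "n \<notin> A" for n using that by (simp add: u_def)
    have "\<bar>E * S - Re (X' k)\<bar> \<le> R * S"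
      using form_boundedD[OF fb fin, of u] u0 unfolding q S_def by blast
    moreover have "(\<bar>E\<bar> - R) * 1 \<le> (\<bar>E\<bar> - R) * S" using E S1 by (intro mult_left_mono) auto
    ultimately show ?thesis
      using E R by (cases "E > 0") (auto simp: sgn_if abs_if algebra_simps split: if_splits)
  qed
  have "(\<lambda>k. sgn E * Re (X' k)) \<longlonglongrightarrow> sgn E * Re X" by (intro tendsto_intros lim)
  then have "sgn E * Re X \<ge> \<bar>E\<bar> - R" using bound by (intro LIMSEQ_le_const) auto
  then show ?thesis using E by simp
qed

section \<open>Coefficient stripping\<close>

definition shift :: "(int \<Rightarrow> 'a) \<Rightarrow> int \<Rightarrow> 'a" where "shift f n = f (n + 1)"

lemma jacobi_matrix_shift: "jacobi_matrix a b \<Longrightarrow> jacobi_matrix (shift a) (shift b)"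
proof -
  have "range (shift a) \<subseteq> range a" "range (shift b) \<subseteq> range b" by (auto simp: shift_def)
  then show "jacobi_matrix a b \<Longrightarrow> jacobi_matrix (shift a) (shift b)"
    unfolding jacobi_matrix_def by (auto intro: bounded_subset simp: shift_def)
qed

lemma weyl_solution_shift:
  assumes "jacobi_matrix a b" "weyl_solution a b z f" "Im z > 0"
  shows "weyl_solution (shift a) (shift b) z (shift f)"
proof -
  obtain n where "f n \<noteq> 0" using assms(2) by (auto simp: weyl_solution_def)
  then have "shift f (n - 1) \<noteq> 0" by (simp add: shift_def)
  moreover have "jacobi_op (shift a) (shift b) (shift f) n = jacobi_op a b f (n + 1)" for n
    by (simp add: jacobi_op_def shift_def)
  moreover have "summable (\<lambda>n::nat. (cmod (f (int (Suc n))))\<^sup>2)"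
    using assms(2) unfolding weyl_solution_def square_summable_on_nonneg_iff 
    by (subst summable_Suc_iff) blast
  moreover have "(\<lambda>n::nat. (cmod (f (int (Suc n))))\<^sup>2) = (\<lambda>n::nat. (cmod (shift f (int n)))\<^sup>2)"
    by (simp add: shift_def add.commute)
  ultimately show ?thesis using assms(2)
    unfolding weyl_solution_def square_summable_on_nonneg_iff is_solution_def
    by (metis shift_def)
qed

lemma exists_half_line_m:
  assumes "jacobi_matrix a b"
  shows "\<exists>R m. half_line_m a b R m"
proof -
  have "form_bounded a b (max 0 (jacobi_norm a b))"
    using form_bounded_jacobi_norm[OF assms] by (rule form_bounded_mono) simp
  from half_line_m_exists[OF assms this] show ?thesis by auto
qed

text \<open>The shift of a Weyl solution is a Weyl solution of the shifted matrix; divide the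
  equation at site 1 by \<open>f 1\<close>. This Riccati relation is one step of the continued
  fraction of \<open>m_plus\<close>.\<close>

lemma m_plus_shift:
  assumes J: "jacobi_matrix a b" and z: "Im z > 0"
  shows "- 1 / m_plus a b z = z - of_real (b 1) + of_real ((a 1)\<^sup>2) * m_plus (shift a) (shift b) z"
proof -
  obtain f where f: "weyl_solution a b z f"
    using exists_half_line_m[OF J] z unfolding half_line_m_def by blast
  note g = weyl_solution_shift[OF J f z] and J' = jacobi_matrix_shift[OF J]
  have f0: "f 0 \<noteq> 0" by (rule weyl_solution_nonzero[OF J f z])
  have f1: "f 1 \<noteq> 0" using weyl_solution_nonzero[OF J' g z] by (simp add: shift_def)
  have a: "a 0 > 0" "a 1 > 0" using J by (simp_all add: jacobi_matrix_def)
  have "jacobi_op a b f 1 = z * f 1" using f by (simp add: weyl_solution_def is_solution_def)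
  then have "of_real (a 0) * f 0 = (z - of_real (b 1)) * f 1 - of_real (a 1) * f 2"
    by (simp add: jacobi_op_def algebra_simps)
  then have "of_real (a 0) * f 0 / f 1 = z - of_real (b 1) - of_real (a 1) * f 2 / f 1"
    using f1 by (simp add: field_simps)
  then show ?thesis
    using m_plus_eqI[OF J f z] m_plus_eqI[OF J' g z] a f0 f1 by (simp add: shift_def power2_eq_square)
qed

lemma imaginary_axis_at_infinity: "filterlim (\<lambda>y::real. \<i> * of_real y) at_infinity at_top"
  by (rule tendsto_mult_filterlim_at_infinity[OF tendsto_const _ filterlim_of_real_at_infinity]) simp

section \<open>The Borg--Marchenko uniqueness theorem\<close>

lemma m_plus_asymptotics:
  assumes J: "jacobi_matrix a b"
  shows "((\<lambda>y. m_plus a b (\<i> * of_real y)) \<longlongrightarrow> 0) at_top"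
    and "((\<lambda>y. (\<i> * of_real y) * m_plus a b (\<i> * of_real y)) \<longlongrightarrow> -1) at_top"
proof -
  obtain R m where m: "half_line_m a b R m" using exists_half_line_m[OF J] by blast
  have eq: "m_plus a b (\<i> * of_real y) = m (\<i> * of_real y)" if "y > 0" for y
    using half_line_mD(2)[OF m] that by simp
  have "\<forall>\<^sub>F y in at_top. m_plus a b (\<i> * of_real y) = m (\<i> * of_real y)"
    using eventually_gt_at_top[of 0] by eventually_elim (rule eq)
  then have ev: "\<forall>\<^sub>F y in at_top. (\<i> * of_real y) * m (\<i> * of_real y) = (\<i> * of_real y) * m_plus a b (\<i> * of_real y)"
    by eventually_elim simp
  have "((\<lambda>y. (\<i> * of_real y) * m (\<i> * of_real y)) \<longlongrightarrow> -1) at_top"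
    by (rule filterlim_compose[OF half_line_mD(7)[OF m] imaginary_axis_at_infinity])
  then show "((\<lambda>y. (\<i> * of_real y) * m_plus a b (\<i> * of_real y)) \<longlongrightarrow> -1) at_top"
    by (rule Lim_transform_eventually) (rule ev)
  show "((\<lambda>y. m_plus a b (\<i> * of_real y)) \<longlongrightarrow> 0) at_top"
  proof (rule Lim_null_comparison)
    show "\<forall>\<^sub>F y in at_top. cmod (m_plus a b (\<i> * of_real y)) \<le> 1 / y"
      using eventually_gt_at_top[of 0] 
    proof eventually_elim
      case (elim y)
      then show ?case using half_line_mD(2,4)[OF m, of "\<i> * of_real y"] by simp
    qed
    show "((\<lambda>y::real. 1 / y) \<longlongrightarrow> 0) at_top"
      by (intro tendsto_divide_0[OF tendsto_const] filterlim_at_top_imp_at_infinity filterlim_ident)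
  qed
qed

text \<open>Along the imaginary axis m tends to 0, which reads off the constant, and z m tends to
  -1, which then reads off the factor.\<close>

lemma affine_m_plus_eq:
  assumes J: "jacobi_matrix a b" and J': "jacobi_matrix a' b'" and p: "p > 0"
    and eq: "\<And>z. Im z > 0 \<Longrightarrow> of_real c + of_real p * m_plus a b z = of_real c' + of_real p' * m_plus a' b' z"
  shows "c = c'" and "p = p'" and "\<And>z. Im z > 0 \<Longrightarrow> m_plus a b z = m_plus a' b' z"
proof -
  let ?w = "\<lambda>y. \<i> * complex_of_real y"
  have ev: "\<forall>\<^sub>F y in at_top. of_real c + of_real p * m_plus a b (?w y) = of_real c' + of_real p' * m_plus a' b' (?w y)"
    using eventually_gt_at_top[of 0] by eventually_elim (simp add: eq)
  have 1: "((\<lambda>y. of_real c + of_real p * m_plus a b (?w y)) \<longlongrightarrow> of_real c + of_real p * 0) at_top"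
    by (intro tendsto_intros m_plus_asymptotics J)
  have 2: "((\<lambda>y. of_real c' + of_real p' * m_plus a' b' (?w y)) \<longlongrightarrow> of_real c' + of_real p' * 0) at_top"
    by (intro tendsto_intros m_plus_asymptotics J')
  have "complex_of_real c + of_real p * 0 = of_real c' + of_real p' * 0"
    by (rule tendsto_unique[OF _ Lim_transform_eventually[OF 1 ev] 2]) simp
  then show c: "c = c'" by simp
  have eq': "of_real p * m_plus a b z = of_real p' * m_plus a' b' z" if "Im z > 0" for z
    using eq[OF that] c by simp
  have ev: "\<forall>\<^sub>F y in at_top. of_real p * (?w y * m_plus a b (?w y)) = of_real p' * (?w y * m_plus a' b' (?w y))"
    using eventually_gt_at_top[of 0]
  proof eventually_elim
    case (elim y)
    then have "?w y * (of_real p * m_plus a b (?w y)) = ?w y * (of_real p' * m_plus a' b' (?w y))" by (simp add: eq')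
    then show ?case by (simp only: mult.left_commute)
  qed
  have 1: "((\<lambda>y. of_real p * (?w y * m_plus a b (?w y))) \<longlongrightarrow> of_real p * (-1)) at_top"
    by (intro tendsto_intros m_plus_asymptotics J)
  have 2: "((\<lambda>y. of_real p' * (?w y * m_plus a' b' (?w y))) \<longlongrightarrow> of_real p' * (-1)) at_top"
    by (intro tendsto_intros m_plus_asymptotics J')
  have "complex_of_real p * (-1) = of_real p' * (-1)"
    by (rule tendsto_unique[OF _ Lim_transform_eventually[OF 1 ev] 2]) simp
  then have "- complex_of_real p = - complex_of_real p'" by simp
  then show pp: "p = p'" by (simp only: neg_equal_iff_equal of_real_eq_iff)
  show "m_plus a b z = m_plus a' b' z" if "Im z > 0" for z
    using eq'[OF that] pp p by simp
qed

text \<open>By \<open>m_plus_shift\<close>, -1 / m is z plus an affine function of the next m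
  function, so \<open>affine_m_plus_eq\<close> separates the coefficients of one site from the
  rest.\<close>

lemma m_plus_determines_step:
  assumes J: "jacobi_matrix a b" and J': "jacobi_matrix a' b'"
    and eq: "\<And>z. Im z > 0 \<Longrightarrow> m_plus a b z = m_plus a' b' z"
  shows "a 1 = a' 1" and "b 1 = b' 1"
    and "\<And>z. Im z > 0 \<Longrightarrow> m_plus (shift a) (shift b) z = m_plus (shift a') (shift b') z"
proof -
  have a: "a 1 > 0" "a' 1 > 0" using J J' by (simp_all add: jacobi_matrix_def)
  have "of_real (- b 1) + of_real ((a 1)\<^sup>2) * m_plus (shift a) (shift b) z
      = of_real (- b' 1) + of_real ((a' 1)\<^sup>2) * m_plus (shift a') (shift b') z" if "Im z > 0" for z
    using m_plus_shift[OF J that] m_plus_shift[OF J' that] eq[OF that] by (simp add: algebra_simps)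
  note * = affine_m_plus_eq[OF jacobi_matrix_shift[OF J] jacobi_matrix_shift[OF J'] _ this]
  show "b 1 = b' 1" using *(1) a by simp
  have "(a 1)\<^sup>2 = (a' 1)\<^sup>2" using *(2) a by simp
  then show "a 1 = a' 1" using a by (simp add: power2_eq_iff)
  show "\<And>z. Im z > 0 \<Longrightarrow> m_plus (shift a) (shift b) z = m_plus (shift a') (shift b') z"
    using *(3) a by simp
qed

lemma m_plus_determines:
  assumes "jacobi_matrix a b" and "jacobi_matrix a' b'"
    and "\<And>z. Im z > 0 \<Longrightarrow> m_plus a b z = m_plus a' b' z" and "n \<ge> 1"
  shows "a n = a' n \<and> b n = b' n"
proof -
  have "a (int k + 1) = a' (int k + 1) \<and> b (int k + 1) = b' (int k + 1)" for k
    using assms(1-3)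
  proof (induction k arbitrary: a b a' b')
    case 0
    then show ?case using m_plus_determines_step[of a b a' b'] by simp
  next
    case (Suc k)
    have "shift a (int k + 1) = shift a' (int k + 1) \<and> shift b (int k + 1) = shift b' (int k + 1)"
      by (rule Suc.IH) (use Suc.prems jacobi_matrix_shift m_plus_determines_step(3)[of a b a' b'] in auto)
    then show ?case by (simp add: shift_def algebra_simps)
  qed
  from this[of "nat (n - 1)"] assms(4) show ?thesis by simp
qed

text \<open>\<open>m_plus\<close> sees only the sites from 1 on. The remaining data come from
  \<open>m_minus\<close>: its growth gives \<open>a 0\<close>, its affine form then gives
  \<open>b 0\<close> and \<open>a (-1)\<close>, and the reflected m function gives the left half
  line.\<close>

lemma m_functions_determine:
  assumes J: "jacobi_matrix a b" and J': "jacobi_matrix a' b'"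
    and p: "\<And>z. Im z > 0 \<Longrightarrow> m_plus a b z = m_plus a' b' z"
    and m: "\<And>z. Im z > 0 \<Longrightarrow> m_minus a b z = m_minus a' b' z"
  shows "a = a' \<and> b = b'"
proof -
  let ?ra = "reflect_a a" and ?rb = "reflect_b b" and ?ra' = "reflect_a a'" and ?rb' = "reflect_b b'"
  note R = jacobi_matrix_reflect[OF J] and R' = jacobi_matrix_reflect[OF J']
  have ap: "a 0 > 0" "a' 0 > 0" "a (-1) > 0" "a' (-1) > 0" using J J' by (simp_all add: jacobi_matrix_def)
  have me: "m_minus a b z = (z - of_real (b 0) + of_real ((a (-1))\<^sup>2) * m_plus (reflect_a a) (reflect_b b) z) / of_real ((a 0)\<^sup>2)"
    if J: "jacobi_matrix a b" and "Im z > 0" for a b z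
    using m_minus_eq[OF J that(2)] exists_half_line_m[OF jacobi_matrix_reflect[OF J]] that(2)
    unfolding half_line_m_def by blast
  let ?w = "\<lambda>y. \<i> * complex_of_real y"
  \<comment> \<open>m_minus(z) / z tends to 1 / (a 0)^2, so \<open>a 0\<close> is known before the
    affine comparison is made.\<close>
  have lim: "((\<lambda>y. (1 / ?w y) * m_minus a b (?w y)) \<longlongrightarrow> 1 / of_real ((a 0)\<^sup>2)) at_top"
    if J: "jacobi_matrix a b" for a b
  proof -
    have i: "((\<lambda>y. 1 / ?w y) \<longlongrightarrow> 0) at_top"
      by (rule tendsto_divide_0[OF tendsto_const imaginary_axis_at_infinity])
    have "((\<lambda>y. (1 + (1 / ?w y) * (of_real ((a (-1))\<^sup>2) * m_plus (reflect_a a) (reflect_b b) (?w y) - of_real (b 0))) / of_real ((a 0)\<^sup>2))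
        \<longlongrightarrow> (1 + 0 * (of_real ((a (-1))\<^sup>2) * 0 - of_real (b 0))) / of_real ((a 0)\<^sup>2)) at_top"
      using J by (intro tendsto_intros i m_plus_asymptotics jacobi_matrix_reflect) (auto simp: jacobi_matrix_def less_imp_neq[symmetric])
    moreover have "\<forall>\<^sub>F y in at_top. (1 + (1 / ?w y) * (of_real ((a (-1))\<^sup>2) * m_plus (reflect_a a) (reflect_b b) (?w y) - of_real (b 0))) / of_real ((a 0)\<^sup>2)
        = (1 / ?w y) * m_minus a b (?w y)"
      using eventually_gt_at_top[of 0]
    proof eventually_elim
      case (elim y)
      have w: "?w y \<noteq> 0" using elim by simp
      have "(1 + (1 / w) * (x - c)) / d = (1 / w) * ((w - c + x) / d)" if "w \<noteq> 0" for w x c d :: complex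
        using that by (cases "d = 0") (simp_all add: field_simps)
      from this[OF w] show ?case using me[OF J, of "?w y"] elim by simp
    qed
    ultimately show ?thesis by (simp add: Lim_transform_eventually)
  qed
  have ev: "\<forall>\<^sub>F y in at_top. (1 / ?w y) * m_minus a b (?w y) = (1 / ?w y) * m_minus a' b' (?w y)"
    using eventually_gt_at_top[of 0] by eventually_elim (simp add: m)
  have "complex_of_real (1 / (a 0)\<^sup>2) = of_real (1 / (a' 0)\<^sup>2)"
    using tendsto_unique[OF _ Lim_transform_eventually[OF lim[OF J] ev] lim[OF J']] by simp
  then have "1 / (a 0)\<^sup>2 = 1 / (a' 0)\<^sup>2" by (simp only: of_real_eq_iff)
  then have "(a 0)\<^sup>2 = (a' 0)\<^sup>2" using ap by simp
  then have a0: "a 0 = a' 0" using ap by (simp add: power2_eq_iff)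
  have aff: "of_real (- b 0) + of_real ((a (-1))\<^sup>2) * m_plus ?ra ?rb z = of_real (- b' 0) + of_real ((a' (-1))\<^sup>2) * m_plus ?ra' ?rb' z"
    if "Im z > 0" for z
  proof -
    have "(x + y) / d = (x' + y') / d \<Longrightarrow> d \<noteq> 0 \<Longrightarrow> x + y = x' + y'" for x y x' y' d :: complex by simp
    from this[of "z - of_real (b 0)" _ "of_real ((a 0)\<^sup>2)" "z - of_real (b' 0)"]
    show ?thesis using me[OF J that] me[OF J' that] m[OF that] a0 ap by simp
  qed
  note * = affine_m_plus_eq[OF R R' _ aff]
  have b0: "b 0 = b' 0" using *(1) ap by simp
  have "(a (-1))\<^sup>2 = (a' (-1))\<^sup>2" using *(2) ap by simp
  then have a1: "a (-1) = a' (-1)" using ap by (simp add: power2_eq_iff)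
  \<comment> \<open>In the original indices this covers the bonds up to -2 and the sites up to -1;
    \<open>a (-1)\<close> is not among them and was found separately.\<close>
  have refl: "?ra n = ?ra' n \<and> ?rb n = ?rb' n" if "n \<ge> 1" for n
    using m_plus_determines[OF R R' _ that] *(3) ap by simp
  have "a n = a' n \<and> b n = b' n" for n
  proof -
    consider "n \<ge> 1" | "n = 0" | "n = -1" | "n \<le> -2" by linarith
    then show ?thesis
    proof cases
      case 1 then show ?thesis using m_plus_determines[OF J J' p] by simp
    next
      case 2 then show ?thesis using a0 b0 by simp
    next
      case 3 then show ?thesis using a1 refl[of 1] by (simp add: reflect_b_def)
    next
      case 4 then show ?thesis using refl[of "- n - 1"] refl[of "- n"] by (simp add: reflect_a_def reflect_b_def)
    qed
  qed
  then show ?thesis by auto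
qed

section \<open>The Herglotz representation\<close>

text \<open>The equation is quadratic in w with the roots \<open>cis t\<close> and
  \<open>cis (- t)\<close>, both on the unit circle.\<close>

lemma joukowski_nonzero:
  assumes "w \<noteq> 0" "cmod w < 1"
  shows "w + 1 / w \<noteq> 2 * of_real (cos t)"
proof
  assume "w + 1 / w = 2 * of_real (cos t)"
  then have "w\<^sup>2 + 1 = 2 * of_real (cos t) * w"
    using assms by (simp add: field_simps power2_eq_square)
  moreover have "(w - cis t) * (w - cis (- t)) = w\<^sup>2 + 1 - 2 * of_real (cos t) * w"
  proof -
    have "cis t * cis (- t) = 1" by (simp add: cis_mult)
    moreover have "cis t + cis (- t) = 2 * of_real (cos t)" by (simp add: complex_eq_iff)
    moreover have "(w - cis t) * (w - cis (- t)) = w\<^sup>2 + cis t * cis (- t) - (cis t + cis (- t)) * w"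
      by (simp add: algebra_simps power2_eq_square)
    ultimately show ?thesis by simp
  qed
  ultimately have "(w - cis t) * (w - cis (- t)) = 0" by simp
  then have "w = cis t \<or> w = cis (- t)" by simp
  then have "cmod w = 1" by auto
  then show False using assms by simp
qed

text \<open>The kernel becomes the Cauchy kernel w / (v - w) times a factor that is analytic for |v|
  \<le> 1, since its pole 1 / w lies outside the closed disc. This prepares the Cauchy integral
  formula.\<close>

lemma sin_kernel:
  fixes t :: real
  assumes "w \<noteq> 0" "cmod w < 1"
  defines "v \<equiv> cis t"
  shows "of_real (sin t) / (w + 1 / w - 2 * of_real (cos t)) = \<i> * (v\<^sup>2 - 1) / (2 * (v * w - 1)) * (w / (v - w))"
proof -
  have v: "v \<noteq> 0" "cmod v = 1" by (simp_all add: v_def)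
  have vw: "v * w \<noteq> 1" "v \<noteq> w"
    using assms v by (auto dest: arg_cong[of _ _ cmod] simp: norm_mult)
  have iv: "1 / v = cis (- t)" by (simp add: v_def divide_inverse cis_inverse)
  have c: "2 * of_real (cos t) = v + 1 / v" unfolding iv unfolding v_def by (simp add: complex_eq_iff)
  have s: "2 * \<i> * of_real (sin t) = v - 1 / v" unfolding iv unfolding v_def by (simp add: complex_eq_iff)
  have "w + 1 / w - (v + 1 / v) = (w - v) * (v * w - 1) / (v * w)"
    using assms(1) v by (simp add: field_simps)
  moreover have "of_real (sin t) = - \<i> * (v\<^sup>2 - 1) / (2 * v)"
  proof -
    have "of_real (sin t) = - \<i> * (2 * \<i> * of_real (sin t)) / 2" by simp
    also have "\<dots> = - \<i> * (v\<^sup>2 - 1) / (2 * v)" unfolding s using v by (simp add: field_simps power2_eq_square)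
    finally show ?thesis .
  qed
  moreover have "v * w - 1 \<noteq> 0" "v - w \<noteq> 0" "w - v \<noteq> 0" using vw by auto
  moreover have "- \<i> * P / (2 * v) / ((w - v) * Q / (v * w)) = \<i> * P / (2 * Q) * (w / (v - w))"
    if "Q \<noteq> 0" "v - w \<noteq> 0" "w - v \<noteq> 0" "v \<noteq> 0" "w \<noteq> 0" for P Q :: complex
    using that by (simp add: divide_simps) (simp add: algebra_simps)
  ultimately show ?thesis unfolding c using v assms(1) by simp
qed

text \<open>Residue calculus on the circle of radius \<open>\<rho>\<close>. The kernel is even in \<open>t\<close>, and by symmetry
  only the odd function \<open>Im g\<close> contributes.\<close>

lemma disc_sin_kernel_integral:
  assumes g: "g holomorphic_on ball 0 1" and g0: "g 0 = 0"
    and sym: "\<And>s. cmod s < 1 \<Longrightarrow> g (cnj s) = cnj (g s)"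
    and \<rho>: "0 < \<rho>" "\<rho> < 1" and w: "w \<noteq> 0" "cmod w < 1"
  shows "((\<lambda>t. of_real (Im (g (of_real \<rho> * cis t)) * sin t) / (w + 1 / w - 2 * of_real (cos t)))
           has_integral of_real pi * g (of_real \<rho> * w)) {0..2 * pi}"
proof -
  let ?r = "complex_of_real \<rho>"
  define G where "G u = g u * ((u / ?r)\<^sup>2 - 1) / (2 * (u / ?r * w - 1))" for u
  have r0: "?r \<noteq> 0" using \<rho> by simp
  have den: "2 * (u / ?r * w - 1) \<noteq> 0" if "u \<in> cball 0 \<rho>" for u
  proof
    assume 0: "2 * (u / ?r * w - 1) = 0"
    have "2 * (X - 1) = 0 \<Longrightarrow> X = 1" for X :: complex by simp
    from this[OF 0] have "u / ?r * w = 1" .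
    then have "cmod u / \<rho> * cmod w = 1" using \<rho> by (metis norm_mult norm_divide norm_of_real norm_one abs_of_pos)
    moreover have "cmod u / \<rho> \<le> 1" using that \<rho> by simp
    then have "cmod u / \<rho> * cmod w \<le> 1 * cmod w" by (intro mult_right_mono) auto
    ultimately show False using w(2) by linarith
  qed
  have hG: "G holomorphic_on cball 0 \<rho>"
    unfolding G_def using den \<rho> r0
    by (intro holomorphic_intros holomorphic_on_subset[OF g]) auto
  have rw: "cmod (?r * w - 0) < \<rho>" using \<rho> w by (simp add: norm_mult)
  \<comment> \<open>The subtracted term contributes \<open>G 0 = 0\<close>, but it turns 1 / (u -
    \<rho> w) into \<rho> w / (u (u - \<rho> w)), which is the shape required by
    \<open>sin_kernel\<close>.\<close>
  have "((\<lambda>u. G u / (u - ?r * w) - G u / (u - 0)) has_contour_integral (2 * of_real pi * \<i> * G (?r * w) - 2 * of_real pi * \<i> * G 0)) (circlepath 0 \<rho>)"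
    by (intro has_contour_integral_diff Cauchy_integral_circlepath_simple[OF hG]) (use rw \<rho> in auto)
  moreover have "G 0 = 0" by (simp add: G_def g0)
  moreover have "G (?r * w) = g (?r * w) / 2"
  proof -
    have "w\<^sup>2 \<noteq> 1" using w by (metis norm_one norm_power power_less_one_iff zero_less_norm_iff pos2 less_irrefl norm_ge_zero)
    then have "w * w - 1 \<noteq> 0" by (simp add: power2_eq_square)
    moreover have "X * (W - 1) / (2 * (W - 1)) = X / 2" if "W - 1 \<noteq> 0" for X W :: complex
      using that by (rule mult_divide_mult_cancel_right)
    moreover have "?r * w / ?r = w" using r0 by simp
    ultimately show ?thesis by (simp only: G_def power2_eq_square)
  qed
  ultimately have "((\<lambda>u. G u / (u - ?r * w) - G u / u) has_contour_integral (of_real pi * \<i> * g (?r * w))) (part_circlepath 0 \<rho> 0 (2 * pi))"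
    by (simp add: circlepath_def mult.assoc)
  then have int: "((\<lambda>t. (G (?r * cis t) / (?r * cis t - ?r * w) - G (?r * cis t) / (?r * cis t)) * ?r * \<i> * cis t)
      has_integral (of_real pi * \<i> * g (?r * w))) {0..2 * pi}"
    by (subst (asm) has_contour_integral_part_circlepath_iff) auto
  define \<Phi> where "\<Phi> t = g (?r * cis t) * (of_real (sin t) / (w + 1 / w - 2 * of_real (cos t)))" for t
  have "(G (?r * cis t) / (?r * cis t - ?r * w) - G (?r * cis t) / (?r * cis t)) * ?r * \<i> * cis t = \<Phi> t" for t
  proof -
    let ?v = "cis t"
    have v: "?v \<noteq> 0" by simp
    have vw: "?v - w \<noteq> 0" using w by (auto dest: arg_cong[of _ _ cmod])
    have X: "(X / (?r * ?v - ?r * w) - X / (?r * ?v)) * ?r * \<i> * ?v = X * \<i> * (w / (?v - w))" for X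
    proof -
      have "?r * ?v - ?r * w = ?r * (?v - w)" by (simp add: algebra_simps)
      then show ?thesis using v vw r0 by (simp add: divide_simps) (simp add: algebra_simps)
    qed
    have Gv: "G (?r * ?v) = g (?r * ?v) * (?v\<^sup>2 - 1) / (2 * (?v * w - 1))"
      using r0 by (simp only: G_def nonzero_mult_div_cancel_left not_False_eq_True)
    show ?thesis unfolding X \<Phi>_def sin_kernel[OF w] Gv
      by (simp only: times_divide_eq_right times_divide_eq_left divide_divide_eq_left mult_ac)
  qed
  with int have int: "(\<Phi> has_integral (of_real pi * \<i> * g (?r * w))) {0..2 * pi}" by simp
  \<comment> \<open>The substitution of 2 pi - t for t conjugates g and changes the sign of the sine
    kernel; adding the two integrals leaves 2 \<i> Im g.\<close>
  have "((\<lambda>t. \<Phi> ((-1) *\<^sub>R t + 2 * pi)) has_integral (1 / \<bar>-1\<bar> ^ DIM(real)) *\<^sub>R (of_real pi * \<i> * g (?r * w)))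
          ((\<lambda>x. (1 / (-1)) *\<^sub>R x + - ((1 / (-1)) *\<^sub>R (2 * pi))) ` cbox 0 (2 * pi))"
    by (rule has_integral_affinity) (use int in auto)
  moreover have "(\<lambda>x. (1 / (-1)) *\<^sub>R x + - ((1 / (-1)) *\<^sub>R (2 * pi))) ` cbox 0 (2 * pi) = {0..2 * pi}"
    by (auto simp: image_iff intro!: bexI[of _ "2 * pi - _"])
  ultimately have int': "((\<lambda>t. \<Phi> (2 * pi - t)) has_integral (of_real pi * \<i> * g (?r * w))) {0..2 * pi}"
    by simp
  have "\<Phi> t + \<Phi> (2 * pi - t) = 2 * \<i> * (of_real (Im (g (?r * cis t)) * sin t) / (w + 1 / w - 2 * of_real (cos t)))" for t
  proof -
    have "cis (2 * pi - t) = cnj (cis t)" by (simp add: complex_eq_iff)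
    then have "g (?r * cis (2 * pi - t)) = cnj (g (?r * cis t))"
      using sym[of "?r * cis t"] \<rho> by (simp add: norm_mult)
    moreover have "g (?r * cis t) - cnj (g (?r * cis t)) = 2 * \<i> * of_real (Im (g (?r * cis t)))"
      by (simp add: complex_eq_iff)
    moreover have "complex_of_real (sin (2 * pi - t)) / (w + 1 / w - 2 * of_real (cos (2 * pi - t)))
       = - (of_real (sin t) / (w + 1 / w - 2 * of_real (cos t)))" by simp
    moreover have "x * s + y * (- s) = (x - y) * s" for x y s :: complex by (simp add: algebra_simps)
    ultimately have "\<Phi> t + \<Phi> (2 * pi - t) = 2 * \<i> * of_real (Im (g (?r * cis t))) * (of_real (sin t) / (w + 1 / w - 2 * of_real (cos t)))"
      unfolding \<Phi>_def by (simp only:)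
    then show ?thesis by (simp only: of_real_mult times_divide_eq_right mult.assoc)
  qed
  with has_integral_add[OF int int']
  have "((\<lambda>t. 2 * \<i> * (of_real (Im (g (?r * cis t)) * sin t) / (w + 1 / w - 2 * of_real (cos t))))
      has_integral (2 * \<i> * (of_real pi * g (?r * w)))) {0..2 * pi}" by (simp add: mult_ac)
  from has_integral_mult_right[OF this, of "1 / (2 * \<i>)"] show ?thesis by simp
qed

lemma joukowski_kernel_continuous:
  assumes "w \<noteq> 0" "cmod w < 1"
  shows "continuous_on S (\<lambda>t::real. 1 / (2 * complex_of_real (cos t) - w - 1 / w))"
proof -
  have "2 * complex_of_real (cos t) - w - 1 / w \<noteq> 0" for t
    using joukowski_nonzero[OF assms, of t] by (auto simp: algebra_simps)
  then show ?thesis by (intro continuous_intros) auto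
qed

text \<open>The kernel is a continuous function of cos t, which ranges over the compact interval
  [-1, 1].\<close>

lemma joukowski_kernel_bounded:
  assumes "w \<noteq> 0" "cmod w < 1"
  shows "\<exists>B. \<forall>t::real. cmod (1 / (2 * complex_of_real (cos t) - w - 1 / w)) \<le> B"
proof -
  let ?h = "\<lambda>x::real. 1 / (2 * complex_of_real x - w - 1 / w)"
  have "2 * complex_of_real x - w - 1 / w \<noteq> 0" if "x \<in> {-1..1}" for x
    using joukowski_nonzero[OF assms, of "arccos x"] that by (auto simp: algebra_simps)
  then have "continuous_on {-1..1} ?h" by (intro continuous_intros) auto
  then have "bounded (?h ` {-1..1})"
    by (intro compact_imp_bounded compact_continuous_image) auto
  then obtain B where "\<forall>x\<in>{-1..1}. cmod (?h x) \<le> B" by (auto simp: bounded_iff)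
  then show ?thesis by (intro exI[of _ B]) (auto simp: cos_ge_minus_one cos_le_one)
qed

text \<open>The masses of the densities vary but stay below C. The missing part is placed on
  [9, 10], which is separated from [0, 2 pi] because 2 pi < 8, so that compactness for probability
  distributions becomes available.\<close>

lemma sum_two_intervals_prob:
  fixes n :: "real \<Rightarrow> real"
  assumes n: "continuous_on UNIV n" "\<And>t. n t \<ge> 0" and C: "integral {0..2 * pi} n \<le> C" "C > 0"
  defines "p \<equiv> \<lambda>t. (indicator {0..2 * pi} t * n t + indicator {9..10} t * (C - integral {0..2 * pi} n)) / C"
  shows "real_distribution (density lborel p)" and "measure (density lborel p) {-1<..11} = 1"
    and "p \<in> borel_measurable lborel" and "\<And>t. p t \<ge> 0"
proof -
  let ?m = "integral {0..2 * pi} n"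
  have nm[measurable]: "n \<in> borel_measurable borel" by (rule borel_measurable_continuous_onI[OF n(1)])
  show pm[measurable]: "p \<in> borel_measurable lborel" unfolding p_def by measurable
  show pn: "p t \<ge> 0" for t unfolding p_def using n(2) C by (auto simp: indicator_def)
  have si: "set_integrable lborel {0..2 * pi} n"
    by (rule borel_integrable_atLeastAtMost'[OF continuous_on_subset[OF n(1)]]) simp
  have i1: "integrable lborel (\<lambda>t. indicator {0..2 * pi} t * n t)"
    using si by (simp add: set_integrable_def)
  have v1: "(\<integral>t. indicator {0..2 * pi} t * n t \<partial>lborel) = ?m"
    using set_borel_integral_eq_integral(2)[OF si] by (simp add: set_lebesgue_integral_def)
  have i2: "integrable lborel (\<lambda>t. indicator {9..10::real} t * (C - ?m))"
    by (intro integrable_mult_left integrable_real_indicator) auto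
  have v2: "(\<integral>t. indicator {9..10::real} t * (C - ?m) \<partial>lborel) = C - ?m"
    by (simp add: measure_def)
  have ip: "integrable lborel p" unfolding p_def by (intro integrable_divide Bochner_Integration.integrable_add i1 i2)
  have vp: "integral\<^sup>L lborel p = 1"
    unfolding p_def using C by (simp add: i1 i2 v1 v2)
  have nn: "(\<integral>\<^sup>+t. p t \<partial>lborel) = 1"
    using nn_integral_eq_integral[OF ip] pn vp by simp
  have em: "emeasure (density lborel p) A = 1" if A: "A \<in> sets borel" "\<And>t. p t \<noteq> 0 \<Longrightarrow> t \<in> A" for A
  proof -
    have p0: "p t = 0" if "t \<notin> A" for t using A(2) that by blast
    have "emeasure (density lborel p) A = (\<integral>\<^sup>+t. ennreal (p t) * indicator A t \<partial>lborel)"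
      using A(1) by (subst emeasure_density) auto
    also have "\<dots> = (\<integral>\<^sup>+t. p t \<partial>lborel)"
      by (intro nn_integral_cong) (auto simp: indicator_def p0)
    finally show ?thesis using nn by simp
  qed
  have "prob_space (density lborel p)" by (rule prob_spaceI) (use em[of UNIV] in simp)
  then show "real_distribution (density lborel p)"
    by (simp add: real_distribution_def real_distribution_axioms_def)
  have "t \<in> {-1<..11}" if "p t \<noteq> 0" for t
  proof (rule ccontr)
    assume "t \<notin> {-1<..11}"
    then have "t \<notin> {0..2 * pi}" "t \<notin> {9..10}" using pi_less_4 by auto
    then show False using that by (simp add: p_def)
  qed
  then show "measure (density lborel p) {-1<..11} = 1"
    using em[of "{-1<..11}"] by (simp add: measure_def)
qed

text \<open>Herglotz measures of the disc, obtained as a weak limit of the densities on circles of radius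
  \<open>\<rho> \<rightarrow> 1\<close>. The dummy mass on \<open>[9, 10]\<close> turns the densities into probability measures.\<close>

lemma disc_measure:
  assumes g: "g holomorphic_on ball 0 1" and g0: "g 0 = 0"
    and sym: "\<And>s. cmod s < 1 \<Longrightarrow> g (cnj s) = cnj (g s)"
    and pos: "\<And>\<rho> t. 0 < \<rho> \<Longrightarrow> \<rho> < 1 \<Longrightarrow> (\<gamma> * (1 / \<rho> - \<rho>) * sin t - Im (g (of_real \<rho> * cis t))) * sin t \<ge> 0"
  shows "\<exists>Q. finite_measure Q \<and> sets Q = sets borel \<and>
     (\<forall>w. w \<noteq> 0 \<and> cmod w < 1 \<longrightarrow> g w = (\<integral>t. 1 / (2 * complex_of_real (cos t) - w - 1 / w) \<partial>Q))"
proof -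
  define \<rho> where "\<rho> k = 1 - 1 / (real k + 2)" for k
  have \<rho>: "0 < \<rho> k" "\<rho> k < 1" for k by (auto simp: \<rho>_def field_simps)
  have \<rho>lim: "\<rho> \<longlonglongrightarrow> 1" unfolding \<rho>_def by real_asymp
  \<comment> \<open>Nonnegative by \<open>pos\<close>. The \<gamma> term disappears as \<rho> tends
    to 1; it is there because a function with a linear part \<alpha> z has nonnegative imaginary
    part only together with that part.\<close>
  define n where "n k t = (\<gamma> * (1 / \<rho> k - \<rho> k) * sin t - Im (g (of_real (\<rho> k) * cis t))) * sin t" for k t
  have n0: "n k t \<ge> 0" for k t unfolding n_def by (rule pos[OF \<rho>])
  have gc: "continuous_on UNIV (\<lambda>t. g (of_real (\<rho> k) * cis t))" for k
    by (rule continuous_on_compose2[OF holomorphic_on_imp_continuous_on[OF g]])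
       (use \<rho>[of k] in \<open>auto intro!: continuous_intros simp: norm_mult\<close>)
  have nc: "continuous_on S (n k)" for k S
    unfolding n_def using gc by (intro continuous_intros) (auto intro: continuous_on_subset)
  define ker where "ker w t = 1 / (2 * complex_of_real (cos t) - w - 1 / w)" for w :: complex and t :: real
  have kc: "continuous_on S (ker w)" if "w \<noteq> 0" "cmod w < 1" for w S
    using joukowski_kernel_continuous[OF that] unfolding ker_def .
  have lim: "(\<lambda>k. integral {0..2 * pi} (\<lambda>t. of_real (n k t) * ker w t)) \<longlonglongrightarrow> of_real pi * g w"
    if w: "w \<noteq> 0" "cmod w < 1" for w
  proof -
    define A where "A = integral {0..2 * pi} (\<lambda>t. of_real ((sin t)\<^sup>2) * ker w t)"
    have A: "((\<lambda>t. of_real ((sin t)\<^sup>2) * ker w t) has_integral A) {0..2 * pi}"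
      unfolding A_def by (intro integrable_integral integrable_continuous_real continuous_on_mult kc w) (intro continuous_intros)
    have "((\<lambda>t. of_real (\<gamma> * (1 / \<rho> k - \<rho> k)) * (of_real ((sin t)\<^sup>2) * ker w t)
              + of_real (Im (g (of_real (\<rho> k) * cis t)) * sin t) / (w + 1 / w - 2 * of_real (cos t)))
           has_integral of_real (\<gamma> * (1 / \<rho> k - \<rho> k)) * A + of_real pi * g (of_real (\<rho> k) * w)) {0..2 * pi}" for k
      by (intro has_integral_add has_integral_mult_right A disc_sin_kernel_integral[OF g g0 sym \<rho> w])
    moreover have "of_real (\<gamma> * (1 / \<rho> k - \<rho> k)) * (of_real ((sin t)\<^sup>2) * ker w t)
              + of_real (Im (g (of_real (\<rho> k) * cis t)) * sin t) / (w + 1 / w - 2 * of_real (cos t))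
           = of_real (n k t) * ker w t" for k t
    proof -
      have "w + 1 / w - 2 * of_real (cos t) = - (2 * complex_of_real (cos t) - w - 1 / w)" by simp
      then have "x / (w + 1 / w - 2 * of_real (cos t)) = - x * ker w t" for x
        by (simp only: divide_minus_right ker_def) simp
      moreover have "x * (s\<^sup>2 * K) + - (y * s) * K = ((x * s - y) * s) * K" for x y s K :: complex
        by (simp add: algebra_simps power2_eq_square)
      ultimately show ?thesis by (simp only: n_def of_real_mult of_real_diff of_real_power)
    qed
    ultimately have "integral {0..2 * pi} (\<lambda>t. of_real (n k t) * ker w t)
        = of_real (\<gamma> * (1 / \<rho> k - \<rho> k)) * A + of_real pi * g (of_real (\<rho> k) * w)" for k
      by (simp add: integral_unique)
    moreover have "(\<lambda>k. of_real (\<gamma> * (1 / \<rho> k - \<rho> k)) * A + of_real pi * g (of_real (\<rho> k) * w))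
        \<longlonglongrightarrow> of_real (\<gamma> * (1 / 1 - 1)) * A + of_real pi * g w"
    proof (intro tendsto_intros \<rho>lim)
      have "isCont g w" using holomorphic_on_imp_continuous_on[OF g] w by (simp add: continuous_on_eq_continuous_at)
      moreover have "(\<lambda>k. of_real (\<rho> k) * w) \<longlonglongrightarrow> of_real 1 * w" by (intro tendsto_intros \<rho>lim)
      ultimately show "(\<lambda>k. g (of_real (\<rho> k) * w)) \<longlonglongrightarrow> g w"
        using isCont_tendsto_compose by fastforce
    qed simp
    ultimately show ?thesis by simp
  qed
  define m where "m k = integral {0..2 * pi} (n k)" for k
  obtain C where C: "C > 0" "\<And>k. m k \<le> C"
  proof -
    \<comment> \<open>Testing at w = 1/2 bounds all masses: there the kernel is -1 / (5/2 - 2 cos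
      t), and 5/2 - 2 cos t lies between 1/2 and 9/2.\<close>
    have w: "(1/2::complex) \<noteq> 0" "cmod (1/2::complex) < 1" by (simp_all add: norm_divide)
    obtain B where B: "\<And>k. cmod (integral {0..2 * pi} (\<lambda>t. of_real (n k t) * ker (1/2) t)) \<le> B"
      using convergent_imp_Bseq[OF convergentI[OF lim[OF w]]] by (auto simp: Bseq_def)
    have "m k \<le> 9/2 * B" for k
    proof -
      let ?D = "\<lambda>t::real. 5/2 - 2 * cos t"
      have D: "1/2 \<le> ?D t" "?D t \<le> 9/2" for t using cos_le_one[of t] cos_ge_minus_one[of t] by linarith+
      have ker: "of_real (n k t) * ker (1/2) t = of_real (- (n k t / ?D t))" for t
      proof -
        have "2 * complex_of_real (cos t) - 1/2 - 1 / (1/2) = - of_real (?D t)" by (simp add: field_simps)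
        then show ?thesis by (simp only: ker_def of_real_minus of_real_divide divide_minus_right mult_minus_right times_divide_eq_right mult_1_right)
      qed
      have D0: "?D t \<noteq> 0" for t using D[of t] by linarith
      have c: "continuous_on {0..2 * pi} (\<lambda>t. n k t / ?D t)"
        using D0 by (intro continuous_on_divide nc continuous_intros) blast
      then have int: "(\<lambda>t. n k t / ?D t) integrable_on {0..2 * pi}" by (rule integrable_continuous_real)
      have "integral {0..2 * pi} (\<lambda>t. complex_of_real (- (n k t / ?D t))) = of_real (- integral {0..2 * pi} (\<lambda>t. n k t / ?D t))"
        using integral_linear[OF integrable_neg[OF int] bounded_linear_of_real, unfolded o_def] by (simp only: integral_neg)
      then have "integral {0..2 * pi} (\<lambda>t. n k t / ?D t) \<le> B"
        using B[of k] unfolding ker by simp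
      moreover have "m k \<le> integral {0..2 * pi} (\<lambda>t. 9/2 * (n k t / ?D t))"
        unfolding m_def
      proof (rule integral_le)
        show "n k integrable_on {0..2 * pi}" by (rule integrable_continuous_real[OF nc])
        show "(\<lambda>t. 9/2 * (n k t / ?D t)) integrable_on {0..2 * pi}"
          by (intro integrable_continuous_real continuous_on_mult c continuous_intros)
        fix t
        have "x \<le> 9/2 * (x / d)" if "x * d \<le> x * (9/2)" "0 < d" for x d :: real
          using that by (simp add: field_simps)
        moreover have "n k t * ?D t \<le> n k t * (9/2)" by (rule mult_left_mono[OF D(2) n0])
        moreover have "0 < ?D t" using D(1)[of t] by linarith
        ultimately show "n k t \<le> 9/2 * (n k t / ?D t)" by blast
      qed
      moreover have "integral {0..2 * pi} (\<lambda>t. 9/2 * (n k t / ?D t)) = 9/2 * integral {0..2 * pi} (\<lambda>t. n k t / ?D t)"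
        by (rule integral_mult_right)
      ultimately show ?thesis by linarith
    qed
    then have "m k \<le> max 1 (9/2 * B)" for k by (simp add: max.coboundedI2)
    then show thesis using that[of "max 1 (9/2 * B)"] by simp
  qed
  define p where "p k t = (indicator {0..2 * pi} t * n k t + indicator {9..10} t * (C - m k)) / C" for k and t :: real
  let ?P = "\<lambda>k. density lborel (p k)"
  have P: "real_distribution (?P k)" "measure (?P k) {-1<..11} = 1" "p k \<in> borel_measurable lborel" "p k t \<ge> 0" for k t
    using sum_two_intervals_prob[of "n k" C, OF nc n0] C unfolding p_def m_def by blast+
  have "tight ?P"
    unfolding tight_def
  proof (intro conjI allI impI)
    fix e :: real assume "e > 0"
    then show "\<exists>a b. a < b \<and> (\<forall>k. 1 - e < measure (?P k) {a<..b})"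
      using P(2) by (intro exI[of _ "-1"] exI[of _ 11]) auto
  qed (rule P)
  from tight_imp_convergent_subsubsequence[OF this strict_mono_id]
  obtain r M where r: "strict_mono r" and M: "real_distribution M" and conv: "weak_conv_m (?P \<circ> r) M"
    by auto
  interpret M: real_distribution M by fact
  \<comment> \<open>Equal to 1 up to 8 and to 0 from 9 on: the dummy mass is removed by a continuous
    factor, as weak convergence requires.\<close>
  define cut where "cut t = max 0 (min 1 (9 - t))" for t :: real
  have cut_c: "continuous_on S cut" for S unfolding cut_def by (intro continuous_intros)
  have cut01: "0 \<le> cut t" "cut t \<le> 1" for t by (auto simp: cut_def)
  have cut_m[measurable]: "cut \<in> borel_measurable M"
    using borel_measurable_continuous_onI[OF cut_c] by simp
  \<comment> \<open>The factor C undoes the normalisation to probability measures, and 1 / pi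
    removes the pi in \<open>lim\<close>.\<close>
  define Q where "Q = density M (\<lambda>t. C / pi * cut t)"
  have gw: "g w = (\<integral>t. ker w t \<partial>Q)" if w: "w \<noteq> 0" "cmod w < 1" for w
  proof -
    let ?F = "\<lambda>t. of_real (cut t) * ker w t"
    have Fc: "isCont ?F t" for t
      using continuous_on_mult[OF continuous_on_of_real[OF cut_c] kc[OF w], of UNIV]
      by (simp add: continuous_on_eq_continuous_at)
    obtain B where B: "\<And>t. cmod (ker w t) \<le> B" using joukowski_kernel_bounded[OF w] unfolding ker_def by blast
    have FB: "norm (?F t) \<le> B" for t
    proof -
      have "norm (?F t) = cut t * cmod (ker w t)" using cut01[of t] by (simp add: norm_mult)
      also have "\<dots> \<le> 1 * cmod (ker w t)" using cut01[of t] by (intro mult_right_mono) auto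
      finally show ?thesis using B[of t] by simp
    qed
    have "(\<lambda>k. integral\<^sup>L ((?P \<circ> r) k) ?F) \<longlonglongrightarrow> integral\<^sup>L M ?F"
      by (rule weak_conv_imp_integral_bdd_continuous_conv[OF _ M conv Fc FB]) (simp add: P)
    moreover have "integral\<^sup>L (?P k) ?F = (1 / of_real C) * integral {0..2 * pi} (\<lambda>t. of_real (n k t) * ker w t)" for k
    proof -
      have Fm: "?F \<in> borel_measurable lborel"
        using borel_measurable_continuous_onI[of ?F] Fc by (simp add: continuous_at_imp_continuous_on)
      have "integral\<^sup>L (?P k) ?F = (\<integral>t. p k t *\<^sub>R ?F t \<partial>lborel)"
        by (rule integral_density) (use P Fm in auto)
      also have "\<dots> = (\<integral>t. (1 / of_real C) * (indicator {0..2 * pi} t *\<^sub>R (of_real (n k t) * ker w t)) \<partial>lborel)"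
      proof (intro Bochner_Integration.integral_cong refl)
        fix t :: real
        have "p k t * cut t = 1 / C * (indicator {0..2 * pi} t * n k t)"
          using pi_less_4 C by (auto simp: p_def cut_def indicator_def)
        then have "complex_of_real (p k t) * of_real (cut t) = of_real (1 / C * (indicator {0..2 * pi} t * n k t))"
          by (metis of_real_mult)
        then have "complex_of_real (p k t) * (of_real (cut t) * K) = of_real (1 / C * (indicator {0..2 * pi} t * n k t)) * K" for K
          by (simp only: mult.assoc[symmetric])
        from this[of "ker w t"] show "p k t *\<^sub>R ?F t = (1 / of_real C) * (indicator {0..2 * pi} t *\<^sub>R (of_real (n k t) * ker w t))"
          by (simp add: scaleR_conv_of_real mult_ac)
      qed
      also have "\<dots> = (1 / of_real C) * (LINT t:{0..2 * pi}|lborel. of_real (n k t) * ker w t)"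
        by (simp only: set_lebesgue_integral_def integral_mult_right_zero)
      also have "(LINT t:{0..2 * pi}|lborel. of_real (n k t) * ker w t) = integral {0..2 * pi} (\<lambda>t. of_real (n k t) * ker w t)"
        by (intro set_borel_integral_eq_integral(2) borel_integrable_atLeastAtMost' continuous_on_mult kc w continuous_on_of_real nc)
      finally show ?thesis .
    qed
    ultimately have 1: "(\<lambda>k. (1 / of_real C) * integral {0..2 * pi} (\<lambda>t. of_real (n (r k) t) * ker w t)) \<longlonglongrightarrow> integral\<^sup>L M ?F"
      by simp
    have "(\<lambda>k. (1 / of_real C) * integral {0..2 * pi} (\<lambda>t. of_real (n (r k) t) * ker w t)) \<longlonglongrightarrow> (1 / of_real C) * (of_real pi * g w)"
      using LIMSEQ_subseq_LIMSEQ[OF lim[OF w] r] by (intro tendsto_intros) (simp add: o_def)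
    from LIMSEQ_unique[OF 1 this] have I: "integral\<^sup>L M ?F = (1 / of_real C) * (of_real pi * g w)" .
    have "(\<integral>t. ker w t \<partial>Q) = (\<integral>t. (C / pi * cut t) *\<^sub>R ker w t \<partial>M)"
      unfolding Q_def using C cut01 borel_measurable_continuous_onI[OF kc[OF w]]
      by (intro integral_density) auto
    also have "\<dots> = (\<integral>t. of_real (C / pi) * ?F t \<partial>M)" by (simp add: scaleR_conv_of_real mult.assoc)
    also have "\<dots> = of_real (C / pi) * integral\<^sup>L M ?F" by (rule integral_mult_right_zero)
    finally show ?thesis unfolding I using C by simp
  qed
  have "finite_measure Q"
  proof (rule finite_measureI)
    have "emeasure Q (space Q) = (\<integral>\<^sup>+t. ennreal (C / pi * cut t) \<partial>M)"
      unfolding Q_def by (subst emeasure_density) (auto intro!: nn_integral_cong)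
    also have "\<dots> \<le> (\<integral>\<^sup>+t. ennreal (C / pi) \<partial>M)"
      using C cut01 by (intro nn_integral_mono ennreal_leI mult_left_le) auto
    also have "\<dots> < \<infinity>" using M.emeasure_space_1 by (simp add: ennreal_mult_less_top)
    finally show "emeasure Q (space Q) \<noteq> \<infinity>" by simp
  qed
  moreover have "sets Q = sets borel" by (simp add: Q_def)
  ultimately show ?thesis using gw unfolding ker_def by blast
qed

text \<open>The two roots of s^2 - q s + 1 have product 1, so one lies inside the disc unless both
  are on the circle; in that case they are conjugate and q = 2 Re s lies in [-2, 2].\<close>

lemma joukowski_surj:
  assumes "q \<notin> spectral_set 2"
  shows "\<exists>s. s \<noteq> 0 \<and> cmod s < 1 \<and> s + 1 / s = q"
proof -
  define d where "d = csqrt (q\<^sup>2 - 4)"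
  have d2: "d\<^sup>2 = q\<^sup>2 - 4" by (simp add: d_def)
  define s1 s2 where "s1 = (q + d) / 2" and "s2 = (q - d) / 2"
  have "s1 * s2 = (q\<^sup>2 - d\<^sup>2) / 4" by (simp add: s1_def s2_def power2_eq_square algebra_simps)
  then have prod: "s1 * s2 = 1" using d2 by simp
  have sum: "s1 + s2 = q" by (simp add: s1_def s2_def field_simps)
  have nz: "s1 \<noteq> 0" "s2 \<noteq> 0" using prod by auto
  have inv: "1 / s1 = s2" "1 / s2 = s1" using prod nz by (simp_all add: field_simps)
  have n: "cmod s1 * cmod s2 = 1" using prod by (metis norm_mult norm_one)
  have "cmod s1 \<noteq> 1"
  proof
    assume 1: "cmod s1 = 1"
    then have "s1 * cnj s1 = 1" using complex_norm_square[of s1] 1 by simp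
    then have "s1 * cnj s1 = s1 * s2" using prod by simp
    then have "s2 = cnj s1" using nz(1) by simp
    then have "q = of_real (2 * Re s1)" using sum complex_add_cnj[of s1] by simp
    moreover have "\<bar>2 * Re s1\<bar> \<le> 2" using abs_Re_le_cmod[of s1] 1 by simp
    then have "2 * Re s1 \<in> {-2..2}" by auto
    ultimately show False using assms by blast
  qed
  then consider "cmod s1 < 1" | "cmod s1 > 1" by linarith
  then show ?thesis
  proof cases
    case 1 then show ?thesis using nz inv sum by auto
  next
    case 2
    have "cmod s2 < 1"
    proof (rule ccontr)
      assume "\<not> cmod s2 < 1"
      then have "cmod s1 * 1 \<le> cmod s1 * cmod s2" by (intro mult_left_mono) auto
      then show False using n 2 by simp
    qed
    then show ?thesis using nz(2) inv(2) sum by (intro exI[of _ s2]) (simp add: add.commute)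
  qed
qed

section \<open>Cauchy transforms of finite measures\<close>

lemma cauchy_kernel_integrable:
  fixes \<mu> :: "real measure"
  assumes "finite_measure \<mu>" and [measurable_cong]: "sets \<mu> = sets borel" and K: "AE t in \<mu>. t \<in> K"
    and e: "e > 0" "\<And>t. t \<in> K \<Longrightarrow> e \<le> cmod (of_real t - z)"
  shows "integrable \<mu> (\<lambda>t. 1 / (of_real t - z))"
proof (rule finite_measure.integrable_const_bound[OF assms(1)])
  show "AE t in \<mu>. norm (1 / (of_real t - z)) \<le> 1 / e"
    using K
  proof eventually_elim
    case (elim t)
    then show ?case using e(1) e(2)[of t] by (simp add: norm_divide frac_le)
  qed
qed measurable

lemma closed_image_of_real: "closed K \<Longrightarrow> closed (complex_of_real ` K)"
  by (rule closed_injective_linear_image[OF _ bounded_linear.linear[OF bounded_linear_of_real] inj_of_real])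

lemma distance_to_closed_real:
  assumes "closed K" "z \<notin> complex_of_real ` K"
  obtains d where "d > 0" "\<And>t. t \<in> K \<Longrightarrow> d \<le> cmod (of_real t - z)"
proof -
  have "open (- complex_of_real ` K)" using closed_image_of_real[OF assms(1)] by (simp add: open_Compl)
  then obtain d where d: "d > 0" "ball z d \<subseteq> - complex_of_real ` K"
    using assms(2) by (metis open_contains_ball ComplI)
  have "d \<le> cmod (of_real t - z)" if "t \<in> K" for t
  proof (rule ccontr)
    assume "\<not> d \<le> cmod (of_real t - z)"
    then have "of_real t \<in> ball z d" by (simp add: dist_norm norm_minus_commute)
    then show False using d that by auto
  qed
  with d show thesis using that by blast
qed

text \<open>With p = t - w and q = t - z, the difference quotient of the kernel minus 1 / q^2 is
  exactly (w - z) / (p q^2). For |w - z| < d / 2 this is at most 2 |w - z| / d^3, uniformly on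
  \<open>K\<close>.\<close>

lemma cauchy_transform_derivative:
  fixes \<mu> :: "real measure"
  assumes fin: "finite_measure \<mu>" and m[measurable_cong]: "sets \<mu> = sets borel" and K: "AE t in \<mu>. t \<in> K" and "closed K"
    and z: "z \<notin> complex_of_real ` K"
  shows "((\<lambda>z. \<integral>t. 1 / (of_real t - z) \<partial>\<mu>) has_field_derivative (\<integral>t. 1 / (of_real t - z)\<^sup>2 \<partial>\<mu>)) (at z)"
proof -
  interpret finite_measure \<mu> by fact
    obtain d where d: "d > 0" "\<And>t. t \<in> K \<Longrightarrow> d \<le> cmod (of_real t - z)"
      using distance_to_closed_real[OF \<open>closed K\<close> z] by blast
    let ?C = "\<lambda>z. \<integral>t. 1 / (of_real t - z) \<partial>\<mu>"
    let ?D = "\<integral>t. 1 / (of_real t - z)\<^sup>2 \<partial>\<mu>"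
    let ?M = "measure \<mu> (space \<mu>)"
    have d2: "d / 2 \<le> cmod (of_real t - w)" if "t \<in> K" "cmod (w - z) < d / 2" for t w
    proof -
      have "cmod (of_real t - z) \<le> cmod (of_real t - w) + cmod (w - z)"
        using norm_triangle_ineq[of "of_real t - w" "w - z"] by simp
      then show ?thesis using d(2)[OF that(1)] that(2) by linarith
    qed
    have iz: "integrable \<mu> (\<lambda>t. 1 / (of_real t - z))" by (rule cauchy_kernel_integrable[OF fin m K d])
    have iz2: "integrable \<mu> (\<lambda>t. 1 / (of_real t - z)\<^sup>2)"
    proof (rule integrable_const_bound[where B = "1 / d\<^sup>2"])
      show "AE t in \<mu>. norm (1 / (of_real t - z)\<^sup>2) \<le> 1 / d\<^sup>2"
        using K
      proof eventually_elim
        case (elim t)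
        then show ?case using d(1) d(2)[of t] by (simp add: norm_divide norm_power frac_le power_mono)
      qed
    qed measurable
    have "((\<lambda>w. (?C w - ?C z) / (w - z) - ?D) \<longlongrightarrow> 0) (at z)"
    proof (rule Lim_null_comparison)
      show "\<forall>\<^sub>F w in at z. norm ((?C w - ?C z) / (w - z) - ?D) \<le> cmod (w - z) * (2 / d ^ 3 * ?M)"
        unfolding eventually_at
      proof (intro exI conjI ballI impI)
        show "0 < d / 2" using d by simp
        fix w assume "w \<noteq> z \<and> dist w z < d / 2"
        then have w: "w \<noteq> z" "cmod (w - z) < d / 2" by (auto simp: dist_norm)
        have iw: "integrable \<mu> (\<lambda>t. 1 / (of_real t - w))"
          by (rule cauchy_kernel_integrable[OF fin m K, of "d / 2"]) (use d d2 w in auto)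
        have "(?C w - ?C z) / (w - z) - ?D = (\<integral>t. (1 / (of_real t - w) - 1 / (of_real t - z)) / (w - z) - 1 / (of_real t - z)\<^sup>2 \<partial>\<mu>)"
          using iw iz iz2 by simp
        then have "norm ((?C w - ?C z) / (w - z) - ?D) = norm (\<integral>t. (1 / (of_real t - w) - 1 / (of_real t - z)) / (w - z) - 1 / (of_real t - z)\<^sup>2 \<partial>\<mu>)"
          by (rule arg_cong)
        also have "\<dots> \<le> (\<integral>t. norm ((1 / (of_real t - w) - 1 / (of_real t - z)) / (w - z) - 1 / (of_real t - z)\<^sup>2) \<partial>\<mu>)"
          by (rule integral_norm_bound)
        also have "\<dots> \<le> (\<integral>t. cmod (w - z) * (2 / d ^ 3) \<partial>\<mu>)"
        proof (rule integral_mono_AE)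
          show "integrable \<mu> (\<lambda>t. norm ((1 / (of_real t - w) - 1 / (of_real t - z)) / (w - z) - 1 / (of_real t - z)\<^sup>2))"
            using iw iz iz2 by simp
          show "AE t in \<mu>. norm ((1 / (of_real t - w) - 1 / (of_real t - z)) / (w - z) - 1 / (of_real t - z)\<^sup>2) \<le> cmod (w - z) * (2 / d ^ 3)"
            using K
          proof eventually_elim
            case (elim t)
            let ?p = "of_real t - w" and ?q = "of_real t - z"
            have p: "d / 2 \<le> cmod ?p" and q: "d \<le> cmod ?q" using d2[OF elim w(2)] d(2)[OF elim] by auto
            have nz: "?p \<noteq> 0" "?q \<noteq> 0" using p q d(1) by auto
            have "1 / P - 1 / Q = (Q - P) / (P * Q)" if "P \<noteq> 0" "Q \<noteq> 0" for P Q :: complex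
              using that by (simp add: field_simps)
            from this[OF nz] have "(1 / ?p - 1 / ?q) / (w - z) = 1 / (?p * ?q)" using w(1) by simp
            also have "\<dots> - 1 / ?q\<^sup>2 = (w - z) / (?p * ?q\<^sup>2)"
              using nz by (simp add: divide_simps power2_eq_square)
            also have "norm \<dots> = cmod (w - z) * (1 / (cmod ?p * (cmod ?q)\<^sup>2))"
              by (simp add: norm_divide norm_mult norm_power)
            also have "\<dots> \<le> cmod (w - z) * (1 / (d / 2 * d\<^sup>2))"
              using d(1) p q nz by (intro mult_left_mono divide_left_mono mult_mono power_mono mult_pos_pos) auto
            also have "1 / (d / 2 * d\<^sup>2) = 2 / d ^ 3" by (simp add: power2_eq_square power3_eq_cube)
            finally show ?case .
          qed
        qed simp
        finally show "norm ((?C w - ?C z) / (w - z) - ?D) \<le> cmod (w - z) * (2 / d ^ 3 * ?M)" by (simp add: mult_ac)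
      qed
      show "((\<lambda>w. cmod (w - z) * (2 / d ^ 3 * ?M)) \<longlongrightarrow> 0) (at z)"
      proof -
        have "((\<lambda>w. cmod (w - z) * (2 / d ^ 3 * ?M)) \<longlongrightarrow> cmod (z - z) * (2 / d ^ 3 * ?M)) (at z)"
          by (intro tendsto_intros)
        then show ?thesis by simp
      qed
    qed
    then have "((\<lambda>w. (?C w - ?C z) / (w - z)) \<longlongrightarrow> ?D) (at z)" by (simp add: LIM_zero_iff)
    then show ?thesis by (simp add: has_field_derivative_iff)
qed

lemma cauchy_transform_holomorphic:
  fixes \<mu> :: "real measure"
  assumes "finite_measure \<mu>" "sets \<mu> = sets borel" "AE t in \<mu>. t \<in> K" "closed K"
  shows "(\<lambda>z. \<integral>t. 1 / (of_real t - z) \<partial>\<mu>) holomorphic_on - complex_of_real ` K"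
  unfolding holomorphic_on_def field_differentiable_def
  using cauchy_transform_derivative[OF assms] by (blast intro: has_field_derivative_at_within)

text \<open>The Joukowski map \<zeta> takes the punctured disc to the complement of [-L, L], with 0
  going to infinity. So N minus its asymptotics becomes a function on the disc that vanishes at 0,
  and \<open>disc_measure\<close> applies to it.\<close>

lemma herglotz_interval:
  assumes L: "L > 0" and N: "N holomorphic_on - spectral_set L"
    and sym: "\<And>z. z \<notin> spectral_set L \<Longrightarrow> N (cnj z) = cnj (N z)"
    and pos: "\<And>z. Im z > 0 \<Longrightarrow> Im (N z) \<ge> 0"
    and lim: "((\<lambda>z. N z - of_real \<alpha> * z - of_real \<beta>) \<longlongrightarrow> 0) at_infinity"
  shows "\<exists>\<mu>. finite_measure \<mu> \<and> sets \<mu> = sets borel \<and> (AE t in \<mu>. t \<in> {-L..L}) \<and>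
     (\<forall>z. z \<notin> spectral_set L \<longrightarrow> N z = of_real \<alpha> * z + of_real \<beta> + (\<integral>t. 1 / (of_real t - z) \<partial>\<mu>))"
proof -
  define c where "c = L / 2"
  have c: "c > 0" and Lc: "L = 2 * c" using L by (simp_all add: c_def)
  define \<zeta> where "\<zeta> s = of_real c * (s + 1 / s)" for s :: complex
  have \<zeta>_spec: "\<zeta> s \<notin> spectral_set L" if s: "s \<noteq> 0" "cmod s < 1" for s
  proof
    assume "\<zeta> s \<in> spectral_set L"
    then obtain x where x: "\<bar>x\<bar> \<le> L" "\<zeta> s = of_real x" by (auto simp: abs_le_iff)
    then have "s + 1 / s = of_real (x / c)" using c by (simp add: \<zeta>_def field_simps)
    also have "\<dots> = 2 * of_real (cos (arccos (x / L)))"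
      using x(1) c Lc by (subst cos_arccos_abs) (auto simp: field_simps)
    finally show False using joukowski_nonzero[OF s] by blast
  qed
  define g where "g s = (if s = 0 then 0 else N (\<zeta> s) - of_real \<alpha> * \<zeta> s - of_real \<beta>)" for s
  have g: "g holomorphic_on ball 0 1"
  proof (rule no_isolated_singularity'[where K = "{0}"])
    have "filterlim (\<lambda>s::complex. s + inverse s) at_infinity (at 0)"
      by (rule tendsto_add_filterlim_at_infinity[OF tendsto_ident_at filterlim_inverse_at_infinity])
    from tendsto_mult_filterlim_at_infinity[OF tendsto_const _ this, of "of_real c"]
    have "filterlim (\<lambda>s. complex_of_real c * (s + inverse s)) at_infinity (at 0)"
      using c by simp
    then have "filterlim \<zeta> at_infinity (at 0)"
      unfolding \<zeta>_def[abs_def] by (simp add: divide_inverse)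
    from filterlim_compose[OF lim this]
    have "((\<lambda>s. N (\<zeta> s) - of_real \<alpha> * \<zeta> s - of_real \<beta>) \<longlongrightarrow> 0) (at 0)" .
    moreover have "\<forall>\<^sub>F s in at 0. N (\<zeta> s) - of_real \<alpha> * \<zeta> s - of_real \<beta> = g s"
      by (auto simp: eventually_at_filter g_def)
    ultimately have "(g \<longlongrightarrow> 0) (at 0)" by (rule Lim_transform_eventually)
    then show "(g \<longlongrightarrow> g z) (at z within ball 0 1)" if "z \<in> {0}" for z
      using that by (auto simp: g_def intro: tendsto_within_subset)
    have "(\<lambda>s. N (\<zeta> s) - of_real \<alpha> * \<zeta> s - of_real \<beta>) holomorphic_on ball 0 1 - {0}"
    proof -
      have z: "\<zeta> holomorphic_on ball 0 1 - {0}" unfolding \<zeta>_def by (intro holomorphic_intros) auto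
      have "(N \<circ> \<zeta>) holomorphic_on ball 0 1 - {0}"
        by (rule holomorphic_on_compose_gen[OF z N], rule image_subsetI, unfold Compl_iff, rule \<zeta>_spec) auto
      then show ?thesis using z by (intro holomorphic_intros) (simp_all add: o_def)
    qed
    then show "g holomorphic_on ball 0 1 - {0}"
      by (rule holomorphic_transform) (auto simp: g_def)
  qed auto
  have gsym: "g (cnj s) = cnj (g s)" if "cmod s < 1" for s
  proof (cases "s = 0")
    case False
    have "\<zeta> (cnj s) = cnj (\<zeta> s)" by (simp add: \<zeta>_def)
    then show ?thesis using False sym[OF \<zeta>_spec[OF False that]] by (simp add: g_def)
  qed (simp add: g_def)
  have gpos: "(\<alpha> * c * (1 / \<rho> - \<rho>) * sin t - Im (g (of_real \<rho> * cis t))) * sin t \<ge> 0" if \<rho>: "0 < \<rho>" "\<rho> < 1" for \<rho> t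
  proof -
    let ?s = "of_real \<rho> * cis t"
    have s: "?s \<noteq> 0" "cmod ?s < 1" using \<rho> by (auto simp: norm_mult)
    have "1 / ?s = of_real (1 / \<rho>) * cis (- t)" using \<rho> by (simp add: divide_inverse cis_inverse mult.commute)
    then have im: "Im (\<zeta> ?s) = - c * (1 / \<rho> - \<rho>) * sin t"
      by (simp add: \<zeta>_def algebra_simps)
    have "Im (g ?s) = Im (N (\<zeta> ?s)) - \<alpha> * Im (\<zeta> ?s)"
      using s(1) by (simp add: g_def)
    then have "\<alpha> * c * (1 / \<rho> - \<rho>) * sin t - Im (g ?s) = - Im (N (\<zeta> ?s))"
      unfolding im by (simp add: algebra_simps)
    \<comment> \<open>The map \<zeta> exchanges the upper and lower half discs, so Im \<zeta> has
      the sign opposite to that of sin t. For sin t > 0 the Herglotz property is used at the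
      conjugate point.\<close>
    moreover have "- Im (N (\<zeta> ?s)) * sin t \<ge> 0"
    proof -
      have r: "c * (1 / \<rho> - \<rho>) > 0"
      proof -
        have "\<rho> * \<rho> < 1 * 1" using \<rho> by (intro mult_strict_mono) auto
        then have "\<rho> < 1 / \<rho>" using \<rho> by (simp add: pos_less_divide_eq)
        then show ?thesis using c by simp
      qed
      consider "sin t = 0" | "sin t > 0" | "sin t < 0" by linarith
      then show ?thesis
      proof cases
        case 2
        have "Im (cnj (\<zeta> ?s)) = c * (1 / \<rho> - \<rho>) * sin t" unfolding cnj.sel im by linarith
        also have "\<dots> > 0" by (rule mult_pos_pos[OF r 2])
        finally have "Im (cnj (\<zeta> ?s)) > 0" .
        then have "Im (N (cnj (\<zeta> ?s))) \<ge> 0" by (rule pos)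
        then have "- Im (N (\<zeta> ?s)) \<ge> 0" unfolding sym[OF \<zeta>_spec[OF s]] cnj.sel .
        then show ?thesis by (rule mult_nonneg_nonneg) (use 2 in linarith)
      next
        case 3
        have "c * (1 / \<rho> - \<rho>) * sin t < 0" by (rule mult_pos_neg[OF r 3])
        then have "Im (\<zeta> ?s) > 0" unfolding im by linarith
        then have "Im (N (\<zeta> ?s)) \<ge> 0" by (rule pos)
        then show ?thesis by (intro mult_nonpos_nonpos) (use 3 in linarith)+
      next
        case 1
        then show ?thesis by (simp only: mult_zero_right order_refl)
      qed
    qed
    ultimately show ?thesis by (simp only:)
  qed
  obtain Q where Q: "finite_measure Q" "sets Q = sets borel"
    and gQ: "\<And>w. w \<noteq> 0 \<Longrightarrow> cmod w < 1 \<Longrightarrow> g w = (\<integral>t. 1 / (2 * complex_of_real (cos t) - w - 1 / w) \<partial>Q)"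
    using disc_measure[OF g _ gsym gpos] by (auto simp: g_def)
  \<comment> \<open>Push forward under t to 2 c cos t. The weight c compensates the scaling of the
    kernel, 2 c cos t - z = c (2 cos t - w - 1 / w).\<close>
  define \<mu> where "\<mu> = distr (density Q (\<lambda>_. ennreal c)) borel (\<lambda>t. 2 * c * cos t)"
  have Qm: "f \<in> borel_measurable Q \<longleftrightarrow> f \<in> borel_measurable borel" for f :: "real \<Rightarrow> 'b::topological_space"
    using Q(2) by (simp cong: measurable_cong_sets)
  have tm: "(\<lambda>t. 2 * c * cos t) \<in> density Q (\<lambda>_. ennreal c) \<rightarrow>\<^sub>M borel"
    using Q(2) by (simp cong: measurable_cong_sets)
  have "finite_measure \<mu>"
    unfolding \<mu>_def
  proof (rule finite_measure.finite_measure_distr[OF finite_measureI tm])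
    have "emeasure (density Q (\<lambda>_. ennreal c)) (space Q) = ennreal c * emeasure Q (space Q)"
      by (subst emeasure_density) (auto simp: nn_integral_cmult_indicator)
    then show "emeasure (density Q (\<lambda>_. ennreal c)) (space (density Q (\<lambda>_. ennreal c))) \<noteq> \<infinity>"
      using finite_measure.emeasure_finite[OF Q(1)] by (simp add: ennreal_mult_eq_top_iff)
  qed
  moreover have "AE t in \<mu>. t \<in> {-L..L}"
    unfolding \<mu>_def
  proof (subst AE_distr_iff[OF tm])
    have "2 * c * cos t \<in> {-L..L}" for t
      using mult_left_mono[OF cos_le_one[of t], of "2 * c"] mult_left_mono[OF cos_ge_minus_one[of t], of "2 * c"] c Lc by auto
    then show "AE t in density Q (\<lambda>_. ennreal c). 2 * c * cos t \<in> {-L..L}" by simp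
  qed simp
  moreover have "N z = of_real \<alpha> * z + of_real \<beta> + (\<integral>t. 1 / (of_real t - z) \<partial>\<mu>)" if z: "z \<notin> spectral_set L" for z
  proof -
    have "z / of_real c \<notin> spectral_set 2"
    proof
      assume "z / of_real c \<in> spectral_set 2"
      then obtain x where x: "x \<in> {-2..2}" "z / of_real c = of_real x" by blast
      then have "z = of_real (c * x)" using c by (simp add: field_simps)
      moreover have "\<bar>c * x\<bar> \<le> L" using x(1) c Lc by (auto simp: abs_mult intro!: mult_left_mono)
      then have "c * x \<in> {-L..L}" by auto
      ultimately show False using z by blast
    qed
    then obtain w where w: "w \<noteq> 0" "cmod w < 1" "w + 1 / w = z / of_real c"
      using joukowski_surj by blast
    then have zw: "\<zeta> w = z" using c by (simp add: \<zeta>_def field_simps)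
    have e1: "(\<integral>t. 1 / (of_real t - z) \<partial>\<mu>) = (\<integral>t. 1 / (of_real (2 * c * cos t) - z) \<partial>density Q (\<lambda>_. ennreal c))"
      unfolding \<mu>_def by (rule integral_distr[OF tm]) measurable
    have e2: "\<dots> = (\<integral>t. c *\<^sub>R (1 / (of_real (2 * c * cos t) - z)) \<partial>Q)"
      by (rule integral_density) (use c in \<open>auto simp: Qm\<close>)
    have e3: "(\<integral>t. c *\<^sub>R (1 / (of_real (2 * c * cos t) - z)) \<partial>Q) = (\<integral>t. 1 / (2 * complex_of_real (cos t) - w - 1 / w) \<partial>Q)"
    proof (intro Bochner_Integration.integral_cong refl)
      fix t
      have "of_real (2 * c * cos t) - z = of_real c * (2 * complex_of_real (cos t) - w - 1 / w)"
        unfolding zw[symmetric] \<zeta>_def by (simp add: algebra_simps)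
      then show "c *\<^sub>R (1 / (of_real (2 * c * cos t) - z)) = 1 / (2 * complex_of_real (cos t) - w - 1 / w)"
        using c by (simp add: scaleR_conv_of_real)
    qed
    have "(\<integral>t. 1 / (of_real t - z) \<partial>\<mu>) = g w"
      unfolding e1 e2 e3 by (rule gQ[OF w(1,2), symmetric])
    then show ?thesis using zw w(1) by (simp add: g_def)
  qed
  moreover have "sets \<mu> = sets borel" by (simp add: \<mu>_def)
  ultimately show ?thesis by blast
qed

section \<open>Localising the Herglotz measure\<close>

lemma cauchy_kernel_integrable_upper:
  fixes \<mu> :: "real measure"
  assumes fin: "finite_measure \<mu>" and m: "sets \<mu> = sets borel" and z: "Im z \<noteq> 0"
  shows "integrable \<mu> (\<lambda>t. 1 / (of_real t - z))"
proof (rule cauchy_kernel_integrable[OF fin m, where K = UNIV and e = "\<bar>Im z\<bar>"])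
  show "\<bar>Im z\<bar> \<le> cmod (of_real t - z)" for t using abs_Im_le_cmod[of "of_real t - z"] by simp
qed (use z in auto)

lemma Im_cauchy_kernel: "Im (1 / (complex_of_real t - Complex x y)) = y / ((t - x)\<^sup>2 + y\<^sup>2)"
  by (simp add: Im_divide)

text \<open>A quantitative Stieltjes inversion. As N is real on the axis and Lipschitz near x0, Im
  N(x + \<i> y) = O(y), so the Poisson kernel gives an interval of length 2 y only mass O(y^2).
  Covering by n such intervals with y = \<delta> / n leaves O(1 / n).\<close>

lemma cauchy_transform_locally_null:
  fixes \<mu> :: "real measure"
  assumes fin: "finite_measure \<mu>" and m[measurable_cong]: "sets \<mu> = sets borel"
    and rep: "\<And>z. Im z > 0 \<Longrightarrow> N z = of_real \<alpha> * z + of_real \<beta> + (\<integral>t. 1 / (of_real t - z) \<partial>\<mu>)"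
    and e: "e > 0" and hol: "N holomorphic_on ball (of_real x0) e" and real: "\<And>x. \<bar>x - x0\<bar> < e \<Longrightarrow> Im (N (of_real x)) = 0"
  shows "\<exists>\<delta>>0. emeasure \<mu> {x0 - \<delta>..<x0 + \<delta>} = 0"
proof -
  interpret finite_measure \<mu> by fact
  define \<delta> where "\<delta> = e / 4"
  have \<delta>: "\<delta> > 0" using e by (simp add: \<delta>_def)
  let ?S = "cball (complex_of_real x0) (e / 2)"
  have sub: "?S \<subseteq> ball (of_real x0) e" using e by auto
  have "continuous_on ?S (deriv N)"
    using holomorphic_on_imp_continuous_on[OF holomorphic_deriv[OF hol open_ball]] sub by (rule continuous_on_subset)
  then have "bounded (deriv N ` ?S)" by (intro compact_imp_bounded compact_continuous_image) auto
  then obtain B where B: "B > 0" "\<And>z. z \<in> ?S \<Longrightarrow> cmod (deriv N z) \<le> B" by (auto simp: bounded_pos)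
  have lip: "cmod (N u - N v) \<le> B * cmod (u - v)" if "u \<in> ?S" "v \<in> ?S" for u v
  proof (rule field_differentiable_bound[OF convex_cball _ B(2) that])
    fix z assume "z \<in> ?S"
    then show "(N has_field_derivative deriv N z) (at z within ?S)"
      using holomorphic_derivI[OF hol open_ball] sub by (blast intro: has_field_derivative_at_within)
  qed
  \<comment> \<open>The term |\<alpha>| absorbs the contribution \<alpha> y of the linear part,
    whose sign is not prescribed here.\<close>
  define B' where "B' = B + \<bar>\<alpha>\<bar>"
  have B': "B' \<ge> 0" using B by (simp add: B'_def)
  have cell: "measure \<mu> {x - y..x + y} \<le> 2 * y\<^sup>2 * B'" if x: "\<bar>x - x0\<bar> \<le> \<delta>" and y: "0 < y" "y \<le> \<delta>" for x y
  proof -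
    let ?z = "Complex x y"
    let ?k = "\<lambda>t. y / ((t - x)\<^sup>2 + y\<^sup>2)"
    have zS: "?z \<in> ?S" "of_real x \<in> ?S"
    proof -
      have "?z - of_real x0 = of_real (x - x0) + \<i> * of_real y" by (simp add: complex_eq_iff)
      then have "cmod (?z - of_real x0) \<le> \<bar>x - x0\<bar> + y"
        using norm_triangle_ineq[of "of_real (x - x0)" "\<i> * of_real y"] y by (simp add: norm_mult del: of_real_diff)
      then show "?z \<in> ?S" using x y e by (simp add: dist_norm norm_minus_commute \<delta>_def)
      have "cmod (of_real x - of_real x0) = \<bar>x - x0\<bar>" by (metis norm_of_real of_real_diff)
      then show "of_real x \<in> ?S" using x e by (simp add: dist_norm norm_minus_commute \<delta>_def)
    qed
    have ik: "integrable \<mu> (\<lambda>t. 1 / (of_real t - ?z))"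
      using cauchy_kernel_integrable_upper[OF fin m, of ?z] y by simp
    have ik': "integrable \<mu> ?k"
      using integrable_Im[OF ik] by (simp only: Im_cauchy_kernel)
    have "\<bar>x - x0\<bar> < e" using x e by (simp add: \<delta>_def)
    then have "Im (N ?z) = Im (N ?z - N (of_real x))"
      using real[of x] by simp
    also have "\<dots> \<le> cmod (N ?z - N (of_real x))" using abs_Im_le_cmod[of "N ?z - N (of_real x)"] by linarith
    also have "\<dots> \<le> B * cmod (?z - of_real x)" by (rule lip[OF zS])
    also have "?z - of_real x = \<i> * of_real y" by (simp add: complex_eq_iff)
    also have "B * cmod (\<i> * of_real y) = B * y" using y by (simp add: norm_mult)
    finally have 1: "Im (N ?z) \<le> B * y" .
    have "Im (\<integral>t. 1 / (of_real t - ?z) \<partial>\<mu>) = (\<integral>t. ?k t \<partial>\<mu>)"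
      using integral_Im[OF ik] by (simp only: Im_cauchy_kernel)
    then have "Im (N ?z) = \<alpha> * y + (\<integral>t. ?k t \<partial>\<mu>)"
      using rep[of ?z] y by simp
    then have 2: "(\<integral>t. ?k t \<partial>\<mu>) \<le> B' * y"
    proof -
      have "- (\<alpha> * y) \<le> \<bar>\<alpha>\<bar> * y" using y by (metis abs_ge_minus_self abs_mult abs_of_pos)
      then show ?thesis using 1 \<open>Im (N ?z) = \<alpha> * y + (\<integral>t. ?k t \<partial>\<mu>)\<close> by (simp add: B'_def distrib_right)
    qed
    have ii: "integrable \<mu> (indicat_real {x - y..x + y})"
      by (rule integrable_real_indicator) (auto simp: m less_top[symmetric])
    have "measure \<mu> {x - y..x + y} = (\<integral>t. indicator {x - y..x + y} t \<partial>\<mu>)"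
      by (simp add: m)
    also have "\<dots> \<le> (\<integral>t. 2 * y * ?k t \<partial>\<mu>)"
    proof (rule integral_mono[OF ii integrable_mult_right[OF ik']])
      fix t
      show "indicator {x - y..x + y} t \<le> 2 * y * ?k t"
      proof (cases "t \<in> {x - y..x + y}")
        case True
        then have "\<bar>t - x\<bar> \<le> y" by (auto simp: abs_le_iff)
        then have "(t - x)\<^sup>2 \<le> y\<^sup>2" by (metis abs_le_square_iff abs_of_pos y(1))
        then have "(t - x)\<^sup>2 + y\<^sup>2 \<le> 2 * y * y" by (simp add: power2_eq_square)
        moreover have "(t - x)\<^sup>2 + y\<^sup>2 > 0" using y by (simp add: add_nonneg_pos)
        ultimately have "1 \<le> 2 * y * y / ((t - x)\<^sup>2 + y\<^sup>2)" by (simp add: pos_le_divide_eq)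
        then show ?thesis using True by simp
      qed (use y in auto)
    qed
    also have "\<dots> = 2 * y * (\<integral>t. ?k t \<partial>\<mu>)" by (simp only: integral_mult_right_zero)
    also have "\<dots> \<le> 2 * y * (B' * y)" using 2 y by (intro mult_left_mono) auto
    finally show ?thesis by (simp add: power2_eq_square mult_ac)
  qed
  have small: "measure \<mu> {x0 - \<delta>..<x0 + \<delta>} \<le> 2 * \<delta>\<^sup>2 * B' / real n" if n: "n > 0" for n :: nat
  proof -
    define y where "y = \<delta> / real n"
    have y: "0 < y" "y \<le> \<delta>" using n \<delta> by (auto simp: y_def field_simps)
    have ny: "real n * y = \<delta>" using n by (simp add: y_def)
    define x where "x j = x0 - \<delta> + (2 * real j + 1) * y" for j
    have xb: "\<bar>x j - x0\<bar> \<le> \<delta>" if "j < n" for j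
    proof -
      have "(2 * real j + 1) * y \<le> (2 * real n) * y" using that y by (intro mult_right_mono) auto
      then show ?thesis using ny y by (auto simp: x_def abs_le_iff)
    qed
    \<comment> \<open>The centres \<open>x j\<close> are the midpoints of the n cells of length 2
      y.\<close>
    have "{x0 - \<delta>..<x0 + \<delta>} \<subseteq> (\<Union>j<n. {x j - y..x j + y})"
    proof
      fix t assume t: "t \<in> {x0 - \<delta>..<x0 + \<delta>}"
      define s where "s = (t - (x0 - \<delta>)) / (2 * y)"
      have s: "0 \<le> s" "s < real n" using t y ny by (auto simp: s_def field_simps)
      define j where "j = nat \<lfloor>s\<rfloor>"
      have js: "real j \<le> s" "s < real j + 1" using s(1) by (auto simp: j_def)
      have "j < n" using js s by linarith
      moreover have ts: "t = x0 - \<delta> + 2 * s * y" using y by (simp add: s_def field_simps)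
      have "real j * y \<le> s * y" "s * y \<le> (real j + 1) * y" using js y by (auto intro!: mult_right_mono)
      then have "t \<in> {x j - y..x j + y}" unfolding ts x_def by (simp add: algebra_simps)
      ultimately show "t \<in> (\<Union>j<n. {x j - y..x j + y})" by blast
    qed
    then have "measure \<mu> {x0 - \<delta>..<x0 + \<delta>} \<le> measure \<mu> (\<Union>j<n. {x j - y..x j + y})"
      by (intro finite_measure_mono) (auto simp: m)
    also have "\<dots> \<le> (\<Sum>j<n. measure \<mu> {x j - y..x j + y})"
      by (intro finite_measure_subadditive_finite) (auto simp: m)
    also have "\<dots> \<le> (\<Sum>j<n. 2 * y\<^sup>2 * B')"
      by (intro sum_mono cell xb y) auto
    also have "\<dots> = 2 * \<delta>\<^sup>2 * B' / real n"
      using n by (simp add: y_def power2_eq_square field_simps)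
    finally show ?thesis .
  qed
  have "measure \<mu> {x0 - \<delta>..<x0 + \<delta>} \<le> 0"
  proof (rule LIMSEQ_le_const)
    show "(\<lambda>n. 2 * \<delta>\<^sup>2 * B' / real n) \<longlonglongrightarrow> 0" by (rule lim_const_over_n)
    show "\<exists>N. \<forall>n\<ge>N. measure \<mu> {x0 - \<delta>..<x0 + \<delta>} \<le> 2 * \<delta>\<^sup>2 * B' / real n"
      using small by (intro exI[of _ 1]) auto
  qed
  then have "measure \<mu> {x0 - \<delta>..<x0 + \<delta>} = 0" by (simp add: measure_le_0_iff)
  then have "emeasure \<mu> {x0 - \<delta>..<x0 + \<delta>} = 0" by (simp add: emeasure_eq_measure)
  then show ?thesis using \<delta> by blast
qed

text \<open>First represent N over an interval containing \<open>K\<close>. In the gaps N is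
  analytic, and real on the axis by symmetry, so the measure is locally null there.\<close>

lemma herglotz_representation:
  fixes K :: "real set"
  assumes K: "compact K" and N: "N holomorphic_on - complex_of_real ` K"
    and sym: "\<And>z. z \<notin> complex_of_real ` K \<Longrightarrow> N (cnj z) = cnj (N z)"
    and pos: "\<And>z. Im z > 0 \<Longrightarrow> Im (N z) \<ge> 0"
    and lim: "((\<lambda>z. N z - of_real \<alpha> * z - of_real \<beta>) \<longlongrightarrow> 0) at_infinity"
  shows "\<exists>\<mu>. finite_measure \<mu> \<and> sets \<mu> = sets borel \<and> (AE t in \<mu>. t \<in> K) \<and>
     (\<forall>z. z \<notin> complex_of_real ` K \<longrightarrow> N z = of_real \<alpha> * z + of_real \<beta> + (\<integral>t. 1 / (of_real t - z) \<partial>\<mu>))"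
proof -
  obtain L0 where L0: "\<And>x. x \<in> K \<Longrightarrow> \<bar>x\<bar> \<le> L0"
    using compact_imp_bounded[OF K] by (auto simp: bounded_iff)
  define L where "L = max 1 L0"
  have L: "L > 0" and KL: "K \<subseteq> {-L..L}"
    using L0 by (fastforce simp: L_def abs_le_iff)+
  have sub: "- spectral_set L \<subseteq> - complex_of_real ` K" using KL by auto
  obtain \<mu> where \<mu>: "finite_measure \<mu>" "sets \<mu> = sets borel"
    and rep: "\<And>z. z \<notin> spectral_set L \<Longrightarrow> N z = of_real \<alpha> * z + of_real \<beta> + (\<integral>t. 1 / (of_real t - z) \<partial>\<mu>)"
    using herglotz_interval[OF L holomorphic_on_subset[OF N sub] _ pos lim] sym sub by blast
  have rep': "N z = of_real \<alpha> * z + of_real \<beta> + (\<integral>t. 1 / (of_real t - z) \<partial>\<mu>)" if "Im z > 0" for z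
    by (rule rep) (use that in auto)
  have opn: "open (- complex_of_real ` K)"
    using closed_image_of_real[OF compact_imp_closed[OF K]] by (simp add: open_Compl)
  have "\<exists>\<delta>>0. emeasure \<mu> {x - \<delta>..<x + \<delta>} = 0" if x: "x \<notin> K" for x
  proof -
    have "of_real x \<in> - complex_of_real ` K" using x by auto
    then obtain e where e: "e > 0" "ball (of_real x) e \<subseteq> - complex_of_real ` K"
      using opn by (meson open_contains_ball)
    have "Im (N (of_real y)) = 0" if "\<bar>y - x\<bar> < e" for y
    proof -
      have "cmod (of_real y - of_real x) = \<bar>y - x\<bar>" by (metis norm_of_real of_real_diff)
      then have "of_real y \<in> ball (complex_of_real x) e" using that by (simp add: dist_norm norm_minus_commute)
      then have "N (cnj (of_real y)) = cnj (N (of_real y))" using e(2) by (intro sym) blast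
      then have "N (of_real y) = cnj (N (of_real y))" by (simp only: complex_cnj_complex_of_real)
      from arg_cong[OF this, of Im] show ?thesis by simp
    qed
    from cauchy_transform_locally_null[OF \<mu> rep' e(1) holomorphic_on_subset[OF N e(2)] this]
    show ?thesis by blast
  qed
  then obtain \<delta> where \<delta>: "\<And>x. x \<notin> K \<Longrightarrow> \<delta> x > 0" "\<And>x. x \<notin> K \<Longrightarrow> emeasure \<mu> {x - \<delta> x..<x + \<delta> x} = 0"
    by metis
  let ?F = "(\<lambda>x. {x - \<delta> x<..<x + \<delta> x}) ` (- K)"
  \<comment> \<open>A countable subcover makes the local null sets add up to one null set containing
    the complement of \<open>K\<close>.\<close>
  obtain F' where F': "F' \<subseteq> ?F" "countable F'" "\<Union>F' = \<Union>?F"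
    by (rule Lindelof[of ?F]) auto
  have null: "A \<in> null_sets \<mu>" if A: "A \<in> F'" for A
  proof -
    obtain x where x: "x \<notin> K" "A = {x - \<delta> x<..<x + \<delta> x}" using subsetD[OF F'(1) A] by blast
    have "{x - \<delta> x..<x + \<delta> x} \<in> null_sets \<mu>" using \<delta>(2)[OF x(1)] by (auto simp: null_sets_def \<mu>(2))
    then show ?thesis unfolding x(2) by (rule null_sets_subset) (auto simp: \<mu>(2))
  qed
  have "(\<Union>A\<in>F'. A) \<in> null_sets \<mu>"
    by (rule null_sets_UN'[OF F'(2) null])
  moreover have "- K \<subseteq> (\<Union>A\<in>F'. A)"
  proof
    fix x assume "x \<in> - K"
    moreover from this have "x \<in> {x - \<delta> x<..<x + \<delta> x}" using \<delta>(1)[of x] by auto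
    ultimately have "x \<in> \<Union>?F" by blast
    then show "x \<in> (\<Union>A\<in>F'. A)" using F'(3) by simp
  qed
  ultimately have AE: "AE t in \<mu>. t \<in> K"
    by (intro AE_I[where N = "\<Union>A\<in>F'. A"]) (auto simp: null_sets_def)
  have "N z = of_real \<alpha> * z + of_real \<beta> + (\<integral>t. 1 / (of_real t - z) \<partial>\<mu>)" if z: "z \<notin> complex_of_real ` K" for z
  proof (cases "z \<in> spectral_set L")
    case True
    then have Imz: "Im z = 0" by auto
    let ?G = "\<lambda>z. of_real \<alpha> * z + of_real \<beta> + (\<integral>t. 1 / (of_real t - z) \<partial>\<mu>)"
    have "?G holomorphic_on - complex_of_real ` K"
      by (intro holomorphic_intros cauchy_transform_holomorphic[OF \<mu> AE compact_imp_closed[OF K]])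
    then have cG: "isCont ?G z" and cN: "isCont N z"
      using z opn N by (auto dest!: holomorphic_on_imp_continuous_on simp: continuous_on_eq_continuous_at)
    \<comment> \<open>A real point in a gap lies outside the first representation; approach it from
      above, where the formula is known and both sides are continuous.\<close>
    have s: "(\<lambda>n. z + \<i> * of_real (1 / real (Suc n))) \<longlonglongrightarrow> z"
    proof -
      have "(\<lambda>n. z + \<i> * of_real (1 / real (Suc n))) \<longlonglongrightarrow> z + \<i> * of_real 0"
        by (intro tendsto_intros LIMSEQ_Suc[OF lim_1_over_n])
      then show ?thesis by simp
    qed
    have "(\<lambda>n. N (z + \<i> * of_real (1 / real (Suc n)))) \<longlonglongrightarrow> N z"
      by (rule isCont_tendsto_compose[OF cN s])
    moreover have eq: "N (z + \<i> * of_real (1 / real (Suc n))) = ?G (z + \<i> * of_real (1 / real (Suc n)))" for n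
      by (rule rep') (simp add: Imz)
    ultimately have 1: "(\<lambda>n. ?G (z + \<i> * of_real (1 / real (Suc n)))) \<longlonglongrightarrow> N z"
      by (simp only: eq)
    have 2: "(\<lambda>n. ?G (z + \<i> * of_real (1 / real (Suc n)))) \<longlonglongrightarrow> ?G z"
      by (rule isCont_tendsto_compose[OF cG s])
    show ?thesis by (rule LIMSEQ_unique[OF 1 2])
  qed (rule rep)
  then show ?thesis using \<mu> AE by blast
qed

section \<open>Uniqueness of the Herglotz measure\<close>

lemma power_cauchy_kernel_integrable:
  fixes \<mu> :: "real measure"
  assumes fin: "finite_measure \<mu>" and m[measurable_cong]: "sets \<mu> = sets borel" and L: "AE t in \<mu>. \<bar>t\<bar> \<le> L" and y: "y > 0"
  shows "integrable \<mu> (\<lambda>t. of_real (t ^ n) / (of_real t - \<i> * of_real y))"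
    and "cmod (\<integral>t. of_real (t ^ n) / (of_real t - \<i> * of_real y) \<partial>\<mu>) \<le> L ^ n / y * measure \<mu> (space \<mu>)"
    and "integrable \<mu> (\<lambda>t. t ^ n)"
proof -
  interpret finite_measure \<mu> by fact
  let ?f = "\<lambda>t. complex_of_real (t ^ n) / (of_real t - \<i> * of_real y)"
  have b: "AE t in \<mu>. norm (?f t) \<le> L ^ n / y"
    using L
  proof eventually_elim
    case (elim t)
    have "y \<le> cmod (of_real t - \<i> * of_real y)" using abs_Im_le_cmod[of "of_real t - \<i> * of_real y"] y by simp
    moreover have "\<bar>t ^ n\<bar> \<le> L ^ n" using elim by (simp add: power_abs power_mono)
    ultimately show ?case using y by (simp add: norm_divide frac_le del: of_real_power)
  qed
  show i: "integrable \<mu> ?f"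
    by (rule integrable_const_bound[OF b]) measurable
  have "cmod (integral\<^sup>L \<mu> ?f) \<le> (\<integral>t. norm (?f t) \<partial>\<mu>)" by (rule integral_norm_bound)
  also have "\<dots> \<le> (\<integral>t. L ^ n / y \<partial>\<mu>)"
    by (rule integral_mono_AE[OF integrable_norm[OF i] _ b]) simp
  finally show "cmod (integral\<^sup>L \<mu> ?f) \<le> L ^ n / y * measure \<mu> (space \<mu>)" by (simp add: mult.commute)
  have "AE t in \<mu>. norm (t ^ n) \<le> L ^ n"
    using L by eventually_elim (simp add: power_abs power_mono)
  then show "integrable \<mu> (\<lambda>t. t ^ n)"
    by (rule integrable_const_bound) measurable
qed

text \<open>The integral A_n of t^n / (t - \<i> y) tends to 0 and satisfies A_(n+1) = (n-th moment)
  + \<i> y A_n. If the A_n agree for both measures, the limit gives equal n-th moments, and the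
  recursion gives equal A_(n+1).\<close>

lemma cauchy_transform_moments:
  fixes \<mu> \<nu> :: "real measure"
  assumes mu: "finite_measure \<mu>" "sets \<mu> = sets borel" "AE t in \<mu>. \<bar>t\<bar> \<le> L"
    and nu: "finite_measure \<nu>" "sets \<nu> = sets borel" "AE t in \<nu>. \<bar>t\<bar> \<le> L"
    and eq: "\<And>y. y > 1 \<Longrightarrow> (\<integral>t. 1 / (of_real t - \<i> * of_real y) \<partial>\<mu>) = (\<integral>t. 1 / (of_real t - \<i> * of_real y) \<partial>\<nu>)"
  shows "(\<integral>t. t ^ n \<partial>\<mu>) = (\<integral>t. t ^ n \<partial>\<nu>)"
proof -
  define A where "A \<mu> n y = (\<integral>t. complex_of_real (t ^ n) / (of_real t - \<i> * of_real y) \<partial>\<mu>)" for \<mu> n y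
  have step: "A \<mu> (Suc n) y = of_real (\<integral>t. t ^ n \<partial>\<mu>) + \<i> * of_real y * A \<mu> n y"
    if "finite_measure \<mu>" "sets \<mu> = sets borel" "AE t in \<mu>. \<bar>t\<bar> \<le> L" "y > 0" for \<mu> n y
  proof -
    have pt: "complex_of_real (t ^ Suc n) / (of_real t - \<i> * of_real y)
        = of_real (t ^ n) + \<i> * of_real y * (of_real (t ^ n) / (of_real t - \<i> * of_real y))" for t
    proof -
      have nz: "complex_of_real t - \<i> * of_real y \<noteq> 0" using that(4) by (auto simp: complex_eq_iff)
      have "T * P / D = P + I * (P / D)" if "D \<noteq> 0" "T - I = D" for T P D I :: complex
        using that by (auto simp: field_simps)
      from this[OF nz refl] show ?thesis by simp
    qed
    have i1: "integrable \<mu> (\<lambda>t. complex_of_real (t ^ n))"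
      using power_cauchy_kernel_integrable(3)[OF that, of n] by (rule integrable_of_real)
    have i2: "integrable \<mu> (\<lambda>t. \<i> * of_real y * (of_real (t ^ n) / (of_real t - \<i> * of_real y)))"
      by (rule integrable_mult_right[OF power_cauchy_kernel_integrable(1)[OF that]])
    show ?thesis
      unfolding A_def pt by (simp only: Bochner_Integration.integral_add[OF i1 i2] integral_mult_right_zero integral_complex_of_real)
  qed
  have lim: "((\<lambda>y. A \<mu> n y) \<longlongrightarrow> 0) at_top" if "finite_measure \<mu>" "sets \<mu> = sets borel" "AE t in \<mu>. \<bar>t\<bar> \<le> L" for \<mu> n
  proof (rule Lim_null_comparison)
    show "\<forall>\<^sub>F y in at_top. cmod (A \<mu> n y) \<le> (L ^ n * measure \<mu> (space \<mu>)) / y"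
      using eventually_gt_at_top[of 0]
      by eventually_elim (use power_cauchy_kernel_integrable(2)[OF that] in \<open>simp add: A_def mult.commute\<close>)
    show "((\<lambda>y::real. (L ^ n * measure \<mu> (space \<mu>)) / y) \<longlongrightarrow> 0) at_top"
      by (intro tendsto_divide_0[OF tendsto_const] filterlim_at_top_imp_at_infinity filterlim_ident)
  qed
  have mom: "(\<integral>t. t ^ n \<partial>\<mu>) = (\<integral>t. t ^ n \<partial>\<nu>)" if "\<And>y. y > 1 \<Longrightarrow> A \<mu> n y = A \<nu> n y" for n
  proof -
    have ev: "\<forall>\<^sub>F y in at_top. A \<mu> (Suc n) y - A \<nu> (Suc n) y = of_real ((\<integral>t. t ^ n \<partial>\<mu>) - (\<integral>t. t ^ n \<partial>\<nu>))"
      using eventually_gt_at_top[of 1]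
      by eventually_elim (simp add: step[OF mu] step[OF nu] that)
    have "((\<lambda>y. A \<mu> (Suc n) y - A \<nu> (Suc n) y) \<longlongrightarrow> 0 - 0) at_top"
      by (intro tendsto_diff lim mu nu)
    from Lim_transform_eventually[OF this ev]
    have "complex_of_real ((\<integral>t. t ^ n \<partial>\<mu>) - (\<integral>t. t ^ n \<partial>\<nu>)) = 0" by (simp add: tendsto_const_iff)
    then show ?thesis by (simp only: of_real_eq_0_iff right_minus_eq)
  qed
  have "A \<mu> n y = A \<nu> n y" if "y > 1" for n y
    using that
  proof (induction n arbitrary: y)
    case 0 then show ?case using eq by (simp add: A_def)
  next
    case (Suc n)
    then show ?case using mom[OF Suc.IH] by (simp add: step[OF mu] step[OF nu])
  qed
  then show ?thesis by (rule mom)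
qed

text \<open>Weierstrass approximation on [-L, L] passes from moments to bounded continuous
  functions; the functions \<open>cts_step\<close> tend to indicators of half lines, so the
  distribution functions agree.\<close>

lemma compact_measure_eq_moments:
  fixes \<mu> \<nu> :: "real measure"
  assumes mu: "finite_measure \<mu>" "sets \<mu> = sets borel" "AE t in \<mu>. \<bar>t\<bar> \<le> L"
    and nu: "finite_measure \<nu>" "sets \<nu> = sets borel" "AE t in \<nu>. \<bar>t\<bar> \<le> L"
    and eq: "\<And>n. (\<integral>t. t ^ n \<partial>\<mu>) = (\<integral>t. t ^ n \<partial>\<nu>)"
  shows "\<mu> = \<nu>"
proof -
  have ipow: "integrable \<mu> (\<lambda>t. t ^ n)" "integrable \<nu> (\<lambda>t. t ^ n)" for n
    using power_cauchy_kernel_integrable(3)[OF mu zero_less_one] power_cauchy_kernel_integrable(3)[OF nu zero_less_one] by auto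
  define V where "V = measure \<mu> (space \<mu>) + measure \<nu> (space \<nu>)"
  have V: "V \<ge> 0" by (simp add: V_def)
  have close: "\<bar>(\<integral>t. f t \<partial>\<mu>) - (\<integral>t. p t \<partial>\<mu>)\<bar> \<le> e * measure \<mu> (space \<mu>)"
    if "finite_measure \<mu>" "AE t in \<mu>. \<bar>t\<bar> \<le> L" "integrable \<mu> f" "integrable \<mu> p"
      "\<And>t. \<bar>t\<bar> \<le> L \<Longrightarrow> \<bar>f t - p t\<bar> \<le> e" for \<mu> :: "real measure" and f p e
  proof -
    interpret finite_measure \<mu> by fact
    have i: "integrable \<mu> (\<lambda>t. f t - p t)" using that by simp
    have ae: "AE t in \<mu>. norm (f t - p t) \<le> e" using that(2) by eventually_elim (simp add: that(5))
    have "norm (\<integral>t. f t - p t \<partial>\<mu>) \<le> (\<integral>t. norm (f t - p t) \<partial>\<mu>)" by (rule integral_norm_bound)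
    also have "\<dots> \<le> (\<integral>t. e \<partial>\<mu>)" by (rule integral_mono_AE[OF integrable_norm[OF i] _ ae]) simp
    finally show ?thesis using that by (simp add: mult.commute)
  qed
  have int_eq: "(\<integral>t. f t \<partial>\<mu>) = (\<integral>t. f t \<partial>\<nu>)" if f: "continuous_on UNIV f" "\<And>t. \<bar>f t\<bar> \<le> 1" for f :: "real \<Rightarrow> real"
  proof -
    have fm: "f \<in> borel_measurable borel" by (rule borel_measurable_continuous_onI[OF f(1)])
    have fi: "integrable \<mu> f" "integrable \<nu> f"
      using finite_measure.integrable_const_bound[OF mu(1), of f 1] finite_measure.integrable_const_bound[OF nu(1), of f 1]
        f(2) fm mu(2) nu(2) by (auto cong: measurable_cong_sets)
    have "\<bar>(\<integral>t. f t \<partial>\<mu>) - (\<integral>t. f t \<partial>\<nu>)\<bar> \<le> e * V" if e: "e > 0" for e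
    proof -
      obtain p where p: "real_polynomial_function p" "\<And>t. t \<in> {-L..L} \<Longrightarrow> \<bar>f t - p t\<bar> < e"
        using Stone_Weierstrass_real_polynomial_function[of "{-L..L}" f e] f(1) e
        by (auto intro: continuous_on_subset)
      obtain a n where pe: "p = (\<lambda>x. \<Sum>i\<le>n. a i * x ^ i)"
        using p(1) by (auto simp: real_polynomial_function_iff_sum)
      have pi: "integrable \<mu> p" "integrable \<nu> p" unfolding pe using ipow by auto
      have "(\<integral>t. p t \<partial>\<mu>) = (\<integral>t. p t \<partial>\<nu>)"
        unfolding pe using ipow by (simp add: eq)
      moreover have "\<bar>f t - p t\<bar> \<le> e" if "\<bar>t\<bar> \<le> L" for t
      proof -
        have "t \<in> {-L..L}" using that by auto
        from p(2)[OF this] show ?thesis by simp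
      qed
      then have "\<bar>(\<integral>t. f t \<partial>\<mu>) - (\<integral>t. p t \<partial>\<mu>)\<bar> \<le> e * measure \<mu> (space \<mu>)"
        "\<bar>(\<integral>t. f t \<partial>\<nu>) - (\<integral>t. p t \<partial>\<nu>)\<bar> \<le> e * measure \<nu> (space \<nu>)"
        by (intro close mu nu fi pi; simp)+
      ultimately show ?thesis by (simp add: V_def distrib_left abs_le_iff)
    qed
    then have "\<bar>(\<integral>t. f t \<partial>\<mu>) - (\<integral>t. f t \<partial>\<nu>)\<bar> \<le> e" if "e > 0" for e
    proof -
      have "e / (V + 1) > 0" using that V by simp
      from \<open>\<And>e. e > 0 \<Longrightarrow> \<bar>(\<integral>t. f t \<partial>\<mu>) - (\<integral>t. f t \<partial>\<nu>)\<bar> \<le> e * V\<close>[OF this]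
      have "\<bar>(\<integral>t. f t \<partial>\<mu>) - (\<integral>t. f t \<partial>\<nu>)\<bar> \<le> e * (V / (V + 1))" by simp
      also have "\<dots> \<le> e * 1" using that V by (intro mult_left_mono) auto
      finally show ?thesis by simp
    qed
    then have "\<bar>(\<integral>t. f t \<partial>\<mu>) - (\<integral>t. f t \<partial>\<nu>)\<bar> \<le> 0" by (rule field_le_epsilon) simp
    then show ?thesis by simp
  qed
  have cts01: "0 \<le> cts_step a b t \<and> cts_step a b t \<le> 1" if "a < b" for a b t
    using that by (auto simp: cts_step_def divide_simps)
  have cts_cont: "continuous_on UNIV (cts_step a b)" if "a < b" for a b
    by (rule uniformly_continuous_imp_continuous[OF cts_step_uniformly_continuous[OF that]])
  have cdf_lim: "(\<lambda>n. \<integral>t. cts_step a (a + 1 / real (Suc n)) t \<partial>\<mu>) \<longlonglongrightarrow> cdf \<mu> a"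
    if "finite_measure \<mu>" and m[measurable_cong]: "sets \<mu> = sets borel" for \<mu> a
  proof -
    interpret finite_measure \<mu> by fact
    have "(\<lambda>n. \<integral>t. cts_step a (a + 1 / real (Suc n)) t \<partial>\<mu>) \<longlonglongrightarrow> (\<integral>t. indicator {..a} t \<partial>\<mu>)"
    proof (rule integral_dominated_convergence[where w = "\<lambda>_. 1"])
      show "AE t in \<mu>. (\<lambda>n. cts_step a (a + 1 / real (Suc n)) t) \<longlonglongrightarrow> indicator {..a} t"
      proof (rule AE_I2)
        fix t
        show "(\<lambda>n. cts_step a (a + 1 / real (Suc n)) t) \<longlonglongrightarrow> indicator {..a} t"
        proof (cases "t \<le> a")
          case False
          have "(\<lambda>n. a + 1 / real (Suc n)) \<longlonglongrightarrow> a + 0"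
            by (intro tendsto_intros LIMSEQ_Suc[OF lim_1_over_n])
          then have "\<forall>\<^sub>F n in sequentially. a + 1 / real (Suc n) < t"
            using False by (intro order_tendstoD) auto
          then have "\<forall>\<^sub>F n in sequentially. 0 = cts_step a (a + 1 / real (Suc n)) t"
            by eventually_elim (use False in \<open>simp add: cts_step_def\<close>)
          then show ?thesis using False by (intro Lim_transform_eventually[OF tendsto_const]) simp
        qed (simp add: cts_step_def)
      qed
      show "AE t in \<mu>. norm (cts_step a (a + 1 / real (Suc n)) t) \<le> 1" for n
        using cts01[of a "a + 1 / real (Suc n)"] by (intro AE_I2) simp
      show "cts_step a (a + 1 / real (Suc n)) \<in> borel_measurable \<mu>" for n
        using borel_measurable_continuous_onI[OF cts_cont[of a "a + 1 / real (Suc n)"]] by simp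
    qed auto
    then show ?thesis using m by (simp add: cdf_def)
  qed
  have "cdf \<mu> a = cdf \<nu> a" for a
  proof (rule LIMSEQ_unique[OF cdf_lim[OF mu(1,2)]])
    have "(\<integral>t. cts_step a (a + 1 / real (Suc n)) t \<partial>\<mu>) = (\<integral>t. cts_step a (a + 1 / real (Suc n)) t \<partial>\<nu>)" for n
      using cts01[of a "a + 1 / real (Suc n)"] by (intro int_eq cts_cont) auto
    then show "(\<lambda>n. \<integral>t. cts_step a (a + 1 / real (Suc n)) t \<partial>\<mu>) \<longlonglongrightarrow> cdf \<nu> a"
      using cdf_lim[OF nu(1,2)] by simp
  qed
  then show ?thesis
    using mu nu by (intro cdf_unique') (auto simp: finite_borel_measure_def finite_borel_measure_axioms_def)
qed

text \<open>The Cauchy transforms vanish at \<i> times infinity, so the real part of the identity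
  gives \<beta> = \<beta>' and the imaginary part divided by y gives \<alpha> = \<alpha>'. What
  remains is an equality of Cauchy transforms.\<close>

lemma herglotz_measure_unique:
  fixes \<mu> \<nu> :: "real measure"
  assumes mu: "finite_measure \<mu>" "sets \<mu> = sets borel" "AE t in \<mu>. \<bar>t\<bar> \<le> L"
    and nu: "finite_measure \<nu>" "sets \<nu> = sets borel" "AE t in \<nu>. \<bar>t\<bar> \<le> L"
    and eq: "\<And>y. y > 1 \<Longrightarrow> of_real \<beta> + of_real \<alpha> * (\<i> * of_real y) + (\<integral>t. 1 / (of_real t - \<i> * of_real y) \<partial>\<mu>)
        = of_real \<beta>' + of_real \<alpha>' * (\<i> * of_real y) + (\<integral>t. 1 / (of_real t - \<i> * of_real y) \<partial>\<nu>)"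
  shows "\<mu> = \<nu>"
proof -
  let ?C = "\<lambda>\<mu> y. \<integral>t. 1 / (complex_of_real t - \<i> * of_real y) \<partial>\<mu>"
  have lim: "(?C \<mu> \<longlongrightarrow> 0) at_top" if "finite_measure \<mu>" "sets \<mu> = sets borel" "AE t in \<mu>. \<bar>t\<bar> \<le> L" for \<mu>
  proof (rule Lim_null_comparison)
    show "\<forall>\<^sub>F y in at_top. cmod (?C \<mu> y) \<le> measure \<mu> (space \<mu>) / y"
      using eventually_gt_at_top[of 0]
      by eventually_elim (use power_cauchy_kernel_integrable(2)[OF that, of _ 0] in simp)
    show "((\<lambda>y::real. measure \<mu> (space \<mu>) / y) \<longlongrightarrow> 0) at_top"
      by (intro tendsto_divide_0[OF tendsto_const] filterlim_at_top_imp_at_infinity filterlim_ident)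
  qed
  have "\<forall>\<^sub>F y in at_top. ?C \<nu> y - ?C \<mu> y = of_real (\<beta> - \<beta>') + of_real (\<alpha> - \<alpha>') * (\<i> * of_real y)"
    using eventually_gt_at_top[of 1]
  proof eventually_elim
    case (elim y)
    then show ?case using eq[of y] by (simp add: algebra_simps)
  qed
  moreover have "((\<lambda>y. ?C \<nu> y - ?C \<mu> y) \<longlongrightarrow> 0 - 0) at_top"
    by (intro tendsto_diff lim mu nu)
  ultimately have *: "((\<lambda>y. complex_of_real (\<beta> - \<beta>') + of_real (\<alpha> - \<alpha>') * (\<i> * of_real y)) \<longlongrightarrow> 0 - 0) at_top"
    by (rule Lim_transform_eventually[rotated])
  have b: "\<beta> = \<beta>'" using tendsto_Re[OF *] by (simp add: tendsto_const_iff)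
  have "((\<lambda>y. (\<alpha> - \<alpha>') * y) \<longlongrightarrow> 0) at_top" using tendsto_Im[OF *] by simp
  moreover have "((\<lambda>y::real. 1 / y) \<longlongrightarrow> 0) at_top"
    by (intro tendsto_divide_0[OF tendsto_const] filterlim_at_top_imp_at_infinity filterlim_ident)
  ultimately have "((\<lambda>y. (\<alpha> - \<alpha>') * y * (1 / y)) \<longlongrightarrow> 0 * 0) at_top" by (rule tendsto_mult)
  moreover have "\<forall>\<^sub>F y in at_top. (\<alpha> - \<alpha>') * y * (1 / y) = \<alpha> - \<alpha>'"
    using eventually_gt_at_top[of 0] by eventually_elim simp
  ultimately have "((\<lambda>y::real. \<alpha> - \<alpha>') \<longlongrightarrow> 0 * 0) at_top" by (rule Lim_transform_eventually)
  then have a: "\<alpha> = \<alpha>'" by (simp add: tendsto_const_iff)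
  show ?thesis
    by (rule compact_measure_eq_moments[OF mu nu cauchy_transform_moments[OF mu nu]]) (use eq a b in auto)
qed

section \<open>Gluing the half-line functions across the interval\<close>

lemma upper_half_plane_facts:
  "open upper_half_plane" "convex upper_half_plane" "closure upper_half_plane = {z. Im z \<ge> 0}"
proof -
  have eq: "upper_half_plane = {z. \<i> \<bullet> z > 0}" by (simp add: upper_half_plane_def inner_complex_def)
  show "open upper_half_plane" unfolding eq by (rule open_halfspace_gt)
  show "convex upper_half_plane" unfolding eq by (rule convex_halfspace_gt)
  show "closure upper_half_plane = {z. Im z \<ge> 0}" unfolding eq
    by (subst closure_halfspace_gt) (auto simp: inner_complex_def)
qed

text \<open>A primitive of a function bounded by 1 is 1-Lipschitz, hence extends continuously to the
  closed half plane although the function itself need not.\<close>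

lemma bounded_holomorphic_primitive:
  assumes g: "g holomorphic_on upper_half_plane" and b: "\<And>z. Im z > 0 \<Longrightarrow> cmod (g z) \<le> 1"
  shows "\<exists>H. continuous_on {z. Im z \<ge> 0} H \<and> (\<forall>z. Im z > 0 \<longrightarrow> (H has_field_derivative g z) (at z))"
proof -
  note U = upper_half_plane_facts
  obtain P where P: "\<And>z. z \<in> upper_half_plane \<Longrightarrow> (P has_field_derivative g z) (at z within upper_half_plane)"
    using holomorphic_convex_primitive'[OF U(2,1) g] by blast
  have "1-lipschitz_on upper_half_plane P"
  proof (rule lipschitz_onI)
    fix u v assume uv: "u \<in> upper_half_plane" "v \<in> upper_half_plane"
    have "cmod (P u - P v) \<le> 1 * cmod (u - v)"
      by (rule field_differentiable_bound[OF U(2) P _ uv]) (use b in \<open>auto simp: upper_half_plane_def\<close>)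
    then show "dist (P u) (P v) \<le> 1 * dist u v" by (simp add: dist_norm)
  qed simp
  then obtain H where H: "1-lipschitz_on (closure upper_half_plane) H" "\<And>z. z \<in> upper_half_plane \<Longrightarrow> H z = P z"
    using lipschitz_extend_closure by blast
  have "continuous_on {z. Im z \<ge> 0} H"
    using lipschitz_on_continuous_on[OF H(1)] U(3) by simp
  moreover have "(H has_field_derivative g z) (at z)" if "Im z > 0" for z
  proof -
    have z: "z \<in> upper_half_plane" using that by (simp add: upper_half_plane_def)
    have "(P has_field_derivative g z) (at z)" using P[OF z] at_within_open[OF z U(1)] by simp
    then show ?thesis
      by (rule has_field_derivative_transform_within_open[OF _ U(1) z]) (simp add: H(2))
  qed
  ultimately show ?thesis by blast
qed

text \<open>Dominated convergence on horizontal segments approaching the real axis.\<close>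

lemma primitives_agree:
  assumes g: "g holomorphic_on upper_half_plane" "\<And>z. Im z > 0 \<Longrightarrow> cmod (g z) \<le> 1"
    and k: "k holomorphic_on upper_half_plane" "\<And>z. Im z > 0 \<Longrightarrow> cmod (k z) \<le> 1"
    and G: "continuous_on {z. Im z \<ge> 0} G" "\<And>z. Im z > 0 \<Longrightarrow> (G has_field_derivative g z) (at z)"
    and K: "continuous_on {z. Im z \<ge> 0} K" "\<And>z. Im z > 0 \<Longrightarrow> (K has_field_derivative k z) (at z)"
    and AE: "AE x in lborel. x \<in> {-2<..<2} \<longrightarrow> ((\<lambda>y. g (Complex x y) - cnj (k (Complex x y))) \<longlongrightarrow> 0) (at_right 0)"
    and x: "-2 < x1" "x1 \<le> x2" "x2 < 2"
  shows "G (of_real x2) - G (of_real x1) = cnj (K (of_real x2) - K (of_real x1))"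
proof -
  define e where "e n = 1 / real (Suc n)" for n
  have e0: "e n > 0" for n by (simp add: e_def)
  have elm: "e \<longlonglongrightarrow> 0" unfolding e_def by (rule LIMSEQ_Suc[OF lim_1_over_n])
  then have er: "filterlim e (at_right 0) sequentially"
    by (rule tendsto_imp_filterlim_at_right) (simp add: e0)
  define f where "f n x = g (Complex x (e n)) - cnj (k (Complex x (e n)))" for n x
  have vd: "((\<lambda>x. P (Complex x y)) has_vector_derivative p (Complex x y)) (at x within S)"
    if "\<And>z. Im z > 0 \<Longrightarrow> (P has_field_derivative p z) (at z)" "y > 0" for P p x y S
  proof -
    have "((\<lambda>x. Complex x y) has_vector_derivative 1) (at x within S)"
      unfolding has_vector_derivative_complex_iff by (auto intro!: derivative_eq_intros)
    then have "((P \<circ> (\<lambda>x. Complex x y)) has_vector_derivative (1 * p (Complex x y))) (at x within S)"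
      by (rule field_vector_diff_chain_within) (use that in \<open>auto intro: has_field_derivative_at_within\<close>)
    then show ?thesis by (simp add: o_def)
  qed
  have int: "((\<lambda>x. f n x) has_integral
      (G (Complex x2 (e n)) - G (Complex x1 (e n))) - cnj (K (Complex x2 (e n)) - K (Complex x1 (e n)))) {x1..x2}" for n
  proof -
    have "((\<lambda>x. k (Complex x (e n))) has_integral K (Complex x2 (e n)) - K (Complex x1 (e n))) {x1..x2}"
      by (intro fundamental_theorem_of_calculus x vd[OF K(2) e0])
    then have "((\<lambda>x. cnj (k (Complex x (e n)))) has_integral cnj (K (Complex x2 (e n)) - K (Complex x1 (e n)))) {x1..x2}"
      using has_integral_cnj[of "\<lambda>x. k (Complex x (e n))"] by (simp only: o_def)
    then show ?thesis unfolding f_def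
      by (intro has_integral_diff fundamental_theorem_of_calculus x vd[OF G(2) e0])
  qed
  have fc: "continuous_on {x1..x2} (f n)" for n
  proof -
    have c: "continuous_on {x1..x2} (\<lambda>x. p (Complex x (e n)))" if "p holomorphic_on upper_half_plane" for p
      by (rule continuous_on_compose2[OF holomorphic_on_imp_continuous_on[OF that]])
         (use e0 in \<open>auto intro!: continuous_intros simp: upper_half_plane_def\<close>)
    show ?thesis unfolding f_def by (intro continuous_intros c g k)
  qed
  have si: "set_integrable lborel {x1..x2} (f n)" for n by (rule borel_integrable_atLeastAtMost'[OF fc])
  have "(\<lambda>n. \<integral>x. indicator {x1..x2} x *\<^sub>R f n x \<partial>lborel) \<longlonglongrightarrow> (\<integral>x. 0 \<partial>(lborel :: real measure))"
  proof (rule integral_dominated_convergence[where w = "\<lambda>x. 2 * indicat_real {x1..x2} x"])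
    show "AE x in lborel. (\<lambda>n. indicator {x1..x2} x *\<^sub>R f n x) \<longlonglongrightarrow> 0"
      using AE
    proof eventually_elim
      case (elim x)
      show ?case
      proof (cases "x \<in> {x1..x2}")
        case True
        then have "x \<in> {-2<..<2}" using x by auto
        then have "(\<lambda>n. f n x) \<longlonglongrightarrow> 0"
          unfolding f_def using filterlim_compose[OF elim[rule_format] er] by blast
        then show ?thesis using True by simp
      qed simp
    qed
    show "AE x in lborel. norm (indicator {x1..x2} x *\<^sub>R f n x) \<le> 2 * indicator {x1..x2} x" for n
    proof (rule AE_I2)
      fix x
      have "cmod (f n x) \<le> cmod (g (Complex x (e n))) + cmod (k (Complex x (e n)))"
        unfolding f_def using norm_triangle_ineq4[of "g (Complex x (e n))" "cnj (k (Complex x (e n)))"] by simp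
      also have "\<dots> \<le> 1 + 1" by (intro add_mono g k) (simp_all add: e0)
      finally show "norm (indicator {x1..x2} x *\<^sub>R f n x) \<le> 2 * indicator {x1..x2} x"
        by (auto simp: indicator_def)
    qed
    show "integrable lborel (\<lambda>x. 2 * indicat_real {x1..x2} x)"
      using x(2) by (intro integrable_mult_right integrable_real_indicator) auto
    show "(\<lambda>x. indicator {x1..x2} x *\<^sub>R f n x) \<in> borel_measurable lborel" for n
      using si[of n] by (auto simp: set_integrable_def)
  qed simp
  moreover have "(\<integral>x. indicator {x1..x2} x *\<^sub>R f n x \<partial>lborel)
      = (G (Complex x2 (e n)) - G (Complex x1 (e n))) - cnj (K (Complex x2 (e n)) - K (Complex x1 (e n)))" for n
    using set_borel_integral_eq_integral(2)[OF si[of n]] integral_unique[OF int[of n]] by (simp add: set_lebesgue_integral_def)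
  ultimately have 1: "(\<lambda>n. (G (Complex x2 (e n)) - G (Complex x1 (e n))) - cnj (K (Complex x2 (e n)) - K (Complex x1 (e n)))) \<longlonglongrightarrow> 0"
    by simp
  have c: "(\<lambda>n. P (Complex x (e n))) \<longlonglongrightarrow> P (of_real x)" if "continuous_on {z. Im z \<ge> 0} P" for P x
  proof (rule continuous_on_tendsto_compose[OF that])
    have "(\<lambda>n. Complex x (e n)) \<longlonglongrightarrow> Complex x 0" by (intro tendsto_Complex tendsto_const elm)
    then show "(\<lambda>n. Complex x (e n)) \<longlonglongrightarrow> of_real x" by (simp add: complex_of_real_def)
  qed (use e0 in \<open>auto simp: less_imp_le\<close>)
  have 2: "(\<lambda>n. (G (Complex x2 (e n)) - G (Complex x1 (e n))) - cnj (K (Complex x2 (e n)) - K (Complex x1 (e n))))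
     \<longlonglongrightarrow> (G (of_real x2) - G (of_real x1)) - cnj (K (of_real x2) - K (of_real x1))"
    by (intro tendsto_intros c G K)
  show ?thesis using LIMSEQ_unique[OF 1 2] by simp
qed

section \<open>Pasting across the interval\<close>

lemma open_Omega: "open Omega"
proof -
  have "Omega = - complex_of_real ` ({..-2} \<union> {2..})"
    by (auto simp: Omega_def upper_half_plane_def lower_half_plane_def image_iff complex_eq_iff not_le)
  moreover have "closed (complex_of_real ` ({..-2} \<union> {2..}))"
    by (intro closed_image_of_real closed_Un) auto
  ultimately show ?thesis by (metis open_Compl)
qed

lemma cayley_bound:
  assumes "Im w > 0" shows "cmod ((w - \<i>) / (w + \<i>)) < 1" "w + \<i> \<noteq> 0"
proof -
  show nz: "w + \<i> \<noteq> 0" using assms by (auto simp: complex_eq_iff)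
  have "(cmod (w - \<i>))\<^sup>2 < (cmod (w + \<i>))\<^sup>2"
    unfolding cmod_power2 using assms by (simp add: power2_eq_square algebra_simps)
  then have "cmod (w - \<i>) < cmod (w + \<i>)" by (simp add: power2_less_imp_less)
  then show "cmod ((w - \<i>) / (w + \<i>)) < 1" using nz by (simp add: norm_divide)
qed

lemma inverse_cayley:
  assumes "w + \<i> \<noteq> 0" shows "\<i> * (1 + (w - \<i>) / (w + \<i>)) / (1 - (w - \<i>) / (w + \<i>)) = w"
proof -
  have "1 + (w - \<i>) / (w + \<i>) = 2 * w / (w + \<i>)" "1 - (w - \<i>) / (w + \<i>) = 2 * \<i> / (w + \<i>)"
    using assms by (simp_all add: field_simps)
  then show ?thesis using assms by simp
qed

lemma inverse_cayley_Im:
  assumes "cmod g < 1" shows "Im (\<i> * (1 + g) / (1 - g)) > 0" "1 - g \<noteq> 0"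
proof -
  show nz: "1 - g \<noteq> 0" using assms by auto
  have "\<i> * (1 + g) / (1 - g) = \<i> * ((1 + g) * cnj (1 - g)) / of_real ((cmod (1 - g))\<^sup>2)"
    by (subst complex_div_cnj) (simp add: mult.assoc)
  then have "Im (\<i> * (1 + g) / (1 - g)) = Re ((1 + g) * cnj (1 - g)) / (cmod (1 - g))\<^sup>2" by simp
  also have "Re ((1 + g) * cnj (1 - g)) = 1 - (cmod g)\<^sup>2"
    unfolding cmod_power2 by (simp add: power2_eq_square algebra_simps)
  also have "(1 - (cmod g)\<^sup>2) / (cmod (1 - g))\<^sup>2 > 0"
    using assms nz by (intro divide_pos_pos) (auto simp: power_less_one_iff abs_square_less_1)
  finally show "Im (\<i> * (1 + g) / (1 - g)) > 0" .
qed

text \<open>After Cayley transforms the primitives of g and of the reflected k differ on (-2, 2)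
  only by a constant, so together they form a continuous function that is holomorphic off the line.
  Pasting makes it holomorphic, and its derivative carries the continuation back.\<close>

lemma glue_herglotz:
  assumes p: "p holomorphic_on upper_half_plane" "\<And>z. Im z > 0 \<Longrightarrow> Im (p z) > 0"
    and q: "q holomorphic_on upper_half_plane" "\<And>z. Im z > 0 \<Longrightarrow> Im (q z) > 0"
    and AE: "AE x in lborel. x \<in> {-2<..<2} \<longrightarrow>
        (\<exists>w v. has_boundary_value p x w \<and> has_boundary_value q x v \<and> w = - cnj v)"
  shows "\<exists>M. M holomorphic_on Omega \<and> M ` Omega \<subseteq> upper_half_plane \<and>
     (\<forall>z\<in>upper_half_plane. M z = p z) \<and> (\<forall>z\<in>lower_half_plane. M z = - cnj (q (cnj z)))"
proof -
  note U = upper_half_plane_facts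
  \<comment> \<open>The Cayley transform turns the relation w = - cnj v between boundary values into
    equality of one with the conjugate of the other.\<close>
  define g where "g z = (p z - \<i>) / (p z + \<i>)" for z
  define k where "k z = (q z - \<i>) / (q z + \<i>)" for z
  have gh: "g holomorphic_on upper_half_plane"
    unfolding g_def using p cayley_bound(2) by (intro holomorphic_intros) (auto simp: upper_half_plane_def)
  have kh: "k holomorphic_on upper_half_plane"
    unfolding k_def using q cayley_bound(2) by (intro holomorphic_intros) (auto simp: upper_half_plane_def)
  have g1: "cmod (g z) < 1" if "Im z > 0" for z unfolding g_def by (rule cayley_bound[OF p(2)[OF that]])
  have k1: "cmod (k z) < 1" if "Im z > 0" for z unfolding k_def by (rule cayley_bound[OF q(2)[OF that]])
  obtain G where G: "continuous_on {z. Im z \<ge> 0} G" "\<And>z. Im z > 0 \<Longrightarrow> (G has_field_derivative g z) (at z)"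
    using bounded_holomorphic_primitive[OF gh] g1 less_imp_le by blast
  obtain K where K: "continuous_on {z. Im z \<ge> 0} K" "\<And>z. Im z > 0 \<Longrightarrow> (K has_field_derivative k z) (at z)"
    using bounded_holomorphic_primitive[OF kh] k1 less_imp_le by blast
  have AE': "AE x in lborel. x \<in> {-2<..<2} \<longrightarrow> ((\<lambda>y. g (Complex x y) - cnj (k (Complex x y))) \<longlongrightarrow> 0) (at_right 0)"
    using AE
  proof eventually_elim
    case (elim x)
    show ?case
    proof
      assume "x \<in> {-2<..<2}"
      then obtain w v where w: "((\<lambda>y. p (Complex x y)) \<longlongrightarrow> w) (at_right 0)"
        and v: "((\<lambda>y. q (Complex x y)) \<longlongrightarrow> v) (at_right 0)" and wv: "w = - cnj v"
        using elim by (auto simp: has_boundary_value_def)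
      \<comment> \<open>The limit may be real, but it stays away from -\<i>, so the Cayley transform
        is continuous there.\<close>
      have "0 \<le> Im v"
      proof (rule tendsto_lowerbound[OF tendsto_Im[OF v]])
        show "\<forall>\<^sub>F y in at_right 0. 0 \<le> Im (q (Complex x y))"
          using eventually_at_right_less[of 0] by eventually_elim (use q(2) in \<open>auto intro: less_imp_le\<close>)
      qed simp
      then have nz: "v + \<i> \<noteq> 0" "w + \<i> \<noteq> 0" using wv by (auto simp: complex_eq_iff)
      have "((\<lambda>y. g (Complex x y) - cnj (k (Complex x y))) \<longlongrightarrow> (w - \<i>) / (w + \<i>) - cnj ((v - \<i>) / (v + \<i>))) (at_right 0)"
        unfolding g_def k_def by (intro tendsto_intros w v nz)
      moreover have "(w - \<i>) / (w + \<i>) = cnj ((v - \<i>) / (v + \<i>))"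
      proof -
        have "w - \<i> = - (cnj v + \<i>)" "w + \<i> = - (cnj v - \<i>)" using wv by simp_all
        then show ?thesis by (simp only: minus_divide_divide) simp
      qed
      ultimately show "((\<lambda>y. g (Complex x y) - cnj (k (Complex x y))) \<longlongrightarrow> 0) (at_right 0)" by simp
    qed
  qed
  define \<kappa> where "\<kappa> = G 0 - cnj (K 0)"
  have agree: "G (of_real x) = cnj (K (of_real x)) + \<kappa>" if x: "-2 < x" "x < 2" for x
  proof -
    have *: "G (of_real x2) - G (of_real x1) = cnj (K (of_real x2) - K (of_real x1))" if "-2 < x1" "x1 \<le> x2" "x2 < 2" for x1 x2
      by (rule primitives_agree[OF gh _ kh _ G K AE' that]) (use g1 k1 less_imp_le in blast)+
    show ?thesis
    proof (cases "0 \<le> x")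
      case True then show ?thesis using *[of 0 x] x by (simp add: \<kappa>_def algebra_simps)
    next
      case False then show ?thesis using *[of x 0] x by (simp add: \<kappa>_def algebra_simps)
    qed
  qed
  define F where "F z = (if Im z \<ge> 0 then G z else cnj (K (cnj z)) + \<kappa>)" for z
  have Fp: "(F has_field_derivative g z) (at z)" if "Im z > 0" for z
    by (rule has_field_derivative_transform_within_open[OF G(2)[OF that] U(1)])
       (use that in \<open>auto simp: upper_half_plane_def F_def\<close>)
  have opl: "open lower_half_plane"
    unfolding lower_half_plane_def by (rule open_halfspace_Im_lt)
  have Fm: "(F has_field_derivative cnj (k (cnj z))) (at z)" if z: "Im z < 0" for z
  proof -
    have "(K has_field_derivative k (cnj z)) (at (cnj z))" using z by (intro K(2)) simp
    then have "(cnj \<circ> K \<circ> cnj has_field_derivative cnj (k (cnj z))) (at z)"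
      by (rule has_field_derivative_cnj_cnj)
    then have "((\<lambda>z. cnj (K (cnj z)) + \<kappa>) has_field_derivative cnj (k (cnj z)) + 0) (at z)"
      by (intro DERIV_add DERIV_const) (simp add: o_def)
    then have "((\<lambda>z. cnj (K (cnj z)) + \<kappa>) has_field_derivative cnj (k (cnj z))) (at z)" by simp
    then show ?thesis
      by (rule has_field_derivative_transform_within_open[OF _ opl])
         (use z in \<open>auto simp: lower_half_plane_def F_def\<close>)
  qed
  have Fc: "continuous_on Omega F"
  proof -
    have "continuous_on ({z \<in> Omega. 0 \<le> Im z} \<union> {z \<in> Omega. Im z \<le> 0}) F"
      unfolding F_def
    proof (rule continuous_on_cases_local)
      show "closedin (top_of_set ({z \<in> Omega. 0 \<le> Im z} \<union> {z \<in> Omega. Im z \<le> 0})) {z \<in> Omega. 0 \<le> Im z}"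
        by (auto simp: closedin_closed intro!: exI[of _ "{z. 0 \<le> Im z}"] closed_halfspace_Im_ge)
      show "closedin (top_of_set ({z \<in> Omega. 0 \<le> Im z} \<union> {z \<in> Omega. Im z \<le> 0})) {z \<in> Omega. Im z \<le> 0}"
        by (auto simp: closedin_closed intro!: exI[of _ "{z. Im z \<le> 0}"] closed_halfspace_Im_le)
      show "continuous_on {z \<in> Omega. 0 \<le> Im z} G" by (rule continuous_on_subset[OF G(1)]) auto
      show "continuous_on {z \<in> Omega. Im z \<le> 0} (\<lambda>z. cnj (K (cnj z)) + \<kappa>)"
        by (intro continuous_intros continuous_on_compose2[OF K(1)]) auto
      fix z assume "z \<in> {z \<in> Omega. 0 \<le> Im z} \<and> \<not> 0 \<le> Im z \<or> z \<in> {z \<in> Omega. Im z \<le> 0} \<and> 0 \<le> Im z"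
      then have "z \<in> Omega" "Im z = 0" by auto
      then obtain x where "z = of_real x" "-2 < x" "x < 2"
        by (auto simp: Omega_def upper_half_plane_def lower_half_plane_def)
      then show "G z = cnj (K (cnj z)) + \<kappa>" using agree by simp
    qed
    moreover have "{z \<in> Omega. 0 \<le> Im z} \<union> {z \<in> Omega. Im z \<le> 0} = Omega" by auto
    ultimately show ?thesis by simp
  qed
  have Fh: "F holomorphic_on Omega"
  proof (rule holomorphic_on_paste_across_line[OF open_Omega, of "\<i>" _ 0])
    have "F holomorphic_on {z. Im z < 0}"
      unfolding holomorphic_on_def field_differentiable_def using Fm has_field_derivative_at_within by blast
    then show "F holomorphic_on (Omega \<inter> {z. \<i> \<bullet> z < 0})"
      by (rule holomorphic_on_subset) (auto simp: inner_complex_def)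
    have "F holomorphic_on {z. Im z > 0}"
      unfolding holomorphic_on_def field_differentiable_def using Fp has_field_derivative_at_within by blast
    then show "F holomorphic_on (Omega \<inter> {z. 0 < \<i> \<bullet> z})"
      by (rule holomorphic_on_subset) (auto simp: inner_complex_def)
  qed (use Fc in auto)
  define D where "D = deriv F"
  have Dh: "D holomorphic_on Omega" unfolding D_def by (rule holomorphic_deriv[OF Fh open_Omega])
  have Dp: "D z = g z" if "Im z > 0" for z using DERIV_imp_deriv[OF Fp[OF that]] by (simp add: D_def)
  have Dm: "D z = cnj (k (cnj z))" if "Im z < 0" for z using DERIV_imp_deriv[OF Fm[OF that]] by (simp add: D_def)
  have Doff: "cmod (D z) < 1" if "Im z \<noteq> 0" for z
    using that Dp[of z] Dm[of z] g1[of z] k1[of "cnj z"] by (cases "Im z > 0") auto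
  \<comment> \<open>On the interval the bound comes from continuity, along a vertical sequence that
    avoids the real axis.\<close>
  have Dle: "cmod (D z) \<le> 1" if z: "z \<in> Omega" for z
  proof (rule LIMSEQ_le_const2)
    have "isCont D z" using z Dh open_Omega
      by (auto dest!: holomorphic_on_imp_continuous_on simp: continuous_on_eq_continuous_at)
    moreover have "(\<lambda>n. z + \<i> * of_real (1 / real (Suc n))) \<longlonglongrightarrow> z + \<i> * of_real 0"
      by (intro tendsto_intros LIMSEQ_Suc[OF lim_1_over_n])
    ultimately show "(\<lambda>n. cmod (D (z + \<i> * of_real (1 / real (Suc n))))) \<longlonglongrightarrow> cmod (D z)"
      by (intro tendsto_norm isCont_tendsto_compose[of z D]) auto
    have "cmod (D (z + \<i> * of_real (1 / real (Suc n)))) \<le> 1" if "Im z = 0 \<or> real n > 1 / \<bar>Im z\<bar>" for n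
    proof (rule less_imp_le[OF Doff], cases "Im z = 0")
      case False
      then have "1 / real (Suc n) < \<bar>Im z\<bar>" using that by (simp add: field_simps)
      moreover have "1 / real (Suc n) > 0" by simp
      ultimately have "Im z + 1 / real (Suc n) \<noteq> 0" by linarith
      then show "Im (z + \<i> * of_real (1 / real (Suc n))) \<noteq> 0" by simp
    qed auto
    moreover obtain N :: nat where "1 / \<bar>Im z\<bar> < real N" using reals_Archimedean2 by blast
    ultimately show "\<exists>N. \<forall>n\<ge>N. cmod (D (z + \<i> * of_real (1 / real (Suc n)))) \<le> 1"
      by (intro exI[of _ N]) (meson less_le_trans of_nat_le_iff)
  qed
  \<comment> \<open>Modulus 1 could occur only on the interval. The maximum principle would make D
    constant nearby, contradicting the strict bound off the axis. Strictness is needed to invert the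
    Cayley transform.\<close>
  have D1: "cmod (D z) < 1" if z: "z \<in> Omega" for z
  proof (rule ccontr)
    assume "\<not> cmod (D z) < 1"
    then have 1: "cmod (D z) = 1" using Dle[OF z] by simp
    obtain e where e: "e > 0" "ball z e \<subseteq> Omega" using open_Omega z open_contains_ball by blast
    have "D constant_on ball z e"
    proof (rule maximum_modulus_principle[of _ _ "ball z e" z])
      show "D holomorphic_on ball z e" using Dh e(2) by (rule holomorphic_on_subset)
      show "cmod (D w) \<le> cmod (D z)" if "w \<in> ball z e" for w using Dle e(2) that 1 by auto
    qed (use e in auto)
    then obtain c where c: "\<And>w. w \<in> ball z e \<Longrightarrow> D w = c" by (auto simp: constant_on_def)
    have "Im z = 0" using Doff[of z] 1 by auto
    have "z + \<i> * of_real (e / 2) \<in> ball z e" using e(1) by (simp add: dist_norm norm_mult)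
    then have "D (z + \<i> * of_real (e / 2)) = D z" using c[of z] c e(1) by simp
    moreover have "cmod (D (z + \<i> * of_real (e / 2))) < 1" by (rule Doff) (use \<open>Im z = 0\<close> e(1) in simp)
    ultimately show False using 1 by simp
  qed
  define M where "M z = \<i> * (1 + D z) / (1 - D z)" for z
  have "M holomorphic_on Omega"
    unfolding M_def using Dh D1 inverse_cayley_Im(2) by (intro holomorphic_intros) auto
  moreover have "M ` Omega \<subseteq> upper_half_plane"
    using inverse_cayley_Im(1)[OF D1] by (auto simp: M_def upper_half_plane_def)
  moreover have "M z = p z" if "Im z > 0" for z
    using inverse_cayley[OF cayley_bound(2)[OF p(2)[OF that]]] Dp[OF that] by (simp add: M_def g_def)
  moreover have "M z = - cnj (q (cnj z))" if z: "Im z < 0" for z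
  proof -
    let ?w = "- cnj (q (cnj z))"
    have "Im ?w > 0" using q(2)[of "cnj z"] z by simp
    note w = cayley_bound(2)[OF this]
    have "?w - \<i> = - (cnj (q (cnj z)) + \<i>)" "?w + \<i> = - (cnj (q (cnj z)) - \<i>)" by simp_all
    then have "(?w - \<i>) / (?w + \<i>) = cnj (k (cnj z))"
      by (simp only: minus_divide_divide k_def) simp
    then show ?thesis using inverse_cayley[OF w] Dm[OF z] by (simp only: M_def)
  qed
  ultimately show ?thesis by (auto simp: upper_half_plane_def lower_half_plane_def)
qed

lemma m_plus_minus_herglotz:
  assumes J: "jacobi_matrix a b"
  shows "m_plus a b holomorphic_on upper_half_plane" "\<And>z. Im z > 0 \<Longrightarrow> Im (m_plus a b z) > 0"
    and "m_minus a b holomorphic_on upper_half_plane" "\<And>z. Im z > 0 \<Longrightarrow> Im (m_minus a b z) > 0"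
    and "\<And>z. Im z > 0 \<Longrightarrow> m_minus a b z =
      (z - of_real (b 0) + of_real ((a (-1))\<^sup>2) * m_plus (reflect_a a) (reflect_b b) z) / of_real ((a 0)\<^sup>2)"
proof -
  have h: "m_plus a b holomorphic_on upper_half_plane" if Jab: "jacobi_matrix a b" for a b
  proof -
    obtain R m where m: "half_line_m a b R m" using exists_half_line_m[OF Jab] by blast
    have "m holomorphic_on upper_half_plane"
      by (rule holomorphic_on_subset[OF half_line_mD(1)[OF m]]) (auto simp: upper_half_plane_def)
    then show ?thesis
      by (rule holomorphic_transform) (simp add: half_line_mD(2)[OF m] upper_half_plane_def)
  qed
  have p: "Im (m_plus a b z) > 0" if Jab: "jacobi_matrix a b" "Im z > 0" for a b z
  proof -
    obtain R m where m: "half_line_m a b R m" using exists_half_line_m[OF Jab(1)] by blast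
    show ?thesis using half_line_mD(2,3)[OF m Jab(2)] by simp
  qed
  show "m_plus a b holomorphic_on upper_half_plane" by (rule h[OF J])
  show "\<And>z. Im z > 0 \<Longrightarrow> Im (m_plus a b z) > 0" by (rule p[OF J])
  note J' = jacobi_matrix_reflect[OF J]
  have a: "a 0 > 0" "a (-1) > 0" using J by (simp_all add: jacobi_matrix_def)
  let ?m = "\<lambda>z. (z - of_real (b 0) + of_real ((a (-1))\<^sup>2) * m_plus (reflect_a a) (reflect_b b) z) / of_real ((a 0)\<^sup>2)"
  show eq: "m_minus a b z = ?m z" if z: "Im z > 0" for z
  proof -
    obtain R m where m: "half_line_m (reflect_a a) (reflect_b b) R m" using exists_half_line_m[OF J'] by blast
    show ?thesis by (rule m_minus_eq[OF J z half_line_mD(5)[OF m z]])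
  qed
  have "?m holomorphic_on upper_half_plane"
    using a by (intro holomorphic_intros h[OF J']) auto
  then show "m_minus a b holomorphic_on upper_half_plane"
    by (rule holomorphic_transform) (simp add: eq upper_half_plane_def)
  show "Im (m_minus a b z) > 0" if z: "Im z > 0" for z
  proof -
    have "Im (?m z) = (Im z + (a (-1))\<^sup>2 * Im (m_plus (reflect_a a) (reflect_b b) z)) / (a 0)\<^sup>2"
      by (simp only: Im_divide_of_real) simp
    also have "\<dots> > 0" using z a p[OF J' z] by (intro divide_pos_pos add_pos_pos mult_pos_pos) auto
    finally show ?thesis using eq[OF z] by simp
  qed
qed

lemma M_function_exists:
  assumes J: "jacobi_matrix a b" and refl: "reflectionless_on a b {-2<..<2}"
  shows "\<exists>M. is_M_function a b M"
  using glue_herglotz[OF m_plus_minus_herglotz(1-4)[OF J]] refl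
  unfolding is_M_function_def reflectionless_on_def by blast

section \<open>The conformal map\<close>

lemma phi_cnj: "phi (cnj l) = cnj (phi l)"
  by (simp add: phi_def)

lemma phi_inverse: "phi (1 / l) = phi l"
  by (simp add: phi_def)

lemma Im_phi: "Im (phi l) = Im l * (1 / (cmod l)\<^sup>2 - 1)"
  by (simp add: phi_def Im_divide cmod_power2 algebra_simps)

lemma phi_holomorphic: "0 \<notin> S \<Longrightarrow> phi holomorphic_on S"
  unfolding phi_def by (intro holomorphic_intros) auto

lemma phi_mult: "l \<noteq> 0 \<Longrightarrow> phi l * l = - (l\<^sup>2 + 1)"
  by (simp add: phi_def field_simps power2_eq_square)

lemma Im_phi_disc_iff:
  assumes "l \<noteq> 0" "cmod l < 1"
  shows "Im (phi l) > 0 \<longleftrightarrow> Im l > 0" "Im (phi l) < 0 \<longleftrightarrow> Im l < 0"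
proof -
  have "0 < (cmod l)\<^sup>2" "(cmod l)\<^sup>2 < 1" using assms by (auto simp: abs_square_less_1)
  then have "1 / (cmod l)\<^sup>2 - 1 > 0" by (simp add: field_simps)
  then show "Im (phi l) > 0 \<longleftrightarrow> Im l > 0" "Im (phi l) < 0 \<longleftrightarrow> Im l < 0"
    unfolding Im_phi by (auto simp: zero_less_mult_iff mult_less_0_iff)
qed

lemma phi_upper_disc:
  assumes "Im l > 0" "cmod l < 1" shows "Im (phi l) > 0"
proof -
  have "l \<noteq> 0" using assms(1) by auto
  then show ?thesis using assms Im_phi_disc_iff(1) by blast
qed

lemma phi_upper_outside:
  assumes "Im l > 0" "cmod l > 1" shows "Im (phi l) < 0"
proof -
  have "1 < (cmod l)\<^sup>2" using assms(2) by (simp add: one_less_power)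
  then have "1 / (cmod l)\<^sup>2 < 1" by (subst divide_less_eq_1_pos) linarith+
  then have "1 / (cmod l)\<^sup>2 - 1 < 0" by simp
  then show ?thesis unfolding Im_phi using assms(1) by (rule mult_pos_neg[rotated])
qed

lemma phi_upper_circle:
  assumes "Im l > 0" "cmod l = 1" shows "phi l = of_real (- 2 * Re l)" and "\<bar>Re l\<bar> < 1"
proof -
  have "l * cnj l = 1" using complex_norm_square[of l] assms(2) by simp
  moreover have "l \<noteq> 0" using assms(1) by auto
  ultimately have "1 / l = cnj l" by (simp add: field_simps)
  then have "phi l = - (l + cnj l)" by (simp add: phi_def)
  then show "phi l = of_real (- 2 * Re l)" by (simp add: complex_add_cnj)
  have "(Re l)\<^sup>2 + (Im l)\<^sup>2 = 1" using assms(2) by (metis cmod_power2 one_power2)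
  moreover have "(Im l)\<^sup>2 > 0" using assms(1) by simp
  ultimately have "(Re l)\<^sup>2 < 1" by linarith
  then show "\<bar>Re l\<bar> < 1" by (simp add: abs_square_less_1)
qed

lemma phi_upper_half_plane:
  assumes "l \<in> upper_half_plane" shows "phi l \<in> Omega"
proof -
  have l: "Im l > 0" using assms by (simp add: upper_half_plane_def)
  consider "cmod l < 1" | "cmod l > 1" | "cmod l = 1" by linarith
  then show ?thesis
  proof cases
    case 1 then show ?thesis using phi_upper_disc[OF l] by (simp add: Omega_def upper_half_plane_def)
  next
    case 2 then show ?thesis using phi_upper_outside[OF l] by (simp add: Omega_def lower_half_plane_def)
  next
    case 3
    have "- 2 * Re l \<in> {-2<..<2}" using phi_upper_circle(2)[OF l 3] by (auto simp: abs_less_iff)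
    then show ?thesis unfolding Omega_def phi_upper_circle(1)[OF l 3] by blast
  qed
qed

text \<open>The difference of the two values factors as (l' - l) (l l' - 1) / (l l'), so
  \<open>phi\<close> identifies exactly l and 1 / l.\<close>

lemma phi_eq_iff:
  assumes "l \<noteq> 0" "l' \<noteq> 0" shows "phi l = phi l' \<longleftrightarrow> l = l' \<or> l * l' = 1"
proof -
  have "phi l - phi l' = (l' - l) * (l * l' - 1) / (l * l')"
    using assms by (simp add: phi_def field_simps)
  then have "phi l - phi l' = 0 \<longleftrightarrow> (l' - l) * (l * l' - 1) = 0" using assms by simp
  then show ?thesis by auto
qed

lemma inj_on_phi_disc: "inj_on phi (ball 0 1 - {0})"
proof (rule inj_onI)
  fix l l' assume *: "l \<in> ball 0 1 - {0}" "l' \<in> ball 0 1 - {0}" "phi l = phi l'"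
  then have "l = l' \<or> l * l' = 1" using phi_eq_iff by auto
  moreover have "cmod (l * l') < 1 * 1"
    unfolding norm_mult using * by (intro mult_strict_mono) auto
  then have "l * l' \<noteq> 1" by auto
  ultimately show "l = l'" by blast
qed

lemma inj_on_phi_upper: "inj_on phi upper_half_plane"
proof (rule inj_onI)
  fix l l' assume *: "l \<in> upper_half_plane" "l' \<in> upper_half_plane" "phi l = phi l'"
  then have nz: "l \<noteq> 0" "l' \<noteq> 0" by (auto simp: upper_half_plane_def)
  then have "l = l' \<or> l * l' = 1" using * phi_eq_iff by auto
  moreover have "l * l' \<noteq> 1"
  proof
    assume "l * l' = 1"
    then have "l' = 1 / l" using nz by (simp add: field_simps)
    then have "Im l' = - Im l / (cmod l)\<^sup>2" by (simp add: Im_divide cmod_power2)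
    moreover have "- Im l / (cmod l)\<^sup>2 < 0" using *(1) nz by (intro divide_neg_pos) (auto simp: upper_half_plane_def)
    ultimately show False using *(2) by (simp add: upper_half_plane_def)
  qed
  ultimately show "l = l'" by blast
qed

lemma phi_disc_image: "phi ` (ball 0 1 - {0}) = - spectral_set 2"
proof (intro equalityI subsetI)
  fix z assume "z \<in> phi ` (ball 0 1 - {0})"
  then obtain l where "l \<in> ball 0 1 - {0}" and l3: "z = phi l" by (rule imageE)
  then have l: "l \<noteq> 0" "cmod l < 1" by auto
  show "z \<in> - spectral_set 2"
  proof
    assume "z \<in> spectral_set 2"
    then obtain x where x: "\<bar>x\<bar> \<le> 2" "z = of_real x" by (auto simp: abs_le_iff)
    have "l + 1 / l = - z" using l3 by (simp add: phi_def)
    also have "\<dots> = 2 * of_real (cos (arccos (- x / 2)))" using x by (subst cos_arccos_abs) auto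
    finally show False using joukowski_nonzero[OF l(1,2)] by blast
  qed
next
  fix z assume "z \<in> - spectral_set 2"
  have "- z \<notin> spectral_set 2"
  proof
    assume "- z \<in> spectral_set 2"
    then obtain x where x: "x \<in> {-2..2}" "- z = of_real x" by blast
    then have "z = of_real (- x)" by (metis minus_minus of_real_minus)
    moreover have "- x \<in> {-2..2}" using x(1) by simp
    ultimately show False using \<open>z \<in> - spectral_set 2\<close> by blast
  qed
  then obtain s where "s \<noteq> 0" "cmod s < 1" and s: "s + 1 / s = - z" using joukowski_surj by blast
  moreover have "phi s = - (s + 1 / s)" by (simp add: phi_def)
  then have "z = phi s" using s by simp
  ultimately show "z \<in> phi ` (ball 0 1 - {0})" by auto
qed

lemma phi_disc_preimage:
  assumes "z \<notin> spectral_set 2"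
  obtains l where "l \<noteq> 0" "cmod l < 1" "z = phi l"
proof -
  have "z \<in> phi ` (ball 0 1 - {0})" unfolding phi_disc_image using assms by simp
  then obtain l where "l \<in> ball 0 1 - {0}" "z = phi l" by (rule imageE)
  then show thesis using that[of l] by simp
qed

text \<open>For nonreal z one of the mutually inverse preimages lies in the upper half plane; points
  of (-2, 2) come from the upper unit semicircle.\<close>

lemma phi_upper_image: "phi ` upper_half_plane = Omega"
proof (intro equalityI subsetI)
  fix z assume "z \<in> Omega"
  then consider "Im z \<noteq> 0" | x where "z = of_real x" "-2 < x" "x < 2"
    by (auto simp: Omega_def upper_half_plane_def lower_half_plane_def)
  then show "z \<in> phi ` upper_half_plane"
  proof cases
    case 1
    then have "z \<notin> spectral_set 2" by auto
    then obtain l where l: "l \<noteq> 0" "cmod l < 1" "z = phi l" by (rule phi_disc_preimage)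
    have "Im l \<noteq> 0" using 1 l(3) by (auto simp: Im_phi)
    moreover have "Im (1 / l) > 0" if "Im l < 0"
    proof -
      have "Im (1 / l) = - Im l / (cmod l)\<^sup>2" by (simp add: Im_divide cmod_power2)
      also have "\<dots> > 0" using that l(1) by (intro divide_pos_pos) auto
      finally show ?thesis .
    qed
    ultimately consider "Im l > 0" | "Im (1 / l) > 0" by linarith
    then show ?thesis
    proof cases
      case 1 then show ?thesis using l(3) by (auto simp: upper_half_plane_def)
    next
      case 2
      then have "1 / l \<in> upper_half_plane" by (simp add: upper_half_plane_def)
      moreover have "z = phi (1 / l)" using l(3) phi_inverse by simp
      ultimately show ?thesis by blast
    qed
  next
    case 2
    define t where "t = arccos (- x / 2)"
    have t: "0 < t" "t < pi" using 2 arccos_lt_bounded[of "- x / 2"] by (auto simp: t_def)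
    have "cos t = - x / 2" unfolding t_def using 2 by (intro cos_arccos) auto
    moreover have im: "Im (cis t) > 0" using t by (simp add: sin_gt_zero)
    ultimately have "phi (cis t) = z" using phi_upper_circle(1)[of "cis t"] 2 by simp
    then show ?thesis using im by (auto simp: upper_half_plane_def)
  qed
qed (auto intro: phi_upper_half_plane)

text \<open>The Herglotz representation produces a measure on this compact set; the endpoints are
  removed later by \<open>positivity_no_endpoint_mass\<close>. For r = 1 it is {-1, 1}, while
  \<open>sigma_support\<close> is empty.\<close>

definition support_hull :: "real \<Rightarrow> real set" where
  "support_hull r = {- 1 / r..- r} \<union> {r..1 / r}"

section \<open>Real points under the conformal map\<close>

lemma support_hull_iff:
  assumes "0 < r" shows "t \<in> support_hull r \<longleftrightarrow> r \<le> \<bar>t\<bar> \<and> \<bar>t\<bar> \<le> 1 / r"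
proof -
  have "1 / r > 0" using assms by simp
  then show ?thesis using assms unfolding support_hull_def by (auto simp: abs_if)
qed

lemma sigma_support_iff:
  assumes "0 < r" shows "t \<in> sigma_support r \<longleftrightarrow> r < \<bar>t\<bar> \<and> \<bar>t\<bar> < 1 / r"
proof -
  have "1 / r > 0" using assms by simp
  then show ?thesis using assms unfolding sigma_support_def by (auto simp: abs_if)
qed

lemma compact_support_hull: "compact (support_hull r)"
  unfolding support_hull_def by (intro compact_Un) auto

text \<open>The difference of the two sides is (t - r) (t r - 1) / (t r).\<close>

lemma joukowski_real_le_iff:
  fixes r t :: real
  assumes "0 < r" "r \<le> 1" "t > 0"
  shows "t + 1 / t \<le> r + 1 / r \<longleftrightarrow> r \<le> t \<and> t \<le> 1 / r"
proof -
  have "t + 1 / t - (r + 1 / r) = (t - r) * (t * r - 1) / (t * r)"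
    using assms by (simp add: field_simps)
  then have "t + 1 / t \<le> r + 1 / r \<longleftrightarrow> (t - r) * (t * r - 1) / (t * r) \<le> 0" by linarith
  also have "\<dots> \<longleftrightarrow> (t - r) * (t * r - 1) \<le> 0"
    using assms by (subst pos_divide_le_eq) auto
  also have "\<dots> \<longleftrightarrow> r \<le> t \<and> t \<le> 1 / r"
  proof -
    have eq: "t * r - 1 \<le> 0 \<longleftrightarrow> t \<le> 1 / r" "t * r - 1 \<ge> 0 \<longleftrightarrow> t \<ge> 1 / r"
      using assms by (auto simp: field_simps)
    have "1 \<le> 1 / r" using assms by simp
    then show ?thesis unfolding mult_le_0_iff using eq assms(2) by auto
  qed
  finally show ?thesis .
qed

lemma phi_real_spectral_iff:
  assumes r: "0 < r" "r \<le> 1" "r + 1 / r = R" and t: "t \<noteq> 0"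
  shows "phi (of_real t) \<in> spectral_set R \<longleftrightarrow> t \<in> support_hull r"
proof -
  have "phi (of_real t) = of_real (- (t + 1 / t))" by (simp add: phi_def)
  then have "phi (of_real t) \<in> spectral_set R \<longleftrightarrow> - (t + 1 / t) \<in> {-R..R}"
    by (metis (no_types, lifting) image_iff of_real_eq_iff)
  also have "\<dots> \<longleftrightarrow> \<bar>t + 1 / t\<bar> \<le> R" by auto
  also have "\<bar>t + 1 / t\<bar> = \<bar>t\<bar> + 1 / \<bar>t\<bar>"
  proof (cases "t > 0")
    case True
    then have "1 / t > 0" by simp
    with True show ?thesis by simp
  next
    case False
    then have "t < 0" "1 / t < 0" using t by auto
    moreover from this have "t + 1 / t < 0" by linarith
    ultimately show ?thesis by (simp only: abs_of_neg)
  qed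
  finally show ?thesis
    using joukowski_real_le_iff[OF r(1,2), of "\<bar>t\<bar>"] t r by (simp add: support_hull_iff[OF r(1)])
qed

lemma phi_spectral_imp_real:
  assumes "phi l \<in> spectral_set R" "l \<noteq> 0" "cmod l \<noteq> 1"
  shows "l = of_real (Re l)"
proof -
  have "Im (phi l) = 0" using assms(1) by auto
  moreover have "(cmod l)\<^sup>2 \<noteq> 1" using assms(3) by (simp add: power2_eq_1_iff) (metis norm_ge_zero not_one_le_zero neg_0_le_iff_le one_neq_neg_one)
  ultimately have "Im l = 0" using assms(2) by (simp add: Im_phi field_simps)
  then show ?thesis by (simp add: complex_eq_iff)
qed

lemma phi_spectral_imp_hull:
  assumes r: "0 < r" "r \<le> 1" "r + 1 / r = R" and "phi l \<in> spectral_set R" "l \<noteq> 0" "cmod l \<noteq> 1"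
  shows "l \<in> of_real ` support_hull r"
proof -
  have l: "l = of_real (Re l)" by (rule phi_spectral_imp_real[OF assms(4-6)])
  then have "phi (of_real (Re l)) \<in> spectral_set R" "Re l \<noteq> 0" using assms(4,5) by auto
  then have "Re l \<in> support_hull r" using phi_real_spectral_iff[OF r] by blast
  then show ?thesis using l by blast
qed

text \<open>The preimage in the disc is real, and |E| > R pushes it below r. For 0 < |t| < 1 both E
  and t - 1 / t have the sign of -t; the sign statement turns inequalities for F(t) - F(1 / t) into
  the positivity condition.\<close>

lemma exists_real_phi_preimage:
  assumes r: "0 < r" "r \<le> 1" "r + 1 / r = R" and E: "\<bar>E\<bar> > R"
  obtains t where "t \<noteq> 0" "\<bar>t\<bar> < r" "phi (of_real t) = of_real E" "t + 1 / t = - E" "sgn (t - 1 / t) = sgn E"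
proof -
  have "1 / r \<ge> 1" using r by simp
  have R2: "R \<ge> 2" using r sum_squares_bound[of r 1] by (simp add: field_simps power2_eq_square flip: r(3))
  have "complex_of_real E \<notin> spectral_set 2" using E R2 by auto
  then obtain l where l: "l \<noteq> 0" "cmod l < 1" "of_real E = phi l" by (rule phi_disc_preimage)
  have "E \<in> {- \<bar>E\<bar>..\<bar>E\<bar>}" by auto
  then have "phi l \<in> spectral_set \<bar>E\<bar>" unfolding l(3)[symmetric] by (rule imageI)
  then have lr: "l = of_real (Re l)" by (rule phi_spectral_imp_real) (use l in auto)
  define t where "t = Re l"
  have t: "t \<noteq> 0" "phi (of_real t) = of_real E" "\<bar>t\<bar> < 1" using l lr by (auto simp: t_def) (metis norm_of_real)
  have "of_real E \<notin> spectral_set R" using E by auto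
  then have nh: "t \<notin> support_hull r" using phi_real_spectral_iff[OF r t(1)] t(2) by simp
  then have tr: "\<bar>t\<bar> < r" using t(3) \<open>1 / r \<ge> 1\<close> by (auto simp: support_hull_iff[OF r(1)])
  have "complex_of_real (- (t + 1 / t)) = of_real E" using t(2) by (simp add: phi_def)
  then have sum: "t + 1 / t = - E" by (metis minus_minus of_real_eq_iff)
  have sg: "sgn (t - 1 / t) = sgn E"
  proof (cases "t > 0")
    case True
    have "t * t < 1 * 1" using True t(3) by (intro mult_strict_mono) auto
    then have "t < 1 / t" using True by (simp add: pos_less_divide_eq)
    moreover have "1 / t > 0" using True by simp
    then have "E < 0" using True sum by linarith
    ultimately show ?thesis by simp
  next
    case False
    then have tn: "t < 0" using t(1) by simp
    have "1 < 1 / (- t)" using t(3) tn by (simp add: field_simps)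
    then have "1 / t < -1" by simp
    moreover have "t > -1" using t(3) by auto
    ultimately have "t - 1 / t > 0" "E > 0" using sum tn by linarith+
    then show ?thesis by simp
  qed
  show thesis by (rule that[OF t(1) tr t(2) sum sg])
qed

section \<open>Measures on the support\<close>

text \<open>A measure on the subspace is regarded as a measure on the whole line, where the lemmas
  on Cauchy transforms are stated; \<open>restrict_space\<close> leads back.\<close>

definition borel_extension :: "real measure \<Rightarrow> real measure" where
  "borel_extension \<sigma> = distr \<sigma> borel (\<lambda>t. t)"

lemma measurable_on_borel_subspace:
  assumes "finite_borel_measure_on S \<sigma>"
  shows "f \<in> borel \<rightarrow>\<^sub>M N \<Longrightarrow> f \<in> \<sigma> \<rightarrow>\<^sub>M N"
  using assms by (simp add: finite_borel_measure_on_def measurable_restrict_space1 cong: measurable_cong_sets)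

lemma space_borel_subspace: "finite_borel_measure_on S \<sigma> \<Longrightarrow> space \<sigma> = S"
  unfolding finite_borel_measure_on_def using sets_eq_imp_space_eq[of \<sigma> "restrict_space borel S"]
  by (simp add: space_restrict_space)

lemma borel_extension:
  assumes \<sigma>: "finite_borel_measure_on S \<sigma>" and S: "S \<in> sets borel"
  shows "finite_measure (borel_extension \<sigma>)" "sets (borel_extension \<sigma>) = sets borel" "AE t in borel_extension \<sigma>. t \<in> S"
proof -
  have id: "(\<lambda>t. t) \<in> \<sigma> \<rightarrow>\<^sub>M borel" by (rule measurable_on_borel_subspace[OF \<sigma>]) simp
  show "finite_measure (borel_extension \<sigma>)"
    unfolding borel_extension_def using \<sigma> by (intro finite_measure.finite_measure_distr id) (simp add: finite_borel_measure_on_def)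
  show "sets (borel_extension \<sigma>) = sets borel" by (simp add: borel_extension_def)
  show "AE t in borel_extension \<sigma>. t \<in> S"
    unfolding borel_extension_def using S by (subst AE_distr_iff[OF id]) (auto simp: space_borel_subspace[OF \<sigma>] intro!: AE_I2)
qed

lemma integral_borel_extension:
  fixes f :: "real \<Rightarrow> 'b::{banach, second_countable_topology}"
  assumes "finite_borel_measure_on S \<sigma>" and "f \<in> borel_measurable borel"
  shows "(\<integral>t. f t \<partial>borel_extension \<sigma>) = (\<integral>t. f t \<partial>\<sigma>)"
  unfolding borel_extension_def
  by (rule integral_distr[OF measurable_on_borel_subspace[OF assms(1)] assms(2)]) simp

lemma borel_extension_inj:
  assumes s: "finite_borel_measure_on S \<sigma>" and t: "finite_borel_measure_on S \<tau>" and S: "S \<in> sets borel"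
    and eq: "borel_extension \<sigma> = borel_extension \<tau>"
  shows "\<sigma> = \<tau>"
proof (rule measure_eqI)
  show "sets \<sigma> = sets \<tau>" using s t by (simp add: finite_borel_measure_on_def)
  fix A assume A: "A \<in> sets \<sigma>"
  then have "A \<in> sets (restrict_space borel S)" using s by (simp add: finite_borel_measure_on_def)
  then have AB: "A \<in> sets borel" "A \<subseteq> S" using S by (auto simp: sets_restrict_space_iff)
  have em: "emeasure (borel_extension \<rho>) A = emeasure \<rho> A" if \<rho>: "finite_borel_measure_on S \<rho>" for \<rho>
  proof -
    have "emeasure (borel_extension \<rho>) A = emeasure \<rho> ((\<lambda>t. t) -` A \<inter> space \<rho>)"
      unfolding borel_extension_def by (rule emeasure_distr[OF measurable_on_borel_subspace[OF \<rho>] AB(1)]) simp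
    also have "(\<lambda>t. t) -` A \<inter> space \<rho> = A" using AB(2) by (auto simp: space_borel_subspace[OF \<rho>])
    finally show ?thesis .
  qed
  show "emeasure \<sigma> A = emeasure \<tau> A" using em[OF s] em[OF t] eq by simp
qed

lemma restrict_measure:
  assumes "finite_measure \<mu>" "sets \<mu> = sets borel" and AE: "AE t in \<mu>. t \<in> S" and S: "S \<in> sets borel"
  shows "finite_borel_measure_on S (restrict_space \<mu> S)"
    and "\<And>f :: real \<Rightarrow> 'b::{banach, second_countable_topology}. f \<in> borel_measurable borel \<Longrightarrow>
           (\<integral>t. f t \<partial>restrict_space \<mu> S) = (\<integral>t. f t \<partial>\<mu>)"
proof -
  have Sm: "S \<inter> space \<mu> \<in> sets \<mu>" using S assms(2) by (simp add: sets_eq_imp_space_eq[OF assms(2)])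
  show "finite_borel_measure_on S (restrict_space \<mu> S)"
    unfolding finite_borel_measure_on_def
    using finite_measure_restrict_space[OF assms(1) Sm] sets_restrict_space_cong[OF assms(2)]
    by (simp add: sets_eq_imp_space_eq[OF assms(2)])
  fix f :: "real \<Rightarrow> 'b" assume f: "f \<in> borel_measurable borel"
  have "(\<integral>t. f t \<partial>restrict_space \<mu> S) = (\<integral>t. indicator S t *\<^sub>R f t \<partial>\<mu>)"
    by (rule integral_restrict_space[OF Sm])
  also have "\<dots> = (\<integral>t. f t \<partial>\<mu>)"
  proof (rule integral_cong_AE)
    show "f \<in> borel_measurable \<mu>" using f assms(2) by (simp cong: measurable_cong_sets)
    show "(\<lambda>t. indicator S t *\<^sub>R f t) \<in> borel_measurable \<mu>" using f S assms(2) by (simp cong: measurable_cong_sets)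
    show "AE t in \<mu>. indicator S t *\<^sub>R f t = f t" using AE by eventually_elim simp
  qed
  finally show "(\<integral>t. f t \<partial>restrict_space \<mu> S) = (\<integral>t. f t \<partial>\<mu>)" .
qed

lemma powi_int_measurable [measurable]: "(\<lambda>t::real. t powi n) \<in> borel_measurable borel"
  by (cases "n \<ge> 0") (auto simp: power_int_def)

text \<open>All three quantities depend on the measure only through integrals of Borel functions;
  this serves both the extension and the restriction.\<close>

lemma measure_functionals_eq:
  assumes r: "\<And>f :: real \<Rightarrow> real. f \<in> borel_measurable borel \<Longrightarrow> (\<integral>t. f t \<partial>\<sigma>) = (\<integral>t. f t \<partial>\<mu>)"
    and c: "\<And>f :: real \<Rightarrow> complex. f \<in> borel_measurable borel \<Longrightarrow> (\<integral>t. f t \<partial>\<sigma>) = (\<integral>t. f t \<partial>\<mu>)"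
  shows "moment \<sigma> = moment \<mu>" "F_of_measure \<sigma> = F_of_measure \<mu>" "positivity_condition R \<sigma> = positivity_condition R \<mu>"
proof -
  show m: "moment \<sigma> = moment \<mu>" unfolding moment_def fun_eq_iff by (intro allI r) measurable
  have "(\<integral>t. 1 / (of_real t - l) \<partial>\<sigma>) = (\<integral>t. 1 / (of_real t - l) \<partial>\<mu>)" for l :: complex by (rule c) measurable
  then show "F_of_measure \<sigma> = F_of_measure \<mu>" unfolding F_of_measure_def m by simp
  have "(\<integral>t. 1 / (t\<^sup>2 + E * t + 1) \<partial>\<sigma>) = (\<integral>t. 1 / (t\<^sup>2 + E * t + 1) \<partial>\<mu>)" for E :: real by (rule r) measurable
  then show "positivity_condition R \<sigma> = positivity_condition R \<mu>" unfolding positivity_condition_def m by simp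
qed

lemma borel_extension_functionals:
  assumes "finite_borel_measure_on S \<sigma>"
  shows "moment (borel_extension \<sigma>) = moment \<sigma>" "F_of_measure (borel_extension \<sigma>) = F_of_measure \<sigma>"
    "positivity_condition R (borel_extension \<sigma>) = positivity_condition R \<sigma>"
  by (rule measure_functionals_eq; rule integral_borel_extension[OF assms], assumption)+

lemma restrict_measure_functionals:
  assumes "finite_measure \<mu>" "sets \<mu> = sets borel" "AE t in \<mu>. t \<in> S" "S \<in> sets borel"
  shows "moment (restrict_space \<mu> S) = moment \<mu>" "F_of_measure (restrict_space \<mu> S) = F_of_measure \<mu>"
    "positivity_condition R (restrict_space \<mu> S) = positivity_condition R \<mu>"
  by (rule measure_functionals_eq; rule restrict_measure(2)[OF assms], assumption)+

section \<open>The quadratic kernel of the positivity condition\<close>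

lemma integral_real_to_complex:
  fixes f :: "real \<Rightarrow> real"
  shows "(\<integral>t. complex_of_real (f t) \<partial>\<mu>) = of_real (\<integral>t. f t \<partial>\<mu>)"
  by (rule integral_complex_of_real)

lemma quadratic_factor:
  fixes t s E :: real
  assumes "s \<noteq> 0" "s + 1 / s = - E"
  shows "(t - s) * (t - 1 / s) = t\<^sup>2 + E * t + 1"
proof -
  have "(t - s) * (t - 1 / s) = t\<^sup>2 - (s + 1 / s) * t + 1"
    using assms(1) by (simp add: field_simps power2_eq_square)
  then show ?thesis using assms(2) by simp
qed

text \<open>For \<open>\<phi>(s) = E\<close> the positivity condition compares \<open>F(s)\<close> with \<open>F(1/s)\<close>.\<close>

lemma F_difference:
  fixes \<mu> :: "real measure"
  assumes fin: "finite_measure \<mu>" and m: "sets \<mu> = sets borel" and K: "AE t in \<mu>. t \<in> support_hull r"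
    and r: "0 < r" "r \<le> 1" and s: "s \<noteq> 0" "\<bar>s\<bar> < r" "s + 1 / s = - E"
  shows "(\<integral>t. 1 / (complex_of_real t - of_real s) \<partial>\<mu>) - (\<integral>t. 1 / (complex_of_real t - of_real (1 / s)) \<partial>\<mu>)
      = of_real ((s - 1 / s) * (\<integral>t. 1 / (t\<^sup>2 + E * t + 1) \<partial>\<mu>))"
proof -
  have cl: "closed (support_hull r)" by (rule compact_imp_closed[OF compact_support_hull])
  have s1: "1 / \<bar>s\<bar> > 1 / r" using s r by (intro divide_strict_left_mono) auto
  have nh: "s \<notin> support_hull r" "1 / s \<notin> support_hull r"
    using s(2) s1 by (auto simp: support_hull_iff[OF r(1)])
  have "1 / (complex_of_real t - of_real s) - 1 / (complex_of_real t - of_real (1 / s)) = of_real ((s - 1 / s) * (1 / (t\<^sup>2 + E * t + 1)))"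
    if t: "t \<in> support_hull r" for t
  proof -
    have nz: "t - s \<noteq> 0" "t - 1 / s \<noteq> 0" using t nh by auto
    have "1 / (t - s) - 1 / (t - 1 / s) = (s - 1 / s) * (1 / ((t - s) * (t - 1 / s)))"
      using nz by (simp add: diff_frac_eq)
    also have "\<dots> = (s - 1 / s) * (1 / (t\<^sup>2 + E * t + 1))" unfolding quadratic_factor[OF s(1,3)] ..
    finally have "complex_of_real (1 / (t - s) - 1 / (t - 1 / s)) = of_real ((s - 1 / s) * (1 / (t\<^sup>2 + E * t + 1)))" by (rule arg_cong)
    then show ?thesis by (simp only: of_real_diff of_real_divide of_real_1)
  qed
  note pt = this
  have ik: "integrable \<mu> (\<lambda>t. 1 / (complex_of_real t - of_real x))" if "x \<notin> support_hull r" for x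
  proof -
    have "complex_of_real x \<notin> of_real ` support_hull r" using that by auto
    then obtain d where d: "d > 0" "\<And>t. t \<in> support_hull r \<Longrightarrow> d \<le> cmod (of_real t - of_real x)"
      using distance_to_closed_real[OF cl] by blast
    show ?thesis by (rule cauchy_kernel_integrable[OF fin m K d])
  qed
  have "(\<integral>t. 1 / (complex_of_real t - of_real s) \<partial>\<mu>) - (\<integral>t. 1 / (complex_of_real t - of_real (1 / s)) \<partial>\<mu>)
      = (\<integral>t. 1 / (complex_of_real t - of_real s) - 1 / (complex_of_real t - of_real (1 / s)) \<partial>\<mu>)"
    by (rule Bochner_Integration.integral_diff[symmetric, OF ik[OF nh(1)] ik[OF nh(2)]])
  moreover have "(\<integral>t. 1 / (complex_of_real t - of_real s) - 1 / (complex_of_real t - of_real (1 / s)) \<partial>\<mu>)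
      = (\<integral>t. complex_of_real ((s - 1 / s) * (1 / (t\<^sup>2 + E * t + 1))) \<partial>\<mu>)"
  proof (rule integral_cong_AE)
    show "(\<lambda>t. 1 / (complex_of_real t - of_real s) - 1 / (complex_of_real t - of_real (1 / s))) \<in> borel_measurable \<mu>"
      using m by (simp cong: measurable_cong_sets)
    show "(\<lambda>t. complex_of_real ((s - 1 / s) * (1 / (t\<^sup>2 + E * t + 1)))) \<in> borel_measurable \<mu>"
      using m by (simp cong: measurable_cong_sets)
    show "AE t in \<mu>. 1 / (complex_of_real t - of_real s) - 1 / (complex_of_real t - of_real (1 / s)) = of_real ((s - 1 / s) * (1 / (t\<^sup>2 + E * t + 1)))"
      using K by eventually_elim (rule pt)
  qed
  ultimately show ?thesis by (simp only: integral_real_to_complex integral_mult_right_zero)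
qed

lemma quadratic_kernel_integrable:
  fixes \<mu> :: "real measure"
  assumes fin: "finite_measure \<mu>" and m: "sets \<mu> = sets borel" and K: "AE t in \<mu>. t \<in> support_hull r"
    and r: "0 < r" "r \<le> 1" "r + 1 / r = R" and E: "\<bar>E\<bar> > R"
  shows "integrable \<mu> (\<lambda>t. 1 / (t\<^sup>2 + E * t + 1))"
proof -
  interpret finite_measure \<mu> by fact
  obtain s where s: "s \<noteq> 0" "\<bar>s\<bar> < r" "s + 1 / s = - E" using exists_real_phi_preimage[OF r E] by metis
  have cl: "closed (support_hull r)" by (rule compact_imp_closed[OF compact_support_hull])
  have s1: "1 / \<bar>s\<bar> > 1 / r" using s r by (intro divide_strict_left_mono) auto
  have nh: "complex_of_real s \<notin> of_real ` support_hull r" "complex_of_real (1 / s) \<notin> of_real ` support_hull r"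
    using s(2) s1 by (auto simp: support_hull_iff[OF r(1)] simp del: of_real_divide)
  obtain d where d: "d > 0" "\<And>t. t \<in> support_hull r \<Longrightarrow> d \<le> cmod (of_real t - of_real s)"
    using distance_to_closed_real[OF cl nh(1)] by blast
  obtain d' where d': "d' > 0" "\<And>t. t \<in> support_hull r \<Longrightarrow> d' \<le> cmod (of_real t - of_real (1 / s))"
    using distance_to_closed_real[OF cl nh(2)] by blast
  show ?thesis
  proof (rule integrable_const_bound[where B = "1 / (d * d')"])
    show "AE t in \<mu>. norm (1 / (t\<^sup>2 + E * t + 1)) \<le> 1 / (d * d')"
      using K
    proof eventually_elim
      case (elim t)
      have "d \<le> \<bar>t - s\<bar>" using d(2)[OF elim] by (metis norm_of_real of_real_diff)
      moreover have "d' \<le> \<bar>t - 1 / s\<bar>" using d'(2)[OF elim] by (metis norm_of_real of_real_diff)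
      ultimately have "d * d' \<le> \<bar>t - s\<bar> * \<bar>t - 1 / s\<bar>" using d(1) d'(1) by (intro mult_mono) auto
      then have "d * d' \<le> \<bar>t\<^sup>2 + E * t + 1\<bar>" unfolding quadratic_factor[OF s(1,3), symmetric] abs_mult .
      then show ?case using d(1) d'(1) by (simp add: frac_le)
    qed
  qed (use m in \<open>simp cong: measurable_cong_sets\<close>)
qed

text \<open>Let E approach the edge of [-R, R] whose preimage is \<open>t0\<close>. At
  \<open>t0\<close> the kernel is -1 / (e |t0|), elsewhere on the hull it is at most 1, so an atom
  at \<open>t0\<close> would drive the positive expression to minus infinity.\<close>

lemma positivity_no_endpoint_mass:
  fixes \<mu> :: "real measure"
  assumes fin: "finite_measure \<mu>" and m: "sets \<mu> = sets borel" and K: "AE t in \<mu>. t \<in> support_hull r"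
    and r: "0 < r" "r \<le> 1" "r + 1 / r = R"
    and pos: "\<And>E. \<bar>E\<bar> > R \<Longrightarrow> \<alpha> + (\<integral>t. 1 / (t\<^sup>2 + E * t + 1) \<partial>\<mu>) > 0"
    and t0: "\<bar>t0\<bar> = r \<or> \<bar>t0\<bar> = 1 / r"
  shows "measure \<mu> {t0} = 0"
proof (rule ccontr)
  assume nz: "measure \<mu> {t0} \<noteq> 0"
  interpret finite_measure \<mu> by fact
  define V where "V = measure \<mu> (space \<mu>)"
  define p where "p = measure \<mu> {t0}"
  have p: "p > 0" using nz by (simp add: p_def zero_less_measure_iff)
  have t0p: "\<bar>t0\<bar> > 0" "\<bar>t0\<bar> + 1 / \<bar>t0\<bar> = R" using t0 r by auto
  have ineq: "0 < \<alpha> + V - p / (e * \<bar>t0\<bar>)" if e: "e > 0" for e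
  proof -
    \<comment> \<open>The sign is opposite to that of \<open>t0\<close>: for t of the same sign as
      \<open>t0\<close> the quadratic is negative, for the other sign it is at least 1.\<close>
    define E where "E = - sgn t0 * (R + e)"
    have R0: "R > 0" using r by (metis add_pos_pos zero_less_divide_1_iff)
    have E: "\<bar>E\<bar> > R" using e R0 t0p(1) by (simp add: E_def abs_mult sgn_if)
    have pt: "1 / (t\<^sup>2 + E * t + 1) \<le> 1 - indicator {t0} t * (1 / (e * \<bar>t0\<bar>))" if t: "t \<in> support_hull r" for t
    proof -
      have tb: "\<bar>t\<bar> > 0" "\<bar>t\<bar> + 1 / \<bar>t\<bar> \<le> R"
        using t r joukowski_real_le_iff[OF r(1,2), of "\<bar>t\<bar>"] by (auto simp: support_hull_iff[OF r(1)])
      have id: "t\<^sup>2 + E * t + 1 = \<bar>t\<bar> * (\<bar>t\<bar> + 1 / \<bar>t\<bar> + E * sgn t)"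
      proof -
        have "\<bar>t\<bar> * (\<bar>t\<bar> + 1 / \<bar>t\<bar> + E * sgn t) = \<bar>t\<bar> * \<bar>t\<bar> + 1 + E * (\<bar>t\<bar> * sgn t)"
          using tb(1) by (simp add: distrib_left)
        then show ?thesis by (simp add: abs_mult_sgn power2_eq_square)
      qed
      show ?thesis
      proof (cases "t = t0")
        case True
        have "E * sgn t = - (R + e)" using True t0p(1) by (simp add: E_def sgn_if)
        then have "t\<^sup>2 + E * t + 1 = - (e * \<bar>t0\<bar>)" unfolding id using True t0p(2) by (simp add: mult.commute)
        then show ?thesis using True by simp
      next
        case False
        have "1 / (t\<^sup>2 + E * t + 1) \<le> 1"
        proof (cases "sgn t = sgn t0")
          case True
          then have "E * sgn t = - (R + e)" using t0p(1) by (simp add: E_def sgn_if split: if_splits)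
          then have "t\<^sup>2 + E * t + 1 < 0" unfolding id using tb e by (intro mult_pos_neg) auto
          then have "1 / (t\<^sup>2 + E * t + 1) < 0" by simp
          then show ?thesis by linarith
        next
          case False
          have "E * t \<ge> 0"
          proof (cases "t > 0")
            case True
            then have "E = R + e" using False t0p(1) by (simp add: E_def sgn_if split: if_splits)
            then show ?thesis using True R0 e by simp
          next
            case tn: False
            then have "E = - (R + e)" "t < 0" using False tb(1) t0p(1) by (auto simp: E_def sgn_if split: if_splits)
            then show ?thesis using R0 e by (simp add: mult_nonpos_nonpos)
          qed
          then have "1 \<le> t\<^sup>2 + E * t + 1" by (simp add: add_nonneg_nonneg)
          then show ?thesis by (simp add: divide_le_eq_1)
        qed
        then show ?thesis using False by simp
      qed
    qed
    have i1: "integrable \<mu> (\<lambda>t. 1 / (t\<^sup>2 + E * t + 1))"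
      by (rule quadratic_kernel_integrable[OF fin m K r E])
    have i2: "integrable \<mu> (\<lambda>t. indicator {t0} t * (1 / (e * \<bar>t0\<bar>)))"
      by (intro integrable_mult_left integrable_real_indicator) (auto simp: m less_top[symmetric])
    have "(\<integral>t. 1 / (t\<^sup>2 + E * t + 1) \<partial>\<mu>) \<le> (\<integral>t. 1 - indicator {t0} t * (1 / (e * \<bar>t0\<bar>)) \<partial>\<mu>)"
    proof (rule integral_mono_AE[OF i1])
      show "integrable \<mu> (\<lambda>t. 1 - indicator {t0} t * (1 / (e * \<bar>t0\<bar>)))" by (intro Bochner_Integration.integrable_diff i2) simp
      show "AE t in \<mu>. 1 / (t\<^sup>2 + E * t + 1) \<le> 1 - indicator {t0} t * (1 / (e * \<bar>t0\<bar>))"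
        using K by eventually_elim (rule pt)
    qed
    also have "\<dots> = (\<integral>t. 1 \<partial>\<mu>) - (\<integral>t. indicator {t0} t * (1 / (e * \<bar>t0\<bar>)) \<partial>\<mu>)"
      by (rule Bochner_Integration.integral_diff[OF _ i2]) simp
    also have "\<dots> = V - p / (e * \<bar>t0\<bar>)" using m by (simp add: V_def p_def)
    finally show ?thesis using pos[OF E] by linarith
  qed
  \<comment> \<open>The value e = p / (W |t0|) makes the atom contribute -W, which exceeds what
    \<alpha> + V can compensate.\<close>
  define W where "W = \<bar>\<alpha> + V\<bar> + 1"
  have W: "W > 0" "\<alpha> + V < W" by (auto simp: W_def)
  have "p / (p / (W * \<bar>t0\<bar>) * \<bar>t0\<bar>) = W" using p W t0p(1) by simp
  moreover have "p / (W * \<bar>t0\<bar>) > 0" using p W t0p(1) by simp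
  ultimately show False using ineq[of "p / (W * \<bar>t0\<bar>)"] W by simp
qed

section \<open>From Jacobi matrices to measures\<close>

lemma filterlim_uminus_complex_at_infinity:
  fixes f :: "'a \<Rightarrow> complex"
  shows "filterlim f at_infinity F \<Longrightarrow> filterlim (\<lambda>x. - f x) at_infinity F"
  by (simp add: filterlim_at_infinity_conv_norm_at_top)

lemma phi_at_0: "filterlim phi at_infinity (at 0)"
proof -
  have "filterlim (\<lambda>l::complex. - l + - inverse l) at_infinity (at 0)"
    by (intro tendsto_add_filterlim_at_infinity[OF tendsto_minus[OF tendsto_ident_at]]
        filterlim_uminus_complex_at_infinity[OF filterlim_inverse_at_infinity])
  then show ?thesis unfolding phi_def[abs_def] by (simp add: divide_inverse)
qed

lemma inverse_tendsto_0_at_infinity: "((\<lambda>l::complex. 1 / l) \<longlongrightarrow> 0) at_infinity"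
  by (rule tendsto_divide_0[OF tendsto_const filterlim_ident])

lemma phi_at_infinity: "filterlim phi at_infinity at_infinity"
proof -
  have "((\<lambda>l::complex. - (1 / l)) \<longlongrightarrow> - 0) at_infinity" by (intro tendsto_minus inverse_tendsto_0_at_infinity)
  then have "filterlim (\<lambda>l::complex. - (1 / l) + - l) at_infinity at_infinity"
    by (rule tendsto_add_filterlim_at_infinity) (rule filterlim_uminus_complex_at_infinity[OF filterlim_ident])
  then show ?thesis unfolding phi_def[abs_def] by (simp add: add.commute)
qed

lemma tendsto_0_at_infinity:
  fixes m :: "complex \<Rightarrow> complex"
  assumes "((\<lambda>z. z * m z) \<longlongrightarrow> c) at_infinity" shows "(m \<longlongrightarrow> 0) at_infinity"
proof -
  have "((\<lambda>z. (z * m z) * (1 / z)) \<longlongrightarrow> c * 0) at_infinity"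
    by (intro tendsto_mult assms inverse_tendsto_0_at_infinity)
  moreover have "\<forall>\<^sub>F z in at_infinity. (z * m z) * (1 / z) = m z"
    unfolding eventually_at_infinity by (intro exI[of _ 1]) auto
  ultimately show ?thesis using Lim_transform_eventually by fastforce
qed

lemma moment_simps:
  "moment \<mu> (-1) = (\<integral>t. 1 / t \<partial>\<mu>)" "moment \<mu> (-2) = (\<integral>t. 1 / t\<^sup>2 \<partial>\<mu>)"
  unfolding moment_def by (simp_all add: power_int_minus divide_inverse)

text \<open>F is assembled from M on the upper half plane, its mirror image below, and the continued
  half-line functions near 0 and infinity, until only the hull is left uncovered.\<close>

lemma class_has_measure:
  assumes J: "jacobi_matrix a b" and refl: "reflectionless_on a b {-2<..<2}" and norm: "jacobi_norm a b \<le> R"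
    and r: "0 < r" "r \<le> 1" "r + 1 / r = R"
  shows "\<exists>\<mu>. finite_measure \<mu> \<and> sets \<mu> = sets borel \<and> (AE t in \<mu>. t \<in> sigma_support r) \<and>
     positivity_condition R \<mu> \<and> is_F_function a b (F_of_measure \<mu>)"
proof -
  have r1: "1 / r \<ge> 1" using r by simp
  then have R0: "R \<ge> 0" using r by linarith
  have fb: "form_bounded a b R" by (rule form_bounded_mono[OF form_bounded_jacobi_norm[OF J] norm])
  obtain mp where mp: "half_line_m a b R mp" using half_line_m_exists[OF J fb R0] by blast
  obtain mr where mr: "half_line_m (reflect_a a) (reflect_b b) R mr"
    using half_line_m_exists[OF jacobi_matrix_reflect[OF J] form_bounded_reflect[OF fb] R0] by blast
  obtain M where M: "is_M_function a b M" using M_function_exists[OF J refl] by blast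
  have Mh: "M holomorphic_on Omega" and Mu: "\<And>z. z \<in> Omega \<Longrightarrow> Im (M z) > 0"
    using M by (auto simp: is_M_function_def upper_half_plane_def)
  have a: "a 0 > 0" "a (-1) > 0" using J by (simp_all add: jacobi_matrix_def)
  define A0 A1 where "A0 = complex_of_real ((a 0)\<^sup>2)" and "A1 = complex_of_real ((a (-1))\<^sup>2)"
  have A0: "A0 \<noteq> 0" using a by (simp add: A0_def)
  \<comment> \<open>The continuation of \<open>m_minus\<close> off [-R, R], obtained from
    \<open>m_minus_eq\<close>.\<close>
  define mm where "mm z = (z - of_real (b 0) + A1 * mr z) / A0" for z
  have mm_cnj: "mm (cnj z) = cnj (mm z)" if "z \<notin> spectral_set R" for z
    using half_line_mD(6)[OF mr that] by (simp add: mm_def A0_def A1_def)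
  have M1: "M z = mp z" if "Im z > 0" for z
    using M half_line_mD(2)[OF mp that] that by (simp add: is_M_function_def upper_half_plane_def)
  have M2: "M z = - mm z" if z: "Im z < 0" for z
  proof -
    have c: "Im (cnj z) > 0" using z by simp
    have "M z = - cnj (m_minus a b (cnj z))" using M z by (simp add: is_M_function_def lower_half_plane_def)
    also have "m_minus a b (cnj z) = mm (cnj z)"
      using m_plus_minus_herglotz(5)[OF J c] half_line_mD(2)[OF mr c] by (simp add: mm_def A0_def A1_def)
    also have "\<dots> = cnj (mm z)" by (rule mm_cnj) (use z in auto)
    finally show ?thesis by simp
  qed
  let ?K = "complex_of_real ` support_hull r"
  \<comment> \<open>On the real axis the half-line functions supply the values. The points 1 and -1,
    where inside and outside meet, belong to the hull.\<close>
  define F where "F l = (if Im l > 0 then M (phi l) else if Im l < 0 then cnj (M (phi (cnj l)))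
      else if l = 0 then 0 else if cmod l < 1 then mp (phi l) else - mm (phi l))" for l
  have FA: "F l = M (phi l)" if "Im l > 0" for l using that by (simp add: F_def)
  have FB: "F l = cnj (M (phi (cnj l)))" if "Im l < 0" for l using that by (simp add: F_def)
  have F0: "F 0 = 0" by (simp add: F_def)
  have FC: "F l = mp (phi l)" if l: "cmod l < 1" "l \<noteq> 0" "phi l \<notin> spectral_set R" for l
  proof -
    consider "Im l > 0" | "Im l < 0" | "Im l = 0" by linarith
    then show ?thesis
    proof cases
      case 1 then show ?thesis using FA M1[OF phi_upper_disc[OF 1 l(1)]] by simp
    next
      case 2
      then have "Im (phi (cnj l)) > 0" using phi_upper_disc[of "cnj l"] l by simp
      then have "F l = cnj (mp (cnj (phi l)))" using FB[OF 2] M1 phi_cnj by simp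
      then show ?thesis using half_line_mD(6)[OF mp l(3)] by simp
    qed (use l in \<open>simp add: F_def\<close>)
  qed
  have FD: "F l = - mm (phi l)" if l: "cmod l > 1" "phi l \<notin> spectral_set R" for l
  proof -
    consider "Im l > 0" | "Im l < 0" | "Im l = 0" by linarith
    then show ?thesis
    proof cases
      case 1 then show ?thesis using FA M2[OF phi_upper_outside[OF 1 l(1)]] by simp
    next
      case 2
      then have "Im (phi (cnj l)) < 0" using phi_upper_outside[of "cnj l"] l by simp
      then have "F l = cnj (- mm (cnj (phi l)))" using FB[OF 2] M2 phi_cnj by simp
      then show ?thesis using mm_cnj[OF l(2)] by simp
    next
      case 3
      moreover have "l \<noteq> 0" using l(1) by auto
      ultimately show ?thesis using l(1) by (simp add: F_def)
    qed
  qed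
  have inK: "r \<le> cmod l \<and> cmod l \<le> 1 / r" if "l \<in> ?K" for l
    using that by (auto simp: support_hull_iff[OF r(1)])
  have C_spec: "phi l \<notin> spectral_set R" if "l \<noteq> 0" "cmod l < r" for l
    using phi_spectral_imp_hull[OF r, of l] inK[of l] that r(2) by auto
  have D_spec: "phi l \<notin> spectral_set R" if "cmod l > 1 / r" for l
  proof -
    have "l \<noteq> 0" "cmod l \<noteq> 1" using that r1 r(1) by auto
    then show ?thesis using phi_spectral_imp_hull[OF r, of l] inK[of l] that by auto
  qed
  have mph: "mp holomorphic_on - spectral_set R" by (rule half_line_mD(1)[OF mp])
  have mmh: "mm holomorphic_on - spectral_set R"
    unfolding mm_def using A0 by (intro holomorphic_intros half_line_mD(1)[OF mr]) auto
  have hA: "F holomorphic_on upper_half_plane"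
  proof -
    have "(M \<circ> phi) holomorphic_on upper_half_plane"
      by (rule holomorphic_on_compose_gen[OF phi_holomorphic Mh])
         (auto intro: phi_upper_half_plane simp: upper_half_plane_def)
    then show ?thesis by (rule holomorphic_transform) (simp add: FA upper_half_plane_def)
  qed
  have opl: "open lower_half_plane"
    unfolding lower_half_plane_def by (rule open_halfspace_Im_lt)
  have hB: "F holomorphic_on lower_half_plane"
  proof -
    have "cnj ` lower_half_plane = upper_half_plane"
      by (auto simp: lower_half_plane_def upper_half_plane_def image_iff intro!: exI[of _ "cnj _"])
    then have "(cnj \<circ> F \<circ> cnj) holomorphic_on lower_half_plane"
      using hA by (intro holomorphic_on_compose_cnj_cnj opl) simp
    then show ?thesis by (rule holomorphic_transform) (simp add: FA FB lower_half_plane_def)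
  qed
  have hC: "F holomorphic_on ball 0 r"
  proof (rule no_isolated_singularity'[where K = "{0}"])
    have ph: "phi holomorphic_on ball 0 r - {0}" by (rule phi_holomorphic) simp
    have "(mp \<circ> phi) holomorphic_on ball 0 r - {0}"
      by (rule holomorphic_on_compose_gen[OF ph mph], rule image_subsetI, unfold Compl_iff, rule C_spec) auto
    then show "F holomorphic_on ball 0 r - {0}"
      by (rule holomorphic_transform) (use FC C_spec r in auto)
    have "((\<lambda>l. mp (phi l)) \<longlongrightarrow> 0) (at 0)"
      by (rule filterlim_compose[OF tendsto_0_at_infinity[OF half_line_mD(7)[OF mp]] phi_at_0])
    moreover have "\<forall>\<^sub>F l in at 0. mp (phi l) = F l"
      unfolding eventually_at using r FC C_spec by (intro exI[of _ r]) auto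
    ultimately have "(F \<longlongrightarrow> F 0) (at 0)" unfolding F0 by (rule Lim_transform_eventually)
    then show "(F \<longlongrightarrow> F z) (at z within ball 0 r)" if "z \<in> {0}" for z
      using that by (auto intro: tendsto_within_subset)
  qed auto
  have opD: "open (- cball (0::complex) (1 / r))" by (simp add: open_Compl)
  have hD: "F holomorphic_on - cball 0 (1 / r)"
  proof -
    have ph: "phi holomorphic_on - cball 0 (1 / r)" by (rule phi_holomorphic) (use r in simp)
    have "(mm \<circ> phi) holomorphic_on - cball 0 (1 / r)"
      by (rule holomorphic_on_compose_gen[OF ph mmh], rule image_subsetI, unfold Compl_iff, rule D_spec) auto
    then have "(\<lambda>l. - (mm \<circ> phi) l) holomorphic_on - cball 0 (1 / r)" by (rule holomorphic_on_minus)
    then show ?thesis by (rule holomorphic_transform) (use FD D_spec r1 in auto)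
  qed
  have hF: "F holomorphic_on - ?K"
  proof (rule holomorphic_on_subset)
    show "F holomorphic_on upper_half_plane \<union> lower_half_plane \<union> ball 0 r \<union> - cball 0 (1 / r)"
      by (intro holomorphic_on_Un hA hB hC hD open_Un opl opD upper_half_plane_facts open_ball)
    show "- ?K \<subseteq> upper_half_plane \<union> lower_half_plane \<union> ball 0 r \<union> - cball 0 (1 / r)"
    proof
      fix l assume l: "l \<in> - ?K"
      show "l \<in> upper_half_plane \<union> lower_half_plane \<union> ball 0 r \<union> - cball 0 (1 / r)"
      proof (cases "Im l = 0")
        case True
        then have lr: "l = of_real (Re l)" by (simp add: complex_eq_iff)
        then have "Re l \<notin> support_hull r" using l by (metis ComplD imageI)
        moreover have "cmod l = \<bar>Re l\<bar>" using lr by (metis norm_of_real)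
        ultimately have "cmod l < r \<or> cmod l > 1 / r" by (auto simp: support_hull_iff[OF r(1)])
        then show ?thesis by auto
      qed (auto simp: upper_half_plane_def lower_half_plane_def)
    qed
  qed
  have Fsym: "F (cnj l) = cnj (F l)" if l: "l \<notin> ?K" for l
  proof -
    consider "Im l > 0" | "Im l < 0" | "Im l = 0" by linarith
    then show ?thesis
    proof cases
      case 3
      then have lc: "cnj l = l" by (simp add: complex_eq_iff)
      then have pc: "cnj (phi l) = phi l" using phi_cnj[of l] by simp
      have lr: "l = of_real (Re l)" using 3 by (simp add: complex_eq_iff)
      then have nh: "Re l \<notin> support_hull r" using l by (metis imageI)
      have "cmod l = \<bar>Re l\<bar>" using lr by (metis norm_of_real)
      then have "cmod l < r \<or> cmod l > 1 / r" using nh by (auto simp: support_hull_iff[OF r(1)])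
      then consider "l = 0" | "l \<noteq> 0" "cmod l < r" | "cmod l > 1 / r" by blast
      then show ?thesis
      proof cases
        case 1 then show ?thesis by (simp add: F0)
      next
        case 2
        have "F l = mp (phi l)" using FC[of l] C_spec 2 r by auto
        then show ?thesis using half_line_mD(6)[OF mp C_spec[OF 2]] lc pc by simp
      next
        case 3
        have "F l = - mm (phi l)" using FD[of l] D_spec 3 r1 by auto
        then show ?thesis using mm_cnj[OF D_spec[OF 3]] lc pc by simp
      qed
    qed (simp_all add: FA FB)
  qed
  have Fpos: "Im (F l) \<ge> 0" if "Im l > 0" for l
    using Mu[OF phi_upper_half_plane[of l]] that by (simp add: FA upper_half_plane_def less_imp_le)
  \<comment> \<open>Near infinity F = - mm o phi, and - phi l = l + 1 / l, so the linear part has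
    slope 1 / (a 0)^2 and constant term b 0 / (a 0)^2.\<close>
  define \<alpha> \<beta> where "\<alpha> = 1 / (a 0)\<^sup>2" and "\<beta> = b 0 / (a 0)\<^sup>2"
  have Flim: "((\<lambda>l. F l - of_real \<alpha> * l - of_real \<beta>) \<longlongrightarrow> 0) at_infinity"
  proof -
    have "((\<lambda>l. (1 / l - A1 * mr (phi l)) / A0) \<longlongrightarrow> (0 - A1 * 0) / A0) at_infinity"
      by (intro tendsto_intros A0 inverse_tendsto_0_at_infinity filterlim_compose[OF tendsto_0_at_infinity[OF half_line_mD(7)[OF mr]] phi_at_infinity])
    moreover have "\<forall>\<^sub>F l in at_infinity. (1 / l - A1 * mr (phi l)) / A0 = F l - of_real \<alpha> * l - of_real \<beta>"
      unfolding eventually_at_infinity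
    proof (intro exI allI impI)
      fix l :: complex assume "1 / r + 1 \<le> cmod l"
      then have l: "cmod l > 1 / r" by linarith
      have "F l = - mm (phi l)" using FD[of l] D_spec[OF l] l r1 by auto
      also have "\<dots> = (l + 1 / l + of_real (b 0) - A1 * mr (phi l)) / A0"
        unfolding mm_def phi_def by (simp add: minus_divide_left)
      finally show "(1 / l - A1 * mr (phi l)) / A0 = F l - of_real \<alpha> * l - of_real \<beta>"
        using A0 by (simp add: \<alpha>_def \<beta>_def A0_def[symmetric] add_divide_distrib diff_divide_distrib flip: of_real_power)
    qed
    ultimately show ?thesis using Lim_transform_eventually by fastforce
  qed
  obtain \<mu> where \<mu>: "finite_measure \<mu>" "sets \<mu> = sets borel" "AE t in \<mu>. t \<in> support_hull r"
    and rep: "\<And>l. l \<notin> ?K \<Longrightarrow> F l = of_real \<alpha> * l + of_real \<beta> + (\<integral>t. 1 / (of_real t - l) \<partial>\<mu>)"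
    using herglotz_representation[OF compact_support_hull hF Fsym Fpos Flim] by blast
  have z0: "0 \<notin> ?K" using inK[of 0] r by auto
  \<comment> \<open>Evaluate the representation at 0, where F vanishes because m_plus tends to 0 at
    infinity.\<close>
  have m1: "\<beta> = - moment \<mu> (-1)"
  proof -
    have "0 = of_real \<beta> + (\<integral>t. 1 / complex_of_real t \<partial>\<mu>)" using rep[OF z0] F0 by simp
    also have "(\<integral>t. 1 / complex_of_real t \<partial>\<mu>) = of_real (\<integral>t. 1 / t \<partial>\<mu>)"
      using integral_real_to_complex[of \<mu> "\<lambda>t. 1 / t"] by simp
    finally have "complex_of_real (\<beta> + (\<integral>t. 1 / t \<partial>\<mu>)) = of_real 0" by simp
    then show ?thesis unfolding moment_simps of_real_eq_iff by linarith
  qed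
  \<comment> \<open>Compare F'(0) computed in two ways: z m_plus(z) tends to -1 and phi l * l =
    -(l^2 + 1) give F'(0) = 1, while the representation gives \<alpha> plus the moment.\<close>
  have m2: "\<alpha> = 1 - moment \<mu> (-2)"
  proof -
    have "((\<lambda>l. (phi l * mp (phi l)) / - (l\<^sup>2 + 1)) \<longlongrightarrow> (-1) / - (0\<^sup>2 + 1)) (at 0)"
      by (intro tendsto_intros filterlim_compose[OF half_line_mD(7)[OF mp] phi_at_0]) auto
    moreover have "\<forall>\<^sub>F l in at 0. (phi l * mp (phi l)) / - (l\<^sup>2 + 1) = (F l - F 0) / (l - 0)"
      unfolding eventually_at
    proof (intro exI[of _ r] conjI ballI impI r)
      fix l :: complex assume "l \<noteq> 0 \<and> dist l 0 < r"
      then have l: "l \<noteq> 0" "cmod l < r" by auto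
      have eq: "phi l * l = - (l\<^sup>2 + 1)" by (rule phi_mult[OF l(1)])
      have "phi l \<noteq> 0"
      proof
        assume "phi l = 0"
        then have "phi l = of_real 0" by simp
        moreover have "0 \<in> {-R..R}" using R0 by simp
        ultimately show False using C_spec[OF l] by blast
      qed
      then have "(phi l * mp (phi l)) / - (l\<^sup>2 + 1) = mp (phi l) / l"
        unfolding eq[symmetric] by (rule mult_divide_mult_cancel_left)
      then show "(phi l * mp (phi l)) / - (l\<^sup>2 + 1) = (F l - F 0) / (l - 0)"
        using FC[of l] C_spec[OF l] l r F0 by simp
    qed
    ultimately have "((\<lambda>l. (F l - F 0) / (l - 0)) \<longlongrightarrow> (-1) / - (0\<^sup>2 + 1)) (at 0)" by (rule Lim_transform_eventually)
    then have d1: "(F has_field_derivative 1) (at 0)" by (simp add: has_field_derivative_iff)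
    have "((\<lambda>l. of_real \<alpha> * l + of_real \<beta> + (\<integral>t. 1 / (of_real t - l) \<partial>\<mu>)) has_field_derivative
        (of_real \<alpha> * 1 + 0 + (\<integral>t. 1 / (complex_of_real t - 0)\<^sup>2 \<partial>\<mu>))) (at 0)"
      by (intro DERIV_add DERIV_cmult DERIV_ident DERIV_const
          cauchy_transform_derivative[OF \<mu> compact_imp_closed[OF compact_support_hull] z0])
    then have d2: "(F has_field_derivative (of_real \<alpha> * 1 + 0 + (\<integral>t. 1 / (complex_of_real t - 0)\<^sup>2 \<partial>\<mu>))) (at 0)"
    proof (rule has_field_derivative_transform_within_open[of _ _ _ "ball 0 r"])
      fix l :: complex assume "l \<in> ball 0 r"
      then have "l \<notin> ?K" using inK[of l] by auto
      then show "of_real \<alpha> * l + of_real \<beta> + (\<integral>t. 1 / (of_real t - l) \<partial>\<mu>) = F l" by (simp add: rep)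
    qed (use r in auto)
    have "(\<integral>t. 1 / (complex_of_real t - 0)\<^sup>2 \<partial>\<mu>) = of_real (\<integral>t. 1 / t\<^sup>2 \<partial>\<mu>)"
      using integral_real_to_complex[of \<mu> "\<lambda>t. 1 / t\<^sup>2"] by simp
    then have "complex_of_real (\<alpha> + (\<integral>t. 1 / t\<^sup>2 \<partial>\<mu>)) = of_real 1" using DERIV_unique[OF d1 d2] by simp
    then show ?thesis unfolding moment_simps of_real_eq_iff by linarith
  qed
  have Feq: "F_of_measure \<mu> l = F l" if "l \<notin> ?K" for l
    using rep[OF that] by (simp add: F_of_measure_def m1 m2[symmetric])
  \<comment> \<open>At the preimages s and 1 / s of E, F takes the values mp(E) and -mm(E). Their
    difference is (s - 1 / s) times the expression in question, and (a 0)^2 times it is the quantity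
    of \<open>half_line_m_pair_positive\<close>.\<close>
  have pos: "positivity_condition R \<mu>"
    unfolding positivity_condition_def m2[symmetric]
  proof (intro allI impI)
    fix E assume E: "\<bar>E\<bar> > R"
    obtain s where s: "s \<noteq> 0" "\<bar>s\<bar> < r" "phi (of_real s) = of_real E" "s + 1 / s = - E" "sgn (s - 1 / s) = sgn E"
      using exists_real_phi_preimage[OF r E] by blast
    let ?I = "\<integral>t. 1 / (t\<^sup>2 + E * t + 1) \<partial>\<mu>"
    have s1: "1 / \<bar>s\<bar> > 1 / r" using s r by (intro divide_strict_left_mono) auto
    have cs: "cmod (of_real s) < r" "cmod (of_real (1 / s)) > 1 / r" using s(2) s1 by (simp_all del: of_real_divide)
    have Fs: "F (of_real s) = mp (of_real E)"
      using FC[of "of_real s"] C_spec[of "of_real s"] s cs r by auto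
    have ps: "phi (of_real (1 / s)) = of_real E" using s(3) phi_inverse[of "of_real s"] by simp
    have Fs1: "F (of_real (1 / s)) = - mm (of_real E)"
      using FD[of "of_real (1 / s)"] D_spec[OF cs(2)] cs(2) r1 unfolding ps by linarith
    have "F (of_real s) - F (of_real (1 / s)) = of_real \<alpha> * (of_real s - of_real (1 / s)) +
        ((\<integral>t. 1 / (complex_of_real t - of_real s) \<partial>\<mu>) - (\<integral>t. 1 / (complex_of_real t - of_real (1 / s)) \<partial>\<mu>))"
    proof -
      have "of_real s \<notin> ?K" "of_real (1 / s) \<notin> ?K" using inK cs by (meson not_less)+
      then show ?thesis by (simp add: rep algebra_simps del: of_real_divide)
    qed
    also have "\<dots> = of_real ((s - 1 / s) * (\<alpha> + ?I))"
      unfolding F_difference[OF \<mu> r(1,2) s(1,2,4)]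
      by (simp only: of_real_mult of_real_add of_real_diff distrib_left mult.commute[of "complex_of_real \<alpha>"])
    finally have diff: "mp (of_real E) + mm (of_real E) = of_real ((s - 1 / s) * (\<alpha> + ?I))"
      unfolding Fs Fs1 by simp
    have "A0 * mp (of_real E) + A1 * mr (of_real E) + of_real E - of_real (b 0) = A0 * (mp (of_real E) + mm (of_real E))"
    proof -
      have "A0 * mm (of_real E) = of_real E - of_real (b 0) + A1 * mr (of_real E)" using A0 by (simp add: mm_def)
      then show ?thesis by (simp add: distrib_left)
    qed
    also have "\<dots> = of_real ((a 0)\<^sup>2 * ((s - 1 / s) * (\<alpha> + ?I)))" unfolding diff A0_def by simp
    finally have "Re (A0 * mp (of_real E) + A1 * mr (of_real E) + of_real E - of_real (b 0)) = (a 0)\<^sup>2 * ((s - 1 / s) * (\<alpha> + ?I))"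
      by (simp only: Re_complex_of_real)
    then have "sgn E * ((a 0)\<^sup>2 * ((s - 1 / s) * (\<alpha> + ?I))) > 0"
      using half_line_m_pair_positive[OF J fb R0 mp mr E] by (simp add: A0_def A1_def)
    moreover have "sgn E * ((a 0)\<^sup>2 * ((s - 1 / s) * (\<alpha> + ?I))) = (a 0)\<^sup>2 * \<bar>s - 1 / s\<bar> * (\<alpha> + ?I)"
      unfolding s(5)[symmetric] by (simp add: abs_sgn mult_ac)
    moreover have "(a 0)\<^sup>2 * \<bar>s - 1 / s\<bar> \<ge> 0" by simp
    ultimately show "\<alpha> + ?I > 0" by (simp only: zero_less_mult_iff) linarith
  qed
  have "AE t in \<mu>. t \<in> sigma_support r"
  proof -
    have pos': "\<alpha> + (\<integral>t. 1 / (t\<^sup>2 + E * t + 1) \<partial>\<mu>) > 0" if "\<bar>E\<bar> > R" for E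
      using pos that unfolding positivity_condition_def m2[symmetric] by blast
    have AEne: "AE t in \<mu>. t \<noteq> t0" if "\<bar>t0\<bar> = r \<or> \<bar>t0\<bar> = 1 / r" for t0
    proof (rule AE_I)
      show "emeasure \<mu> {t0} = 0"
        using positivity_no_endpoint_mass[OF \<mu> r pos' that] finite_measure.emeasure_eq_measure[OF \<mu>(1), of "{t0}"] by simp
    qed (auto simp: \<mu>(2))
    have "AE t in \<mu>. t \<noteq> r" "AE t in \<mu>. t \<noteq> - r" "AE t in \<mu>. t \<noteq> 1 / r" "AE t in \<mu>. t \<noteq> - (1 / r)"
      using r by (auto intro!: AEne)
    then show ?thesis
      using \<mu>(3)
    proof eventually_elim
      case (elim t)
      then have "\<bar>t\<bar> \<noteq> r" "\<bar>t\<bar> \<noteq> 1 / r" by (auto simp: abs_if split: if_splits)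
      then show ?case using elim by (auto simp: support_hull_iff[OF r(1)] sigma_support_iff[OF r(1)])
    qed
  qed
  moreover have "is_F_function a b (F_of_measure \<mu>)"
    unfolding is_F_function_def
  proof (intro conjI J refl exI[of _ M] M ballI)
    fix l assume "l \<in> upper_half_plane"
    then have l: "Im l > 0" by (simp add: upper_half_plane_def)
    then have "l \<notin> ?K" by auto
    then show "F_of_measure \<mu> l = M (phi l)" using Feq FA[OF l] by simp
  qed
  ultimately show ?thesis using \<mu> pos by blast
qed

section \<open>Continued fractions\<close>

text \<open>The second clause excludes finitely supported measures, whose transforms have no nonreal
  limit at 0. It is inherited under stripping, so the continued fraction never terminates.\<close>

definition stieltjes :: "real \<Rightarrow> (complex \<Rightarrow> complex) \<Rightarrow> bool" where
  "stieltjes R m \<longleftrightarrow>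
     (\<exists>\<rho>. finite_measure \<rho> \<and> sets \<rho> = sets borel \<and> (AE t in \<rho>. t \<in> {-R..R}) \<and> measure \<rho> (space \<rho>) = 1 \<and>
        (\<forall>z. z \<notin> spectral_set R \<longrightarrow> m z = (\<integral>t. 1 / (of_real t - z) \<partial>\<rho>))) \<and>
     (\<exists>w. Im w > 0 \<and> (m \<longlongrightarrow> w) (at 0 within upper_half_plane))"

section \<open>Expansion of Cauchy transforms at infinity\<close>

lemma power_cauchy_transform_at_infinity:
  fixes \<mu> :: "real measure"
  assumes fin: "finite_measure \<mu>" and m[measurable_cong]: "sets \<mu> = sets borel" and K: "AE t in \<mu>. t \<in> {-R..R}" and R: "R \<ge> 0"
  shows "((\<lambda>z::complex. \<integral>t. of_real (t ^ n) / (of_real t - z) \<partial>\<mu>) \<longlongrightarrow> 0) at_infinity"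
    and "\<And>z. cmod z > R \<Longrightarrow> integrable \<mu> (\<lambda>t. of_real (t ^ n) / (of_real t - z))"
    and "integrable \<mu> (\<lambda>t. t ^ n)"
proof -
  interpret finite_measure \<mu> by fact
  have b: "AE t in \<mu>. norm (complex_of_real (t ^ n) / (of_real t - z)) \<le> R ^ n / (cmod z - R)" if z: "cmod z > R" for z
    using K
  proof eventually_elim
    case (elim t)
    have t: "\<bar>t\<bar> \<le> R" using elim by auto
    have "cmod z - R \<le> cmod (of_real t - z)"
      using norm_triangle_ineq2[of z "of_real t"] t by (simp add: norm_minus_commute)
    moreover have "\<bar>t ^ n\<bar> \<le> R ^ n" using t by (simp add: power_abs power_mono)
    ultimately show ?case using z R by (simp add: norm_divide frac_le del: of_real_power)
  qed
  show i: "integrable \<mu> (\<lambda>t. complex_of_real (t ^ n) / (of_real t - z))" if z: "cmod z > R" for z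
    by (rule integrable_const_bound[OF b[OF z]]) measurable
  have "AE t in \<mu>. norm (t ^ n) \<le> R ^ n"
    using K by eventually_elim (auto simp: power_abs abs_le_iff intro!: power_mono)
  then show "integrable \<mu> (\<lambda>t. t ^ n)" by (rule integrable_const_bound) measurable
  show "((\<lambda>z::complex. \<integral>t. of_real (t ^ n) / (of_real t - z) \<partial>\<mu>) \<longlongrightarrow> 0) at_infinity"
  proof (rule Lim_null_comparison)
    show "\<forall>\<^sub>F z in at_infinity. norm (\<integral>t. of_real (t ^ n) / (of_real t - z) \<partial>\<mu>) \<le> (R ^ n * measure \<mu> (space \<mu>)) / (cmod z - R)"
      unfolding eventually_at_infinity
    proof (intro exI allI impI)
      fix z :: complex assume "R + 1 \<le> cmod z"
      then have z: "cmod z > R" by linarith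
      have "norm (\<integral>t. complex_of_real (t ^ n) / (of_real t - z) \<partial>\<mu>) \<le> (\<integral>t. norm (complex_of_real (t ^ n) / (of_real t - z)) \<partial>\<mu>)"
        by (rule integral_norm_bound)
      also have "\<dots> \<le> (\<integral>t. R ^ n / (cmod z - R) \<partial>\<mu>)"
        by (rule integral_mono_AE[OF integrable_norm[OF i[OF z]] _ b[OF z]]) simp
      finally show "norm (\<integral>t. complex_of_real (t ^ n) / (of_real t - z) \<partial>\<mu>) \<le> (R ^ n * measure \<mu> (space \<mu>)) / (cmod z - R)"
        by (simp add: mult.commute)
    qed
    have "filterlim (\<lambda>z::complex. - R + cmod z) at_top at_infinity"
      by (rule filterlim_tendsto_add_at_top[OF tendsto_const filterlim_norm_at_top])
    then have "filterlim (\<lambda>z::complex. cmod z - R) at_infinity at_infinity"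
      by (intro filterlim_at_top_imp_at_infinity) simp
    then show "((\<lambda>z::complex. (R ^ n * measure \<mu> (space \<mu>)) / (cmod z - R)) \<longlongrightarrow> 0) at_infinity"
      by (rule tendsto_divide_0[OF tendsto_const])
  qed
qed

lemma power_cauchy_transform_step:
  fixes \<mu> :: "real measure"
  assumes \<mu>: "finite_measure \<mu>" "sets \<mu> = sets borel" "AE t in \<mu>. t \<in> {-R..R}" "R \<ge> 0" and z: "cmod z > R"
  shows "(\<integral>t. of_real (t ^ Suc n) / (of_real t - z) \<partial>\<mu>) = of_real (\<integral>t. t ^ n \<partial>\<mu>) + z * (\<integral>t. of_real (t ^ n) / (of_real t - z) \<partial>\<mu>)"
proof -
  note I = power_cauchy_transform_at_infinity[OF \<mu>]
  have i1: "integrable \<mu> (\<lambda>t. complex_of_real (t ^ n))" by (rule integrable_of_real[OF I(3)])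
  have i2: "integrable \<mu> (\<lambda>t. z * (of_real (t ^ n) / (of_real t - z)))" by (rule integrable_mult_right[OF I(2)[OF z]])
  have "(\<integral>t. of_real (t ^ Suc n) / (of_real t - z) \<partial>\<mu>) = (\<integral>t. of_real (t ^ n) + z * (of_real (t ^ n) / (of_real t - z)) \<partial>\<mu>)"
  proof (rule integral_cong_AE)
    show "AE t in \<mu>. of_real (t ^ Suc n) / (of_real t - z) = of_real (t ^ n) + z * (of_real (t ^ n) / (of_real t - z))"
      using \<mu>(3)
    proof eventually_elim
      case (elim t)
      then have "complex_of_real t \<noteq> z" using z by auto
      then have nz: "complex_of_real t - z \<noteq> 0" by simp
      have "T * P / D = P + I * (P / D)" if "D \<noteq> 0" "T - I = D" for T P D I :: complex
        using that by (auto simp: field_simps)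
      from this[OF nz refl] show ?case by simp
    qed
  qed (use \<mu>(2) in \<open>simp_all cong: measurable_cong_sets\<close>)
  also have "\<dots> = of_real (\<integral>t. t ^ n \<partial>\<mu>) + z * (\<integral>t. of_real (t ^ n) / (of_real t - z) \<partial>\<mu>)"
    by (simp only: Bochner_Integration.integral_add[OF i1 i2] integral_mult_right_zero integral_complex_of_real)
  finally show ?thesis .
qed

text \<open>Two terms of the expansion, with the mass and the first moment, are what one stripping
  step consumes.\<close>

lemma cauchy_transform_asymptotics:
  fixes \<mu> :: "real measure"
  assumes \<mu>: "finite_measure \<mu>" "sets \<mu> = sets borel" "AE t in \<mu>. t \<in> {-R..R}" "R \<ge> 0"
  defines "C \<equiv> \<lambda>z::complex. \<integral>t. 1 / (of_real t - z) \<partial>\<mu>"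
  shows "((\<lambda>z. z * C z) \<longlongrightarrow> - of_real (measure \<mu> (space \<mu>))) at_infinity"
    and "((\<lambda>z. z * (z * C z + of_real (measure \<mu> (space \<mu>)))) \<longlongrightarrow> - of_real (\<integral>t. t \<partial>\<mu>)) at_infinity"
proof -
  let ?V = "measure \<mu> (space \<mu>)"
  let ?A = "\<lambda>n (z::complex). \<integral>t. complex_of_real (t ^ n) / (of_real t - z) \<partial>\<mu>"
  have ev: "\<forall>\<^sub>F z in at_infinity. cmod z > R"
    unfolding eventually_at_infinity by (intro exI[of _ "R + 1"]) auto
  have 1: "?A 1 z = of_real ?V + z * C z" if "cmod z > R" for z
    using power_cauchy_transform_step[OF \<mu> that, of 0] by (simp add: C_def)
  have 2: "?A 2 z = of_real (\<integral>t. t \<partial>\<mu>) + z * ?A 1 z" if "cmod z > R" for z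
    using power_cauchy_transform_step[OF \<mu> that, of 1] by (simp add: numeral_2_eq_2)
  have "((\<lambda>z. ?A 1 z - of_real ?V) \<longlongrightarrow> 0 - of_real ?V) at_infinity"
    by (intro tendsto_diff tendsto_const power_cauchy_transform_at_infinity(1)[OF \<mu>])
  moreover have "\<forall>\<^sub>F z in at_infinity. ?A 1 z - of_real ?V = z * C z"
    using ev by eventually_elim (subst 1, simp_all)
  ultimately have "((\<lambda>z. z * C z) \<longlongrightarrow> 0 - of_real ?V) at_infinity" by (rule Lim_transform_eventually)
  then show "((\<lambda>z. z * C z) \<longlongrightarrow> - of_real ?V) at_infinity" by simp
  have "((\<lambda>z. ?A 2 z - of_real (\<integral>t. t \<partial>\<mu>)) \<longlongrightarrow> 0 - of_real (\<integral>t. t \<partial>\<mu>)) at_infinity"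
    by (intro tendsto_diff tendsto_const power_cauchy_transform_at_infinity(1)[OF \<mu>])
  moreover have "\<forall>\<^sub>F z in at_infinity. ?A 2 z - of_real (\<integral>t. t \<partial>\<mu>) = z * (z * C z + of_real ?V)"
    using ev by eventually_elim (subst 2, assumption, subst 1, assumption, simp add: add.commute)
  ultimately have "((\<lambda>z. z * (z * C z + of_real ?V)) \<longlongrightarrow> 0 - of_real (\<integral>t. t \<partial>\<mu>)) at_infinity" by (rule Lim_transform_eventually)
  then show "((\<lambda>z. z * (z * C z + of_real ?V)) \<longlongrightarrow> - of_real (\<integral>t. t \<partial>\<mu>)) at_infinity" by simp
qed

lemma cauchy_transform_cnj:
  "(\<integral>t. 1 / (complex_of_real t - cnj z) \<partial>\<mu>) = cnj (\<integral>t. 1 / (complex_of_real t - z) \<partial>\<mu>)"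
  using Bochner_Integration.integral_cnj[of \<mu> "\<lambda>t. 1 / (complex_of_real t - z)"] by simp

lemma cauchy_transform_Im_nonneg:
  fixes \<mu> :: "real measure"
  assumes \<mu>: "finite_measure \<mu>" "sets \<mu> = sets borel" and z: "Im z > 0"
  shows "Im (\<integral>t. 1 / (complex_of_real t - z) \<partial>\<mu>) \<ge> 0"
proof -
  define x y where "x = Re z" and "y = Im z"
  have zxy: "z = Complex x y" by (simp add: x_def y_def)
  have "z \<notin> complex_of_real ` UNIV" using z by auto
  then obtain d where d: "d > 0" "\<And>t. t \<in> UNIV \<Longrightarrow> d \<le> cmod (of_real t - z)"
    using distance_to_closed_real[OF closed_UNIV] by blast
  have i: "integrable \<mu> (\<lambda>t. 1 / (complex_of_real t - Complex x y))"
    using cauchy_kernel_integrable[OF \<mu> AE_I2[OF UNIV_I] d] unfolding zxy by simp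
  have "Im (\<integral>t. 1 / (of_real t - z) \<partial>\<mu>) = (\<integral>t. y / ((t - x)\<^sup>2 + y\<^sup>2) \<partial>\<mu>)"
    using integral_Im[OF i] unfolding zxy by (simp only: Im_cauchy_kernel)
  also have "\<dots> \<ge> 0" using z by (intro integral_nonneg_AE AE_I2) (simp add: y_def)
  finally show ?thesis .
qed

lemma spectral_kernel_integrable:
  fixes \<mu> :: "real measure"
  assumes "finite_measure \<mu>" "sets \<mu> = sets borel" "AE t in \<mu>. t \<in> {-R..R}" "z \<notin> spectral_set R"
  shows "integrable \<mu> (\<lambda>t. 1 / (complex_of_real t - z))"
proof -
  obtain d where d: "d > 0" "\<And>t. t \<in> {-R..R} \<Longrightarrow> d \<le> cmod (of_real t - z)"
    using distance_to_closed_real[OF closed_atLeastAtMost assms(4)] by blast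
  show ?thesis by (rule cauchy_kernel_integrable[OF assms(1,2,3) d])
qed

lemma stieltjes_properties:
  assumes st: "stieltjes R m" and R: "R > 0"
  shows "m holomorphic_on - spectral_set R"
    and "\<And>z. z \<notin> spectral_set R \<Longrightarrow> m (cnj z) = cnj (m z)"
    and "\<And>z. Im z > 0 \<Longrightarrow> Im (m z) > 0"
    and "\<And>E. \<bar>E\<bar> > R \<Longrightarrow> m (of_real E) = of_real (Re (m (of_real E))) \<and> sgn E * Re (m (of_real E)) < 0"
    and "\<And>z. z \<notin> spectral_set R \<Longrightarrow> m z \<noteq> 0"
proof -
  obtain \<rho> where \<rho>: "finite_measure \<rho>" "sets \<rho> = sets borel" "AE t in \<rho>. t \<in> {-R..R}" and one: "measure \<rho> (space \<rho>) = 1"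
    and m: "\<And>z. z \<notin> spectral_set R \<Longrightarrow> m z = (\<integral>t. 1 / (of_real t - z) \<partial>\<rho>)"
    using st by (auto simp: stieltjes_def)
  interpret finite_measure \<rho> by fact
  show "m holomorphic_on - spectral_set R"
    by (rule holomorphic_transform[OF cauchy_transform_holomorphic[OF \<rho> closed_atLeastAtMost]]) (simp add: m)
  show "m (cnj z) = cnj (m z)" if "z \<notin> spectral_set R" for z
  proof -
    have "cnj z \<notin> spectral_set R" using that by (auto simp: image_iff complex_eq_iff)
    then show ?thesis using m that cauchy_transform_cnj by simp
  qed
  show im: "Im (m z) > 0" if z: "Im z > 0" for z
  proof -
    have zs: "z \<notin> spectral_set R" using z by auto
    define x y where "x = Re z" and "y = Im z"
    have zxy: "z = Complex x y" by (simp add: x_def y_def)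
    have y: "y > 0" using z by (simp add: y_def)
    have i: "integrable \<rho> (\<lambda>t. 1 / (complex_of_real t - Complex x y))"
      using spectral_kernel_integrable[OF \<rho> zs] zxy by simp
    have "Im (m z) = (\<integral>t. Im (1 / (complex_of_real t - Complex x y)) \<partial>\<rho>)"
      unfolding m[OF zs] using integral_Im[OF i] zxy by simp
    also have "\<dots> = (\<integral>t. y / ((t - x)\<^sup>2 + y\<^sup>2) \<partial>\<rho>)" by (simp only: Im_cauchy_kernel)
    also have "\<dots> \<ge> (\<integral>t. y / ((R + \<bar>x\<bar>)\<^sup>2 + y\<^sup>2) \<partial>\<rho>)"
    proof (rule integral_mono_AE)
      show "integrable \<rho> (\<lambda>t. y / ((t - x)\<^sup>2 + y\<^sup>2))" using integrable_Im[OF i] by (simp only: Im_cauchy_kernel)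
      show "AE t in \<rho>. y / ((R + \<bar>x\<bar>)\<^sup>2 + y\<^sup>2) \<le> y / ((t - x)\<^sup>2 + y\<^sup>2)"
        using \<rho>(3)
      proof eventually_elim
        case (elim t)
        then have "\<bar>t - x\<bar> \<le> R + \<bar>x\<bar>" by auto
        then have "(t - x)\<^sup>2 \<le> (R + \<bar>x\<bar>)\<^sup>2" by (rule power2_le_iff_abs_le[THEN iffD2, rotated]) (use R in simp)
        then show ?case using y by (intro divide_left_mono add_right_mono mult_pos_pos add_nonneg_pos) auto
      qed
    qed simp
    finally have "(\<integral>t. y / ((R + \<bar>x\<bar>)\<^sup>2 + y\<^sup>2) \<partial>\<rho>) \<le> Im (m z)" .
    moreover have "(\<integral>t. y / ((R + \<bar>x\<bar>)\<^sup>2 + y\<^sup>2) \<partial>\<rho>) = y / ((R + \<bar>x\<bar>)\<^sup>2 + y\<^sup>2)" using one by simp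
    moreover have "y / ((R + \<bar>x\<bar>)\<^sup>2 + y\<^sup>2) > 0" using y by (intro divide_pos_pos add_nonneg_pos) auto
    ultimately show ?thesis by linarith
  qed
  show real: "m (of_real E) = of_real (Re (m (of_real E))) \<and> sgn E * Re (m (of_real E)) < 0" if E: "\<bar>E\<bar> > R" for E
  proof -
    have zs: "complex_of_real E \<notin> spectral_set R" using E by auto
    have ker: "(\<lambda>t. 1 / (complex_of_real t - of_real E)) = (\<lambda>t. complex_of_real (1 / (t - E)))" by simp
    then have eq: "m (of_real E) = of_real (\<integral>t. 1 / (t - E) \<partial>\<rho>)" unfolding m[OF zs] by (simp only: integral_complex_of_real)
    have i: "integrable \<rho> (\<lambda>t. 1 / (t - E))"
      using integrable_Re[OF spectral_kernel_integrable[OF \<rho> zs, unfolded ker]]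
      by (simp only: Re_complex_of_real)
    have "(\<integral>t. sgn E * (1 / (t - E)) \<partial>\<rho>) \<le> (\<integral>t. - 1 / (\<bar>E\<bar> + R) \<partial>\<rho>)"
    proof (rule integral_mono_AE)
      show "integrable \<rho> (\<lambda>t. sgn E * (1 / (t - E)))" by (rule integrable_mult_right[OF i])
      show "AE t in \<rho>. sgn E * (1 / (t - E)) \<le> - 1 / (\<bar>E\<bar> + R)"
        using \<rho>(3)
      proof eventually_elim
        case (elim t)
        show ?case
        proof (cases "E > 0")
          case True
          then have p: "E - t > 0" "E - t \<le> E + R" using elim E by auto
          have "sgn E * (1 / (t - E)) = - (1 / (E - t))" using True p(1) by (simp add: divide_simps)
          also have "\<dots> \<le> - (1 / (E + R))" using p by (intro le_imp_neg_le divide_left_mono) auto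
          finally show ?thesis using True by simp
        next
          case False
          then have p: "t - E > 0" "t - E \<le> - E + R" using elim E by auto
          have "sgn E * (1 / (t - E)) = - (1 / (t - E))" using False E R by (simp add: sgn_if)
          also have "\<dots> \<le> - (1 / (- E + R))" using p by (intro le_imp_neg_le divide_left_mono) auto
          finally show ?thesis using False by simp
        qed
      qed
    qed simp
    also have "\<dots> = - 1 / (\<bar>E\<bar> + R)" using one by simp
    also have "\<dots> < 0" using E R by (intro divide_neg_pos) auto
    finally have "sgn E * (\<integral>t. 1 / (t - E) \<partial>\<rho>) < 0" by (simp only: integral_mult_right_zero)
    then show ?thesis unfolding eq by simp
  qed
  show "m z \<noteq> 0" if z: "z \<notin> spectral_set R" for z
  proof (cases "Im z = 0")
    case True
    then have zr: "z = of_real (Re z)" by (simp add: complex_eq_iff)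
    then have "\<bar>Re z\<bar> > R" using z by (metis abs_le_iff atLeastAtMost_iff imageI minus_le_iff not_less)
    from real[OF this] show ?thesis using zr by (metis less_irrefl mult_zero_right zero_complex.simps(1))
  next
    case False
    then consider "Im z > 0" | "Im (cnj z) > 0" by fastforce
    then show ?thesis
    proof cases
      case 1 then show ?thesis using im[OF 1] by auto
    next
      case 2
      then have "m (cnj z) \<noteq> 0" using im[OF 2] by auto
      moreover have "m (cnj z) = cnj (m z)"
      proof -
        have "cnj z \<notin> spectral_set R" using z by (auto simp: image_iff complex_eq_iff)
        then show ?thesis using m z cauchy_transform_cnj by simp
      qed
      ultimately show ?thesis by auto
    qed
  qed
qed

text \<open>The measure comes from \<open>herglotz_representation\<close> with zero linear part, and
  z m tending to -1 fixes its mass as 1.\<close>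

lemma stieltjesI:
  assumes R: "R > 0" and hol: "m holomorphic_on - spectral_set R"
    and sym: "\<And>z. z \<notin> spectral_set R \<Longrightarrow> m (cnj z) = cnj (m z)"
    and pos: "\<And>z. Im z > 0 \<Longrightarrow> Im (m z) \<ge> 0"
    and lim: "((\<lambda>z. z * m z) \<longlongrightarrow> -1) at_infinity"
    and w: "Im w > 0" "(m \<longlongrightarrow> w) (at 0 within upper_half_plane)"
  shows "stieltjes R m"
proof -
  have m0: "(m \<longlongrightarrow> 0) at_infinity" by (rule tendsto_0_at_infinity[OF lim])
  have "((\<lambda>z. m z - of_real 0 * z - of_real 0) \<longlongrightarrow> 0) at_infinity" using m0 by simp
  from herglotz_representation[OF compact_Icc hol sym pos this]
  obtain \<rho> where \<rho>: "finite_measure \<rho>" "sets \<rho> = sets borel" "AE t in \<rho>. t \<in> {-R..R}"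
    and rep: "\<And>z. z \<notin> spectral_set R \<Longrightarrow> m z = (\<integral>t. 1 / (of_real t - z) \<partial>\<rho>)" by auto
  have "((\<lambda>z. z * (\<integral>t. 1 / (complex_of_real t - z) \<partial>\<rho>)) \<longlongrightarrow> - of_real (measure \<rho> (space \<rho>))) at_infinity"
    by (rule cauchy_transform_asymptotics(1)[OF \<rho>]) (use R in simp)
  moreover have "\<forall>\<^sub>F z in at_infinity. z * (\<integral>t. 1 / (complex_of_real t - z) \<partial>\<rho>) = z * m z"
    unfolding eventually_at_infinity
  proof (intro exI allI impI)
    fix z :: complex assume "R + 1 \<le> cmod z"
    then have "z \<notin> spectral_set R" by auto
    then show "z * (\<integral>t. 1 / (complex_of_real t - z) \<partial>\<rho>) = z * m z" by (simp add: rep)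
  qed
  ultimately have "((\<lambda>z. z * m z) \<longlongrightarrow> - of_real (measure \<rho> (space \<rho>))) at_infinity" by (rule Lim_transform_eventually)
  from tendsto_unique[OF trivial_limit_at_infinity this lim] have "complex_of_real (measure \<rho> (space \<rho>)) = of_real 1" by simp
  then have "measure \<rho> (space \<rho>) = 1" by (simp only: of_real_eq_iff)
  then show ?thesis unfolding stieltjes_def using \<rho> rep w by blast
qed

lemma at_0_upper_half_plane_nontrivial: "at 0 within upper_half_plane \<noteq> bot"
proof -
  have "0 islimpt upper_half_plane"
    unfolding islimpt_approachable
  proof (intro allI impI)
    fix e :: real assume "e > 0"
    then show "\<exists>x'\<in>upper_half_plane. x' \<noteq> 0 \<and> dist x' 0 < e"
      by (intro bexI[of _ "\<i> * of_real (e / 2)"]) (auto simp: upper_half_plane_def norm_mult)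
  qed
  then show ?thesis by (simp add: trivial_limit_within)
qed

text \<open>-1 / m is again a Herglotz function, and by the two-term expansion it is z - b + o(1)
  with b the mean of the measure. Its Herglotz measure has some mass a^2, and dividing by that mass
  gives the next function.\<close>

lemma stieltjes_strip:
  assumes st: "stieltjes R m" and R: "R > 0"
  shows "\<exists>a b m1. 0 < a \<and> a \<le> 3 * R \<and> \<bar>b\<bar> \<le> R \<and> stieltjes R m1 \<and>
     (\<forall>z. z \<notin> spectral_set R \<longrightarrow> - 1 / m z = z - of_real b + of_real (a\<^sup>2) * m1 z)"
proof -
  note P = stieltjes_properties[OF st R]
  obtain \<rho> w where \<rho>: "finite_measure \<rho>" "sets \<rho> = sets borel" "AE t in \<rho>. t \<in> {-R..R}" and one: "measure \<rho> (space \<rho>) = 1"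
    and m: "\<And>z. z \<notin> spectral_set R \<Longrightarrow> m z = (\<integral>t. 1 / (of_real t - z) \<partial>\<rho>)"
    and w: "Im w > 0" "(m \<longlongrightarrow> w) (at 0 within upper_half_plane)"
    using st by (auto simp: stieltjes_def)
  have R0: "R \<ge> 0" using R by simp
  define b where "b = (\<integral>t. t \<partial>\<rho>)"
  have it: "integrable \<rho> (\<lambda>t. t)" using power_cauchy_transform_at_infinity(3)[OF \<rho> R0, of 1] by simp
  have bR: "\<bar>b\<bar> \<le> R"
  proof -
    have "norm (\<integral>t. t \<partial>\<rho>) \<le> (\<integral>t. norm t \<partial>\<rho>)" by (rule integral_norm_bound)
    also have "\<dots> \<le> (\<integral>t. R \<partial>\<rho>)"
    proof (rule integral_mono_AE[OF integrable_norm[OF it]])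
      show "AE t in \<rho>. norm t \<le> R" using \<rho>(3) by eventually_elim auto
      show "integrable \<rho> (\<lambda>_. R)" using \<rho>(1) by (simp add: finite_measure.integrable_const)
    qed
    finally show ?thesis using one by (simp add: b_def)
  qed
  define N where "N z = - 1 / m z" for z
  have ev: "\<forall>\<^sub>F z in at_infinity. z \<notin> spectral_set R \<and> z \<noteq> 0"
    unfolding eventually_at_infinity using R by (intro exI[of _ "R + 1"]) auto
  have z1: "((\<lambda>z. z * m z) \<longlongrightarrow> -1) at_infinity"
  proof (rule Lim_transform_eventually)
    show "((\<lambda>z. z * (\<integral>t. 1 / (complex_of_real t - z) \<partial>\<rho>)) \<longlongrightarrow> -1) at_infinity"
      using cauchy_transform_asymptotics(1)[OF \<rho> R0] one by simp
    show "\<forall>\<^sub>F z in at_infinity. z * (\<integral>t. 1 / (complex_of_real t - z) \<partial>\<rho>) = z * m z"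
      using ev by eventually_elim (simp add: m)
  qed
  have z2: "((\<lambda>z. z * (z * m z + 1)) \<longlongrightarrow> - of_real b) at_infinity"
  proof (rule Lim_transform_eventually)
    show "((\<lambda>z. z * (z * (\<integral>t. 1 / (complex_of_real t - z) \<partial>\<rho>) + 1)) \<longlongrightarrow> - of_real b) at_infinity"
      using cauchy_transform_asymptotics(2)[OF \<rho> R0] one by (simp add: b_def)
    show "\<forall>\<^sub>F z in at_infinity. z * (z * (\<integral>t. 1 / (complex_of_real t - z) \<partial>\<rho>) + 1) = z * (z * m z + 1)"
      using ev by eventually_elim (simp add: m)
  qed
  have Nh: "N holomorphic_on - spectral_set R"
    unfolding N_def using P(1,5) by (intro holomorphic_intros) auto
  have Nsym: "N (cnj z) = cnj (N z)" if "z \<notin> spectral_set R" for z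
    using P(2)[OF that] by (simp add: N_def)
  have Npos: "Im (N z) \<ge> 0" if "Im z > 0" for z
  proof -
    have "Im (N z) = Im (m z) / (cmod (m z))\<^sup>2" by (simp add: N_def Im_divide cmod_power2)
    then show ?thesis using P(3)[OF that] by simp
  qed
  have Nlim: "((\<lambda>z. N z - of_real 1 * z - of_real (- b)) \<longlongrightarrow> 0) at_infinity"
  proof -
    have "((\<lambda>z. - (z * (z * m z + 1)) / (z * m z) - of_real (- b)) \<longlongrightarrow> - (- of_real b) / (-1) - of_real (- b)) at_infinity"
      by (intro tendsto_intros z1 z2) simp
    moreover have "\<forall>\<^sub>F z in at_infinity. - (z * (z * m z + 1)) / (z * m z) - of_real (- b) = N z - of_real 1 * z - of_real (- b)"
      using ev
    proof eventually_elim
      case (elim z)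
      then have nz: "z \<noteq> 0" "m z \<noteq> 0" using P(5) by auto
      have "- (z * (z * m z + 1)) / (z * m z) = N z - z" using nz by (simp add: N_def field_simps)
      then show ?case by simp
    qed
    ultimately show ?thesis using Lim_transform_eventually by fastforce
  qed
  obtain \<mu> where \<mu>: "finite_measure \<mu>" "sets \<mu> = sets borel" "AE t in \<mu>. t \<in> {-R..R}"
    and rep: "\<And>z. z \<notin> spectral_set R \<Longrightarrow> N z = of_real 1 * z + of_real (- b) + (\<integral>t. 1 / (of_real t - z) \<partial>\<mu>)"
    using herglotz_representation[OF compact_Icc Nh Nsym Npos Nlim] by auto
  define V where "V = measure \<mu> (space \<mu>)"
  have wnz: "w \<noteq> 0" using w(1) by auto
  have limN: "(N \<longlongrightarrow> - 1 / w) (at 0 within upper_half_plane)"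
    unfolding N_def by (intro tendsto_intros w wnz)
  have Imw: "Im (- 1 / w) > 0"
  proof -
    have "Im (- 1 / w) = Im w / (cmod w)\<^sup>2" by (simp add: Im_divide cmod_power2)
    then show ?thesis using w(1) wnz by simp
  qed
  have evU: "\<forall>\<^sub>F z in at 0 within upper_half_plane. z \<notin> spectral_set R"
    unfolding eventually_at by (intro exI[of _ 1]) (auto simp: upper_half_plane_def)
  have lim1: "((\<lambda>z. N z - z + of_real b) \<longlongrightarrow> - 1 / w - 0 + of_real b) (at 0 within upper_half_plane)"
    by (intro tendsto_intros limN)
  \<comment> \<open>With V = 0, -1 / m would be z - b, with a real limit at 0, whereas the limit -1
    / w has positive imaginary part.\<close>
  have V: "V > 0"
  proof (rule ccontr)
    assume "\<not> V > 0"
    then have "V = 0" by (simp add: V_def zero_less_measure_iff)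
    then have "emeasure \<mu> (space \<mu>) = 0" by (simp add: V_def finite_measure.emeasure_eq_measure[OF \<mu>(1)])
    then have "space \<mu> \<in> null_sets \<mu>" by auto
    then have "AE t in \<mu>. 1 / (complex_of_real t - z) = 0" for z by (rule AE_I'[of "space \<mu>"]) auto
    then have "(\<integral>t. 1 / (complex_of_real t - z) \<partial>\<mu>) = 0" for z by (rule integral_eq_zero_AE)
    then have zero: "N z - z + of_real b = 0" if "z \<notin> spectral_set R" for z using rep[OF that] by simp
    have "\<forall>\<^sub>F z in at 0 within upper_half_plane. N z - z + of_real b = 0"
      using evU by eventually_elim (rule zero)
    then have "((\<lambda>z. 0) \<longlongrightarrow> - 1 / w - 0 + of_real b) (at 0 within upper_half_plane)"
      by (rule Lim_transform_eventually[OF lim1])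
    then have "- 1 / w + of_real b = 0"
      using at_0_upper_half_plane_nontrivial by (simp add: tendsto_const_iff)
    then have "Im (- 1 / w + of_real b) = 0" by (simp only: zero_complex.simps)
    then show False using Imw by simp
  qed
  define a where "a = sqrt V"
  have a: "a > 0" "a\<^sup>2 = V" using V by (auto simp: a_def)
  define m1 where "m1 z = (N z - z + of_real b) / of_real V" for z
  have st1: "stieltjes R m1"
  proof (rule stieltjesI[OF R])
    show "m1 holomorphic_on - spectral_set R"
      unfolding m1_def using V by (intro holomorphic_intros Nh) auto
    show "m1 (cnj z) = cnj (m1 z)" if "z \<notin> spectral_set R" for z
      using Nsym[OF that] by (simp add: m1_def)
    have m1C: "m1 z = (\<integral>t. 1 / (of_real t - z) \<partial>\<mu>) / of_real V" if "z \<notin> spectral_set R" for z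
      using rep[OF that] by (simp add: m1_def)
    show "Im (m1 z) \<ge> 0" if z: "Im z > 0" for z
    proof -
      have "z \<notin> spectral_set R" using z by auto
      then show ?thesis
        using V cauchy_transform_Im_nonneg[OF \<mu>(1,2) z] by (simp add: m1C Im_divide_of_real)
    qed
    have "((\<lambda>z. z * (\<integral>t. 1 / (complex_of_real t - z) \<partial>\<mu>) / of_real V) \<longlongrightarrow> - of_real V / of_real V) at_infinity"
      using cauchy_transform_asymptotics(1)[OF \<mu> R0] V by (intro tendsto_intros) (auto simp: V_def)
    moreover have "\<forall>\<^sub>F z in at_infinity. z * (\<integral>t. 1 / (complex_of_real t - z) \<partial>\<mu>) / of_real V = z * m1 z"
      using ev by eventually_elim (simp add: m1C)
    ultimately show "((\<lambda>z. z * m1 z) \<longlongrightarrow> -1) at_infinity" using V Lim_transform_eventually by fastforce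
    show "(m1 \<longlongrightarrow> (- 1 / w - 0 + of_real b) / of_real V) (at 0 within upper_half_plane)"
      unfolding m1_def using V by (intro tendsto_divide lim1 tendsto_const) simp
    have "Im ((- 1 / w - 0 + of_real b) / of_real V) = Im (- 1 / w) / V" by (simp add: Im_divide_of_real)
    also have "\<dots> > 0" by (rule divide_pos_pos[OF Imw V])
    finally show "Im ((- 1 / w - 0 + of_real b) / of_real V) > 0" .
  qed
  \<comment> \<open>Evaluate at E = 2 R: positivity of -1 / m gives V (-m1(2 R)) < 2 R - b \<le> 3
    R, and -m1(2 R) \<ge> 1 / (3 R) because 2 R - t \<le> 3 R on the support. A bound uniform in the
    step is needed for a bounded matrix.\<close>
  have aR: "a \<le> 3 * R"
  proof -
    have z: "complex_of_real (2 * R) \<notin> spectral_set R" using R by (auto simp del: of_real_mult)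
    have E: "\<bar>2 * R\<bar> > R" using R by simp
    let ?x = "Re (m (of_real (2 * R)))" and ?x1 = "Re (m1 (of_real (2 * R)))"
    have x: "?x < 0" "m (of_real (2 * R)) = of_real ?x" using P(4)[OF E] R by auto
    have "N (of_real (2 * R)) = of_real (2 * R) - of_real b + of_real V * m1 (of_real (2 * R))"
      using V by (simp add: m1_def)
    moreover have "N (of_real (2 * R)) = of_real (- 1 / ?x)" unfolding N_def by (subst x(2)) simp
    moreover have "m1 (of_real (2 * R)) = of_real ?x1" using stieltjes_properties(4)[OF st1 R E] by simp
    ultimately have "complex_of_real (- 1 / ?x) = of_real (2 * R - b + V * ?x1)" by (metis of_real_add of_real_diff of_real_mult)
    then have "- 1 / ?x = 2 * R - b + V * ?x1" by (simp only: of_real_eq_iff)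
    moreover have "- 1 / ?x > 0" using x(1) by (simp add: zero_less_divide_iff)
    ultimately have "V * (- ?x1) < 2 * R - b" by simp
    moreover have "- ?x1 \<ge> 1 / (3 * R)"
    proof -
      obtain \<nu> where \<nu>: "finite_measure \<nu>" "sets \<nu> = sets borel" "AE t in \<nu>. t \<in> {-R..R}" and nu1: "measure \<nu> (space \<nu>) = 1"
        and m1: "\<And>z. z \<notin> spectral_set R \<Longrightarrow> m1 z = (\<integral>t. 1 / (of_real t - z) \<partial>\<nu>)"
        using st1 by (auto simp: stieltjes_def)
      have i: "integrable \<nu> (\<lambda>t. Re (1 / (complex_of_real t - of_real (2 * R))))"
        by (rule integrable_Re[OF spectral_kernel_integrable[OF \<nu> z]])
      have re: "Re (1 / (complex_of_real t - of_real (2 * R))) = 1 / (t - 2 * R)" for t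
        by (metis Re_complex_of_real of_real_1 of_real_diff of_real_divide)
      have "?x1 = (\<integral>t. 1 / (t - 2 * R) \<partial>\<nu>)"
        unfolding m1[OF z] using integral_Re[OF spectral_kernel_integrable[OF \<nu> z]] by (simp only: re)
      also have "\<dots> \<le> (\<integral>t. - (1 / (3 * R)) \<partial>\<nu>)"
      proof (rule integral_mono_AE)
        show "integrable \<nu> (\<lambda>t. 1 / (t - 2 * R))" using i by (simp only: re)
        show "integrable \<nu> (\<lambda>_. - (1 / (3 * R)))" using \<nu>(1) by (simp add: finite_measure.integrable_const)
        show "AE t in \<nu>. 1 / (t - 2 * R) \<le> - (1 / (3 * R))"
          using \<nu>(3)
        proof eventually_elim
          case (elim t)
          then have p: "2 * R - t > 0" "2 * R - t \<le> 3 * R" using R by auto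
          have "1 / (t - 2 * R) = - (1 / (2 * R - t))" using p(1) by (simp add: divide_simps)
          also have "\<dots> \<le> - (1 / (3 * R))" using p R by (intro le_imp_neg_le divide_left_mono) auto
          finally show ?case .
        qed
      qed
      finally show ?thesis using nu1 by simp
    qed
    then have "V * (1 / (3 * R)) \<le> V * (- ?x1)" using V by (intro mult_left_mono) auto
    ultimately have "V * (1 / (3 * R)) \<le> 3 * R" using bR by linarith
    then have "V \<le> (3 * R) * (3 * R)" using R by (simp add: pos_divide_le_eq)
    then have "a\<^sup>2 \<le> (3 * R)\<^sup>2" using a(2) by (simp add: power2_eq_square)
    then show ?thesis by (rule power2_le_imp_le) (use R in simp)
  qed
  have "- 1 / m z = z - of_real b + of_real (a\<^sup>2) * m1 z" for z
    using V by (simp add: m1_def N_def a(2))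
  then show ?thesis using a(1) aR bR st1 by blast
qed

lemma stieltjes_continued_fraction:
  assumes st: "stieltjes R m" and R: "R > 0"
  shows "\<exists>M A B. M 0 = m \<and> (\<forall>k::nat. stieltjes R (M k) \<and> 0 < A k \<and> A k \<le> 3 * R \<and> \<bar>B k\<bar> \<le> R \<and>
     (\<forall>z. z \<notin> spectral_set R \<longrightarrow> - 1 / M k z = z - of_real (B k) + of_real ((A k)\<^sup>2) * M (Suc k) z))"
proof -
  define Q where "Q m a b m1 \<longleftrightarrow> 0 < a \<and> a \<le> 3 * R \<and> \<bar>b\<bar> \<le> R \<and>
    (\<forall>z. z \<notin> spectral_set R \<longrightarrow> - 1 / m z = z - of_real b + of_real (a\<^sup>2) * m1 z)" for m m1 :: "complex \<Rightarrow> complex" and a b :: real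
  have "\<exists>M. \<forall>k. (stieltjes R (M k) \<and> (k = 0 \<longrightarrow> M k = m)) \<and> (\<exists>a b. Q (M k) a b (M (Suc k)))"
  proof (rule dependent_nat_choice)
    show "\<exists>x. stieltjes R x \<and> (0 = 0 \<longrightarrow> x = m)" using st by blast
  next
    fix x :: "complex \<Rightarrow> complex" and n :: nat
    assume "stieltjes R x \<and> (n = 0 \<longrightarrow> x = m)"
    then have "\<exists>a b m1. 0 < a \<and> a \<le> 3 * R \<and> \<bar>b\<bar> \<le> R \<and> stieltjes R m1 \<and>
       (\<forall>z. z \<notin> spectral_set R \<longrightarrow> - 1 / x z = z - of_real b + of_real (a\<^sup>2) * m1 z)" using stieltjes_strip[OF _ R] by blast
    then show "\<exists>y. (stieltjes R y \<and> (Suc n = 0 \<longrightarrow> y = m)) \<and> (\<exists>a b. Q x a b y)"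
      unfolding Q_def by blast
  qed
  then obtain M where M: "\<And>k. stieltjes R (M k)" "M 0 = m" "\<And>k. \<exists>a b. Q (M k) a b (M (Suc k))" by blast
  then obtain A B where "\<And>k. Q (M k) (A k) (B k) (M (Suc k))" by metis
  then show ?thesis using M unfolding Q_def by blast
qed

text \<open>By the recursion the ratios -a_k M_k belong to a solution. As Im M_k > 0 its current is
  never positive, so the telescoped current bounds the sum of |f|^2 and the solution is a Weyl
  solution.\<close>

lemma continued_fraction_m_plus:
  assumes J: "jacobi_matrix a b" and M: "\<And>k. stieltjes R (M k)" and R: "R > 0"
    and rec: "\<And>k z. z \<notin> spectral_set R \<Longrightarrow> - 1 / M k z = z - of_real (b (int k + 1)) + of_real ((a (int k + 1))\<^sup>2) * M (Suc k) z"
    and z: "Im z > 0"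
  shows "m_plus a b z = M 0 z"
proof -
  have zs: "z \<notin> spectral_set R" using z by auto
  have a: "\<And>n. a n > 0" using J by (simp add: jacobi_matrix_def)
  have anz: "complex_of_real (a n) \<noteq> 0" for n using a[of n] by simp
  define f where "f = solution a b z 1 (- of_real (a 0) * M 0 z)"
  have fs: "is_solution a b z f" unfolding f_def by (rule is_solution_solution[of a, OF a])
  have Mnz: "M k z \<noteq> 0" for k by (rule stieltjes_properties(5)[OF M R zs])
  have ratio: "f (int k + 1) = - of_real (a (int k)) * M k z * f (int k)" for k
  proof (induction k)
    case 0 then show ?case by (simp add: f_def)
  next
    case (Suc k)
    have "jacobi_op a b f (int k + 1) = z * f (int k + 1)" using fs by (simp add: is_solution_def)
    then have eq: "of_real (a (int k + 1)) * f (int k + 2) = (z - of_real (b (int k + 1))) * f (int k + 1) - of_real (a (int k)) * f (int k)"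
      by (simp add: jacobi_op_def algebra_simps)
    have "of_real (a (int k)) * f (int k) = (- 1 / M k z) * f (int k + 1)"
      unfolding Suc.IH using Mnz[of k] by simp
    then have "of_real (a (int k + 1)) * f (int k + 2) = - of_real ((a (int k + 1))\<^sup>2) * M (Suc k) z * f (int k + 1)"
      unfolding eq rec[OF zs] by (simp add: algebra_simps)
    then have "of_real (a (int k + 1)) * f (int k + 2) = of_real (a (int k + 1)) * (- of_real (a (int k + 1)) * M (Suc k) z * f (int k + 1))"
      by (simp add: power2_eq_square)
    then have "f (int k + 2) = - of_real (a (int k + 1)) * M (Suc k) z * f (int k + 1)"
      by (rule mult_left_cancel[OF anz, THEN iffD1])
    then show ?case by (simp add: add.commute)
  qed
  have cur: "current a f (int k) \<le> 0" for k
  proof -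
    have "f (int k + 1) * cnj (f (int k)) = - of_real (a (int k)) * M k z * (f (int k) * cnj (f (int k)))"
      unfolding ratio by simp
    also have "\<dots> = - of_real (a (int k)) * M k z * of_real ((cmod (f (int k)))\<^sup>2)"
      by (simp only: complex_norm_square)
    finally have "current a f (int k) = - ((a (int k))\<^sup>2 * (cmod (f (int k)))\<^sup>2 * Im (M k z))"
      by (simp add: current_def power2_eq_square)
    then show ?thesis using stieltjes_properties(3)[OF M R z, of k] by simp
  qed
  have tele: "(\<Sum>k\<le>n. Im z * (cmod (f (int k)))\<^sup>2) = current a f (int n) - current a f (-1)" for n :: nat
  proof (induction n)
    case 0 then show ?case using current_diff[OF fs, of 0] by simp
  next
    case (Suc n) then show ?case using current_diff[OF fs, of "int (Suc n)"] by simp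
  qed
  have "square_summable_on f {0..}"
    unfolding square_summable_on_nonneg_iff
  proof (rule bounded_imp_summable)
    fix n :: nat
    have "Im z * (\<Sum>k\<le>n. (cmod (f (int k)))\<^sup>2) \<le> - current a f (-1)"
      using tele[of n] cur[of n] by (simp add: sum_distrib_left)
    then show "(\<Sum>k\<le>n. (cmod (f (int k)))\<^sup>2) \<le> - current a f (-1) / Im z"
      by (subst pos_le_divide_eq[OF z]) (simp only: mult.commute)
  qed simp
  moreover have "f 0 \<noteq> 0" by (simp add: f_def)
  ultimately have "weyl_solution a b z f" using fs by (auto simp: weyl_solution_def)
  from m_plus_eqI[OF J this z] show ?thesis using anz[of 0] by (simp add: f_def)
qed

text \<open>A positive supersolution \<open>u\<close> of \<open>J u = E u\<close> gives \<open>J \<le> E\<close>: estimate the off-diagonal terms of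
  the form by \<open>2 |v\<^sub>n v\<^sub>n\<^sub>+\<^sub>1| \<le> (u\<^sub>n\<^sub>+\<^sub>1 / u\<^sub>n) |v\<^sub>n|\<^sup>2 + (u\<^sub>n / u\<^sub>n\<^sub>+\<^sub>1) |v\<^sub>n\<^sub>+\<^sub>1|\<^sup>2\<close>.\<close>

lemma supersolution_form_bound:
  assumes a: "\<And>n. a n > 0" and u: "\<And>n. u n > 0"
    and super: "\<And>n. a n * u (n + 1) + a (n - 1) * u (n - 1) + b n * u n \<le> E * u n"
    and A: "finite A" and v0: "\<And>n. n \<notin> A \<Longrightarrow> v n = 0"
  shows "(\<Sum>n\<in>A. Re (cnj (v n) * jacobi_op a b v n)) \<le> E * (\<Sum>n\<in>A. (cmod (v n))\<^sup>2)"
proof -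
  define N where "N = nat (Max (insert 0 (abs ` A))) + 2"
  let ?I = "{- int N..int N}"
  have AN: "\<bar>n\<bar> + 2 \<le> int N" if "n \<in> A" for n
  proof -
    have "\<bar>n\<bar> \<le> Max (insert 0 (abs ` A))" using A that by (intro Max_ge) auto
    moreover have "0 \<le> Max (insert 0 (abs ` A))" using A by (intro Max_ge) auto
    ultimately show ?thesis by (simp add: N_def)
  qed
  have AI: "A \<subseteq> ?I" using AN by fastforce
  have vN: "v n = 0" if "\<bar>n\<bar> \<ge> int N - 1" for n using v0 AN that by fastforce
  define p where "p n = a n * Re (cnj (v n) * v (n + 1))" for n
  define s where "s n = a n * u (n + 1) / u n * (cmod (v n))\<^sup>2" for n
  define t where "t n = a (n - 1) * u (n - 1) / u n * (cmod (v n))\<^sup>2" for n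
  have p_le: "p n \<le> (s n + t (n + 1)) / 2" for n
  proof -
    have amgm: "x * y \<le> (U / V * x\<^sup>2 + V / U * y\<^sup>2) / 2" if "U > 0" "V > 0" for x y U V :: real
    proof -
      have "0 \<le> (U * x - V * y)\<^sup>2 / (U * V)" using that by simp
      also have "\<dots> = U / V * x\<^sup>2 + V / U * y\<^sup>2 - 2 * (x * y)"
        using that by (simp add: power2_diff field_simps power2_eq_square)
      finally show ?thesis by simp
    qed
    have "Re (cnj (v n) * v (n + 1)) \<le> cmod (v n) * cmod (v (n + 1))"
      using complex_Re_le_cmod[of "cnj (v n) * v (n + 1)"] by (simp add: norm_mult)
    also have "\<dots> \<le> (u (n + 1) / u n * (cmod (v n))\<^sup>2 + u n / u (n + 1) * (cmod (v (n + 1)))\<^sup>2) / 2"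
      by (rule amgm[OF u u])
    finally have "a n * Re (cnj (v n) * v (n + 1)) \<le> a n * ((u (n + 1) / u n * (cmod (v n))\<^sup>2 + u n / u (n + 1) * (cmod (v (n + 1)))\<^sup>2) / 2)"
      using a[of n] by (intro mult_left_mono) auto
    then show ?thesis by (simp add: p_def s_def t_def algebra_simps)
  qed
  have st: "s n + t n + b n * (cmod (v n))\<^sup>2 \<le> E * (cmod (v n))\<^sup>2" for n
  proof -
    have "a n * u (n + 1) / u n + a (n - 1) * u (n - 1) / u n + b n \<le> E"
      using super[of n] u[of n] by (simp add: field_simps)
    then have "(a n * u (n + 1) / u n + a (n - 1) * u (n - 1) / u n + b n) * (cmod (v n))\<^sup>2 \<le> E * (cmod (v n))\<^sup>2"
      by (intro mult_right_mono) auto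
    then show ?thesis by (simp add: s_def t_def distrib_right)
  qed
  \<comment> \<open>The terms produced at site n do not match those needed at n; the mismatch is a
    difference of \<open>d\<close> and telescopes to 0.\<close>
  define d where "d n = (t (n + 1) - s n) / 2" for n
  have pt: "Re (cnj (v n) * jacobi_op a b v n) \<le> E * (cmod (v n))\<^sup>2 + (d n - d (n - 1))" for n
  proof -
    have "Re (cnj (v n) * jacobi_op a b v n) = p n + p (n - 1) + b n * (cmod (v n))\<^sup>2"
      by (simp only: cmod_power2) (simp add: jacobi_op_def p_def algebra_simps power2_eq_square)
    also have "\<dots> \<le> (s n + t (n + 1)) / 2 + (s (n - 1) + t (n - 1 + 1)) / 2 + b n * (cmod (v n))\<^sup>2"
      using p_le[of n] p_le[of "n - 1"] by linarith
    also have "\<dots> = s n + t n + b n * (cmod (v n))\<^sup>2 + (d n - d (n - 1))"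
      by (simp add: d_def field_simps)
    finally show ?thesis using st[of n] by linarith
  qed
  have "(\<Sum>n\<in>A. Re (cnj (v n) * jacobi_op a b v n)) = (\<Sum>n\<in>?I. Re (cnj (v n) * jacobi_op a b v n))"
    using AI v0 by (intro sum.mono_neutral_left) auto
  also have "\<dots> \<le> (\<Sum>n\<in>?I. E * (cmod (v n))\<^sup>2 + (d n - d (n - 1)))" by (intro sum_mono pt)
  also have "\<dots> = E * (\<Sum>n\<in>?I. (cmod (v n))\<^sup>2) + (d (int N) - d (- int N - 1))"
    by (simp only: sum.distrib sum_distrib_left telescope_symmetric)
  also have "d (int N) = 0" using vN[of "int N"] vN[of "int N + 1"] by (simp add: d_def s_def t_def)
  also have "d (- int N - 1) = 0" using vN[of "- int N - 1"] vN[of "- int N"] by (simp add: d_def s_def t_def)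
  also have "(\<Sum>n\<in>?I. (cmod (v n))\<^sup>2) = (\<Sum>n\<in>A. (cmod (v n))\<^sup>2)"
    using AI v0 by (intro sum.mono_neutral_right) auto
  finally show ?thesis by simp
qed

text \<open>The lower bound is the upper bound for the diagonal -b and the vector (-1)^n v, since
  conjugation by alternating signs maps J to minus that matrix. This accounts for
  \<open>sgn E\<close> in front of \<open>b\<close>.\<close>

lemma form_boundedI_supersolution:
  assumes a: "\<And>n. a n > 0"
    and u: "\<And>E. \<bar>E\<bar> > R \<Longrightarrow> \<exists>u. (\<forall>n. u n > 0) \<and>
      (\<forall>n. a n * u (n + 1) + a (n - 1) * u (n - 1) + sgn E * b n * u n \<le> \<bar>E\<bar> * u n)"
    and R: "R \<ge> 0"
  shows "form_bounded a b R"
  unfolding form_bounded_def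
proof (intro allI impI)
  fix v :: "int \<Rightarrow> complex" and A :: "int set"
  assume A: "finite A" and "\<forall>n. n \<notin> A \<longrightarrow> v n = 0"
  then have v0: "\<And>n. n \<notin> A \<Longrightarrow> v n = 0" by blast
  let ?Q = "\<Sum>n\<in>A. Re (cnj (v n) * jacobi_op a b v n)" and ?S = "\<Sum>n\<in>A. (cmod (v n))\<^sup>2"
  have bound: "\<bar>?Q\<bar> \<le> e * ?S" if e: "e > R" for e
  proof -
    have e0: "e > 0" using e R by linarith
    obtain u1 where u1: "\<And>n. u1 n > 0" "\<And>n. a n * u1 (n + 1) + a (n - 1) * u1 (n - 1) + b n * u1 n \<le> e * u1 n"
      using u[of e] e e0 by auto
    have up: "?Q \<le> e * ?S" by (rule supersolution_form_bound[of a u1, OF a u1(1,2) A v0])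
    obtain u2 where u2: "\<And>n. u2 n > 0" "\<And>n. a n * u2 (n + 1) + a (n - 1) * u2 (n - 1) + - b n * u2 n \<le> e * u2 n"
      using u[of "- e"] e e0 by auto
    define w where "w n = (if even n then v n else - v n)" for n
    have "(\<Sum>n\<in>A. Re (cnj (w n) * jacobi_op a (\<lambda>n. - b n) w n)) \<le> e * (\<Sum>n\<in>A. (cmod (w n))\<^sup>2)"
      by (rule supersolution_form_bound[of a u2 "\<lambda>n. - b n", OF a u2(1,2) A]) (simp add: w_def v0)
    moreover have "Re (cnj (w n) * jacobi_op a (\<lambda>n. - b n) w n) = - Re (cnj (v n) * jacobi_op a b v n)" for n
      by (simp add: w_def jacobi_op_def algebra_simps)
    moreover have "cmod (w n) = cmod (v n)" for n by (simp add: w_def)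
    ultimately have "- ?Q \<le> e * ?S" by (simp only: sum_negf)
    then show ?thesis using up by linarith
  qed
  show "\<bar>?Q\<bar> \<le> R * ?S"
  proof (rule tendsto_lowerbound)
    show "((\<lambda>e. e * ?S) \<longlongrightarrow> R * ?S) (at_right R)" by (intro tendsto_intros)
    show "\<forall>\<^sub>F e in at_right R. \<bar>?Q\<bar> \<le> e * ?S"
      unfolding eventually_at_right_field using bound by (intro exI[of _ "R + 1"]) auto
  qed simp
qed

text \<open>The numbers -sgn E M_k(E) are positive, and U is the product of these numbers with the
  \<alpha> k. The stripping recursion is the equation for U; for E < 0 this is the half-line
  solution with alternating signs removed.\<close>

lemma half_line_positive_solution:
  assumes M: "\<And>k::nat. stieltjes R (M k)" and R: "R > 0" and \<alpha>: "\<And>k::nat. \<alpha> k > 0"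
    and rec: "\<And>k z. z \<notin> spectral_set R \<Longrightarrow> - 1 / M k z = z - of_real (\<beta> (Suc k)) + of_real ((\<alpha> (Suc k))\<^sup>2) * M (Suc k) z"
    and E: "\<bar>E\<bar> > R"
  shows "\<exists>U. U 0 = 1 \<and> (\<forall>k. U k > 0) \<and> U 1 = - sgn E * \<alpha> 0 * Re (M 0 (of_real E)) \<and>
     (\<forall>k. \<alpha> (Suc k) * U (Suc (Suc k)) + \<alpha> k * U k + sgn E * \<beta> (Suc k) * U (Suc k) = \<bar>E\<bar> * U (Suc k))"
proof -
  define x where "x k = - sgn E * Re (M k (of_real E))" for k
  note P = stieltjes_properties(4)[OF M R E]
  have x: "x k > 0" for k using P[of k] by (simp add: x_def)
  have zs: "complex_of_real E \<notin> spectral_set R" using E by auto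
  have rx: "1 / x k = \<bar>E\<bar> - sgn E * \<beta> (Suc k) - (\<alpha> (Suc k))\<^sup>2 * x (Suc k)" for k
  proof -
    define y where "y k = Re (M k (of_real E))" for k
    have My: "M k (of_real E) = of_real (y k)" for k using P[of k] by (simp add: y_def)
    have "complex_of_real (- 1 / y k) = of_real (E - \<beta> (Suc k) + (\<alpha> (Suc k))\<^sup>2 * y (Suc k))"
      using rec[OF zs, of k] unfolding My by simp
    then have y: "- 1 / y k = E - \<beta> (Suc k) + (\<alpha> (Suc k))\<^sup>2 * y (Suc k)" by (simp only: of_real_eq_iff)
    have "1 / x k = sgn E * (- 1 / y k)"
      using E R by (cases "E > 0") (simp_all add: x_def y_def sgn_if)
    also have "\<dots> = sgn E * E - sgn E * \<beta> (Suc k) - (\<alpha> (Suc k))\<^sup>2 * x (Suc k)"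
      unfolding y by (simp add: x_def y_def algebra_simps)
    finally show ?thesis by (simp add: sgn_mult_abs mult_sgn_abs abs_sgn mult.commute)
  qed
  define U where "U = rec_nat 1 (\<lambda>k w. \<alpha> k * x k * w)"
  have U: "U 0 = 1" "U (Suc k) = \<alpha> k * x k * U k" for k by (simp_all add: U_def)
  have Up: "U k > 0" for k by (induction k) (simp_all add: U \<alpha> x)
  have "\<alpha> (Suc k) * U (Suc (Suc k)) + \<alpha> k * U k + sgn E * \<beta> (Suc k) * U (Suc k) = \<bar>E\<bar> * U (Suc k)" for k
  proof -
    have "\<alpha> k * U k = 1 / x k * U (Suc k)" using x[of k] by (simp add: U)
    then have "\<alpha> k * U k = (\<bar>E\<bar> - sgn E * \<beta> (Suc k) - (\<alpha> (Suc k))\<^sup>2 * x (Suc k)) * U (Suc k)" unfolding rx .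
    moreover have "U (Suc (Suc k)) = \<alpha> (Suc k) * x (Suc k) * U (Suc k)" by (rule U)
    ultimately show ?thesis by (simp add: algebra_simps power2_eq_square)
  qed
  moreover have "U 1 = - sgn E * \<alpha> 0 * Re (M 0 (of_real E))" using U(2)[of 0] by (simp add: U(1) x_def)
  ultimately show ?thesis using U(1) Up by blast
qed

text \<open>Both continued fractions supply the coefficients away from site 0. The positive
  half-line solutions joined there form a supersolution: equality holds off 0, and at 0 the required
  inequality is \<open>pos\<close>.\<close>

lemma jacobi_from_stieltjes_pair:
  assumes mp: "stieltjes R mp" and mr: "stieltjes R mr" and R: "R > 0" and a01: "a0 > 0" "a1 > 0"
    and pos: "\<And>E. \<bar>E\<bar> > R \<Longrightarrow>
      sgn E * Re (of_real (a0\<^sup>2) * mp (of_real E) + of_real (a1\<^sup>2) * mr (of_real E) + of_real E - of_real b0) \<ge> 0"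
  shows "\<exists>a b. jacobi_matrix a b \<and> form_bounded a b R \<and> a 0 = a0 \<and> a (-1) = a1 \<and> b 0 = b0 \<and>
     (\<forall>z. Im z > 0 \<longrightarrow> m_plus a b z = mp z \<and> m_plus (reflect_a a) (reflect_b b) z = mr z)"
proof -
  obtain M A B where M: "M 0 = mp" "\<And>k::nat. stieltjes R (M k)" and A: "\<And>k. 0 < A k" "\<And>k. A k \<le> 3 * R" "\<And>k. \<bar>B k\<bar> \<le> R"
    and rec: "\<And>k z. z \<notin> spectral_set R \<Longrightarrow> - 1 / M k z = z - of_real (B k) + of_real ((A k)\<^sup>2) * M (Suc k) z"
    using stieltjes_continued_fraction[OF mp R] by metis
  obtain M' A' B' where M': "M' 0 = mr" "\<And>k::nat. stieltjes R (M' k)" and A': "\<And>k. 0 < A' k" "\<And>k. A' k \<le> 3 * R" "\<And>k. \<bar>B' k\<bar> \<le> R"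
    and rec': "\<And>k z. z \<notin> spectral_set R \<Longrightarrow> - 1 / M' k z = z - of_real (B' k) + of_real ((A' k)\<^sup>2) * M' (Suc k) z"
    using stieltjes_continued_fraction[OF mr R] by metis
  \<comment> \<open>Reflection sends bond n to -n - 1 and site n to -n, so \<open>A' k\<close> is
    placed at bond -k - 2 and \<open>B' k\<close> at site -k - 1. The bonds 0 and -1 next to site 0
    carry \<open>a0\<close> and \<open>a1\<close>.\<close>
  define a where "a n = (if n \<ge> 1 then A (nat (n - 1)) else if n = 0 then a0 else if n = -1 then a1 else A' (nat (- n - 2)))" for n :: int
  define b where "b n = (if n \<ge> 1 then B (nat (n - 1)) else if n = 0 then b0 else B' (nat (- n - 1)))" for n :: int
  have a: "a n > 0" for n using A(1) A'(1) a01 by (simp add: a_def)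
  have aS: "a (int (Suc k)) = A k" "b (int (Suc k)) = B k" for k by (simp_all add: a_def b_def)
  have aS': "reflect_a a (int (Suc k)) = A' k" "reflect_b b (int (Suc k)) = B' k" for k
    by (simp_all add: a_def b_def reflect_a_def reflect_b_def)
  have J: "jacobi_matrix a b"
    unfolding jacobi_matrix_def
  proof (intro conjI allI a)
    have "\<bar>a n\<bar> \<le> 3 * R + a0 + a1" for n
      using A(1,2)[of "nat (n - 1)"] A'(1,2)[of "nat (- n - 2)"] a01 R by (simp add: a_def)
    then show "bounded (range a)" by (intro boundedI) auto
    have "\<bar>b n\<bar> \<le> R + \<bar>b0\<bar>" for n
      using A(3)[of "nat (n - 1)"] A'(3)[of "nat (- n - 1)"] R by (simp add: b_def add_increasing2)
    then show "bounded (range b)" by (intro boundedI) auto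
  qed
  have "form_bounded a b R"
  proof (rule form_boundedI_supersolution[of a, OF a])
    fix E assume E: "\<bar>E\<bar> > R"
    obtain U where U: "U 0 = 1" "\<And>k. U k > 0" "U 1 = - sgn E * a (int 0) * Re (M 0 (of_real E))"
      "\<And>k. a (int (Suc k)) * U (Suc (Suc k)) + a (int k) * U k + sgn E * b (int (Suc k)) * U (Suc k) = \<bar>E\<bar> * U (Suc k)"
      using half_line_positive_solution[of R M "\<lambda>k. a (int k)" "\<lambda>k. b (int k)", OF M(2) R a _ E] rec unfolding aS by blast
    obtain U' where U': "U' 0 = 1" "\<And>k. U' k > 0" "U' 1 = - sgn E * reflect_a a (int 0) * Re (M' 0 (of_real E))"
      "\<And>k. reflect_a a (int (Suc k)) * U' (Suc (Suc k)) + reflect_a a (int k) * U' k + sgn E * reflect_b b (int (Suc k)) * U' (Suc k) = \<bar>E\<bar> * U' (Suc k)"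
      using half_line_positive_solution[of R M' "\<lambda>k. reflect_a a (int k)" "\<lambda>k. reflect_b b (int k)", OF M'(2) R _ _ E] rec' a
      unfolding aS' by (auto simp: reflect_a_def)
    define u where "u n = (if n \<ge> 0 then U (nat n) else U' (nat (- n)))" for n
    have "a n * u (n + 1) + a (n - 1) * u (n - 1) + sgn E * b n * u n \<le> \<bar>E\<bar> * u n" for n
    proof -
      consider k where "n = int (Suc k)" | k where "n = - int (Suc k)" | "n = 0"
        by (metis int_cases3 gr0_conv_Suc)
      then show ?thesis
      proof cases
        case 1
        have "u (n + 1) = U (Suc (Suc k))" "u (n - 1) = U k" "u n = U (Suc k)"
          unfolding 1 by (simp_all add: u_def nat_add_distrib)
        then show ?thesis using U(4)[of k] 1 by simp
      next
        case 2
        have n1: "n - 1 = - int (Suc (Suc k))" "n + 1 = - int k" using 2 by auto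
        have uj: "u (- int j) = U' j" for j using U(1) U'(1) by (cases "j = 0") (simp_all add: u_def)
        then have uu: "u (n - 1) = U' (Suc (Suc k))" "u (n + 1) = U' k" "u n = U' (Suc k)"
          unfolding n1 using uj[of "Suc k"] 2 by (simp_all only: uj)
        have "reflect_a a (int (Suc k)) = a (n - 1)" "reflect_a a (int k) = a n" "reflect_b b (int (Suc k)) = b n"
          unfolding 2 reflect_a_def reflect_b_def by (auto intro: arg_cong[where f = a])
        then show ?thesis using U'(4)[of k] unfolding uu by (simp add: mult.commute)
      next
        case 3
        have "u 1 = - sgn E * a0 * Re (mp (of_real E))" using U(3) M(1) by (simp add: u_def a_def)
        moreover have "u (- 1) = - sgn E * a1 * Re (mr (of_real E))" using U'(3) M'(1) by (simp add: u_def a_def reflect_a_def)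
        moreover have "u 0 = 1" using U(1) by (simp add: u_def)
        moreover have "a 0 = a0" "a (-1) = a1" "b 0 = b0" by (simp_all add: a_def b_def)
        moreover have "sgn E * E = \<bar>E\<bar>" by (simp add: abs_sgn mult.commute)
        ultimately show ?thesis
          using pos[OF E] unfolding 3 by (simp add: algebra_simps power2_eq_square)
      qed
    qed
    moreover have "u n > 0" for n using U(2) U'(2) by (simp add: u_def)
    ultimately show "\<exists>u. (\<forall>n. u n > 0) \<and>
      (\<forall>n. a n * u (n + 1) + a (n - 1) * u (n - 1) + sgn E * b n * u n \<le> \<bar>E\<bar> * u n)" by blast
  qed (use R in simp)
  moreover have "m_plus a b z = mp z" if "Im z > 0" for z
  proof -
    have "m_plus a b z = M 0 z"
      by (rule continued_fraction_m_plus[OF J M(2) R _ that]) (use rec aS in \<open>simp add: add.commute\<close>)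
    then show ?thesis using M(1) by simp
  qed
  moreover have "m_plus (reflect_a a) (reflect_b b) z = mr z" if "Im z > 0" for z
  proof -
    have "m_plus (reflect_a a) (reflect_b b) z = M' 0 z"
      by (rule continued_fraction_m_plus[OF jacobi_matrix_reflect[OF J] M'(2) R _ that]) (use rec' aS' in \<open>simp add: add.commute\<close>)
    then show ?thesis using M'(1) by simp
  qed
  moreover have "a 0 = a0" "a (-1) = a1" "b 0 = b0" by (simp_all add: a_def b_def)
  ultimately show ?thesis using J by blast
qed

section \<open>From measures to Jacobi matrices\<close>

text \<open>The inverse branch with values in the disc. All limits follow from z \<kappa> =
  -(\<kappa>^2 + 1), which is the equation phi \<kappa> = z.\<close>

lemma phi_disc_inverse:
  "\<exists>\<kappa>. \<kappa> holomorphic_on - spectral_set 2 \<and>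
     (\<forall>z. z \<notin> spectral_set 2 \<longrightarrow> \<kappa> z \<noteq> 0 \<and> cmod (\<kappa> z) < 1 \<and> phi (\<kappa> z) = z) \<and>
     (\<forall>l. l \<noteq> 0 \<longrightarrow> cmod l < 1 \<longrightarrow> \<kappa> (phi l) = l) \<and>
     (\<forall>z. z \<notin> spectral_set 2 \<longrightarrow> \<kappa> (cnj z) = cnj (\<kappa> z)) \<and>
     filterlim \<kappa> (at 0) at_infinity \<and> ((\<lambda>z. z * \<kappa> z) \<longlongrightarrow> -1) at_infinity \<and>
     (\<kappa> \<longlongrightarrow> \<i>) (at 0 within upper_half_plane)"
proof -
  have "phi holomorphic_on ball 0 1 - {0}" by (rule phi_holomorphic) simp
  moreover have "open (ball (0::complex) 1 - {0})" by (intro open_Diff) auto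
  ultimately obtain \<kappa> where h: "\<kappa> holomorphic_on phi ` (ball 0 1 - {0})"
    and inv: "\<And>l. l \<in> ball 0 1 - {0} \<Longrightarrow> \<kappa> (phi l) = l"
    using holomorphic_has_inverse[OF _ _ inj_on_phi_disc] by metis
  have inv': "\<kappa> (phi l) = l" if "l \<noteq> 0" "cmod l < 1" for l using inv[of l] that by simp
  have \<kappa>: "\<kappa> z \<noteq> 0 \<and> cmod (\<kappa> z) < 1 \<and> phi (\<kappa> z) = z" if "z \<notin> spectral_set 2" for z
    using phi_disc_preimage[OF that] inv' by metis
  have eq: "z * \<kappa> z = - ((\<kappa> z)\<^sup>2 + 1)" if "z \<notin> spectral_set 2" for z
  proof -
    have "z * \<kappa> z = phi (\<kappa> z) * \<kappa> z" using \<kappa>[OF that] by simp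
    also have "\<dots> = - ((\<kappa> z)\<^sup>2 + 1)" using \<kappa>[OF that] by (intro phi_mult) simp
    finally show ?thesis .
  qed
  have far: "\<forall>\<^sub>F z in at_infinity. z \<notin> spectral_set 2 \<and> z \<noteq> 0"
    unfolding eventually_at_infinity by (intro exI[of _ 3]) auto
  have lim0: "(\<kappa> \<longlongrightarrow> 0) at_infinity"
  proof (rule Lim_null_comparison)
    show "\<forall>\<^sub>F z in at_infinity. cmod (\<kappa> z) \<le> 2 * cmod (1 / z)"
      using far
    proof eventually_elim
      case (elim z)
      have "(cmod (\<kappa> z))\<^sup>2 \<le> 1" using \<kappa>[of z] elim by (simp add: abs_square_le_1)
      then have "cmod ((\<kappa> z)\<^sup>2 + 1) \<le> 2"
        using norm_triangle_ineq[of "(\<kappa> z)\<^sup>2" 1] by (simp add: norm_power)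
      then have "cmod z * cmod (\<kappa> z) \<le> 2" using eq[of z] elim by (metis norm_minus_cancel norm_mult)
      then show ?case using elim by (simp add: norm_divide field_simps)
    qed
    have "((\<lambda>z::complex. 2 * cmod (1 / z)) \<longlongrightarrow> 2 * cmod 0) at_infinity"
      by (intro tendsto_intros inverse_tendsto_0_at_infinity)
    then show "((\<lambda>z::complex. 2 * cmod (1 / z)) \<longlongrightarrow> 0) at_infinity" by simp
  qed
  show ?thesis
  proof (intro exI[of _ \<kappa>] conjI allI impI)
    show "\<kappa> holomorphic_on - spectral_set 2" using h unfolding phi_disc_image .
    show "\<kappa> (cnj z) = cnj (\<kappa> z)" if "z \<notin> spectral_set 2" for z
    proof -
      have "\<kappa> (phi (cnj (\<kappa> z))) = cnj (\<kappa> z)" by (rule inv') (use \<kappa>[OF that] in auto)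
      then show ?thesis using \<kappa>[OF that] by (simp add: phi_cnj)
    qed
    show "filterlim \<kappa> (at 0) at_infinity"
      unfolding filterlim_at using lim0 far \<kappa> by (auto elim!: eventually_mono)
    have "((\<lambda>z. - ((\<kappa> z)\<^sup>2 + 1)) \<longlongrightarrow> - (0\<^sup>2 + 1)) at_infinity" by (intro tendsto_intros lim0)
    moreover have "\<forall>\<^sub>F z in at_infinity. - ((\<kappa> z)\<^sup>2 + 1) = z * \<kappa> z"
      using far by eventually_elim (simp add: eq)
    ultimately have "((\<lambda>z. z * \<kappa> z) \<longlongrightarrow> - (0\<^sup>2 + 1)) at_infinity" by (rule Lim_transform_eventually)
    then show "((\<lambda>z. z * \<kappa> z) \<longlongrightarrow> -1) at_infinity" by simp
    have "((\<lambda>z. \<kappa> z - \<i>) \<longlongrightarrow> 0) (at 0 within upper_half_plane)"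
    proof (rule Lim_null_comparison)
      show "\<forall>\<^sub>F z in at 0 within upper_half_plane. cmod (\<kappa> z - \<i>) \<le> cmod z"
        unfolding eventually_at_filter
      proof (rule always_eventually, intro allI impI)
        fix z assume "z \<in> upper_half_plane"
        then have z: "Im z > 0" by (simp add: upper_half_plane_def)
        then have zs: "z \<notin> spectral_set 2" by auto
        have "Im (\<kappa> z) > 0" using \<kappa>[OF zs] Im_phi_disc_iff(1)[of "\<kappa> z"] z by auto
        \<comment> \<open>Since |\<kappa> - \<i>| |\<kappa> + \<i>| = |z| |\<kappa>| \<le> |z|, it
          is enough to keep the second factor at least 1.\<close>
        then have "1 \<le> cmod (\<kappa> z + \<i>)" using abs_Im_le_cmod[of "\<kappa> z + \<i>"] by simp
        then have "cmod (\<kappa> z - \<i>) * 1 \<le> cmod (\<kappa> z - \<i>) * cmod (\<kappa> z + \<i>)" by (intro mult_left_mono) auto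
        also have "\<dots> = cmod ((\<kappa> z)\<^sup>2 + 1)" by (simp add: power2_eq_square algebra_simps flip: norm_mult)
        also have "\<dots> = cmod z * cmod (\<kappa> z)" using eq[OF zs] by (metis norm_minus_cancel norm_mult)
        also have "\<dots> \<le> cmod z * 1" using \<kappa>[OF zs] by (intro mult_left_mono) auto
        finally show "cmod (\<kappa> z - \<i>) \<le> cmod z" by simp
      qed
      show "(cmod \<longlongrightarrow> 0) (at 0 within upper_half_plane)" by (rule tendsto_norm_zero) (rule tendsto_ident_at)
    qed
    then show "(\<kappa> \<longlongrightarrow> \<i>) (at 0 within upper_half_plane)" by (rule LIM_zero_cancel)
  qed (use \<kappa> inv' in auto)
qed

text \<open>M is continuous across the interval, so both boundary values exist at every point and
  come from the same number M(x).\<close>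

lemma M_function_reflectionless:
  assumes M: "is_M_function a b M"
  shows "reflectionless_on a b {-2<..<2}"
  unfolding reflectionless_on_def
proof (intro conjI AE_I2 impI)
  show "emeasure lborel {-2<..<2::real} > 0" by simp
  fix x :: real assume x: "x \<in> {-2<..<2}"
  have xO: "of_real x \<in> Omega" using x by (simp add: Omega_def)
  have "isCont M (of_real x)"
    using M xO open_Omega holomorphic_on_imp_continuous_on continuous_on_eq_continuous_at
    unfolding is_M_function_def by blast
  then have cM: "(M \<longlongrightarrow> M (of_real x)) (nhds (of_real x))" by (simp add: isCont_def tendsto_at_iff_tendsto_nhds)
  have l: "((\<lambda>y. Complex x (s * y)) \<longlongrightarrow> of_real x) (at_right 0)" for s
  proof -
    have "((\<lambda>y. Complex x (s * y)) \<longlongrightarrow> Complex x (s * 0)) (at_right 0)"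
      by (intro tendsto_Complex tendsto_intros)
    then show ?thesis by (simp add: complex_of_real_def)
  qed
  have ev: "\<forall>\<^sub>F y::real in at_right 0. y > 0" by (rule eventually_at_right_less)
  have "has_boundary_value (m_plus a b) x (M (of_real x))"
    unfolding has_boundary_value_def
  proof (rule Lim_transform_eventually[OF filterlim_compose[OF cM l[of 1]]])
    show "\<forall>\<^sub>F y in at_right 0. M (Complex x (1 * y)) = m_plus a b (Complex x y)"
      using ev by eventually_elim (use M in \<open>simp add: is_M_function_def upper_half_plane_def\<close>)
  qed
  moreover have "has_boundary_value (m_minus a b) x (- cnj (M (of_real x)))"
    unfolding has_boundary_value_def
  proof (rule Lim_transform_eventually[OF tendsto_minus[OF tendsto_cnj[OF filterlim_compose[OF cM l[of "-1"]]]]])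
    show "\<forall>\<^sub>F y in at_right 0. - cnj (M (Complex x (- 1 * y))) = m_minus a b (Complex x y)"
      using ev
    proof eventually_elim
      case (elim y)
      have "cnj (Complex x (- y)) = Complex x y" by (simp add: complex_eq_iff)
      then show ?case using M elim by (simp add: is_M_function_def lower_half_plane_def)
    qed
  qed
  ultimately show "\<exists>w v. has_boundary_value (m_plus a b) x w \<and> has_boundary_value (m_minus a b) x v \<and> w = - cnj v"
    by (intro exI[of _ "M (of_real x)"] exI[of _ "- cnj (M (of_real x))"]) simp
qed simp

text \<open>Add the conditions at E and -E. With p = t^2 + 1 the two kernels sum to 2 p / (p^2 - E^2
  t^2), which is negative on the hull for |E| > R.\<close>

lemma positivity_imp_moment_less_1:
  fixes \<mu> :: "real measure"
  assumes fin: "finite_measure \<mu>" and m: "sets \<mu> = sets borel" and K: "AE t in \<mu>. t \<in> support_hull r"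
    and r: "0 < r" "r \<le> 1" "r + 1 / r = R" and pos: "positivity_condition R \<mu>"
  shows "1 - moment \<mu> (-2) > 0"
proof -
  define E where "E = R + 1"
  have "1 / r > 0" using r by simp
  then have R: "R > 0" using r by linarith
  have E: "\<bar>E\<bar> > R" "\<bar>- E\<bar> > R" using R by (auto simp: E_def)
  note i = quadratic_kernel_integrable[OF fin m K r E(1)] quadratic_kernel_integrable[OF fin m K r E(2)]
  have "(\<integral>t. 1 / (t\<^sup>2 + E * t + 1) + 1 / (t\<^sup>2 + - E * t + 1) \<partial>\<mu>) \<le> (\<integral>t. 0 \<partial>\<mu>)"
  proof (rule integral_mono_AE[OF Bochner_Integration.integrable_add[OF i]])
    show "AE t in \<mu>. 1 / (t\<^sup>2 + E * t + 1) + 1 / (t\<^sup>2 + - E * t + 1) \<le> 0"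
      using K
    proof eventually_elim
      case (elim t)
      then have t: "\<bar>t\<bar> > 0" "\<bar>t\<bar> + 1 / \<bar>t\<bar> \<le> R"
        using r joukowski_real_le_iff[OF r(1,2), of "\<bar>t\<bar>"] by (auto simp: support_hull_iff[OF r(1)])
      have "\<bar>t\<bar> * (\<bar>t\<bar> + 1 / \<bar>t\<bar>) < \<bar>t\<bar> * E" using t by (intro mult_strict_left_mono) (auto simp: E_def)
      then have q: "t\<^sup>2 + 1 < E * \<bar>t\<bar>" using t(1) by (simp add: distrib_left power2_eq_square mult.commute)
      define p where "p = t\<^sup>2 + 1"
      have p: "p > 0" "p < \<bar>E * t\<bar>" using q R by (auto simp: p_def abs_mult E_def add_nonneg_pos)
      then have "p\<^sup>2 < \<bar>E * t\<bar>\<^sup>2" by (intro power_strict_mono) auto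
      then have neg: "(p + E * t) * (p - E * t) < 0" by (simp add: algebra_simps power2_eq_square)
      then have nz: "p + E * t \<noteq> 0" "p - E * t \<noteq> 0" by auto
      have "1 / (p + E * t) + 1 / (p - E * t) = 2 * p / ((p + E * t) * (p - E * t))"
        using nz by (simp add: field_simps)
      also have "\<dots> < 0" using p(1) neg by (intro divide_pos_neg) auto
      finally show ?case by (simp add: p_def algebra_simps)
    qed
  qed simp
  then have "(\<integral>t. 1 / (t\<^sup>2 + E * t + 1) \<partial>\<mu>) + (\<integral>t. 1 / (t\<^sup>2 + - E * t + 1) \<partial>\<mu>) \<le> 0"
    using Bochner_Integration.integral_add[OF i] by simp
  moreover have "1 - moment \<mu> (-2) + (\<integral>t. 1 / (t\<^sup>2 + E * t + 1) \<partial>\<mu>) > 0"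
      "1 - moment \<mu> (-2) + (\<integral>t. 1 / (t\<^sup>2 + - E * t + 1) \<partial>\<mu>) > 0"
    using pos E unfolding positivity_condition_def by blast+
  ultimately show ?thesis by linarith
qed

text \<open>With \<kappa> the inverse of \<open>phi\<close> in the disc, F(\<kappa>) must be m_plus
  and -F(1 / \<kappa>) must be m_minus. The coefficients at site 0 are chosen so that the second
  function has the form of \<open>m_minus_eq\<close>.\<close>

lemma measure_gives_jacobi:
  fixes \<mu> :: "real measure"
  assumes fin: "finite_measure \<mu>" and m: "sets \<mu> = sets borel" and S: "AE t in \<mu>. t \<in> sigma_support r"
    and pos: "positivity_condition R \<mu>" and r: "0 < r" "r \<le> 1" "r + 1 / r = R" and R2: "R \<ge> 2"
  shows "\<exists>a b. jacobi_matrix a b \<and> reflectionless_on a b {-2<..<2} \<and> jacobi_norm a b \<le> R \<and>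
     is_F_function a b (F_of_measure \<mu>)"
proof -
  let ?K = "complex_of_real ` support_hull r"
  have K: "AE t in \<mu>. t \<in> support_hull r"
    using S by eventually_elim (auto simp: sigma_support_iff[OF r(1)] support_hull_iff[OF r(1)])
  note \<mu> = fin m K
  have cl: "closed (support_hull r)" by (rule compact_imp_closed[OF compact_support_hull])
  have R: "R > 0" using R2 by simp
  define \<alpha> \<beta> V where "\<alpha> = 1 - moment \<mu> (-2)" and "\<beta> = - moment \<mu> (-1)" and "V = measure \<mu> (space \<mu>)"
  have \<alpha>: "\<alpha> > 0" unfolding \<alpha>_def by (rule positivity_imp_moment_less_1[OF \<mu> r pos])
  have V: "V \<ge> 0" by (simp add: V_def)
  define C where "C l = (\<integral>t. 1 / (complex_of_real t - l) \<partial>\<mu>)" for l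
  define F where "F = F_of_measure \<mu>"
  have F: "F l = of_real \<beta> + of_real \<alpha> * l + C l" for l
    by (simp add: F_def F_of_measure_def \<alpha>_def \<beta>_def C_def)
  have Ch: "C holomorphic_on - ?K" unfolding C_def by (rule cauchy_transform_holomorphic[OF \<mu> cl])
  have Fh: "F holomorphic_on - ?K" unfolding F by (intro holomorphic_intros Ch)
  have opK: "open (- ?K)" using closed_image_of_real[OF cl] by (simp add: open_Compl)
  have Ccnj: "C (cnj l) = cnj (C l)" for l unfolding C_def by (rule cauchy_transform_cnj)
  have Fcnj: "F (cnj l) = cnj (F l)" for l by (simp add: F Ccnj)
  have CIm: "Im (C l) \<ge> 0" if "Im l > 0" for l unfolding C_def by (rule cauchy_transform_Im_nonneg[OF fin m that])
  have FIm: "Im (F l) > 0" if "Im l > 0" for l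
  proof -
    have "Im (F l) = \<alpha> * Im l + Im (C l)" by (simp add: F)
    moreover have "\<alpha> * Im l > 0" using \<alpha> that by simp
    ultimately show ?thesis using CIm[OF that] by linarith
  qed
  have z0: "0 \<notin> ?K" using r by (auto simp: support_hull_iff[OF r(1)])
  have F0: "F 0 = 0"
  proof -
    have "C 0 = of_real (\<integral>t. 1 / t \<partial>\<mu>)"
      using integral_real_to_complex[of \<mu> "\<lambda>t. 1 / t"] by (simp add: C_def)
    then show ?thesis by (simp add: F \<beta>_def moment_simps)
  qed
  have F1: "(F has_field_derivative 1) (at 0)"
  proof -
    have "(F has_field_derivative (0 + of_real \<alpha> * 1 + (\<integral>t. 1 / (complex_of_real t - 0)\<^sup>2 \<partial>\<mu>))) (at 0)"
      unfolding F[abs_def] C_def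
      by (intro DERIV_add DERIV_cmult DERIV_ident DERIV_const cauchy_transform_derivative[OF \<mu> cl z0])
    moreover have "(\<integral>t. 1 / (complex_of_real t - 0)\<^sup>2 \<partial>\<mu>) = of_real (\<integral>t. 1 / t\<^sup>2 \<partial>\<mu>)"
      using integral_real_to_complex[of \<mu> "\<lambda>t. 1 / t\<^sup>2"] by simp
    ultimately show ?thesis by (simp add: \<alpha>_def moment_simps)
  qed
  obtain \<kappa> where kh: "\<kappa> holomorphic_on - spectral_set 2"
    and k: "\<And>z. z \<notin> spectral_set 2 \<Longrightarrow> \<kappa> z \<noteq> 0 \<and> cmod (\<kappa> z) < 1 \<and> phi (\<kappa> z) = z"
    and kinv: "\<And>l. l \<noteq> 0 \<Longrightarrow> cmod l < 1 \<Longrightarrow> \<kappa> (phi l) = l"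
    and kcnj: "\<And>z. z \<notin> spectral_set 2 \<Longrightarrow> \<kappa> (cnj z) = cnj (\<kappa> z)"
    and k0: "filterlim \<kappa> (at 0) at_infinity"
    and k1: "((\<lambda>z. z * \<kappa> z) \<longlongrightarrow> -1) at_infinity"
    and ki: "(\<kappa> \<longlongrightarrow> \<i>) (at 0 within upper_half_plane)"
    using phi_disc_inverse by blast
  have s2: "z \<notin> spectral_set 2" if "z \<notin> spectral_set R" for z
    using that image_mono[of "{-2..2}" "{-R..R}" complex_of_real] R2 by auto
  have kK: "\<kappa> z \<notin> ?K" "1 / \<kappa> z \<notin> ?K" if z: "z \<notin> spectral_set R" for z
  proof -
    have "phi (of_real t) \<in> spectral_set R" if "t \<in> support_hull r" for t
      by (rule phi_real_spectral_iff[OF r, THEN iffD2, OF _ that]) (use that r in \<open>auto simp: support_hull_iff[OF r(1)]\<close>)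
    then show "\<kappa> z \<notin> ?K" "1 / \<kappa> z \<notin> ?K"
      using k[OF s2[OF z]] phi_inverse[of "\<kappa> z"] z by (metis imageE)+
  qed
  have kIm: "Im (\<kappa> z) > 0" if "Im z > 0" for z
  proof -
    have "z \<notin> spectral_set 2" using that by auto
    then show ?thesis using k Im_phi_disc_iff(1)[of "\<kappa> z"] that by auto
  qed
  have kh': "\<kappa> holomorphic_on - spectral_set R" using kh s2 by (blast intro: holomorphic_on_subset)
  have kin: "\<kappa> holomorphic_on - spectral_set R" "(\<lambda>z. 1 / \<kappa> z) holomorphic_on - spectral_set R"
    using kh' k s2 by (auto intro!: holomorphic_intros)
  define mp where "mp z = F (\<kappa> z)" for z
  have mp: "stieltjes R mp"
  proof (rule stieltjesI[OF R])
    have "(F \<circ> \<kappa>) holomorphic_on - spectral_set R"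
      by (rule holomorphic_on_compose_gen[OF kin(1) Fh], rule image_subsetI, unfold Compl_iff, rule kK(1))
    then show "mp holomorphic_on - spectral_set R" by (simp add: mp_def[abs_def] o_def)
    show "mp (cnj z) = cnj (mp z)" if "z \<notin> spectral_set R" for z
      using kcnj[OF s2[OF that]] Fcnj by (simp add: mp_def)
    show "Im (mp z) \<ge> 0" if "Im z > 0" for z using FIm[OF kIm[OF that]] by (simp add: mp_def)
    have "((\<lambda>l. (F l - F 0) / (l - 0)) \<longlongrightarrow> 1) (at 0)" using F1 by (simp only: has_field_derivative_iff)
    then have "((\<lambda>l. F l / l) \<longlongrightarrow> 1) (at 0)" by (simp only: F0 diff_zero)
    then have "((\<lambda>z. (z * \<kappa> z) * (F (\<kappa> z) / \<kappa> z)) \<longlongrightarrow> -1 * 1) at_infinity"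
      by (intro tendsto_mult k1) (rule filterlim_compose[OF _ k0])
    moreover have "\<forall>\<^sub>F z in at_infinity. (z * \<kappa> z) * (F (\<kappa> z) / \<kappa> z) = z * mp z"
      unfolding eventually_at_infinity
    proof (intro exI[of _ 3] allI impI)
      fix z :: complex assume "3 \<le> cmod z"
      then have "z \<notin> spectral_set 2" by auto
      then show "(z * \<kappa> z) * (F (\<kappa> z) / \<kappa> z) = z * mp z" using k by (simp add: mp_def)
    qed
    ultimately show "((\<lambda>z. z * mp z) \<longlongrightarrow> -1) at_infinity" using Lim_transform_eventually by fastforce
    have "\<i> \<in> - ?K" by (auto simp: complex_eq_iff)
    then have "isCont F \<i>" using Fh opK by (auto dest!: holomorphic_on_imp_continuous_on simp: continuous_on_eq_continuous_at)
    then show "(mp \<longlongrightarrow> F \<i>) (at 0 within upper_half_plane)" unfolding mp_def by (rule isCont_tendsto_compose[OF _ ki])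
    show "Im (F \<i>) > 0" by (rule FIm) simp
  qed
  \<comment> \<open>At infinity \<kappa> behaves like -1 / z and C(1 / \<kappa>) like V / z, so A is
    the total mass by which \<kappa> - C(1 / \<kappa>) / \<alpha> has to be normalised.\<close>
  define A where "A = 1 + V / \<alpha>"
  have A: "A > 0" using \<alpha> V by (simp add: A_def add_pos_nonneg)
  define mr where "mr z = (\<kappa> z - C (1 / \<kappa> z) / of_real \<alpha>) / of_real A" for z
  have CIm': "Im (C l) \<le> 0" if "Im l < 0" for l using CIm[of "cnj l"] that Ccnj[of l] by simp
  have invIm: "Im (1 / l) < 0" if "Im l > 0" for l
  proof -
    have "Im (1 / l) = - (Im l / (cmod l)\<^sup>2)" by (simp add: Im_divide cmod_power2)
    moreover have "Im l / (cmod l)\<^sup>2 > 0" using that by (intro divide_pos_pos) (auto simp: complex_eq_iff)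
    ultimately show ?thesis by linarith
  qed
  have mr: "stieltjes R mr"
  proof (rule stieltjesI[OF R])
    have "(C \<circ> (\<lambda>z. 1 / \<kappa> z)) holomorphic_on - spectral_set R"
      by (rule holomorphic_on_compose_gen[OF kin(2) Ch], rule image_subsetI, unfold Compl_iff, rule kK(2))
    then show "mr holomorphic_on - spectral_set R"
      unfolding mr_def[abs_def] o_def using \<alpha> A by (intro holomorphic_intros kin(1)) auto
    show "mr (cnj z) = cnj (mr z)" if "z \<notin> spectral_set R" for z
      using kcnj[OF s2[OF that]] Ccnj[of "1 / \<kappa> z"] by (simp add: mr_def)
    show "Im (mr z) \<ge> 0" if "Im z > 0" for z
    proof -
      have "Im (C (1 / \<kappa> z)) \<le> 0" by (rule CIm'[OF invIm[OF kIm[OF that]]])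
      then have "Im (C (1 / \<kappa> z)) / \<alpha> \<le> 0" using \<alpha> by (simp add: divide_nonpos_pos)
      then have "Im (\<kappa> z) - Im (C (1 / \<kappa> z)) / \<alpha> \<ge> 0" using kIm[OF that] by linarith
      then show ?thesis using A by (simp add: mr_def Im_divide_of_real)
    qed
    have K': "AE t in \<mu>. t \<in> {- (1 / r)..1 / r}"
      using K by eventually_elim (auto simp: support_hull_iff[OF r(1)])
    have "((\<lambda>l. l * C l) \<longlongrightarrow> - of_real V) at_infinity"
      unfolding C_def V_def by (rule cauchy_transform_asymptotics(1)[OF fin m K']) (use r in simp)
    moreover have "filterlim (\<lambda>z. inverse (\<kappa> z)) at_infinity at_infinity"
      by (rule filterlim_compose[OF filterlim_inverse_at_infinity k0])
    ultimately have "((\<lambda>z. inverse (\<kappa> z) * C (inverse (\<kappa> z))) \<longlongrightarrow> - of_real V) at_infinity"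
      by (rule filterlim_compose)
    then have "((\<lambda>z. (z * \<kappa> z - (z * \<kappa> z) * (inverse (\<kappa> z) * C (inverse (\<kappa> z))) / of_real \<alpha>) / of_real A)
        \<longlongrightarrow> (-1 - (-1) * (- of_real V) / of_real \<alpha>) / of_real A) at_infinity"
      using \<alpha> A by (intro tendsto_divide tendsto_diff tendsto_mult k1 tendsto_const) auto
    moreover have "(-1 - (-1) * (- of_real V) / of_real \<alpha>) / of_real A = (-1 :: complex)"
    proof -
      have "(-1 - (-1) * (- of_real V) / of_real \<alpha>) / of_real A = - (complex_of_real A) / of_real A"
        by (simp add: A_def)
      then show ?thesis using A by simp
    qed
    moreover have "\<forall>\<^sub>F z in at_infinity. (z * \<kappa> z - (z * \<kappa> z) * (inverse (\<kappa> z) * C (inverse (\<kappa> z))) / of_real \<alpha>) / of_real A = z * mr z"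
      unfolding eventually_at_infinity
    proof (intro exI[of _ 3] allI impI)
      fix z :: complex assume "3 \<le> cmod z"
      then have "z \<notin> spectral_set 2" by auto
      then have nz: "\<kappa> z \<noteq> 0" using k by blast
      have "(z * \<kappa> z) * (inverse (\<kappa> z) * C (inverse (\<kappa> z))) = z * C (1 / \<kappa> z)" using nz by (simp add: divide_inverse)
      then show "(z * \<kappa> z - (z * \<kappa> z) * (inverse (\<kappa> z) * C (inverse (\<kappa> z))) / of_real \<alpha>) / of_real A = z * mr z"
        by (simp add: mr_def right_diff_distrib)
    qed
    ultimately show "((\<lambda>z. z * mr z) \<longlongrightarrow> -1) at_infinity" using Lim_transform_eventually by fastforce
    have "- \<i> \<in> - ?K" by (auto simp: complex_eq_iff)
    then have "isCont C (1 / \<i>)" using Ch opK by (auto dest!: holomorphic_on_imp_continuous_on simp: continuous_on_eq_continuous_at)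
    moreover have "((\<lambda>z. 1 / \<kappa> z) \<longlongrightarrow> 1 / \<i>) (at 0 within upper_half_plane)" by (intro tendsto_intros ki) simp
    ultimately have "((\<lambda>z. C (1 / \<kappa> z)) \<longlongrightarrow> C (1 / \<i>)) (at 0 within upper_half_plane)" by (rule isCont_tendsto_compose)
    then show "(mr \<longlongrightarrow> (\<i> - C (1 / \<i>) / of_real \<alpha>) / of_real A) (at 0 within upper_half_plane)"
      unfolding mr_def using \<alpha> A by (intro tendsto_divide tendsto_diff ki tendsto_const) auto
    have "Im (C (1 / \<i>)) / \<alpha> \<le> 0" using \<alpha> CIm'[of "1 / \<i>"] by (simp add: divide_nonpos_pos)
    then show "Im ((\<i> - C (1 / \<i>) / of_real \<alpha>) / of_real A) > 0" using A by (simp add: Im_divide_of_real)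
  qed
  \<comment> \<open>Dividing -F(1 / \<kappa>) by its leading coefficient \<alpha> must give z - b0 +
    a1^2 mr.\<close>
  define a0 a1 b0 where "a0 = sqrt (1 / \<alpha>)" and "a1 = sqrt A" and "b0 = \<beta> / \<alpha>"
  have a01: "a0 > 0" "a1 > 0" "a0\<^sup>2 = 1 / \<alpha>" "a1\<^sup>2 = A" using \<alpha> A by (auto simp: a0_def a1_def)
  have mm: "z - of_real b0 + of_real (a1\<^sup>2) * mr z = - of_real (a0\<^sup>2) * F (1 / \<kappa> z)" if "z \<notin> spectral_set 2" for z
  proof -
    have sw: "- i = z + x" if "- x - i = z" for x i :: complex using that by auto
    have "- \<kappa> z - 1 / \<kappa> z = z" using k[OF that] by (simp add: phi_def)
    from sw[OF this] have i: "- (1 / \<kappa> z) = z + \<kappa> z" .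
    have "- F (1 / \<kappa> z) = of_real \<alpha> * - (1 / \<kappa> z) - of_real \<beta> - C (1 / \<kappa> z)"
      unfolding F by (simp add: algebra_simps)
    then have "- F (1 / \<kappa> z) = of_real \<alpha> * (z + \<kappa> z) - of_real \<beta> - C (1 / \<kappa> z)" unfolding i .
    then have "- of_real (a0\<^sup>2) * F (1 / \<kappa> z) = (of_real \<alpha> * (z + \<kappa> z) - of_real \<beta> - C (1 / \<kappa> z)) / of_real \<alpha>"
      unfolding a01 by (simp add: field_simps)
    also have "\<dots> = z - of_real b0 + of_real (a1\<^sup>2) * mr z"
    proof -
      have "of_real A * mr z = \<kappa> z - C (1 / \<kappa> z) / of_real \<alpha>" using A by (simp add: mr_def)
      then show ?thesis using \<alpha> by (simp add: a01 b0_def diff_divide_distrib add_divide_distrib)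
    qed
    finally show ?thesis ..
  qed
  \<comment> \<open>The same computation as for the positivity condition in
    \<open>class_has_measure\<close>, read in the opposite direction.\<close>
  have X: "sgn E * Re (of_real (a0\<^sup>2) * mp (of_real E) + of_real (a1\<^sup>2) * mr (of_real E) + of_real E - of_real b0) \<ge> 0"
    if E: "\<bar>E\<bar> > R" for E
  proof -
    let ?I = "\<integral>t. 1 / (t\<^sup>2 + E * t + 1) \<partial>\<mu>"
    obtain s where s: "s \<noteq> 0" "\<bar>s\<bar> < r" "phi (of_real s) = of_real E" "s + 1 / s = - E" "sgn (s - 1 / s) = sgn E"
      using exists_real_phi_preimage[OF r E] by blast
    have kE: "\<kappa> (of_real E) = of_real s" using kinv[of "of_real s"] s r by simp
    have E2: "complex_of_real E \<notin> spectral_set 2" using E R2 by auto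
    have "of_real (a0\<^sup>2) * mp (of_real E) + of_real (a1\<^sup>2) * mr (of_real E) + of_real E - of_real b0
        = of_real (a0\<^sup>2) * mp (of_real E) + (of_real E - of_real b0 + of_real (a1\<^sup>2) * mr (of_real E))" by simp
    also have "\<dots> = of_real (a0\<^sup>2) * (F (of_real s) - F (of_real (1 / s)))"
      unfolding mm[OF E2] mp_def kE by (simp add: algebra_simps)
    also have "F (of_real s) - F (of_real (1 / s)) = of_real \<alpha> * (of_real s - of_real (1 / s)) + (C (of_real s) - C (of_real (1 / s)))"
      by (simp add: F algebra_simps)
    also have "\<dots> = of_real ((s - 1 / s) * (\<alpha> + ?I))"
      unfolding C_def F_difference[OF \<mu> r(1,2) s(1,2,4)]
      by (simp only: of_real_mult of_real_add of_real_diff distrib_left mult.commute[of "complex_of_real \<alpha>"])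
    finally have "Re (of_real (a0\<^sup>2) * mp (of_real E) + of_real (a1\<^sup>2) * mr (of_real E) + of_real E - of_real b0) = a0\<^sup>2 * ((s - 1 / s) * (\<alpha> + ?I))"
      by (simp only: Re_complex_of_real flip: of_real_mult)
    moreover have "sgn E * (a0\<^sup>2 * ((s - 1 / s) * (\<alpha> + ?I))) = a0\<^sup>2 * \<bar>s - 1 / s\<bar> * (\<alpha> + ?I)"
      unfolding s(5)[symmetric] by (simp add: abs_sgn mult_ac)
    moreover have "\<alpha> + ?I > 0" using pos E unfolding positivity_condition_def \<alpha>_def by blast
    then have "a0\<^sup>2 * \<bar>s - 1 / s\<bar> * (\<alpha> + ?I) \<ge> 0" by simp
    ultimately show ?thesis by (simp only:)
  qed
  obtain a b where J: "jacobi_matrix a b" and fb: "form_bounded a b R" and ab: "a 0 = a0" "a (-1) = a1" "b 0 = b0"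
    and mpr: "\<And>z. Im z > 0 \<Longrightarrow> m_plus a b z = mp z \<and> m_plus (reflect_a a) (reflect_b b) z = mr z"
    using jacobi_from_stieltjes_pair[OF mp mr R a01(1,2) X] by blast
  have mminus: "m_minus a b z = - F (1 / \<kappa> z)" if "Im z > 0" for z
  proof -
    have "z \<notin> spectral_set 2" using that by auto
    then have "m_minus a b z = - of_real (a0\<^sup>2) * F (1 / \<kappa> z) / of_real (a0\<^sup>2)"
      using m_plus_minus_herglotz(5)[OF J that] mm mpr[OF that] unfolding ab by metis
    then show ?thesis using a01(1) by simp
  qed
  have "phi holomorphic_on upper_half_plane" by (rule phi_holomorphic) (simp add: upper_half_plane_def)
  \<comment> \<open>Unlike \<kappa>, this is the inverse of \<open>phi\<close> on the upper half
    plane, defined on all of \<open>Omega\<close>; on the lower half plane it equals 1 /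
    \<kappa>.\<close>
  then obtain \<psi> where ph: "\<psi> holomorphic_on Omega" and pinv: "\<And>l. l \<in> upper_half_plane \<Longrightarrow> \<psi> (phi l) = l"
    using holomorphic_has_inverse[OF _ upper_half_plane_facts(1) inj_on_phi_upper] unfolding phi_upper_image by metis
  have p: "\<psi> z \<in> upper_half_plane" if "z \<in> Omega" for z
    using that pinv unfolding phi_upper_image[symmetric] by auto
  define M where "M = F \<circ> \<psi>"
  have M: "is_M_function a b M"
    unfolding is_M_function_def
  proof (intro conjI ballI)
    have up: "upper_half_plane \<subseteq> - ?K" by (auto simp: upper_half_plane_def)
    show "M holomorphic_on Omega"
      unfolding M_def by (rule holomorphic_on_compose_gen[OF ph Fh], rule image_subsetI, rule subsetD[OF up], rule p)
    show "M ` Omega \<subseteq> upper_half_plane" using p FIm by (auto simp: M_def upper_half_plane_def)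
    show "M z = m_plus a b z" if "z \<in> upper_half_plane" for z
    proof -
      have z: "Im z > 0" using that by (simp add: upper_half_plane_def)
      have "\<psi> (phi (\<kappa> z)) = \<kappa> z" by (rule pinv) (use kIm[OF z] in \<open>simp add: upper_half_plane_def\<close>)
      moreover have "z \<notin> spectral_set 2" using z by auto
      then have "phi (\<kappa> z) = z" using k by blast
      ultimately show ?thesis using mpr[OF z] by (simp add: M_def mp_def)
    qed
    show "M z = - cnj (m_minus a b (cnj z))" if "z \<in> lower_half_plane" for z
    proof -
      have z: "Im (cnj z) > 0" using that by (simp add: lower_half_plane_def)
      then have zs: "z \<notin> spectral_set 2" by auto
      have kc: "\<kappa> (cnj z) = cnj (\<kappa> z)" by (rule kcnj[OF zs])
      have "Im (cnj (1 / \<kappa> z)) < 0"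
        using invIm[OF kIm[OF z]] unfolding kc by (simp only: complex_cnj_divide complex_cnj_one)
      then have "Im (1 / \<kappa> z) > 0" unfolding cnj.sel by linarith
      then have "\<psi> (phi (1 / \<kappa> z)) = 1 / \<kappa> z" by (intro pinv) (simp add: upper_half_plane_def)
      moreover have "phi (1 / \<kappa> z) = z" unfolding phi_inverse using k[OF zs] by blast
      ultimately have Mz: "M z = F (1 / \<kappa> z)" by (simp only: M_def o_apply)
      have "1 / \<kappa> (cnj z) = cnj (1 / \<kappa> z)" unfolding kc by (simp only: complex_cnj_divide complex_cnj_one)
      then have "m_minus a b (cnj z) = - cnj (F (1 / \<kappa> z))" using mminus[OF z] by (simp only: Fcnj)
      then show ?thesis unfolding Mz by simp
    qed
  qed
  have refl: "reflectionless_on a b {-2<..<2}" by (rule M_function_reflectionless[OF M])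
  have "is_F_function a b F"
    unfolding is_F_function_def using J refl M pinv by (auto simp: M_def)
  then show ?thesis using J refl jacobi_norm_le[OF J fb R] unfolding F_def by blast
qed

text \<open>Since \<open>phi\<close> maps the upper half plane onto \<open>Omega\<close>, F
  determines M, hence both m functions.\<close>

lemma F_function_determines_matrix:
  assumes F: "is_F_function a b F" and F': "is_F_function a' b' F"
  shows "a = a' \<and> b = b'"
proof -
  obtain M where M: "is_M_function a b M" "\<And>l. l \<in> upper_half_plane \<Longrightarrow> F l = M (phi l)"
    using F by (auto simp: is_F_function_def)
  obtain M' where M': "is_M_function a' b' M'" "\<And>l. l \<in> upper_half_plane \<Longrightarrow> F l = M' (phi l)"
    using F' by (auto simp: is_F_function_def)
  have eq: "M z = M' z" if "z \<in> Omega" for z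
    using that M(2) M'(2) unfolding phi_upper_image[symmetric] by auto
  have mp: "m_plus a b z = m_plus a' b' z" if "Im z > 0" for z
    using eq[of z] M(1) M'(1) that by (auto simp: is_M_function_def Omega_def upper_half_plane_def)
  have mm: "m_minus a b z = m_minus a' b' z" if "Im z > 0" for z
  proof -
    have z: "cnj z \<in> lower_half_plane" using that by (simp add: lower_half_plane_def)
    then have "- cnj (m_minus a b z) = - cnj (m_minus a' b' z)"
      using eq[of "cnj z"] M(1) M'(1) by (auto simp: is_M_function_def Omega_def)
    then show ?thesis by simp
  qed
  show ?thesis using m_functions_determine[OF _ _ mp mm] F F' by (auto simp: is_F_function_def)
qed

lemma F_function_determines_measure:
  assumes \<sigma>: "finite_borel_measure_on (sigma_support r) \<sigma>" and \<tau>: "finite_borel_measure_on (sigma_support r) \<tau>"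
    and r: "0 < r" and F: "is_F_function a b (F_of_measure \<sigma>)" and F': "is_F_function a b (F_of_measure \<tau>)"
  shows "\<sigma> = \<tau>"
proof (rule borel_extension_inj[OF \<sigma> \<tau>])
  show S: "sigma_support r \<in> sets borel" by (simp add: sigma_support_def)
  obtain M where M: "is_M_function a b M" "\<And>l. l \<in> upper_half_plane \<Longrightarrow> F_of_measure \<sigma> l = M (phi l)"
    using F by (auto simp: is_F_function_def)
  obtain M' where M': "is_M_function a b M'" "\<And>l. l \<in> upper_half_plane \<Longrightarrow> F_of_measure \<tau> l = M' (phi l)"
    using F' by (auto simp: is_F_function_def)
  have bd: "AE t in borel_extension \<rho>. \<bar>t\<bar> \<le> 1 / r" if "finite_borel_measure_on (sigma_support r) \<rho>" for \<rho>
    using borel_extension(3)[OF that S] by eventually_elim (simp add: sigma_support_iff[OF r])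
  show "borel_extension \<sigma> = borel_extension \<tau>"
  proof (rule herglotz_measure_unique[OF borel_extension(1,2)[OF \<sigma> S] bd[OF \<sigma>] borel_extension(1,2)[OF \<tau> S] bd[OF \<tau>]])
    \<comment> \<open>For y > 1 the point lies outside the disc, so \<open>phi\<close> takes it to
      the lower half plane, where both M functions are prescribed by \<open>m_minus\<close>.\<close>
    fix y :: real assume y: "y > 1"
    let ?l = "\<i> * complex_of_real y"
    have l: "?l \<in> upper_half_plane" "phi ?l \<in> lower_half_plane"
      using y phi_upper_outside[of ?l] by (simp_all add: upper_half_plane_def lower_half_plane_def norm_mult)
    then have "M (phi ?l) = M' (phi ?l)" using M(1) M'(1) by (simp add: is_M_function_def)
    then have "F_of_measure (borel_extension \<sigma>) ?l = F_of_measure (borel_extension \<tau>) ?l"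
      using M(2)[OF l(1)] M'(2)[OF l(1)] by (simp add: borel_extension_functionals[OF \<sigma>] borel_extension_functionals[OF \<tau>])
    then show "of_real (- moment (borel_extension \<sigma>) (-1)) + of_real (1 - moment (borel_extension \<sigma>) (-2)) * ?l
          + (\<integral>t. 1 / (complex_of_real t - ?l) \<partial>borel_extension \<sigma>)
        = of_real (- moment (borel_extension \<tau>) (-1)) + of_real (1 - moment (borel_extension \<tau>) (-2)) * ?l
          + (\<integral>t. 1 / (complex_of_real t - ?l) \<partial>borel_extension \<tau>)"
      by (simp add: F_of_measure_def)
  qed
qed

theorem theorem3p1:
  fixes R r :: real
  assumes "R \<ge> 2" and "0 < r" and "r \<le> 1" and "r + 1 / r = R"
  shows "(\<forall>a b. jacobi_matrix a b \<longrightarrow>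
            ((a, b) \<in> reflectionless_class R \<longleftrightarrow>
             (\<exists>\<sigma>. finite_borel_measure_on (sigma_support r) \<sigma> \<and> positivity_condition R \<sigma> \<and>
                  is_F_function a b (F_of_measure \<sigma>)))) \<and>
         (\<forall>a b. (a, b) \<in> reflectionless_class R \<longrightarrow>
            (\<exists>!\<sigma>. finite_borel_measure_on (sigma_support r) \<sigma> \<and> positivity_condition R \<sigma> \<and>
                  is_F_function a b (F_of_measure \<sigma>))) \<and>
         (\<forall>\<sigma>. finite_borel_measure_on (sigma_support r) \<sigma> \<and> positivity_condition R \<sigma> \<longrightarrow>
            (\<exists>!J. J \<in> reflectionless_class R \<and>
                  is_F_function (fst J) (snd J) (F_of_measure \<sigma>)))"
proof -
  note r = assms(2-4)
  have S: "sigma_support r \<in> sets borel" by (simp add: sigma_support_def)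
  have ex_measure: "\<exists>\<sigma>. finite_borel_measure_on (sigma_support r) \<sigma> \<and> positivity_condition R \<sigma> \<and>
      is_F_function a b (F_of_measure \<sigma>)" if "(a, b) \<in> reflectionless_class R" for a b
  proof -
    have J: "jacobi_matrix a b" "reflectionless_on a b {-2<..<2}" "jacobi_norm a b \<le> R"
      using that by (simp_all add: reflectionless_class_def)
    obtain \<mu> where \<mu>: "finite_measure \<mu>" "sets \<mu> = sets borel" "AE t in \<mu>. t \<in> sigma_support r"
      and "positivity_condition R \<mu>" "is_F_function a b (F_of_measure \<mu>)"
      using class_has_measure[OF J r] by blast
    then show ?thesis
      using restrict_measure(1)[OF \<mu> S] restrict_measure_functionals[OF \<mu> S]
      by (intro exI[of _ "restrict_space \<mu> (sigma_support r)"]) simp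
  qed
  have ex_matrix: "\<exists>a b. (a, b) \<in> reflectionless_class R \<and> is_F_function a b (F_of_measure \<sigma>)"
    if \<sigma>: "finite_borel_measure_on (sigma_support r) \<sigma>" and "positivity_condition R \<sigma>" for \<sigma>
    using measure_gives_jacobi[OF borel_extension[OF \<sigma> S] _ r assms(1)] that(2)
    unfolding borel_extension_functionals[OF \<sigma>] reflectionless_class_def by blast
  \<comment> \<open>Being an F function of (a, b) contains no norm bound. It comes from the matrix
    constructed out of the measure, which has the same F function and hence is (a, b).\<close>
  have "(a, b) \<in> reflectionless_class R"
    if "finite_borel_measure_on (sigma_support r) \<sigma>" "positivity_condition R \<sigma>" "is_F_function a b (F_of_measure \<sigma>)" for a b \<sigma>
    using ex_matrix[OF that(1,2)] F_function_determines_matrix[OF that(3)] by metis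
  moreover have "\<exists>!\<sigma>. finite_borel_measure_on (sigma_support r) \<sigma> \<and> positivity_condition R \<sigma> \<and>
      is_F_function a b (F_of_measure \<sigma>)" if "(a, b) \<in> reflectionless_class R" for a b
    using ex_measure[OF that] F_function_determines_measure[OF _ _ assms(2)] by blast
  moreover have "\<exists>!J. J \<in> reflectionless_class R \<and> is_F_function (fst J) (snd J) (F_of_measure \<sigma>)"
    if \<sigma>: "finite_borel_measure_on (sigma_support r) \<sigma>" "positivity_condition R \<sigma>" for \<sigma>
  proof -
    obtain a b where ab: "(a, b) \<in> reflectionless_class R" "is_F_function a b (F_of_measure \<sigma>)" using ex_matrix[OF \<sigma>] by blast
    show ?thesis
    proof (rule ex1I)
      show "(a, b) \<in> reflectionless_class R \<and> is_F_function (fst (a, b)) (snd (a, b)) (F_of_measure \<sigma>)" using ab by simp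
      fix J assume "J \<in> reflectionless_class R \<and> is_F_function (fst J) (snd J) (F_of_measure \<sigma>)"
      then have "fst J = a \<and> snd J = b" using F_function_determines_matrix[OF _ ab(2)] by blast
      then show "J = (a, b)" by (simp add: prod_eq_iff)
    qed
  qed
  ultimately show ?thesis using ex_measure by blast
qed

end
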